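(* Let $Q\colon\mathbb{N}\to\mathbb{R}$ be a generalized polynomial. Then the sequence $Q(\Omega(n))$, $n\in\mathbb{N}$, is uniformly distributed mod $1$ if and only if the sequence $Q(n)$, $n\in\mathbb{N}$, is uniformly distributed mod $1$.
   Context: $\mathbb{N}=\{1,2,3,\ldots\}$. $\Omega(n)$ denotes the number of prime factors of $n$ counted with multiplicities. The class of generalized polynomials is the class of functions generated by starting with conventional real polynomials (in the variable $n$) and applying, in an arbitrary order and finitely many times, the operations of taking the integer part $\lfloor\cdot\rfloor$, addition, and multiplication. (Such an expression is defined also at $n=0=\Omega(1)$.) *)

theory Defs
  imports
    Complex_Main
    "HOL-Computational_Algebra.Primes"
    "HOL-Computational_Algebra.Polynomial"
begin

text \<open>The number of prime factors, counted with multiplicity; in particular the value at 1 is 0.\<close>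

definition bigomega :: "nat \<Rightarrow> nat" where
  "bigomega n = size (prime_factorization n)"

text \<open>
  Generalized polynomials are taken as functions on all of \<^typ>\<open>nat\<close>, including 0, so that
  they can be evaluated at \<open>bigomega 1 = 0\<close>. Subtraction is covered by multiplication with
  the constant polynomial -1.
\<close>

inductive generalized_polynomial :: "(nat \<Rightarrow> real) \<Rightarrow> bool" where
  poly: "generalized_polynomial (\<lambda>n. poly p (real n))"
| floor: "generalized_polynomial f \<Longrightarrow> generalized_polynomial (\<lambda>n. real_of_int \<lfloor>f n\<rfloor>)"
| add: "generalized_polynomial f \<Longrightarrow> generalized_polynomial g \<Longrightarrow>
    generalized_polynomial (\<lambda>n. f n + g n)"
| mult: "generalized_polynomial f \<Longrightarrow> generalized_polynomial g \<Longrightarrow>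
    generalized_polynomial (\<lambda>n. f n * g n)"

text \<open>
  The sequence is indexed by the positive integers; the value \<open>x 0\<close> plays no role.
\<close>

definition uniformly_distributed_mod1 :: "(nat \<Rightarrow> real) \<Rightarrow> bool" where
  "uniformly_distributed_mod1 x \<longleftrightarrow>
    (\<forall>a b. 0 \<le> a \<and> a < b \<and> b \<le> 1 \<longrightarrow>
      (\<lambda>N. real (card {n \<in> {1..N}. frac (x n) \<in> {a..<b}}) / real N) \<longlonglongrightarrow> b - a)"

end

theory Submission
  imports "HOL-Analysis.Analysis" "HOL-Real_Asymp.Real_Asymp" Defs
begin

text \<open>
  Suppose that the averages of a bounded sequence \<open>a\<close> over the windows \<open>{M..<M + N}\<close> converge, uniformly in \<open>M\<close>, as
  \<open>N\<close> grows. Then the averages of \<open>a (bigomega n)\<close> converge to the same limit, because \<open>bigomega\<close> is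
  asymptotically invariant under shifts: the averages of \<open>a (bigomega n + 1) - a (bigomega n)\<close> tend to 0, uniformly
  over all \<open>a\<close> bounded by 1. Indeed, by the Turan--Kubilius inequality, if this average up to \<open>x\<close> is close to its largest
  possible value \<open>D\<close>, then so is, for most primes \<open>p\<close>, the average up to \<open>x / p\<close> for the shifted sequence. Using pairs of
  such primes with ratio close to 1 the scales can be brought together, so that \<open>m\<close> consecutive shifts of one sequence
  are nearly extremal at one scale; the telescoping sum gives \<open>m * D \<le> 2\<close>.

  It remains to see that the indicator functions of \<open>frac (Q n) \<in> {a..<b}\<close> have uniform window averages. The fractional
  part \<open>frac (Q n)\<close> is a coordinate, in the fundamental cube, of an orbit of a translation on a nilmanifold of
  unitriangular matrices, and the indicator is piecewise polynomial on the cube. If no nonzero rational homomorphism to the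
  reals vanishes at the translating element \<open>g\<close>, the orbit is uniformly equidistributed, by induction along the central
  series with Fourier expansion and van der Corput's inequality. Otherwise the orbit stays in the kernel of the
  homomorphism, which has one coordinate less.
\<close>

subsection \<open>Primes at controlled ratios\<close>

text \<open>In the first half the obstacle is that the primes excluded by Turan--Kubilius depend on
  the scale and on the sequence; only their reciprocal sum is bounded, by 8 / e^2 for each
  condition. Good primes are therefore taken from finite sets fixed beforehand, and the scales which
  they produce are uncontrolled. Ratios of two good primes repair this: being at least 1 + d1 they
  multiply up to any given factor, and being at most 1 + d they do so without gaps.

  In the second half equidistribution is also obstructed by a rational homomorphism h with an
  integral value at g, which a condition on homomorphisms vanishing at g does not seem to see. An
  extra coordinate 0, equal to 1 at g, makes it visible: h - h(g) * (coordinate 0) vanishes at g.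
  The price is that passing to a kernel divides coordinate 0 by an integer E. Only the E-th power of
  the translation is normalized again, and the orbit has to be split into progressions modulo
  E.\<close>

lemma multiplicity_eq_card_powers:
  fixes p n N :: nat
  assumes "prime p" "1 \<le> n" "n \<le> N"
  shows "multiplicity p n = card {i\<in>{1..N}. p ^ i dvd n}"
proof -
  have "{i\<in>{1..N}. p ^ i dvd n} = {1..multiplicity p n}"
  proof (intro set_eqI iffI)
    fix i assume "i \<in> {i\<in>{1..N}. p ^ i dvd n}"
    thus "i \<in> {1..multiplicity p n}"
      using assms power_dvd_iff_le_multiplicity[of n p i] prime_gt_1_nat[of p] by auto
  next
    fix i assume i: "i \<in> {1..multiplicity p n}"
    have d: "p ^ i dvd n" using i multiplicity_dvd' by auto
    have "i < p ^ i" using prime_ge_2_nat[OF assms(1)] by (intro power_gt_expt) auto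
    also have "p ^ i \<le> n" using d assms by (intro dvd_imp_le) auto
    finally show "i \<in> {i\<in>{1..N}. p ^ i dvd n}" using d i assms by auto
  qed
  thus ?thesis by simp
qed

lemma card_multiples:
  fixes d N :: nat
  assumes "d > 0"
  shows "card {n\<in>{1..N}. d dvd n} = N div d"
proof -
  have "{n\<in>{1..N}. d dvd n} = (\<lambda>m. d * m) ` {1..N div d}"
  proof (intro set_eqI iffI)
    fix n assume n: "n \<in> {n\<in>{1..N}. d dvd n}"
    then obtain m where m: "n = d * m" by auto
    have "m \<le> N div d" using n m assms by (simp add: less_eq_div_iff_mult_less_eq mult.commute)
    moreover have "1 \<le> m" using n m by (cases m) auto
    ultimately show "n \<in> (\<lambda>m. d * m) ` {1..N div d}" using m by auto
  next
    fix n assume "n \<in> (\<lambda>m. d * m) ` {1..N div d}"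
    then obtain m where m: "n = d * m" "1 \<le> m" "m \<le> N div d" by force
    have "d * m \<le> N" using m(3) assms by (simp add: less_eq_div_iff_mult_less_eq mult.commute)
    moreover have "1 \<le> d * m" using m(2) assms by simp
    ultimately show "n \<in> {n\<in>{1..N}. d dvd n}" using m(1) by simp
  qed
  moreover have "inj_on (\<lambda>m. d * m) {1..N div d}" using assms by (auto simp: inj_on_def)
  ultimately show ?thesis by (simp add: card_image)
qed

text \<open>Legendre's formula: the exponent is the sum of N div p^i, which a geometric series
  dominates.\<close>

lemma multiplicity_fact_le:
  fixes p N :: nat
  assumes "prime p"
  shows "real (multiplicity p (fact N :: nat)) \<le> real N / (real p - 1)"
proof -
  have p: "p \<ge> 2" using assms by (rule prime_ge_2_nat)
  have "multiplicity p (fact N :: nat) = (\<Sum>n\<in>{1..N}. multiplicity p n)"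
    unfolding fact_prod using assms
    by (simp add: prime_elem_multiplicity_prod_distrib)
  also have "\<dots> = (\<Sum>n\<in>{1..N}. card {i\<in>{1..N}. p ^ i dvd n})"
    using assms by (intro sum.cong refl multiplicity_eq_card_powers) auto
  also have "\<dots> = (\<Sum>n\<in>{1..N}. \<Sum>i\<in>{1..N}. if p ^ i dvd n then 1 else 0)"
    by (intro sum.cong refl) (simp add: sum.If_cases Int_def)
  also have "\<dots> = (\<Sum>i\<in>{1..N}. \<Sum>n\<in>{1..N}. if p ^ i dvd n then 1 else 0)"
    by (rule sum.swap)
  also have "\<dots> = (\<Sum>i\<in>{1..N}. card {n\<in>{1..N}. p ^ i dvd n})"
    by (intro sum.cong refl) (simp add: sum.If_cases Int_def)
  also have "\<dots> = (\<Sum>i\<in>{1..N}. N div p ^ i)"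
    using p by (intro sum.cong refl card_multiples) auto
  finally have "real (multiplicity p (fact N :: nat)) = (\<Sum>i\<in>{1..N}. real (N div p ^ i))" by simp
  also have "\<dots> \<le> (\<Sum>i\<in>{1..N}. real N * (1 / real p) ^ i)"
  proof (intro sum_mono)
    fix i assume "i \<in> {1..N}"
    have "real (N div p ^ i) \<le> real N / real (p ^ i)" by (rule of_nat_div_le_of_nat)
    thus "real (N div p ^ i) \<le> real N * (1 / real p) ^ i" by (simp add: power_divide)
  qed
  also have "\<dots> = real N * (\<Sum>i\<in>{1..N}. (1 / real p) ^ i)" by (simp add: sum_distrib_left)
  also have "(\<Sum>i\<in>{1..N}. (1 / real p) ^ i) \<le> 1 / (real p - 1)"
  proof -
    have "(\<Sum>i\<in>{1..N}. (1 / real p) ^ i) * (real p - 1) = 1 - (1 / real p) ^ N"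
      using p by (induction N) (auto simp: field_simps)
    also have "\<dots> \<le> 1" by simp
    finally show ?thesis using p by (simp add: field_simps)
  qed
  finally show ?thesis by (simp add: mult_left_mono)
qed

section \<open>Mertens and Chebyshev type estimates\<close>

lemma ln_fact_ge: "ln (fact N :: real) \<ge> real N * ln (real N) - real N"
proof (induction N)
  case (Suc N)
  show ?case
  proof (cases "N = 0")
    case False
    have "ln (real (Suc N) / real N) \<le> real (Suc N) / real N - 1"
      using False by (intro ln_le_minus_one) auto
    hence "real N * (ln (real (Suc N)) - ln (real N)) \<le> 1"
      using False by (simp add: ln_div field_simps)
    moreover have "ln (fact (Suc N) :: real) = ln (real (Suc N)) + ln (fact N)"
      by (simp add: ln_mult del: of_nat_Suc)
    ultimately show ?thesis using Suc.IH by (simp add: algebra_simps)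
  qed simp
qed simp

text \<open>Logarithms are taken in the prime factorization of N!. The denominators p - 1 account
  for the higher prime powers; replacing them by p later costs a factor 2.\<close>

lemma mertens_lower:
  assumes "N > 0"
  shows "(\<Sum>p | prime p \<and> p \<le> N. ln (real p) / (real p - 1)) \<ge> ln (real N) - 1"
proof -
  have pf: "prime_factors (fact N :: nat) = {p. prime p \<and> p \<le> N}"
    by (auto simp: prime_factors_fact prime_ge_2_nat)
  have f: "finite {p. prime p \<and> p \<le> N}" by simp
  have "real N * ln (real N) - real N \<le> ln (fact N)" by (rule ln_fact_ge)
  also have "(fact N :: real) = real (fact N)" by simp
  also have "(fact N :: nat) = (\<Prod>p\<in>prime_factors (fact N). p ^ multiplicity p (fact N))"
    by (subst prime_factorization_nat) auto
  also have "ln (real \<dots>) = (\<Sum>p | prime p \<and> p \<le> N. real (multiplicity p (fact N :: nat)) * ln (real p))"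
    unfolding pf of_nat_prod using f
    by (subst ln_prod) (auto simp: prime_gt_0_nat ln_realpow)
  also have "\<dots> \<le> (\<Sum>p | prime p \<and> p \<le> N. real N / (real p - 1) * ln (real p))"
  proof (intro sum_mono mult_right_mono multiplicity_fact_le)
    fix p assume "p \<in> {p. prime p \<and> p \<le> N}"
    hence p: "prime p" by simp
    thus "prime p" .
    show "0 \<le> ln (real p)" using prime_ge_1_nat[OF p] by simp
  qed
  also have "\<dots> = real N * (\<Sum>p | prime p \<and> p \<le> N. ln (real p) / (real p - 1))"
    by (simp add: sum_distrib_left)
  finally have "real N * (ln (real N) - 1) \<le> real N * (\<Sum>p | prime p \<and> p \<le> N. ln (real p) / (real p - 1))"
    by (simp add: right_diff_distrib)
  thus ?thesis using assms by simp
qed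

text \<open>With M the integer part of (1 + e) q, each prime in question divides M! but neither q!
  nor (M - q)!, because M - q < q < p; hence their product divides the binomial coefficient M choose
  q. That coefficient is bounded by keeping a single term of the expansion of (1 + e)^M. What
  matters is that the bound is linear in q with a factor tending to 0 with e.\<close>

lemma sum_ln_primes_short_interval:
  fixes q :: nat and e :: real
  assumes q: "q \<ge> 1" and e: "0 < e" "e < 1"
  shows "(\<Sum>p | prime p \<and> q < p \<and> real p \<le> (1 + e) * real q. ln (real p))
           \<le> (2 * e + e * ln (1 / e)) * real q"
proof -
  have prod_coprime_dvd: "prod f B dvd n"
    if "finite B" "\<And>x y. x \<in> B \<Longrightarrow> y \<in> B \<Longrightarrow> x \<noteq> y \<Longrightarrow> coprime (f x) (f y)" "\<And>x. x \<in> B \<Longrightarrow> f x dvd n"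
    for f :: "nat \<Rightarrow> nat" and B n
    using that by (induction B rule: finite_induct) (auto intro!: divides_mult prod_coprime_right)
  define M where "M = nat \<lfloor>(1 + e) * real q\<rfloor>"
  define A where "A = {p. prime p \<and> q < p \<and> real p \<le> (1 + e) * real q}"
  have Mle: "real M \<le> (1 + e) * real q" using q e unfolding M_def by simp
  have qM: "q \<le> M" unfolding M_def using q e by (intro le_nat_floor) (simp add: algebra_simps)
  have A_eq: "A = {p. prime p \<and> q < p \<and> p \<le> M}"
  proof -
    have "real p \<le> (1 + e) * real q \<longleftrightarrow> p \<le> M" for p
      using Mle unfolding M_def by (meson dual_order.trans le_nat_floor of_nat_le_iff)
    thus ?thesis unfolding A_def by auto
  qed
  have fA: "finite A" unfolding A_eq by (rule finite_subset[of _ "{..M}"]) auto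
  define k where "k = M - q"
  have kle: "real k \<le> e * real q" using Mle qM unfolding k_def by (simp add: algebra_simps of_nat_diff)
  have "(\<Prod>p\<in>A. p) dvd (M choose q)"
  proof (rule prod_coprime_dvd)
    show "finite A" by (rule fA)
    show "coprime p p'" if "p \<in> A" "p' \<in> A" "p \<noteq> p'" for p p'
      using that by (intro primes_coprime) (auto simp: A_eq)
    fix p assume p: "p \<in> A"
    have "e * real q < real q" using q e by simp
    also have "real q < real p" using p by (simp add: A_eq)
    finally have "e * real q < real p" .
    hence pk: "k < p" using kle by simp
    have "p dvd fact M" using p prime_ge_1_nat by (intro dvd_fact) (auto simp: A_eq)
    also have "(fact M :: nat) = fact q * fact k * (M choose q)"
      using binomial_fact_lemma[OF qM] by (simp add: k_def)
    finally show "p dvd (M choose q)"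
      using p pk by (auto simp: A_eq prime_dvd_mult_iff prime_dvd_fact_iff)
  qed
  moreover have ch0: "(M choose q) > 0" using qM by simp
  ultimately have "(\<Prod>p\<in>A. p) \<le> (M choose q)" by (intro dvd_imp_le)
  hence "real (\<Prod>p\<in>A. p) \<le> real (M choose q)" by (simp only: of_nat_le_iff)
  moreover have "real (\<Prod>p\<in>A. p) > 0" using prime_gt_0_nat by (auto simp: A_eq intro!: prod_pos)
  ultimately have "ln (real (\<Prod>p\<in>A. p)) \<le> ln (real (M choose q))"
    by (intro ln_mono)
  moreover have "ln (real (\<Prod>p\<in>A. p)) = (\<Sum>p\<in>A. ln (real p))"
    unfolding of_nat_prod using fA by (subst ln_prod) (auto simp: A_eq prime_gt_0_nat)
  moreover have "ln (real (M choose q)) \<le> (2 * e + e * ln (1 / e)) * real q"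
  proof -
    have "real (M choose q) * e ^ k = real (M choose k) * e ^ k"
      using binomial_symmetric[OF qM] by (simp add: k_def)
    also have "\<dots> \<le> (\<Sum>i\<le>M. real (M choose i) * e ^ i)"
      using e by (intro member_le_sum) (auto simp: k_def)
    also have "\<dots> = (1 + e) ^ M" using binomial_ring[of e 1 M] by (simp add: add.commute)
    finally have "ln (real (M choose q) * e ^ k) \<le> ln ((1 + e) ^ M)" using e ch0 by simp
    hence "ln (real (M choose q)) + real k * ln e \<le> real M * ln (1 + e)"
      using e ch0 by (simp add: ln_mult ln_realpow)
    moreover have "real M * ln (1 + e) \<le> (2 * real q) * e"
    proof (intro mult_mono)
      have "(1 + e) * real q \<le> 2 * real q" using e by (intro mult_right_mono) auto
      thus "real M \<le> 2 * real q" using Mle by simp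
      show "ln (1 + e) \<le> e" using ln_add_one_self_le_self[of e] e by simp
    qed (use e in auto)
    moreover have "real k * (- ln e) \<le> e * real q * (- ln e)"
      using kle e by (intro mult_right_mono) (auto simp: ln_le_zero_iff)
    moreover have "ln (1 / e) = - ln e" using e by (simp add: ln_div)
    ultimately show ?thesis by (simp add: algebra_simps)
  qed
  ultimately show ?thesis unfolding A_def by simp
qed

text \<open>A set G without such a pair is thin: in a window (X, (1 + d) X] its members lie within a
  factor 1 + d1 of the least one, so they carry little of the sum of ln p / p. Mertens' bound then
  leaves a fixed proportion of ln B to the primes outside G, and ln p <= ln B turns this into a
  bound for the reciprocals. Here d1 is chosen before A, so that blocks can be stacked.\<close>

lemma prime_pairs_block:
  fixes d :: real
  assumes d: "0 < d" "d < 1"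
  obtains d1 where "0 < d1" "d1 < d"
    "\<And>A::nat. \<exists>B>A. \<forall>G. G \<subseteq> {p. prime p \<and> A < p \<and> p \<le> B} \<longrightarrow>
       (\<forall>p\<in>G. \<forall>q\<in>G. p < q \<longrightarrow> real q / real p \<notin> {1 + d1..1 + d}) \<longrightarrow>
       (\<Sum>p\<in>{p. prime p \<and> A < p \<and> p \<le> B} - G. 1 / real p) \<ge> 1 / 8"
proof -
  \<comment> \<open>A window contributes at most 2 c, and about ln B / ln (1 + d) windows reach from
    A to B; the 16 makes their total ln B / 8 up to a constant.\<close>
  define c where "c = ln (1 + d) / 16"
  have c: "c > 0" using d by (simp add: c_def)
  have "((\<lambda>e::real. 2 * e + e * ln (1 / e)) \<longlongrightarrow> 0) (at_right 0)" by real_asymp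
  hence "eventually (\<lambda>e. 2 * e + e * ln (1 / e) < c) (at_right 0)" using c by (rule order_tendstoD)
  moreover have "eventually (\<lambda>e::real. 0 < e \<and> e < d) (at_right 0)"
    using d by (auto simp: eventually_at_right_field)
  ultimately have "eventually (\<lambda>e. (2 * e + e * ln (1 / e) < c) \<and> 0 < e \<and> e < d) (at_right 0)"
    by eventually_elim auto
  then obtain d1 where d1: "2 * d1 + d1 * ln (1 / d1) < c" "0 < d1" "d1 < d"
    by (metis (no_types, lifting) eventually_happens trivial_limit_at_right_real)
  have "((\<lambda>n::nat. ln (real n) / real n) \<longlonglongrightarrow> 0)" by real_asymp
  hence "eventually (\<lambda>n. ln (real n) / real n < c) sequentially" using c by (rule order_tendstoD)
  then obtain X0 where X0: "\<And>n. n \<ge> X0 \<Longrightarrow> ln (real n) / real n < c" by (auto simp: eventually_sequentially)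
  show ?thesis
  proof (rule that[of d1])
    fix A0 :: nat
    define A where "A = max A0 (max X0 2)"
    define C where "C = (\<Sum>p | prime p \<and> p \<le> A. ln (real p) / (real p - 1))"
    have "filterlim (\<lambda>n::nat. 1 / 4 * ln (real n)) at_top sequentially" by real_asymp
    hence "eventually (\<lambda>n::nat. 1 / 4 * ln (real n) \<ge> 1 + C + 4 * c) sequentially"
      by (simp only: filterlim_at_top)
    hence "eventually (\<lambda>n::nat. n > A \<and> 1 / 4 * ln (real n) \<ge> 1 + C + 4 * c) sequentially"
      using eventually_gt_at_top by (rule eventually_conj[rotated])
    then obtain B where B: "B > A" "1 / 4 * ln (real B) \<ge> 1 + C + 4 * c"
      using eventually_happens'[OF sequentially_bot] by blast
    define Q where "Q = {p. prime p \<and> A < p \<and> p \<le> B}"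
    have fQ: "finite Q" unfolding Q_def by simp
    have A2: "A \<ge> 2" "A \<ge> X0" "A \<ge> A0" unfolding A_def by auto
    have lnB: "ln (real B) > 0" using B A2 by simp
    show "\<exists>B>A0. \<forall>G. G \<subseteq> {p. prime p \<and> A0 < p \<and> p \<le> B} \<longrightarrow>
       (\<forall>p\<in>G. \<forall>q\<in>G. p < q \<longrightarrow> real q / real p \<notin> {1 + d1..1 + d}) \<longrightarrow>
       (\<Sum>p\<in>{p. prime p \<and> A0 < p \<and> p \<le> B} - G. 1 / real p) \<ge> 1 / 8"
    proof (intro exI[of _ B] conjI allI impI)
      show "B > A0" using B A2 by simp
      fix G0 assume G0: "G0 \<subseteq> {p. prime p \<and> A0 < p \<and> p \<le> B}"
        and np0: "\<forall>p\<in>G0. \<forall>q\<in>G0. p < q \<longrightarrow> real q / real p \<notin> {1 + d1..1 + d}"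
      define G where "G = G0 \<inter> Q"
      have GQ: "G \<subseteq> Q" and fG: "finite G" unfolding G_def using fQ by auto
      have np: "\<And>p q. p \<in> G \<Longrightarrow> q \<in> G \<Longrightarrow> p < q \<Longrightarrow> real q / real p \<notin> {1 + d1..1 + d}"
        using np0 unfolding G_def by auto
      have lnp: "p \<in> Q \<Longrightarrow> ln (real p) > 0 \<and> real p > 2" for p using A2 unfolding Q_def by auto
      have window: "(\<Sum>p | p \<in> G \<and> X < real p \<and> real p \<le> (1 + d) * X. ln (real p) / real p) \<le> 2 * c"
        for X :: real
      proof -
        define H where "H = {p. p \<in> G \<and> X < real p \<and> real p \<le> (1 + d) * X}"
        have fH: "finite H" using fG unfolding H_def by simp
        show ?thesis
        proof (cases "H = {}")
          case False
          define q where "q = Min H"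
          have qH: "q \<in> H" and qmin: "\<And>p. p \<in> H \<Longrightarrow> q \<le> p"
            using fH False Min_in Min_le unfolding q_def by auto
          have qQ: "q \<in> Q" using qH GQ unfolding H_def by auto
          have q2: "real q > 2" using lnp[OF qQ] by simp
          have Xpos: "X > 0"
          proof (rule ccontr)
            assume "\<not> X > 0"
            hence "(1 + d) * X \<le> 0" using d by (simp add: mult_nonneg_nonpos)
            thus False using qH q2 unfolding H_def by auto
          qed
          define K where "K = {p. prime p \<and> q < p \<and> real p \<le> (1 + d1) * real q}"
          have fK: "finite K" unfolding K_def
          proof (rule finite_subset)
            show "{p. prime p \<and> q < p \<and> real p \<le> (1 + d1) * real q} \<subseteq> {..nat \<lfloor>(1 + d1) * real q\<rfloor>}"
              by (auto intro: le_nat_floor)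
          qed simp
          have HK: "H - {q} \<subseteq> K"
          proof
            fix p assume p: "p \<in> H - {q}"
            hence qp: "q < p" using qmin[of p] by auto
            have pG: "p \<in> G" "q \<in> G" using p qH unfolding H_def by auto
            have "real p \<le> (1 + d) * X" "X < real q" using p qH unfolding H_def by auto
            hence "real p \<le> (1 + d) * real q"
              using d by (meson add_pos_pos less_eq_real_def mult_left_mono order_trans zero_less_one)
            hence "real p / real q \<le> 1 + d" using q2 by (simp add: field_simps)
            hence "real p / real q < 1 + d1" using np[OF pG(2) pG(1) qp] by auto
            hence "real p \<le> (1 + d1) * real q" using q2 by (simp add: field_simps)
            thus "p \<in> K" using qp pG GQ unfolding K_def Q_def by auto
          qed
          \<comment> \<open>The least element q is split off because the short interval estimate
            covers only primes strictly above q; both parts are at most c.\<close>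
          have "(\<Sum>p\<in>H. ln (real p) / real p) = ln (real q) / real q + (\<Sum>p\<in>H - {q}. ln (real p) / real p)"
            using fH qH by (simp add: sum.remove)
          also have "(\<Sum>p\<in>H - {q}. ln (real p) / real p) \<le> (\<Sum>p\<in>H - {q}. ln (real p) / real q)"
          proof (intro sum_mono divide_left_mono)
            fix p assume p: "p \<in> H - {q}"
            hence pq: "q < p" "p > 0" using HK unfolding K_def by auto
            show "real q \<le> real p" using pq by simp
            show "0 \<le> ln (real p)" using pq by simp
            show "0 < real p * real q" using pq q2 by simp
          qed
          also have "\<dots> \<le> (\<Sum>p\<in>K. ln (real p) / real q)"
            using fK HK q2 by (intro sum_mono2) (auto simp: K_def)
          also have "\<dots> = (\<Sum>p\<in>K. ln (real p)) / real q" by (simp add: sum_divide_distrib)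
          also have "\<dots> \<le> (2 * d1 + d1 * ln (1 / d1)) * real q / real q"
            unfolding K_def using q2 d1 d by (intro divide_right_mono sum_ln_primes_short_interval) auto
          also have "\<dots> \<le> c" using q2 d1 by simp
          also have "ln (real q) / real q \<le> c"
          proof -
            have "q \<ge> X0" using qQ A2 unfolding Q_def by auto
            thus ?thesis using X0[of q] by simp
          qed
          finally show ?thesis unfolding H_def by simp
        next
          case True
          thus ?thesis using c unfolding H_def by (simp only: sum.empty)
        qed
      qed
      have tele: "(\<Sum>p | p \<in> G \<and> real p \<le> real A * (1 + d) ^ j. ln (real p) / real p) \<le> 2 * c * real j" for j
      proof (induction j)
        case 0
        have "{p. p \<in> G \<and> real p \<le> real A * (1 + d) ^ 0} = {}"
          using GQ unfolding Q_def by auto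
        thus ?case by (simp only: sum.empty)
      next
        case (Suc j)
        let ?X = "real A * (1 + d) ^ j"
        have "{p. p \<in> G \<and> real p \<le> real A * (1 + d) ^ Suc j} \<subseteq>
           {p. p \<in> G \<and> real p \<le> ?X} \<union> {p. p \<in> G \<and> ?X < real p \<and> real p \<le> (1 + d) * ?X}"
          by (auto simp: algebra_simps)
        hence "(\<Sum>p | p \<in> G \<and> real p \<le> real A * (1 + d) ^ Suc j. ln (real p) / real p) \<le>
          (\<Sum>p\<in>{p. p \<in> G \<and> real p \<le> ?X} \<union> {p. p \<in> G \<and> ?X < real p \<and> real p \<le> (1 + d) * ?X}. ln (real p) / real p)"
          using fG GQ lnp by (intro sum_mono2) (auto intro!: divide_nonneg_nonneg dest!: subsetD[OF GQ] lnp less_imp_le)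
        also have "\<dots> = (\<Sum>p | p \<in> G \<and> real p \<le> ?X. ln (real p) / real p) +
           (\<Sum>p | p \<in> G \<and> ?X < real p \<and> real p \<le> (1 + d) * ?X. ln (real p) / real p)"
          using fG by (intro sum.union_disjoint) auto
        also have "\<dots> \<le> 2 * c * real j + 2 * c" using Suc.IH window[of ?X] by (intro add_mono)
        finally show ?case by (simp add: algebra_simps)
      qed
      define j where "j = nat \<lceil>ln (real B) / ln (1 + d)\<rceil>"
      have jlow: "real j \<ge> ln (real B) / ln (1 + d)" unfolding j_def by linarith
      have jup: "real j \<le> ln (real B) / ln (1 + d) + 1"
      proof -
        have "ln (real B) / ln (1 + d) > 0" using lnB d by simp
        hence "real j = of_int \<lceil>ln (real B) / ln (1 + d)\<rceil>" unfolding j_def by simp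
        thus ?thesis by linarith
      qed
      have "ln (real B) \<le> real j * ln (1 + d)" using jlow d by (simp add: pos_divide_le_eq)
      also have "\<dots> = ln ((1 + d) ^ j)" using d by (simp add: ln_realpow)
      finally have "real B \<le> (1 + d) ^ j" using B d by (simp add: ln_le_cancel_iff)
      also have "\<dots> \<le> real A * (1 + d) ^ j" using A2 d by simp
      finally have "G = {p. p \<in> G \<and> real p \<le> real A * (1 + d) ^ j}"
        using GQ unfolding Q_def by force
      hence "(\<Sum>p\<in>G. ln (real p) / real p) \<le> 2 * c * real j" using tele[of j] by simp
      also have "\<dots> \<le> 2 * c * (ln (real B) / ln (1 + d) + 1)" using jup c by (intro mult_left_mono) auto
      also have "\<dots> = ln (real B) / 8 + 2 * c" using d unfolding c_def by (simp add: field_simps)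
      finally have Gsum: "(\<Sum>p\<in>G. ln (real p) / real p) \<le> ln (real B) / 8 + 2 * c" .
      have up: "ln (real p) / (real p - 1) \<le> 2 * (ln (real p) / real p)" if "p \<in> Q" for p
        using lnp[OF that] by (simp add: field_simps)
      have "ln (real B) - 1 \<le> (\<Sum>p | prime p \<and> p \<le> B. ln (real p) / (real p - 1))"
        using B by (intro mertens_lower) auto
      also have "{p. prime p \<and> p \<le> B} = {p. prime p \<and> p \<le> A} \<union> Q" using B unfolding Q_def by auto
      also have "(\<Sum>p\<in>{p. prime p \<and> p \<le> A} \<union> Q. ln (real p) / (real p - 1)) = C + (\<Sum>p\<in>Q. ln (real p) / (real p - 1))"
        unfolding C_def using fQ by (intro sum.union_disjoint) (auto simp: Q_def)
      also have "(\<Sum>p\<in>Q. ln (real p) / (real p - 1)) \<le> (\<Sum>p\<in>Q. 2 * (ln (real p) / real p))"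
        by (intro sum_mono up)
      also have "\<dots> = 2 * (\<Sum>p\<in>Q. ln (real p) / real p)" by (simp add: sum_distrib_left)
      also have "(\<Sum>p\<in>Q. ln (real p) / real p) = (\<Sum>p\<in>G. ln (real p) / real p) + (\<Sum>p\<in>Q - G. ln (real p) / real p)"
        using fQ GQ by (simp add: sum.subset_diff)
      also have "(\<Sum>p\<in>Q - G. ln (real p) / real p) \<le> (\<Sum>p\<in>Q - G. ln (real B) * (1 / real p))"
      proof (intro sum_mono)
        fix p assume "p \<in> Q - G"
        hence "ln (real p) \<le> ln (real B)" "real p > 0" using lnp[of p] unfolding Q_def by auto
        thus "ln (real p) / real p \<le> ln (real B) * (1 / real p)" by (simp add: divide_right_mono)
      qed
      also have "\<dots> = ln (real B) * (\<Sum>p\<in>Q - G. 1 / real p)" by (simp add: sum_distrib_left)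
      finally have main: "ln (real B) - 1 \<le> C + 2 * ((\<Sum>p\<in>G. ln (real p) / real p) + ln (real B) * (\<Sum>p\<in>Q - G. 1 / real p))"
        by simp
      define T where "T = ln (real B) * (\<Sum>p\<in>Q - G. 1 / real p)"
      have "ln (real B) * (1 / 8) \<le> T"
        using main[folded T_def] Gsum B(2) lnB by (simp add: field_simps)
      hence "ln (real B) * (1 / 8) \<le> ln (real B) * (\<Sum>p\<in>Q - G. 1 / real p)" unfolding T_def .
      hence "1 / 8 \<le> (\<Sum>p\<in>Q - G. 1 / real p)" using lnB by (subst (asm) mult_le_cancel_left_pos) auto
      also have "\<dots> \<le> (\<Sum>p\<in>{p. prime p \<and> A0 < p \<and> p \<le> B} - G0. 1 / real p)"
        using A2 unfolding G_def Q_def by (intro sum_mono2) auto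
      finally show "1 / 8 \<le> (\<Sum>p\<in>{p. prime p \<and> A0 < p \<and> p \<le> B} - G0. 1 / real p)" .
    qed
  qed (use d1 in auto)
qed

text \<open>Each of several disjoint blocks forces a weight of 1 / 8 outside a set without pairs, so
  more than 8 K blocks exceed the allowed weight K. The gap d1 depends on d alone and not on
  K.\<close>

lemma prime_pairs:
  fixes d :: real
  assumes d: "0 < d" "d < 1"
  obtains d1 where "0 < d1" "d1 < d"
    "\<And>K::real. \<exists>P. finite P \<and> (\<forall>p\<in>P. prime p) \<and> (\<forall>G. G \<subseteq> P \<longrightarrow>
       (\<Sum>p\<in>P - G. 1 / real p) \<le> K \<longrightarrow>
       (\<exists>p\<in>G. \<exists>q\<in>G. p < q \<and> real q / real p \<in> {1 + d1..1 + d}))"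
proof -
  obtain d1 where d1: "0 < d1" "d1 < d" and blk:
    "\<And>A::nat. \<exists>B>A. \<forall>G. G \<subseteq> {p. prime p \<and> A < p \<and> p \<le> B} \<longrightarrow>
       (\<forall>p\<in>G. \<forall>q\<in>G. p < q \<longrightarrow> real q / real p \<notin> {1 + d1..1 + d}) \<longrightarrow>
       (\<Sum>p\<in>{p. prime p \<and> A < p \<and> p \<le> B} - G. 1 / real p) \<ge> 1 / 8"
    using prime_pairs_block[OF d] by blast
  have step: "\<exists>P. finite P \<and> (\<forall>p\<in>P. prime p) \<and> (\<forall>G. G \<subseteq> P \<longrightarrow>
      (\<forall>p\<in>G. \<forall>q\<in>G. p < q \<longrightarrow> real q / real p \<notin> {1 + d1..1 + d}) \<longrightarrow>
      (\<Sum>p\<in>P - G. 1 / real p) \<ge> real n / 8)" for n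
  proof (induction n)
    case 0
    show ?case by (intro exI[of _ "{}"]) auto
  next
    case (Suc n)
    then obtain P where P: "finite P" "\<forall>p\<in>P. prime p" "\<And>G. G \<subseteq> P \<Longrightarrow>
      (\<forall>p\<in>G. \<forall>q\<in>G. p < q \<longrightarrow> real q / real p \<notin> {1 + d1..1 + d}) \<Longrightarrow>
      (\<Sum>p\<in>P - G. 1 / real p) \<ge> real n / 8" by blast
    obtain A where A: "\<forall>p\<in>P. p \<le> A" using P(1) finite_nat_set_iff_bounded_le by auto
    obtain B where B: "B > A" "\<And>G. G \<subseteq> {p. prime p \<and> A < p \<and> p \<le> B} \<Longrightarrow>
       (\<forall>p\<in>G. \<forall>q\<in>G. p < q \<longrightarrow> real q / real p \<notin> {1 + d1..1 + d}) \<Longrightarrow>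
       (\<Sum>p\<in>{p. prime p \<and> A < p \<and> p \<le> B} - G. 1 / real p) \<ge> 1 / 8" using blk[of A] by blast
    define Q where "Q = {p. prime p \<and> A < p \<and> p \<le> B}"
    have fQ: "finite Q" unfolding Q_def by simp
    have disj: "P \<inter> Q = {}" using A unfolding Q_def by force
    show ?case
    proof (intro exI[of _ "P \<union> Q"] conjI allI impI)
      fix G assume G: "G \<subseteq> P \<union> Q" "\<forall>p\<in>G. \<forall>q\<in>G. p < q \<longrightarrow> real q / real p \<notin> {1 + d1..1 + d}"
      have "(\<Sum>p\<in>(P - G \<inter> P) \<union> (Q - G \<inter> Q). 1 / real p) =
            (\<Sum>p\<in>P - G \<inter> P. 1 / real p) + (\<Sum>p\<in>Q - G \<inter> Q. 1 / real p)"
        using P(1) fQ disj by (intro sum.union_disjoint) auto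
      moreover have "(\<Sum>p\<in>P - G \<inter> P. 1 / real p) \<ge> real n / 8" using G by (intro P(3)) auto
      moreover have "(\<Sum>p\<in>Q - G \<inter> Q. 1 / real p) \<ge> 1 / 8"
        using G unfolding Q_def by (intro B(2)) auto
      moreover have "(P - G \<inter> P) \<union> (Q - G \<inter> Q) = P \<union> Q - G" using disj by auto
      ultimately show "real (Suc n) / 8 \<le> (\<Sum>p\<in>P \<union> Q - G. 1 / real p)" by simp
    qed (use P fQ in \<open>auto simp: Q_def\<close>)
  qed
  show ?thesis
  proof (rule that[OF d1])
    fix K :: real
    obtain n where n: "real n > 8 * K" using reals_Archimedean2 by blast
    obtain P where P: "finite P" "\<forall>p\<in>P. prime p" "\<And>G. G \<subseteq> P \<Longrightarrow>
      (\<forall>p\<in>G. \<forall>q\<in>G. p < q \<longrightarrow> real q / real p \<notin> {1 + d1..1 + d}) \<Longrightarrow>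
      (\<Sum>p\<in>P - G. 1 / real p) \<ge> real n / 8" using step[of n] by blast
    show "\<exists>P. finite P \<and> (\<forall>p\<in>P. prime p) \<and> (\<forall>G. G \<subseteq> P \<longrightarrow>
       (\<Sum>p\<in>P - G. 1 / real p) \<le> K \<longrightarrow>
       (\<exists>p\<in>G. \<exists>q\<in>G. p < q \<and> real q / real p \<in> {1 + d1..1 + d}))"
    proof (intro exI[of _ P] conjI allI impI P(1,2))
      fix G assume G: "G \<subseteq> P" "(\<Sum>p\<in>P - G. 1 / real p) \<le> K"
      show "\<exists>p\<in>G. \<exists>q\<in>G. p < q \<and> real q / real p \<in> {1 + d1..1 + d}"
      proof (rule ccontr)
        assume "\<not> ?thesis"
        hence "real n / 8 \<le> (\<Sum>p\<in>P - G. 1 / real p)" using G by (intro P(3)) auto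
        thus False using G n by simp
      qed
    qed
  qed
qed

subsection \<open>Shift invariance of the distribution of the number of prime factors\<close>

text \<open>The scale is a real number, because it will be divided by primes and by ratios of
  primes.\<close>

definition omega_diff :: "real \<Rightarrow> (nat \<Rightarrow> real) \<Rightarrow> real" where
  "omega_diff x a = (\<Sum>n\<in>{1..nat \<lfloor>x\<rfloor>}. a (Suc (bigomega n)) - a (bigomega n)) / x"

lemma bigomega_prime_mult:
  assumes "prime p" "m > 0"
  shows "bigomega (p * m) = Suc (bigomega m)"
  unfolding bigomega_def using assms
  by (subst prime_factorization_mult) (auto simp: prime_factorization_prime prime_gt_0_nat)

text \<open>The dual form. With w n the number of p in P dividing n, the sums over multiples regroup
  to the sum of b n * w n. The second moment of w - S is at most 2 N S, so Cauchy--Schwarz allows w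
  to be replaced by the constant S. The hypothesis on N pays for the rounding in N div p.\<close>

lemma turan_kubilius:
  fixes b :: "nat \<Rightarrow> real"
  assumes P: "finite P" "\<And>p. p \<in> P \<Longrightarrow> prime p" "P \<noteq> {}"
    and N: "N \<ge> 2 * card P" and b: "\<And>n. \<bar>b n\<bar> \<le> C" and C: "C \<ge> 0"
  defines "S \<equiv> \<Sum>p\<in>P. 1 / real p"
  shows "\<bar>(\<Sum>n\<in>{1..N}. b n) * S - (\<Sum>p\<in>P. \<Sum>m\<in>{1..N div p}. b (p * m))\<bar> \<le> C * (real N * sqrt (2 * S))"
proof -
  define w :: "nat \<Rightarrow> real" where "w n = (\<Sum>p\<in>P. if p dvd n then 1 else 0)" for n
  have p0: "p \<in> P \<Longrightarrow> p > 0" for p using P(2) prime_gt_0_nat by blast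
  have cardP: "card P > 0" using P by (simp add: card_gt_0_iff)
  have Npos: "N > 0" using N cardP by simp
  have S0: "S > 0" unfolding S_def using P(1,3) p0 by (intro sum_pos) auto
  have reindex: "(\<Sum>n\<in>{1..N}. if p dvd n then b n else 0) = (\<Sum>m\<in>{1..N div p}. b (p * m))" if "p \<in> P" for p
  proof -
    have "(\<Sum>n\<in>{1..N}. if p dvd n then b n else 0) = (\<Sum>n\<in>{n\<in>{1..N}. p dvd n}. b n)"
      by (rule sum.inter_filter[symmetric]) simp
    also have "\<dots> = (\<Sum>m\<in>{1..N div p}. b (p * m))"
    proof (rule sum.reindex_bij_witness[of _ "\<lambda>m. p * m" "\<lambda>n. n div p"])
      fix n assume n: "n \<in> {n\<in>{1..N}. p dvd n}"
      thus "p * (n div p) = n" by simp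
      show "n div p \<in> {1..N div p}"
        using n p0[OF that] by (auto simp: div_le_mono Suc_le_eq div_greater_zero_iff dvd_imp_le)
      show "b (p * (n div p)) = b n" using n by simp
    next
      fix m assume m: "m \<in> {1..N div p}"
      show "p * m div p = m" using p0[OF that] by simp
      have "p * m \<le> N" using m p0[OF that] by (simp add: less_eq_div_iff_mult_less_eq mult.commute)
      thus "p * m \<in> {n\<in>{1..N}. p dvd n}" using m p0[OF that] by simp
    qed
    finally show ?thesis .
  qed
  have "(\<Sum>p\<in>P. \<Sum>m\<in>{1..N div p}. b (p * m)) = (\<Sum>p\<in>P. \<Sum>n\<in>{1..N}. if p dvd n then b n else 0)"
    using reindex by simp
  also have "\<dots> = (\<Sum>n\<in>{1..N}. b n * w n)"
    unfolding w_def by (subst sum.swap) (auto simp: sum_distrib_left intro!: sum.cong)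
  finally have e1: "(\<Sum>n\<in>{1..N}. b n) * S - (\<Sum>p\<in>P. \<Sum>m\<in>{1..N div p}. b (p * m)) = (\<Sum>n\<in>{1..N}. b n * (S - w n))"
    by (simp add: sum_distrib_right sum_subtractf right_diff_distrib)
  have cnt: "(\<Sum>n\<in>{1..N}. if d dvd n then 1 else 0 :: real) = real (N div d)" if "d > 0" for d
    using card_multiples[OF that, of N] sum.inter_filter[of "{1..N}" "\<lambda>_. 1 :: real" "\<lambda>n. d dvd n"] by simp
  have s1: "(\<Sum>n\<in>{1..N}. w n) = (\<Sum>p\<in>P. real (N div p))"
    unfolding w_def by (subst sum.swap) (intro sum.cong refl cnt p0)
  have divlow: "real (N div p) \<ge> real N / real p - 1" if "p > 0" for p
  proof -
    have "N < N div p * p + p"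
      using mod_less_divisor[OF that, of N] div_mult_mod_eq[of N p] by linarith
    hence "real N < real (N div p * p + p)" by (simp only: of_nat_less_iff)
    thus ?thesis using that by (simp add: field_simps)
  qed
  have "(\<Sum>p\<in>P. real (N div p)) \<ge> (\<Sum>p\<in>P. real N / real p - 1)"
    using divlow p0 by (intro sum_mono) auto
  hence s1': "(\<Sum>n\<in>{1..N}. w n) \<ge> real N * S - real (card P)"
    unfolding s1 S_def by (simp add: sum_subtractf sum_distrib_left)
  have s2: "(\<Sum>n\<in>{1..N}. w n ^ 2) \<le> real N * S ^ 2 + real N * S"
  proof -
    have "(\<Sum>n\<in>{1..N}. w n ^ 2) = (\<Sum>n\<in>{1..N}. \<Sum>p\<in>P. \<Sum>q\<in>P. if p dvd n \<and> q dvd n then 1 else 0)"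
      unfolding w_def power2_eq_square sum_product by (intro sum.cong refl) auto
    also have "\<dots> = (\<Sum>p\<in>P. \<Sum>n\<in>{1..N}. \<Sum>q\<in>P. if p dvd n \<and> q dvd n then 1 else 0)"
      by (rule sum.swap)
    also have "\<dots> = (\<Sum>p\<in>P. \<Sum>q\<in>P. \<Sum>n\<in>{1..N}. if p dvd n \<and> q dvd n then 1 else 0)"
      by (rule sum.cong[OF refl], rule sum.swap)
    also have "\<dots> \<le> (\<Sum>p\<in>P. \<Sum>q\<in>P. real N * ((1 / real p) * (1 / real q)) + (if p = q then real N / real p else 0))"
    proof (intro sum_mono)
      fix p q assume pq: "p \<in> P" "q \<in> P"
      show "(\<Sum>n\<in>{1..N}. if p dvd n \<and> q dvd n then 1 else 0) \<le> real N * ((1 / real p) * (1 / real q)) + (if p = q then real N / real p else 0)"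
      proof (cases "p = q")
        case True
        have "(\<Sum>n\<in>{1..N}. if p dvd n \<and> q dvd n then 1 else 0) = real (N div p)"
          using True cnt[OF p0[OF pq(1)]] by simp
        also have "\<dots> \<le> real N / real p" by (rule of_nat_div_le_of_nat)
        finally show ?thesis using True by (auto intro: add_increasing)
      next
        case False
        hence "coprime p q" using pq P(2) by (intro primes_coprime)
        hence "p dvd n \<and> q dvd n \<longleftrightarrow> p * q dvd n" for n
          by (auto intro: divides_mult dvd_mult_left dvd_mult_right)
        hence "(\<Sum>n\<in>{1..N}. if p dvd n \<and> q dvd n then 1 else 0) = real (N div (p * q))"
          using cnt[of "p * q"] p0 pq by simp
        also have "\<dots> \<le> real N / real (p * q)" by (rule of_nat_div_le_of_nat)
        finally show ?thesis using False by simp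
      qed
    qed
    also have "\<dots> = real N * S ^ 2 + real N * S"
    proof -
      have "S ^ 2 = (\<Sum>p\<in>P. \<Sum>q\<in>P. (1 / real p) * (1 / real q))"
        unfolding S_def power2_eq_square by (rule sum_product)
      moreover have "(\<Sum>p\<in>P. \<Sum>q\<in>P. if p = q then real N / real p else 0) = real N * S"
        using P(1) unfolding S_def by (simp add: sum_distrib_left)
      ultimately show ?thesis by (simp only: sum.distrib sum_distrib_left[symmetric])
    qed
    finally show ?thesis .
  qed
  have "(\<Sum>n\<in>{1..N}. (S - w n) ^ 2) = real N * S ^ 2 - 2 * S * (\<Sum>n\<in>{1..N}. w n) + (\<Sum>n\<in>{1..N}. w n ^ 2)"
    by (simp add: power2_diff sum.distrib sum_subtractf sum_distrib_left)
  also have "\<dots> \<le> real N * S ^ 2 - 2 * S * (real N * S - real (card P)) + (real N * S ^ 2 + real N * S)"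
    using s1' s2 S0 by (intro add_mono diff_mono mult_left_mono) auto
  also have "\<dots> = S * (real N + 2 * real (card P))" by (simp add: algebra_simps power2_eq_square)
  also have "\<dots> \<le> S * (2 * real N)" using N S0 by (intro mult_left_mono) auto
  finally have var: "(\<Sum>n\<in>{1..N}. (S - w n) ^ 2) \<le> S * (2 * real N)" .
  have "\<bar>\<Sum>n\<in>{1..N}. b n * (S - w n)\<bar> \<le> (\<Sum>n\<in>{1..N}. C * \<bar>S - w n\<bar>)"
    by (rule order_trans[OF sum_abs]) (auto simp: abs_mult intro!: sum_mono mult_right_mono b)
  also have "\<dots> = C * (\<Sum>n\<in>{1..N}. 1 * \<bar>S - w n\<bar>)" by (simp add: sum_distrib_left)
  also have "(\<Sum>n\<in>{1..N}. 1 * \<bar>S - w n\<bar>) \<le> sqrt (real N * (S * (2 * real N)))"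
  proof (rule real_le_rsqrt)
    have "(\<Sum>n\<in>{1..N}. 1 * \<bar>S - w n\<bar>)\<^sup>2 \<le> (\<Sum>n\<in>{1..N}. 1\<^sup>2) * (\<Sum>n\<in>{1..N}. \<bar>S - w n\<bar>\<^sup>2)"
      by (rule Cauchy_Schwarz_ineq_sum)
    also have "\<dots> \<le> real N * (S * (2 * real N))" using var by (simp add: mult_left_mono)
    finally show "(\<Sum>n\<in>{1..N}. 1 * \<bar>S - w n\<bar>)\<^sup>2 \<le> real N * (S * (2 * real N))" .
  qed
  also have "real N * (S * (2 * real N)) = (real N)\<^sup>2 * (2 * S)" by (simp add: power2_eq_square)
  finally show ?thesis unfolding e1 using C by (simp add: real_sqrt_mult mult_left_mono)
qed

text \<open>Since \<open>bigomega (p * m) = Suc (bigomega m)\<close>, the sum over the multiples of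
  p is the average of the shifted sequence at scale y / p. If all these averages fall short by e,
  Turan--Kubilius gives e S <= 2 sqrt (2 S) for the reciprocal sum S of B. The resulting bound is
  independent of y, a and B.\<close>

lemma bad_primes_bound:
  fixes a :: "nat \<Rightarrow> real"
  assumes B: "finite B" "\<And>p. p \<in> B \<Longrightarrow> prime p" and y: "y \<ge> 2 * real (card B) + 1"
    and a: "\<And>n. \<bar>a n\<bar> \<le> 1" and c: "omega_diff y a \<ge> c" and e: "e > 0"
    and bad: "\<And>p. p \<in> B \<Longrightarrow> omega_diff (y / real p) (\<lambda>n. a (Suc n)) < c - e"
  shows "(\<Sum>p\<in>B. 1 / real p) \<le> 8 / e ^ 2"
proof (cases "B = {}")
  case False
  define S where "S = (\<Sum>p\<in>B. 1 / real p)"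
  define N where "N = nat \<lfloor>y\<rfloor>"
  define b where "b n = a (Suc (bigomega n)) - a (bigomega n)" for n
  have p0: "p \<in> B \<Longrightarrow> p > 0" for p using B(2) prime_gt_0_nat by blast
  have S0: "S > 0" unfolding S_def using B(1) False p0 by (intro sum_pos) auto
  have ypos: "y > 0" using y by simp
  have N: "N \<ge> 2 * card B" unfolding N_def using y by (intro le_nat_floor) simp
  have bb: "\<bar>b n\<bar> \<le> 2" for n
    using a[of "Suc (bigomega n)"] a[of "bigomega n"] unfolding b_def by linarith
  have "\<bar>(\<Sum>n\<in>{1..N}. b n) * S - (\<Sum>p\<in>B. \<Sum>m\<in>{1..N div p}. b (p * m))\<bar> \<le> 2 * (real N * sqrt (2 * S))"
    unfolding S_def using B False N bb by (intro turan_kubilius) auto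
  also have "\<dots> \<le> 2 * (y * sqrt (2 * S))"
    using S0 ypos unfolding N_def by (intro mult_left_mono mult_right_mono) auto
  finally have tk: "(\<Sum>n\<in>{1..N}. b n) * S - (\<Sum>p\<in>B. \<Sum>m\<in>{1..N div p}. b (p * m)) \<le> 2 * (y * sqrt (2 * S))" by simp
  have "(\<Sum>n\<in>{1..N}. b n) \<ge> c * y"
    using c ypos unfolding omega_diff_def b_def N_def by (simp add: field_simps)
  hence l: "(\<Sum>n\<in>{1..N}. b n) * S \<ge> c * y * S" using S0 by simp
  have "(\<Sum>p\<in>B. \<Sum>m\<in>{1..N div p}. b (p * m)) \<le> (\<Sum>p\<in>B. (c - e) * y * (1 / real p))"
  proof (intro sum_mono)
    fix p assume p: "p \<in> B"
    have "N div p = nat \<lfloor>y / real p\<rfloor>"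
    proof -
      have "\<lfloor>y / real p\<rfloor> = \<lfloor>y\<rfloor> div int p" using floor_divide_real_eq_div[of "int p" y] by simp
      thus ?thesis unfolding N_def using ypos by (simp add: nat_div_distrib)
    qed
    moreover have "b (p * m) = a (Suc (Suc (bigomega m))) - a (Suc (bigomega m))" if "m \<in> {1..N div p}" for m
      using bigomega_prime_mult[of p m] B(2)[OF p] that unfolding b_def by simp
    ultimately have "(\<Sum>m\<in>{1..N div p}. b (p * m)) = omega_diff (y / real p) (\<lambda>n. a (Suc n)) * (y / real p)"
      unfolding omega_diff_def using ypos p0[OF p] by simp
    also have "\<dots> \<le> (c - e) * (y / real p)"
      using bad[OF p] ypos by (intro mult_right_mono) auto
    finally show "(\<Sum>m\<in>{1..N div p}. b (p * m)) \<le> (c - e) * y * (1 / real p)" by simp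
  qed
  also have "\<dots> = (c - e) * y * S" unfolding S_def by (simp add: sum_distrib_left)
  finally have "e * S * y \<le> 2 * sqrt (2 * S) * y" using l tk by (simp add: algebra_simps)
  hence "e * S \<le> 2 * sqrt (2 * S)" using ypos by simp
  hence "(e * S) ^ 2 \<le> (2 * sqrt (2 * S)) ^ 2" using e S0 by (intro power_mono) auto
  also have "\<dots> = 8 * S" using S0 by (simp add: power_mult_distrib)
  finally have "e ^ 2 * S \<le> 8" using S0 by (simp add: power2_eq_square)
  thus ?thesis unfolding S_def[symmetric] using e by (simp add: field_simps)
qed (use e in simp)

text \<open>The pair \<open>(k, v)\<close> stands for the sequence \<open>a\<close> shifted by \<open>k\<close>, at the scale \<open>x / v\<close>: dividing the
  integers up to \<open>x\<close> by a prime \<open>p\<close> turns \<open>(k, v)\<close> into \<open>(k + 1, v p)\<close>.\<close>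

definition realizable :: "(nat \<times> real) set \<Rightarrow> real \<Rightarrow> bool" where
  "realizable E c \<longleftrightarrow> (\<forall>X. \<exists>x\<ge>X. \<exists>a. (\<forall>n. \<bar>a n\<bar> \<le> 1) \<and>
     (\<forall>(k, v)\<in>E. omega_diff (x / v) (\<lambda>n. a (n + k)) \<ge> c))"

lemma realizable_mono:
  assumes "realizable E c" "E' \<subseteq> E" "c' \<le> c"
  shows "realizable E' c'"
  unfolding realizable_def
proof
  fix X
  obtain x a where "x \<ge> X" "\<forall>n. \<bar>a n\<bar> \<le> 1" "\<forall>(k, v)\<in>E. omega_diff (x / v) (\<lambda>n. a (n + k)) \<ge> c"
    using assms(1) unfolding realizable_def by blast
  moreover from this(3) have "\<forall>(k, v)\<in>E'. omega_diff (x / v) (\<lambda>n. a (n + k)) \<ge> c'"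
    using assms(2,3) by force
  ultimately show "\<exists>x\<ge>X. \<exists>a. (\<forall>n. \<bar>a n\<bar> \<le> 1) \<and> (\<forall>(k, v)\<in>E'. omega_diff (x / v) (\<lambda>n. a (n + k)) \<ge> c')"
    by blast
qed

text \<open>If each of the finitely many r failed beyond a threshold of its own, all would fail
  beyond the largest threshold. This turns a choice that varies with x and a into a fixed
  one.\<close>

lemma realizable_pigeonhole:
  assumes "finite R" and "\<And>X. \<exists>r\<in>R. \<exists>x\<ge>X. \<exists>a. (\<forall>n. \<bar>a n\<bar> \<le> 1) \<and>
     (\<forall>(k, v)\<in>E r. omega_diff (x / v) (\<lambda>n. a (n + k)) \<ge> c)"
  obtains r where "r \<in> R" "realizable (E r) c"
proof -
  have "\<exists>r\<in>R. realizable (E r) c"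
  proof (rule ccontr)
    assume "\<not> ?thesis"
    hence "\<forall>r\<in>R. \<exists>X. \<not> (\<exists>x\<ge>X. \<exists>a. (\<forall>n. \<bar>a n\<bar> \<le> 1) \<and>
       (\<forall>(k, v)\<in>E r. omega_diff (x / v) (\<lambda>n. a (n + k)) \<ge> c))"
      unfolding realizable_def by blast
    then obtain f where f: "\<And>r. r \<in> R \<Longrightarrow> \<not> (\<exists>x\<ge>f r. \<exists>a. (\<forall>n. \<bar>a n\<bar> \<le> 1) \<and>
       (\<forall>(k, v)\<in>E r. omega_diff (x / v) (\<lambda>n. a (n + k)) \<ge> c))" by metis
    obtain r where r: "r \<in> R" "\<exists>x\<ge>Max (insert 0 (f ` R)). \<exists>a. (\<forall>n. \<bar>a n\<bar> \<le> 1) \<and>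
       (\<forall>(k, v)\<in>E r. omega_diff (x / v) (\<lambda>n. a (n + k)) \<ge> c)" using assms(2) by blast
    have "f r \<le> Max (insert 0 (f ` R))" using assms(1) r(1) by (intro Max_ge) auto
    thus False using f[OF r(1)] r(2) order_trans by blast
  qed
  thus ?thesis using that by blast
qed

text \<open>The set of primes to avoid depends on the realization, hence the good primes are taken
  from a finite set fixed in advance.\<close>

lemma realizable_good_primes:
  assumes E: "finite E" "\<forall>(k, v)\<in>E. v > 0" and rz: "realizable E c" and e: "e > 0"
    and P: "finite P" "\<forall>p\<in>P. prime p"
  shows "\<exists>x\<ge>X. \<exists>a G. (\<forall>n. \<bar>a n\<bar> \<le> 1) \<and> (\<forall>(k, v)\<in>E. omega_diff (x / v) (\<lambda>n. a (n + k)) \<ge> c) \<and>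
     G \<subseteq> P \<and> (\<Sum>p\<in>P - G. 1 / real p) \<le> real (card E) * (8 / e ^ 2) \<and>
     (\<forall>p\<in>G. \<forall>(k, v)\<in>E. omega_diff (x / (v * real p)) (\<lambda>n. a (n + Suc k)) \<ge> c - e)"
proof -
  \<comment> \<open>A common bound for the v in E; x >= (2 card P + 1) M makes every scale x / v
    large enough for \<open>bad_primes_bound\<close>.\<close>
  define M where "M = (\<Sum>(k, v)\<in>E. v)"
  have M: "v \<le> M" if "(k, v) \<in> E" for k v
  proof -
    have "(case (k, v) of (k, v) \<Rightarrow> v) \<le> M" unfolding M_def using E that by (intro member_le_sum) (auto intro: less_imp_le)
    thus ?thesis by simp
  qed
  obtain x a where x: "x \<ge> max X ((2 * real (card P) + 1) * M)" and a: "\<And>n. \<bar>a n\<bar> \<le> 1"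
    and w: "\<And>k v. (k, v) \<in> E \<Longrightarrow> omega_diff (x / v) (\<lambda>n. a (n + k)) \<ge> c"
    using rz unfolding realizable_def by fast
  define Bd where "Bd kv = {p\<in>P. omega_diff (x / (snd kv * real p)) (\<lambda>n. a (n + Suc (fst kv))) < c - e}" for kv
  define G where "G = P - (\<Union>kv\<in>E. Bd kv)"
  have fB: "finite (Bd kv)" for kv unfolding Bd_def using P by simp
  have bnd: "(\<Sum>p\<in>Bd kv. 1 / real p) \<le> 8 / e ^ 2" if "kv \<in> E" for kv
  proof -
    obtain k v where kv: "kv = (k, v)" by force
    have v: "v > 0" "v \<le> M" using E M that kv by auto
    show ?thesis
    proof (rule bad_primes_bound[where y = "x / v" and a = "\<lambda>n. a (n + k)" and c = c])
      have "2 * real (card (Bd kv)) + 1 \<le> 2 * real (card P) + 1"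
        unfolding Bd_def using P by (auto intro: card_mono)
      also have "(2 * real (card P) + 1) * v \<le> (2 * real (card P) + 1) * M" using v by (intro mult_left_mono) auto
      hence "2 * real (card P) + 1 \<le> x / v" using v x by (simp add: field_simps)
      finally show "2 * real (card (Bd kv)) + 1 \<le> x / v" .
    qed (use fB P a w that kv e in \<open>auto simp: Bd_def\<close>)
  qed
  have "(\<Sum>p\<in>P - G. 1 / real p) = (\<Sum>p\<in>(\<Union>kv\<in>E. Bd kv). 1 / real p)"
    unfolding G_def Bd_def by (intro sum.cong) auto
  also have "\<dots> \<le> (\<Sum>kv\<in>E. \<Sum>p\<in>Bd kv. 1 / real p)"
    using E(1)
  proof (induction E rule: finite_induct)
    case (insert kv E)
    have "(\<Sum>p\<in>Bd kv \<union> (\<Union>kv\<in>E. Bd kv). 1 / real p) \<le> (\<Sum>p\<in>Bd kv. 1 / real p) + (\<Sum>p\<in>(\<Union>kv\<in>E. Bd kv). 1 / real p)"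
      using fB insert.hyps by (subst sum_Un) (auto intro!: sum_nonneg)
    thus ?case using insert by simp
  qed simp
  also have "\<dots> \<le> real (card E) * (8 / e ^ 2)" using bnd by (rule sum_bounded_above)
  finally have s: "(\<Sum>p\<in>P - G. 1 / real p) \<le> real (card E) * (8 / e ^ 2)" .
  have g: "\<forall>p\<in>G. \<forall>(k, v)\<in>E. omega_diff (x / (v * real p)) (\<lambda>n. a (n + Suc k)) \<ge> c - e"
    unfolding G_def Bd_def by force
  show ?thesis using x a w s g unfolding G_def by (intro exI[of _ x] conjI exI[of _ a] exI[of _ G]) (auto simp: G_def)
qed

text \<open>\<open>prime_pairs\<close> serves here as a form of the divergence of the sum of 1 / p:
  a subset of P that misses only primes of bounded reciprocal sum cannot be empty, so a good prime
  exists in P.\<close>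

lemma realizable_extend:
  assumes E: "finite E" "\<forall>(k, v)\<in>E. v > 0" and rz: "realizable E c" and e: "e > 0"
    and mv: "(m, v) \<in> E"
  obtains p where "prime p" "realizable (insert (Suc m, v * real p) E) (c - e)"
proof -
  have h1: "1 / 2 < (1 :: real)" by simp
  obtain d1 :: real where "0 < d1" "d1 < 1 / 2" and prs: "\<And>K::real. \<exists>P. finite P \<and> (\<forall>p\<in>P. prime p) \<and> (\<forall>G. G \<subseteq> P \<longrightarrow>
       (\<Sum>p\<in>P - G. 1 / real p) \<le> K \<longrightarrow>
       (\<exists>p\<in>G. \<exists>q\<in>G. p < q \<and> real q / real p \<in> {1 + d1..1 + 1 / 2}))"
    by (rule prime_pairs[OF half_gt_zero[OF zero_less_one] h1], rule that)
  obtain P :: "nat set" where P: "finite P" "\<forall>p\<in>P. prime p"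
    and G: "\<And>G. G \<subseteq> P \<Longrightarrow> (\<Sum>p\<in>P - G. 1 / real p) \<le> real (card E) * (8 / e ^ 2) \<Longrightarrow> G \<noteq> {}"
  proof -
    obtain P :: "nat set" where P: "finite P" "\<forall>p\<in>P. prime p" and G: "\<forall>G. G \<subseteq> P \<longrightarrow>
       (\<Sum>p\<in>P - G. 1 / real p) \<le> real (card E) * (8 / e ^ 2) \<longrightarrow>
       (\<exists>p\<in>G. \<exists>q\<in>G. p < q \<and> real q / real p \<in> {1 + d1..1 + 1 / 2})"
      using prs[of "real (card E) * (8 / e ^ 2)"] by (elim exE conjE)
    have "G \<noteq> {}" if "G \<subseteq> P" "(\<Sum>p\<in>P - G. 1 / real p) \<le> real (card E) * (8 / e ^ 2)" for G
      using G[rule_format, OF that] by blast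
    with P show thesis by (rule that)
  qed
  have "\<exists>p\<in>P. \<exists>x\<ge>X. \<exists>a. (\<forall>n. \<bar>a n\<bar> \<le> 1) \<and>
     (\<forall>(k, v)\<in>insert (Suc m, v * real p) E. omega_diff (x / v) (\<lambda>n. a (n + k)) \<ge> c - e)" for X
  proof -
    obtain x a G' where x: "x \<ge> X" "\<forall>n. \<bar>a n\<bar> \<le> 1" "\<forall>(k, v)\<in>E. omega_diff (x / v) (\<lambda>n. a (n + k)) \<ge> c"
     "G' \<subseteq> P" "(\<Sum>p\<in>P - G'. 1 / real p) \<le> real (card E) * (8 / e ^ 2)"
     "\<forall>p\<in>G'. \<forall>(k, v)\<in>E. omega_diff (x / (v * real p)) (\<lambda>n. a (n + Suc k)) \<ge> c - e"
      using realizable_good_primes[OF E rz e P, where X = X] by blast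
    obtain p where p: "p \<in> G'" using G[OF x(4,5)] by blast
    have "\<forall>(k, v)\<in>insert (Suc m, v * real p) E. omega_diff (x / v) (\<lambda>n. a (n + k)) \<ge> c - e"
      using x(3,6) p mv e by fastforce
    thus ?thesis using x p by blast
  qed
  from realizable_pigeonhole[OF P(1) this] P(2) that show ?thesis by blast
qed

text \<open>Two good primes p < q give the shifted averages at x / (v p) and at x / (v q). With x /
  p as the new scale and the shifted sequence as the new a, the shift is absorbed: E survives,
  together with a copy stretched by r = q / p. The lower bound on r guarantees progress when this is
  iterated.\<close>

lemma realizable_stretch:
  assumes d: "0 < d" "d < 1"
  obtains d1 where "0 < d1" "d1 < d" "\<And>E c e. finite E \<Longrightarrow> \<forall>(k, v)\<in>E. v > 0 \<Longrightarrow>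
    realizable E c \<Longrightarrow> e > 0 \<Longrightarrow>
    \<exists>r\<in>{1 + d1..1 + d}. realizable (E \<union> (\<lambda>(k, v). (k, v * r)) ` E) (c - e)"
proof -
  obtain d1 where d1: "0 < d1" "d1 < d" and prs:
    "\<And>K::real. \<exists>P. finite P \<and> (\<forall>p\<in>P. prime p) \<and> (\<forall>G. G \<subseteq> P \<longrightarrow>
       (\<Sum>p\<in>P - G. 1 / real p) \<le> K \<longrightarrow>
       (\<exists>p\<in>G. \<exists>q\<in>G. p < q \<and> real q / real p \<in> {1 + d1..1 + d}))"
    by (rule prime_pairs[OF d], rule that)
  show ?thesis
  proof (rule that[OF d1])
    fix E :: "(nat \<times> real) set" and c e :: real
    assume E: "finite E" "\<forall>(k, v)\<in>E. v > 0" and rz: "realizable E c" and e: "e > 0"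
    obtain P where P: "finite P" "\<forall>p\<in>P. prime p" and
      G: "\<And>G. G \<subseteq> P \<Longrightarrow> (\<Sum>p\<in>P - G. 1 / real p) \<le> real (card E) * (8 / e ^ 2) \<Longrightarrow>
       (\<exists>p\<in>G. \<exists>q\<in>G. p < q \<and> real q / real p \<in> {1 + d1..1 + d})"
      using prs[of "real (card E) * (8 / e ^ 2)"] by blast
    define R where "R = (\<lambda>(p, q). real q / real p) ` (P \<times> P) \<inter> {1 + d1..1 + d}"
    have fR: "finite R" unfolding R_def using P by blast
    have "\<exists>r\<in>R. \<exists>x\<ge>X. \<exists>a. (\<forall>n. \<bar>a n\<bar> \<le> 1) \<and>
     (\<forall>(k, v)\<in>E \<union> (\<lambda>(k, v). (k, v * r)) ` E. omega_diff (x / v) (\<lambda>n. a (n + k)) \<ge> c - e)" for X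
    proof -
      \<comment> \<open>The new scale x / p must still be at least X, for whichever p in P is
        used.\<close>
      define X' where "X' = \<bar>X\<bar> * (\<Sum>p\<in>P. real p)"
      obtain x a G' where x: "x \<ge> X'" "\<forall>n. \<bar>a n\<bar> \<le> 1"
       "G' \<subseteq> P" "(\<Sum>p\<in>P - G'. 1 / real p) \<le> real (card E) * (8 / e ^ 2)"
       "\<And>p k v. p \<in> G' \<Longrightarrow> (k, v) \<in> E \<Longrightarrow> omega_diff (x / (v * real p)) (\<lambda>n. a (n + Suc k)) \<ge> c - e"
        using realizable_good_primes[OF E rz e P, where X = X'] by blast
      obtain p q where pq: "p \<in> G'" "q \<in> G'" "real q / real p \<in> {1 + d1..1 + d}"
        using G[OF x(3,4)] by blast
      have pP: "p \<in> P" "q \<in> P" using pq x(3) by auto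
      have p0: "real p > 0" using P(2) pP(1) prime_gt_0_nat by auto
      have "real p \<le> (\<Sum>p\<in>P. real p)" using P(1) pP(1) by (intro member_le_sum) auto
      hence "\<bar>X\<bar> * real p \<le> X'" unfolding X'_def by (intro mult_left_mono) auto
      moreover have "X * real p \<le> \<bar>X\<bar> * real p" using p0 by (intro mult_right_mono) auto
      ultimately have "X * real p \<le> x" using x(1) by linarith
      hence xp: "x / real p \<ge> X" using p0 by (simp add: pos_le_divide_eq)
      show ?thesis
      proof (intro bexI[of _ "real q / real p"] exI[of _ "x / real p"] conjI exI[of _ "\<lambda>n. a (Suc n)"])
        show "\<forall>n. \<bar>a (Suc n)\<bar> \<le> 1" using x(2) by blast
        show "\<forall>(k, v)\<in>E \<union> (\<lambda>(k, v). (k, v * (real q / real p))) ` E.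
           omega_diff (x / real p / v) (\<lambda>n. a (Suc (n + k))) \<ge> c - e"
        proof clarify
          fix k v assume "(k, v) \<in> E \<union> (\<lambda>(k, v). (k, v * (real q / real p))) ` E"
          then consider "(k, v) \<in> E" | v' where "(k, v') \<in> E" "v = v' * (real q / real p)" by auto
          thus "omega_diff (x / real p / v) (\<lambda>n. a (Suc (n + k))) \<ge> c - e"
          proof cases
            case 1
            thus ?thesis using x(5)[OF pq(1) 1] by (simp add: mult.commute)
          next
            case 2
            have e: "x / real p / v = x / (v' * real q)" using p0 2 by simp
            show ?thesis using x(5)[OF pq(2) 2(1)] unfolding e by simp
          qed
        qed
        show "real q / real p \<in> R" unfolding R_def using pP pq(3) by auto
      qed (use xp in auto)
    qed
    from realizable_pigeonhole[OF fR this]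
    obtain r where "r \<in> R" "realizable (E \<union> (\<lambda>(k, v). (k, v * r)) ` E) (c - e)" .
    thus "\<exists>r\<in>{1 + d1..1 + d}. realizable (E \<union> (\<lambda>(k, v). (k, v * r)) ` E) (c - e)"
      unfolding R_def by blast
  qed
qed

text \<open>Each link multiplies the last scale factor by a good prime. The factors v j are far
  apart and unknown, which is what \<open>not_realizable\<close> has to repair.\<close>

lemma realizable_chain:
  assumes "realizable {(0, 1)} c" "c' < c"
  shows "\<exists>v. (\<forall>j. v j \<ge> 1) \<and> realizable ((\<lambda>j. (j, v j)) ` {..m}) c'"
  using assms(2)
proof (induction m arbitrary: c')
  case 0
  have "realizable ((\<lambda>j. (j, (\<lambda>_. 1) j)) ` {..0::nat}) c'"
    using assms(1) by (rule realizable_mono) (use 0 in auto)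
  thus ?case by (intro exI[of _ "\<lambda>_. 1"]) auto
next
  case (Suc m)
  obtain v where v: "\<And>j. v j \<ge> 1" "realizable ((\<lambda>j. (j, v j)) ` {..m}) ((c + c') / 2)"
    using Suc.IH[of "(c + c') / 2"] Suc.prems by auto
  have v0: "v j > 0" for j using v(1)[of j] by linarith
  obtain p where p: "prime p"
    "realizable (insert (Suc m, v m * real p) ((\<lambda>j. (j, v j)) ` {..m})) ((c + c') / 2 - (c - c') / 2)"
    by (rule realizable_extend[OF _ _ v(2), of "(c - c') / 2" m "v m"]) (use Suc.prems v0 in auto)
  have "realizable ((\<lambda>j. (j, (v(Suc m := v m * real p)) j)) ` {..Suc m}) c'"
    using p(2) by (rule realizable_mono) (auto simp: field_simps atMost_Suc)
  moreover have "v m * real p \<ge> 1" using v(1)[of m] prime_ge_1_nat[OF p(1)] 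
    by (metis mult_mono' mult_1 of_nat_1 of_nat_mono zero_le_one)
  ultimately show ?case using v(1) by (intro exI[of _ "v(Suc m := v m * real p)"]) auto
qed

lemma omega_diff_compare:
  assumes a: "\<And>n. \<bar>a n\<bar> \<le> 1" and y: "0 < y'" "y' \<le> y" "y \<le> (1 + d) * y'"
  shows "omega_diff y' a \<le> omega_diff y a + 4 * d + 2 / y'"
proof -
  define b where "b n = a (Suc (bigomega n)) - a (bigomega n)" for n
  define N' N where "N' = nat \<lfloor>y'\<rfloor>" "N = nat \<lfloor>y\<rfloor>"
  have bb: "\<bar>b n\<bar> \<le> 2" for n
    using a[of "Suc (bigomega n)"] a[of "bigomega n"] unfolding b_def by linarith
  have NN: "N' \<le> N" unfolding N'_N_def using y by (intro nat_mono floor_mono)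
  have Ny: "real N \<le> y" "real N' \<ge> y' - 1" "real N' \<ge> 0" unfolding N'_N_def using y by linarith+
  have "{1..N} = {1..N'} \<union> {N'<..N}" using NN by auto
  hence split: "(\<Sum>n\<in>{1..N}. b n) = (\<Sum>n\<in>{1..N'}. b n) + (\<Sum>n\<in>{N'<..N}. b n)"
    by (simp only:) (intro sum.union_disjoint, auto)
  have "\<bar>\<Sum>n\<in>{N'<..N}. b n\<bar> \<le> (\<Sum>n\<in>{N'<..N}. 2)"
    by (rule order_trans[OF sum_abs]) (intro sum_mono bb)
  also have "\<dots> \<le> 2 * (y - y' + 1)" using Ny NN by (simp add: of_nat_diff)
  finally have d1: "(\<Sum>n\<in>{1..N'}. b n) \<le> (\<Sum>n\<in>{1..N}. b n) + 2 * (y - y' + 1)" using split by linarith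
  have "\<bar>\<Sum>n\<in>{1..N}. b n\<bar> \<le> (\<Sum>n\<in>{1..N}. 2)"
    by (rule order_trans[OF sum_abs]) (intro sum_mono bb)
  hence D: "\<bar>\<Sum>n\<in>{1..N}. b n\<bar> \<le> 2 * y" using Ny by simp
  define s where "s = (\<Sum>n\<in>{1..N}. b n)"
  have "s / y' - s / y = (s / y) * ((y - y') / y')" using y by (simp add: field_simps)
  also have "\<dots> \<le> 2 * d"
  proof (intro mult_mono)
    show "s / y \<le> 2" using D y unfolding s_def by (simp add: field_simps)
    show "(y - y') / y' \<le> d" "0 \<le> (y - y') / y'" using y by (simp_all add: field_simps)
  qed simp
  finally have s: "s / y' \<le> s / y + 2 * d" by simp
  have "(\<Sum>n\<in>{1..N'}. b n) / y' \<le> (s + 2 * (y - y' + 1)) / y'"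
    using d1 y unfolding s_def by (intro divide_right_mono) auto
  also have "\<dots> = s / y' + 2 * ((y - y') / y') + 2 / y'" using y by (simp add: field_simps)
  also have "(y - y') / y' \<le> d" using y by (simp add: field_simps)
  finally have "(\<Sum>n\<in>{1..N'}. b n) / y' \<le> s / y + 4 * d + 2 / y'" using s by linarith
  thus ?thesis unfolding omega_diff_def s_def b_def N'_N_def .
qed

text \<open>The stretches provide a net R of factors, common to all j, with steps between 1 + d1 and
  1 + d. By the lower bound it passes every v j / v i after T steps; by the upper bound it cannot
  jump over the interval from V to (1 + d) V. Hence every v j is brought to V up to a factor 1 + d,
  and all shifts become comparable at the scale x / V.\<close>

lemma not_realizable:
  assumes c: "c > 0"
  shows "\<not> realizable {(0, 1)} c"
proof
  assume rz: "realizable {(0, 1)} c"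
  \<comment> \<open>With d <= c / 32 the comparison of scales loses at most c / 8, and the term 2 /
    y' another c / 8; of c / 2 there remains c / 4.\<close>
  define d where "d = min (1 / 2) (c / 32)"
  have d: "0 < d" "d < 1" "d \<le> c / 32" using c unfolding d_def by auto
  obtain d1 where d1: "0 < d1" "d1 < d" and stretch: "\<And>E c e. finite E \<Longrightarrow> \<forall>(k, v)\<in>E. v > 0 \<Longrightarrow>
    realizable E c \<Longrightarrow> e > 0 \<Longrightarrow>
    \<exists>r\<in>{1 + d1..1 + d}. realizable (E \<union> (\<lambda>(k, v). (k, v * r)) ` E) (c - e)"
    by (rule realizable_stretch[OF d(1,2)], rule that)
  obtain m :: nat where m: "real m > 8 / c" using reals_Archimedean2 by blast
  obtain v where v: "\<And>j. v j \<ge> 1" "realizable ((\<lambda>j. (j, v j)) ` {..m}) (3 * c / 4)"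
    using realizable_chain[OF rz, of "3 * c / 4" m] c by auto
  have v0: "v j > 0" for j using v(1)[of j] by linarith
  have fill: "\<exists>R. R 0 = 1 \<and> (\<forall>s<t. R (Suc s) / R s \<in> {1 + d1..1 + d}) \<and> (\<forall>s. R s > 0) \<and>
     realizable ((\<lambda>(j, s). (j, v j * R s)) ` ({..m} \<times> {..t})) c'" if "c' < 3 * c / 4" for t c'
    using that
  proof (induction t arbitrary: c')
    case 0
    have "realizable ((\<lambda>(j, s). (j, v j * (\<lambda>_. 1) s)) ` ({..m} \<times> {..0::nat})) c'"
      using v(2) by (rule realizable_mono) (use 0 in auto)
    thus ?case by (intro exI[of _ "\<lambda>_. 1"]) auto
  next
    case (Suc t)
    obtain R where R: "R 0 = 1" "\<And>s. s < t \<Longrightarrow> R (Suc s) / R s \<in> {1 + d1..1 + d}" "\<And>s. R s > 0"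
      "realizable ((\<lambda>(j, s). (j, v j * R s)) ` ({..m} \<times> {..t})) ((3 * c / 4 + c') / 2)"
      using Suc.IH[of "(3 * c / 4 + c') / 2"] Suc.prems by auto
    define E where "E = (\<lambda>(j, s). (j, v j * R s)) ` ({..m} \<times> {..t})"
    obtain r where r: "r \<in> {1 + d1..1 + d}"
      "realizable (E \<union> (\<lambda>(k, v). (k, v * r)) ` E) ((3 * c / 4 + c') / 2 - (3 * c / 4 - c') / 2)"
    proof -
      have "finite E" "\<forall>(k, v)\<in>E. v > 0" "realizable E ((3 * c / 4 + c') / 2)" "(3 * c / 4 - c') / 2 > 0"
        using R v0 Suc.prems unfolding E_def by auto
      from stretch[OF this] show thesis using that by blast
    qed
    have r0: "r > 0" using r d1 by auto
    define R' where "R' = R(Suc t := r * R t)"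
    have "(\<lambda>(j, s). (j, v j * R' s)) ` ({..m} \<times> {..Suc t}) \<subseteq> E \<union> (\<lambda>(k, v). (k, v * r)) ` E"
    proof
      fix z assume "z \<in> (\<lambda>(j, s). (j, v j * R' s)) ` ({..m} \<times> {..Suc t})"
      then obtain j s where z: "z = (j, v j * R' s)" "j \<le> m" "s \<le> Suc t" by auto
      show "z \<in> E \<union> (\<lambda>(k, v). (k, v * r)) ` E"
      proof (cases "s = Suc t")
        case True
        have "(j, v j * R t) \<in> E" using z unfolding E_def by auto
        hence "(\<lambda>(k, v). (k, v * r)) (j, v j * R t) \<in> (\<lambda>(k, v). (k, v * r)) ` E" by (rule imageI)
        thus ?thesis using True z by (simp add: R'_def mult_ac)
      next
        case False
        thus ?thesis using z unfolding E_def R'_def by auto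
      qed
    qed
    hence "realizable ((\<lambda>(j, s). (j, v j * R' s)) ` ({..m} \<times> {..Suc t})) c'"
      using r(2) by (intro realizable_mono[OF r(2)]) (auto simp: field_simps)
    moreover have "R' 0 = 1" "\<forall>s. R' s > 0" using R r0 by (auto simp: R'_def)
    moreover have "\<forall>s<Suc t. R' (Suc s) / R' s \<in> {1 + d1..1 + d}"
    proof (intro allI impI)
      fix s assume s: "s < Suc t"
      show "R' (Suc s) / R' s \<in> {1 + d1..1 + d}"
      proof (cases "s = t")
        case True
        thus ?thesis using r R(3)[of t] by (simp add: R'_def)
      next
        case False
        thus ?thesis using R(2)[of s] s by (simp add: R'_def)
      qed
    qed
    ultimately show ?case by blast
  qed
  define V where "V = (\<Sum>j\<le>m. v j)"
  have vV: "v j \<le> V" if "j \<le> m" for j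
    unfolding V_def using that v0 by (intro member_le_sum) (auto intro: less_imp_le)
  have V0: "V > 0" using vV[of 0] v0[of 0] by simp
  obtain T where T: "(1 + d1) ^ T > V" using real_arch_pow[of "1 + d1" V] d1 by auto
  obtain R where R: "R 0 = 1" "\<And>s. s < T \<Longrightarrow> R (Suc s) / R s \<in> {1 + d1..1 + d}" "\<And>s. R s > 0"
    "realizable ((\<lambda>(j, s). (j, v j * R s)) ` ({..m} \<times> {..T})) (c / 2)"
    using fill[of "c / 2" T] c by auto
  have Rpow: "s \<le> T \<Longrightarrow> R s \<ge> (1 + d1) ^ s" for s
  proof (induction s)
    case (Suc s)
    have "(1 + d1) * (1 + d1) ^ s \<le> (R (Suc s) / R s) * R s"
      using Suc R(2)[of s] d1 by (intro mult_mono) auto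
    thus ?case using R(3)[of s] by simp
  qed (simp add: R)
  have hit: "\<exists>s\<le>T. V \<le> v j * R s \<and> v j * R s \<le> (1 + d) * V" if j: "j \<le> m" for j
  proof -
    \<comment> \<open>The previous member of the net is still below V and one step multiplies by at
      most 1 + d, so the first member above V overshoots by at most this factor.\<close>
    define s where "s = (LEAST s. V \<le> v j * R s)"
    have "V \<le> 1 * R T" using T Rpow[of T] by simp
    also have "\<dots> \<le> v j * R T" using v(1)[of j] R(3)[of T] by (intro mult_right_mono) auto
    finally have VT: "V \<le> v j * R T" .
    have s: "V \<le> v j * R s" "s \<le> T" unfolding s_def using VT by (auto intro: LeastI Least_le)
    have "v j * R s \<le> (1 + d) * V"
    proof (cases s)
      case 0
      have "v j * R s \<le> 1 * V" using 0 R(1) vV[OF j] by simp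
      also have "\<dots> \<le> (1 + d) * V" using d V0 by (intro mult_right_mono) auto
      finally show ?thesis .
    next
      case (Suc s')
      have lt: "v j * R s' < V" using not_less_Least[of s' "\<lambda>s. V \<le> v j * R s"] Suc unfolding s_def by auto
      have "R s = (R (Suc s') / R s') * R s'" using R(3)[of s'] Suc by simp
      also have "\<dots> \<le> (1 + d) * R s'" using R(2)[of s'] R(3)[of s'] Suc s(2) by (intro mult_right_mono) auto
      finally have "v j * R s \<le> v j * ((1 + d) * R s')" using v0[of j] by (intro mult_left_mono) auto
      also have "\<dots> = (1 + d) * (v j * R s')" by simp
      also have "\<dots> \<le> (1 + d) * V" using lt d by (intro mult_left_mono) auto
      finally show ?thesis .
    qed
    thus ?thesis using s by blast
  qed
  obtain x a where x: "x \<ge> 16 / c * (1 + d) * V" and a: "\<And>n. \<bar>a n\<bar> \<le> 1"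
    and w: "\<And>j s. j \<le> m \<Longrightarrow> s \<le> T \<Longrightarrow> omega_diff (x / (v j * R s)) (\<lambda>n. a (n + j)) \<ge> c / 2"
    using R(4) unfolding realizable_def by fastforce
  have xpos: "x > 0" using x c d V0 by (intro less_le_trans[OF _ x]) simp
  define y where "y = x / V"
  have ypos: "y > 0" using xpos V0 unfolding y_def by simp
  have low: "omega_diff y (\<lambda>n. a (n + j)) \<ge> c / 4" if j: "j \<le> m" for j
  proof -
    obtain s where s: "s \<le> T" "V \<le> v j * R s" "v j * R s \<le> (1 + d) * V" using hit[OF j] by blast
    define y' where "y' = x / (v j * R s)"
    have pos: "v j * R s > 0" using v0 R(3) by simp
    have y'0: "y' > 0" using xpos pos unfolding y'_def by simp
    have y1: "y' \<le> y" unfolding y'_def y_def using s xpos V0 pos by (intro divide_left_mono) auto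
    have "x / ((1 + d) * V) \<le> y'" unfolding y'_def using s xpos V0 pos d by (intro divide_left_mono) auto
    hence y2: "y \<le> (1 + d) * y'" and y3: "y' \<ge> 16 / c"
    proof -
      assume le: "x / ((1 + d) * V) \<le> y'"
      have "y = (1 + d) * (x / ((1 + d) * V))" unfolding y_def using d by simp
      also have "\<dots> \<le> (1 + d) * y'" using le d by (intro mult_left_mono) auto
      finally show "y \<le> (1 + d) * y'" .
      have "16 / c \<le> x / ((1 + d) * V)" using x d V0 by (subst pos_le_divide_eq) (simp_all only: mult.assoc, simp)
      thus "y' \<ge> 16 / c" using le by linarith
    qed
    have "2 / y' \<le> c / 8" using y3 c y'0 by (simp add: field_simps)
    moreover have "c / 2 \<le> omega_diff y' (\<lambda>n. a (n + j))" using w[OF j s(1)] unfolding y'_def .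
    moreover have "omega_diff y' (\<lambda>n. a (n + j)) \<le> omega_diff y (\<lambda>n. a (n + j)) + 4 * d + 2 / y'"
      using a y'0 y1 y2 by (intro omega_diff_compare) auto
    ultimately show ?thesis using d(3) by linarith
  qed
  define N where "N = nat \<lfloor>y\<rfloor>"
  have "real m * (c / 4) \<le> real (Suc m) * (c / 4)" using c by (intro mult_right_mono) auto
  also have "\<dots> = (\<Sum>j\<le>m. c / 4)" by simp
  also have "\<dots> \<le> (\<Sum>j\<le>m. omega_diff y (\<lambda>n. a (n + j)))" using low by (intro sum_mono) auto
  also have "\<dots> = (\<Sum>n\<in>{1..N}. \<Sum>j\<le>m. a (Suc (bigomega n) + j) - a (bigomega n + j)) / y"
    unfolding omega_diff_def N_def by (simp only: sum_divide_distrib[symmetric]) (subst sum.swap, rule refl)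
  also have "(\<Sum>n\<in>{1..N}. \<Sum>j\<le>m. a (Suc (bigomega n) + j) - a (bigomega n + j)) \<le> (\<Sum>n\<in>{1..N}. 2)"
  proof (rule sum_mono)
    fix n
    have "(\<Sum>j\<le>m. a (Suc (bigomega n) + j) - a (bigomega n + j)) = a (bigomega n + Suc m) - a (bigomega n)"
      by (induction m) auto
    also have "\<dots> \<le> 2" using a[of "bigomega n + Suc m"] a[of "bigomega n"] by linarith
    finally show "(\<Sum>j\<le>m. a (Suc (bigomega n) + j) - a (bigomega n + j)) \<le> 2" .
  qed
  finally have "real m * (c / 4) \<le> 2 * real N / y" using ypos by (simp add: divide_right_mono)
  also have "\<dots> \<le> 2" using ypos unfolding N_def by (simp add: field_simps)
  finally show False using m c by (simp add: field_simps)
qed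

text \<open>\<open>not_realizable\<close> bounds the difference for all sequences beyond one
  threshold; applied to a and to - a it gives both signs.\<close>

lemma omega_shift:
  assumes a: "\<And>n. \<bar>a n\<bar> \<le> 1"
  shows "(\<lambda>N. (\<Sum>n\<in>{1..N}. a (Suc (bigomega n)) - a (bigomega n)) / real N) \<longlonglongrightarrow> 0"
proof -
  have up: "eventually (\<lambda>N::nat. omega_diff (real N) a < e) sequentially" if e: "e > 0" and a: "\<And>n. \<bar>a n\<bar> \<le> 1" for e a
  proof -
    obtain X where X: "\<And>x a. x \<ge> X \<Longrightarrow> (\<And>n. \<bar>a n\<bar> \<le> 1) \<Longrightarrow> omega_diff x a < e"
    proof -
      obtain X where "\<not> (\<exists>x\<ge>X. \<exists>a. (\<forall>n. \<bar>a n\<bar> \<le> 1) \<and> omega_diff x a \<ge> e)"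
        using not_realizable[OF e] unfolding realizable_def by auto
      thus thesis using that[of X] not_le by blast
    qed
    obtain M :: nat where "real M \<ge> X" using real_arch_simple by blast
    hence "\<And>N. N \<ge> M \<Longrightarrow> omega_diff (real N) a < e" using a by (intro X) auto
    thus ?thesis by (auto simp: eventually_sequentially)
  qed
  have "(\<lambda>N. omega_diff (real N) a) \<longlonglongrightarrow> 0"
  proof (rule order_tendstoI)
    fix e :: real assume "e < 0"
    hence "eventually (\<lambda>N::nat. omega_diff (real N) (\<lambda>n. - a n) < - e) sequentially" using a by (intro up) auto
    moreover have "omega_diff x (\<lambda>n. - a n) = - omega_diff x a" for x
      unfolding omega_diff_def by (simp add: sum_subtractf diff_divide_distrib)
    ultimately show "eventually (\<lambda>N::nat. e < omega_diff (real N) a) sequentially" by simp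
  qed (use up a in auto)
  thus ?thesis unfolding omega_diff_def by simp
qed

section \<open>From window averages to averages along \<open>bigomega\<close>\<close>

definition uniform_mean :: "(nat \<Rightarrow> 'a::real_normed_vector) \<Rightarrow> 'a \<Rightarrow> bool" where
  "uniform_mean a z \<longleftrightarrow> (\<forall>e>0. \<exists>H. \<forall>N\<ge>H. \<forall>M. norm ((1 / real N) *\<^sub>R (\<Sum>n<N. a (M + n)) - z) < e)"

text \<open>Averaging over H shifts changes the mean along \<open>bigomega\<close> by o(1). After
  exchanging the sums, the inner average runs over a window that starts at
  \<open>bigomega n\<close>; uniformity in the starting point makes it close to z without any
  knowledge of \<open>bigomega\<close>.\<close>

theorem uniform_mean_bigomega:
  fixes a :: "nat \<Rightarrow> real"
  assumes b: "\<And>n. \<bar>a n\<bar> \<le> 1" and m: "uniform_mean a z"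
  shows "(\<lambda>N. (\<Sum>n\<in>{1..N}. a (bigomega n)) / real N) \<longlonglongrightarrow> z"
proof -
  define A where "A h N = (\<Sum>n\<in>{1..N}. a (bigomega n + h)) / real N" for h N
  have shift: "(\<lambda>N. A h N - A 0 N) \<longlonglongrightarrow> 0" for h
  proof (induction h)
    case (Suc h)
    have "(\<lambda>N. (\<Sum>n\<in>{1..N}. a (Suc (bigomega n) + h) - a (bigomega n + h)) / real N) \<longlonglongrightarrow> 0"
      using omega_shift[of "\<lambda>n. a (n + h)"] b by simp
    hence "(\<lambda>N. A (Suc h) N - A h N) \<longlonglongrightarrow> 0"
      unfolding A_def by (simp add: sum_subtractf diff_divide_distrib)
    from tendsto_add[OF this Suc.IH] show ?case by simp
  qed simp
  show ?thesis
  proof (rule LIMSEQ_I)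
    fix e :: real assume e: "e > 0"
    obtain H0 where H0: "\<And>N M. N \<ge> H0 \<Longrightarrow> norm ((1 / real N) *\<^sub>R (\<Sum>n<N. a (M + n)) - z) < e / 2"
      using m e unfolding uniform_mean_def by (metis half_gt_zero)
    define H where "H = Suc H0"
    have H: "H > 0" "H \<ge> H0" unfolding H_def by auto
    have "(\<lambda>N. (\<Sum>h<H. A h N - A 0 N) / real H) \<longlonglongrightarrow> (\<Sum>h<H. 0) / real H"
      by (intro tendsto_divide tendsto_sum shift tendsto_const) (use H in auto)
    hence "(\<lambda>N. (\<Sum>h<H. A h N - A 0 N) / real H) \<longlonglongrightarrow> 0" by simp
    from LIMSEQ_D[OF this, of "e / 2"] e obtain N0 where
      N0: "\<And>N. N \<ge> N0 \<Longrightarrow> \<bar>(\<Sum>h<H. A h N - A 0 N) / real H\<bar> < e / 2" by auto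
    show "\<exists>no. \<forall>N\<ge>no. norm ((\<Sum>n\<in>{1..N}. a (bigomega n)) / real N - z) < e"
    proof (intro exI[of _ "Suc N0"] allI impI)
      fix N assume N: "N \<ge> Suc N0"
      have e1: "(\<Sum>h<H. A h N - A 0 N) / real H = (\<Sum>h<H. A h N) / real H - A 0 N"
        using H by (simp add: sum_subtractf field_simps)
      have "(\<Sum>h<H. A h N) / real H = (\<Sum>n\<in>{1..N}. (1 / real H) *\<^sub>R (\<Sum>h<H. a (bigomega n + h))) / real N"
        unfolding A_def by (simp add: sum_divide_distrib[symmetric] sum_distrib_left[symmetric]) (subst sum.swap, simp)
      also have "\<dots> - z = (\<Sum>n\<in>{1..N}. (1 / real H) *\<^sub>R (\<Sum>h<H. a (bigomega n + h)) - z) / real N"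
        using N by (simp add: sum_subtractf field_simps)
      finally have "(\<Sum>h<H. A h N) / real H - z = (\<Sum>n\<in>{1..N}. (1 / real H) *\<^sub>R (\<Sum>h<H. a (bigomega n + h)) - z) / real N" .
      moreover have "\<bar>\<Sum>n\<in>{1..N}. (1 / real H) *\<^sub>R (\<Sum>h<H. a (bigomega n + h)) - z\<bar> \<le> (\<Sum>n\<in>{1..N}. e / 2)"
        by (rule order_trans[OF sum_abs]) (use H0[OF H(2)] in \<open>intro sum_mono; simp add: less_imp_le\<close>)
      ultimately have "\<bar>(\<Sum>h<H. A h N) / real H - z\<bar> \<le> e / 2"
        using N by (simp only: abs_divide) (simp add: pos_divide_le_eq mult.commute)
      hence "\<bar>A 0 N - z\<bar> < e" using N0[of N] N e1 by linarith
      thus "norm ((\<Sum>n\<in>{1..N}. a (bigomega n)) / real N - z) < e" unfolding A_def by simp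
    qed
  qed
qed

subsection \<open>Polynomial functions in finitely many coordinates\<close>

text \<open>Polynomials are treated as functions, so that substitution is composition. K records
  where the coefficients come from: rational ones are needed to clear denominators, real ones
  suffice for the walls between pieces.\<close>

inductive alg :: "real set \<Rightarrow> 'v set \<Rightarrow> (('v \<Rightarrow> real) \<Rightarrow> real) \<Rightarrow> bool" for K V where
  alg_const: "c \<in> K \<Longrightarrow> alg K V (\<lambda>_. c)"
| alg_var: "i \<in> V \<Longrightarrow> alg K V (\<lambda>x. x i)"
| alg_add: "alg K V f \<Longrightarrow> alg K V g \<Longrightarrow> alg K V (\<lambda>x. f x + g x)"
| alg_mult: "alg K V f \<Longrightarrow> alg K V g \<Longrightarrow> alg K V (\<lambda>x. f x * g x)"

lemma alg_subst:
  assumes "alg K V f" "\<And>v. v \<in> V \<Longrightarrow> alg K W (\<lambda>x. \<phi> v x)"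
  shows "alg K W (\<lambda>x. f (\<lambda>v. \<phi> v x))"
  using assms by (induction rule: alg.induct) (auto intro: alg.intros)

lemma alg_cong: "alg K V f \<Longrightarrow> (\<And>v. v \<in> V \<Longrightarrow> x v = y v) \<Longrightarrow> f x = f y"
  by (induction rule: alg.induct) auto

lemma alg_cmult: "alg K V f \<Longrightarrow> c \<in> K \<Longrightarrow> alg K V (\<lambda>x. c * f x)"
  by (intro alg.intros)

lemma alg_uminus: "alg K V f \<Longrightarrow> -1 \<in> K \<Longrightarrow> alg K V (\<lambda>x. - f x)"
  using alg_cmult[of K V f "-1"] by simp

lemma alg_diff: "alg K V f \<Longrightarrow> alg K V g \<Longrightarrow> -1 \<in> K \<Longrightarrow> alg K V (\<lambda>x. f x - g x)"
  using alg_add[OF _ alg_uminus] by fastforce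

lemma alg_sum: "(\<And>a. a \<in> A \<Longrightarrow> alg K V (f a)) \<Longrightarrow> 0 \<in> K \<Longrightarrow> alg K V (\<lambda>x. \<Sum>a\<in>A. f a x)"
  by (induction A rule: infinite_finite_induct) (auto intro: alg.intros)

lemma alg_poly:
  assumes "\<And>i. coeff p i \<in> K" "alg K V f" "0 \<in> K"
  shows "alg K V (\<lambda>x. poly p (f x))"
  using assms(1)
proof (induction p)
  case (pCons a p)
  have "alg K V (\<lambda>x. poly p (f x))" using pCons.prems[of "Suc _"] by (intro pCons.IH) simp
  moreover have "a \<in> K" using pCons.prems[of 0] by simp
  ultimately have "alg K V (\<lambda>x. a + f x * poly p (f x))" using assms(2) by (intro alg.intros)
  thus ?case by simp
qed (use assms(3) in \<open>auto intro: alg_const\<close>)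

text \<open>Statements in several variables are reduced to one variable by restriction to lines. The
  restricted polynomial has arbitrary real coefficients, as u and w are arbitrary.\<close>

lemma alg_line:
  assumes "alg K V f"
  shows "\<exists>p. \<forall>t. f (\<lambda>v. u v + t * w v) = poly p t"
  using assms
proof (induction rule: alg.induct)
  case (alg_const c)
  show ?case by (intro exI[of _ "[:c:]"]) simp
next
  case (alg_var i)
  show ?case by (intro exI[of _ "[:u i, w i:]"]) simp
next
  case (alg_add f g)
  thus ?case by (metis poly_add)
next
  case (alg_mult f g)
  thus ?case by (metis poly_mult)
qed

lemma alg_update:
  assumes "alg K V f"
  shows "\<exists>p. \<forall>t. f (u(i := t)) = poly p t"
proof -
  have "(\<lambda>v. (u(i := 0)) v + t * (if v = i then 1 else 0)) = u(i := t)" for t by auto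
  thus ?thesis using alg_line[OF assms, of "u(i := 0)" "\<lambda>v. if v = i then 1 else 0"] by simp
qed

lemma alg_rat_poly:
  fixes f :: "(unit \<Rightarrow> real) \<Rightarrow> real"
  assumes "alg \<rat> UNIV f"
  shows "\<exists>p. (\<forall>i. coeff p i \<in> \<rat>) \<and> (\<forall>z. f z = poly p (z ()))"
  using assms
proof (induction rule: alg.induct)
  case (alg_const c)
  thus ?case by (intro exI[of _ "[:c:]"]) (auto simp: coeff_pCons split: nat.splits)
next
  case (alg_var i)
  show ?case by (intro exI[of _ "[:0, 1:]"]) (auto simp: coeff_pCons split: nat.splits)
next
  case (alg_add f g)
  then obtain p q where "\<forall>i. coeff p i \<in> \<rat>" "\<forall>z. f z = poly p (z ())" "\<forall>i. coeff q i \<in> \<rat>" "\<forall>z. g z = poly q (z ())"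
    by blast
  thus ?case by (intro exI[of _ "p + q"]) auto
next
  case (alg_mult f g)
  then obtain p q where "\<forall>i. coeff p i \<in> \<rat>" "\<forall>z. f z = poly p (z ())" "\<forall>i. coeff q i \<in> \<rat>" "\<forall>z. g z = poly q (z ())"
    by blast
  thus ?case by (intro exI[of _ "p * q"]) (auto simp: coeff_mult)
qed

text \<open>On the line through u and w both factors restrict to nonzero polynomials in one
  variable, and these have no zero divisors.\<close>

lemma alg_mult_nonzero:
  assumes f: "alg K V f" "f u \<noteq> 0" and g: "alg K V g" "g w \<noteq> 0"
  shows "\<exists>x. f x * g x \<noteq> 0"
proof -
  let ?l = "\<lambda>t v. u v + t * (w v - u v)"
  obtain p where p: "\<And>t. f (?l t) = poly p t" using alg_line[OF f(1), of u "\<lambda>v. w v - u v"] by blast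
  obtain q where q: "\<And>t. g (?l t) = poly q t" using alg_line[OF g(1), of u "\<lambda>v. w v - u v"] by blast
  have "poly p 0 \<noteq> 0" using p[of 0] f(2) by simp
  moreover have "poly q 1 \<noteq> 0" using q[of 1] g(2) by simp
  ultimately have "p * q \<noteq> 0" by auto
  then obtain t where "poly (p * q) t \<noteq> 0" using poly_all_0_iff_0 by blast
  thus ?thesis using p[of t] q[of t] by (intro exI[of _ "?l t"]) simp
qed

text \<open>The constant terms are carried along because of the product: f g - f0 g0 = (f - f0) g +
  f0 (g - g0) mixes differences with values, so the values at 0 need a bounded denominator
  too.\<close>

lemma alg_denominators:
  assumes "alg \<rat> V f"
  shows "\<exists>D::nat. D > 0 \<and> of_nat D * f (\<lambda>_. 0) \<in> \<int> \<and> (\<forall>M::int. \<forall>z. (\<forall>v\<in>V. z v \<in> \<int>) \<longrightarrow>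
     (\<exists>j\<in>\<int>. real D * (f (\<lambda>v. of_int M * z v) - f (\<lambda>_. 0)) = of_int M * j))"
  using assms
proof (induction rule: alg.induct)
  case (alg_const c)
  then obtain a b :: int where ab: "b > 0" "c = of_int a / of_int b"
    by (metis Rats_cases' )
  have "real (nat b) * c \<in> \<int>" using ab by simp
  thus ?case using ab(1) by (intro exI[of _ "nat b"]) auto
next
  case (alg_var i)
  thus ?case by (intro exI[of _ 1]) auto
next
  case (alg_add f g)
  then obtain D E :: nat where D: "D > 0" "of_nat D * f (\<lambda>_. 0) \<in> \<int>" "\<And>M z. (\<forall>v\<in>V. z v \<in> \<int>) \<Longrightarrow>
     \<exists>j\<in>\<int>. real D * (f (\<lambda>v. of_int M * z v) - f (\<lambda>_. 0)) = of_int M * j"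
    and E: "E > 0" "of_nat E * g (\<lambda>_. 0) \<in> \<int>" "\<And>M z. (\<forall>v\<in>V. z v \<in> \<int>) \<Longrightarrow>
     \<exists>j\<in>\<int>. real E * (g (\<lambda>v. of_int M * z v) - g (\<lambda>_. 0)) = of_int M * j" by blast
  have "real E * (real D * f (\<lambda>_. 0)) + real D * (real E * g (\<lambda>_. 0)) \<in> \<int>"
    by (rule Ints_add[OF Ints_mult[OF Ints_of_nat D(2)] Ints_mult[OF Ints_of_nat E(2)]])
  hence "real (D * E) * (f (\<lambda>_. 0) + g (\<lambda>_. 0)) \<in> \<int>" by (simp add: algebra_simps)
  moreover have "\<exists>j\<in>\<int>. real (D * E) * (f (\<lambda>v. of_int M * z v) + g (\<lambda>v. of_int M * z v) - (f (\<lambda>_. 0) + g (\<lambda>_. 0))) = of_int M * j"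
    if z: "\<forall>v\<in>V. z v \<in> \<int>" for M :: int and z
  proof -
    obtain i where i: "i \<in> \<int>" "real D * (f (\<lambda>v. of_int M * z v) - f (\<lambda>_. 0)) = of_int M * i" using D(3)[OF z] by blast
    obtain j where j: "j \<in> \<int>" "real E * (g (\<lambda>v. of_int M * z v) - g (\<lambda>_. 0)) = of_int M * j" using E(3)[OF z] by blast
    have "real (D * E) * (f (\<lambda>v. of_int M * z v) + g (\<lambda>v. of_int M * z v) - (f (\<lambda>_. 0) + g (\<lambda>_. 0)))
      = real E * (real D * (f (\<lambda>v. of_int M * z v) - f (\<lambda>_. 0))) + real D * (real E * (g (\<lambda>v. of_int M * z v) - g (\<lambda>_. 0)))"
      by (simp add: algebra_simps)
    also have "\<dots> = of_int M * (real E * i + real D * j)" unfolding i(2) j(2) by (simp add: algebra_simps)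
    finally show ?thesis using i(1) j(1) by (intro bexI[of _ "real E * i + real D * j"]) auto
  qed
  ultimately show ?case using D(1) E(1) by (intro exI[of _ "D * E"]) auto
next
  case (alg_mult f g)
  then obtain D E :: nat where D: "D > 0" "of_nat D * f (\<lambda>_. 0) \<in> \<int>" "\<And>M z. (\<forall>v\<in>V. z v \<in> \<int>) \<Longrightarrow>
     \<exists>j\<in>\<int>. real D * (f (\<lambda>v. of_int M * z v) - f (\<lambda>_. 0)) = of_int M * j"
    and E: "E > 0" "of_nat E * g (\<lambda>_. 0) \<in> \<int>" "\<And>M z. (\<forall>v\<in>V. z v \<in> \<int>) \<Longrightarrow>
     \<exists>j\<in>\<int>. real E * (g (\<lambda>v. of_int M * z v) - g (\<lambda>_. 0)) = of_int M * j" by blast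
  have "(real D * f (\<lambda>_. 0)) * (real E * g (\<lambda>_. 0)) \<in> \<int>"
    by (rule Ints_mult[OF D(2) E(2)])
  hence "real (D * E) * (f (\<lambda>_. 0) * g (\<lambda>_. 0)) \<in> \<int>" by (simp add: algebra_simps)
  moreover have "\<exists>j\<in>\<int>. real (D * E) * (f (\<lambda>v. of_int M * z v) * g (\<lambda>v. of_int M * z v) - (f (\<lambda>_. 0) * g (\<lambda>_. 0))) = of_int M * j"
    if z: "\<forall>v\<in>V. z v \<in> \<int>" for M :: int and z
  proof -
    obtain i where i: "i \<in> \<int>" "real D * (f (\<lambda>v. of_int M * z v) - f (\<lambda>_. 0)) = of_int M * i" using D(3)[OF z] by blast
    obtain j where j: "j \<in> \<int>" "real E * (g (\<lambda>v. of_int M * z v) - g (\<lambda>_. 0)) = of_int M * j" using E(3)[OF z] by blast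
    have "real (D * E) * (f (\<lambda>v. of_int M * z v) * g (\<lambda>v. of_int M * z v) - (f (\<lambda>_. 0) * g (\<lambda>_. 0)))
      = (real D * (f (\<lambda>v. of_int M * z v) - f (\<lambda>_. 0))) * (real E * (g (\<lambda>v. of_int M * z v) - g (\<lambda>_. 0)) + real E * g (\<lambda>_. 0))
        + (real D * f (\<lambda>_. 0)) * (real E * (g (\<lambda>v. of_int M * z v) - g (\<lambda>_. 0)))"
      by (simp add: algebra_simps)
    also have "\<dots> = of_int M * (i * (of_int M * j + real E * g (\<lambda>_. 0)) + (real D * f (\<lambda>_. 0)) * j)"
      unfolding i(2) j(2) by (simp add: algebra_simps)
    finally show ?thesis using i(1) j(1) D(2) E(2)
      by (intro bexI[of _ "i * (of_int M * j + real E * g (\<lambda>_. 0)) + (real D * f (\<lambda>_. 0)) * j"]) (auto intro!: Ints_add Ints_mult)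
  qed
  ultimately show ?case using D(1) E(1) by (intro exI[of _ "D * E"]) auto
qed

lemma alg_continuous:
  assumes "alg K V f" "\<And>v. v \<in> V \<Longrightarrow> continuous_on S (\<lambda>x. \<phi> x v)"
  shows "continuous_on S (\<lambda>x. f (\<phi> x))"
  using assms by (induction rule: alg.induct) (auto intro: continuous_intros)

lemma additive_poly_linear:
  fixes p :: "real poly"
  assumes "\<And>s t. poly p (s + t) = poly p s + poly p t"
  shows "poly p s = s * poly p 1"
proof -
  have n: "poly p (real n) = real n * poly p 1" for n
  proof (induction n)
    case 0
    show ?case using assms[of 0 0] by simp
  next
    case (Suc n)
    show ?case using assms[of "real n" 1] Suc by (simp add: algebra_simps)
  qed
  define q where "q = p - [:0, poly p 1:]"
  have "poly q (real n) = 0" for n using n[of n] by (simp add: q_def)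
  hence "range real \<subseteq> {x. poly q x = 0}" by auto
  moreover have "infinite (range real)" by (simp add: finite_image_iff)
  ultimately have "q = 0" using poly_roots_finite finite_subset by blast
  hence "poly q s = 0" by simp
  thus ?thesis by (simp add: q_def)
qed

text \<open>Used in \<open>chr_extend\<close> to write a cocycle as a coboundary. Removing the
  leading term divides only by n + 1, so the coefficients stay rational.\<close>

lemma poly_antidifference:
  fixes p :: "real poly"
  assumes "\<And>i. coeff p i \<in> \<rat>"
  shows "\<exists>q. (\<forall>i. coeff q i \<in> \<rat>) \<and> poly q 0 = 0 \<and> (\<forall>x. poly q (x + 1) - poly q x = poly p x)"
  using assms
proof (induction "degree p" arbitrary: p rule: less_induct)
  case less
  show ?case
  proof (cases "p = 0")
    case True
    thus ?thesis by (intro exI[of _ 0]) auto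
  next
    case False
    define n where "n = degree p"
    define c where "c = coeff p n / real (Suc n)"
    have cQ: "c \<in> \<rat>" unfolding c_def using less.prems by auto
    define m where "m = monom c (Suc n)"
    \<comment> \<open>\<open>m(x+1) - m(x)\<close> has the same leading term as \<open>p\<close>\<close>
    define dm where "dm = (\<Sum>k\<le>n. monom (c * real (Suc n choose k)) k)"
    have dm: "poly m (x + 1) - poly m x = poly dm x" for x
    proof -
      have "(x + 1) ^ Suc n = (\<Sum>k\<le>Suc n. real (Suc n choose k) * x ^ k)"
        using binomial_ring[of x 1 "Suc n"] by simp
      also have "\<dots> = (\<Sum>k\<le>n. real (Suc n choose k) * x ^ k) + x ^ Suc n" by simp
      finally have "c * (x + 1) ^ Suc n - c * x ^ Suc n = c * (\<Sum>k\<le>n. real (Suc n choose k) * x ^ k)"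
        by (simp add: algebra_simps)
      thus ?thesis unfolding m_def dm_def
        by (simp add: poly_monom poly_sum sum_distrib_left mult.assoc del: power_Suc)
    qed
    have coeff_dm: "coeff dm k = (if k \<le> n then c * real (Suc n choose k) else 0)" for k
      unfolding dm_def by (simp add: coeff_sum if_distrib cong: if_cong)
    have "coeff dm n = coeff p n" unfolding coeff_dm c_def by simp
    moreover have "coeff dm k = 0" "coeff p k = 0" if "k > n" for k
      using that coeff_dm coeff_eq_0[of p k] by (auto simp: n_def)
    ultimately have deg: "coeff (p - dm) k = 0" if "k \<ge> n" for k
      using that by (cases "k = n") auto
    have coeffs: "coeff (p - dm) i \<in> \<rat>" for i
      using less.prems cQ by (auto simp: coeff_dm)
    have "\<exists>q. (\<forall>i. coeff q i \<in> \<rat>) \<and> poly q 0 = 0 \<and> (\<forall>x. poly q (x + 1) - poly q x = poly (p - dm) x)"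
    proof (cases "p - dm = 0")
      case True
      thus ?thesis by (intro exI[of _ 0]) auto
    next
      case nz: False
      have "degree (p - dm) < degree p"
      proof -
        have "coeff (p - dm) (degree (p - dm)) \<noteq> 0" using nz leading_coeff_0_iff by blast
        thus ?thesis using deg[of "degree (p - dm)"] unfolding n_def by force
      qed
      thus ?thesis using coeffs by (intro less.hyps) auto
    qed
    then obtain q where q: "\<And>i. coeff q i \<in> \<rat>" "poly q 0 = 0" "\<And>x. poly q (x + 1) - poly q x = poly (p - dm) x"
      by blast
    show ?thesis
    proof (intro exI[of _ "q + m"] conjI allI)
      show "coeff (q + m) i \<in> \<rat>" for i using q(1) cQ by (auto simp: m_def)
      show "poly (q + m) 0 = 0" using q(2) by (simp add: m_def poly_monom)
      show "poly (q + m) (x + 1) - poly (q + m) x = poly p x" for x using q(3)[of x] dm[of x] by simp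
    qed
  qed
qed

subsection \<open>Nilpotent groups in triangular polynomial coordinates\<close>

text \<open>The group consists of all real sequences. Only the first \<open>k\<close> coordinates carry a correction
  term, and the subgroup \<open>V k\<close> plays no role for functions of these coordinates.\<close>

locale tower =
  fixes k :: nat and p :: "nat \<Rightarrow> (nat \<Rightarrow> real) \<Rightarrow> (nat \<Rightarrow> real) \<Rightarrow> real"
  assumes p_alg: "i < k \<Longrightarrow> alg \<rat> (Inl ` {..<i} \<union> Inr ` {..<i}) (\<lambda>z. p i (\<lambda>j. z (Inl j)) (\<lambda>j. z (Inr j)))"
    and p_beyond: "i \<ge> k \<Longrightarrow> p i x y = 0"
    and p_zero_right: "p i x (\<lambda>_. 0) = 0"
    and p_zero_left: "p i (\<lambda>_. 0) y = 0"
    and p_assoc: "(\<lambda>i. (x i + y i + p i x y) + z i + p i (\<lambda>i. x i + y i + p i x y) z) =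
       (\<lambda>i. x i + (y i + z i + p i y z) + p i x (\<lambda>i. y i + z i + p i y z))"
    and p_Ints: "\<And>x y. (\<And>j. x j \<in> \<int>) \<Longrightarrow> (\<And>j. y j \<in> \<int>) \<Longrightarrow> p i x y \<in> \<int>"
    and k_pos: "k > 0"
begin

definition op :: "(nat \<Rightarrow> real) \<Rightarrow> (nat \<Rightarrow> real) \<Rightarrow> nat \<Rightarrow> real"  (infixl "\<otimes>" 70)
  where "x \<otimes> y = (\<lambda>i. x i + y i + p i x y)"

definition unit :: "nat \<Rightarrow> real" ("\<one>") where "\<one> = (\<lambda>_. 0)"

lemma op_apply: "(x \<otimes> y) i = x i + y i + p i x y" by (simp add: op_def)

lemma op_assoc: "(x \<otimes> y) \<otimes> z = x \<otimes> (y \<otimes> z)"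
  unfolding op_def by (rule p_assoc)

lemma unit_left [simp]: "\<one> \<otimes> x = x" and unit_right [simp]: "x \<otimes> \<one> = x"
  by (simp_all add: op_def unit_def p_zero_left p_zero_right)

lemma p_cong:
  assumes "\<And>j. j < i \<Longrightarrow> x j = x' j" "\<And>j. j < i \<Longrightarrow> y j = y' j"
  shows "p i x y = p i x' y'"
proof (cases "i < k")
  case True
  have "p i (\<lambda>j. (case_sum x y) (Inl j)) (\<lambda>j. (case_sum x y) (Inr j)) =
        p i (\<lambda>j. (case_sum x' y') (Inl j)) (\<lambda>j. (case_sum x' y') (Inr j))"
    using assms by (intro alg_cong[OF p_alg[OF True]]) auto
  thus ?thesis by simp
qed (simp add: p_beyond)

lemma p_low:
  assumes "(\<forall>j<i. x j = 0) \<or> (\<forall>j<i. y j = 0)"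
  shows "p i x y = 0"
  using assms
proof
  assume "\<forall>j<i. x j = 0"
  hence "p i x y = p i (\<lambda>_. 0) y" by (intro p_cong) auto
  thus ?thesis by (simp add: p_zero_left)
next
  assume "\<forall>j<i. y j = 0"
  hence "p i x y = p i x (\<lambda>_. 0)" by (intro p_cong) auto
  thus ?thesis by (simp add: p_zero_right)
qed

lemma alg_p:
  assumes "i < k" "\<And>j. j < i \<Longrightarrow> alg \<rat> V (\<lambda>z. f z j)" "\<And>j. j < i \<Longrightarrow> alg \<rat> V (\<lambda>z. g z j)"
  shows "alg \<rat> V (\<lambda>z. p i (f z) (g z))"
proof -
  have "alg \<rat> V (\<lambda>z. p i (\<lambda>j. case_sum (f z) (g z) (Inl j)) (\<lambda>j. case_sum (f z) (g z) (Inr j)))"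
    using assms(2,3) by (intro alg_subst[OF p_alg[OF assms(1)]]) auto
  thus ?thesis by simp
qed

lemma alg_op:
  assumes "i < k" "\<And>j. j \<le> i \<Longrightarrow> alg \<rat> V (\<lambda>z. f z j)" "\<And>j. j \<le> i \<Longrightarrow> alg \<rat> V (\<lambda>z. g z j)"
  shows "alg \<rat> V (\<lambda>z. (f z \<otimes> g z) i)"
  unfolding op_apply using assms by (intro alg_add alg_p) auto

lemma right_inverse_upto: "\<exists>y. \<forall>i<n. (x \<otimes> y) i = 0"
proof (induction n)
  case (Suc n)
  then obtain y where y: "\<And>i. i < n \<Longrightarrow> (x \<otimes> y) i = 0" by blast
  define y' where "y' = y(n := - x n - p n x y)"
  have "(x \<otimes> y') i = 0" if "i < Suc n" for i
  proof -
    have "p i x y' = p i x y" using that by (intro p_cong) (auto simp: y'_def)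
    thus ?thesis using y[of i] that by (cases "i = n") (auto simp: op_apply y'_def)
  qed
  thus ?case by blast
qed simp

lemma right_inverse_ex: "\<exists>y. x \<otimes> y = \<one>"
proof -
  obtain y where y: "\<And>i. i < k \<Longrightarrow> (x \<otimes> y) i = 0" using right_inverse_upto by blast
  define y' where "y' = (\<lambda>i. if i < k then y i else - x i)"
  have "(x \<otimes> y') i = 0" for i
  proof (cases "i < k")
    case True
    hence "p i x y' = p i x y" by (intro p_cong) (auto simp: y'_def)
    thus ?thesis using y[OF True] True by (simp add: op_apply y'_def)
  qed (simp add: op_apply y'_def p_beyond)
  thus ?thesis unfolding unit_def by blast
qed

definition inv :: "(nat \<Rightarrow> real) \<Rightarrow> nat \<Rightarrow> real" where "inv x = (SOME y. x \<otimes> y = \<one>)"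

lemma right_inv [simp]: "x \<otimes> inv x = \<one>"
  unfolding inv_def using right_inverse_ex by (rule someI_ex)

lemma left_inv [simp]: "inv x \<otimes> x = \<one>"
proof -
  have "inv x \<otimes> x = (inv x \<otimes> x) \<otimes> (inv x \<otimes> inv (inv x))" by simp
  also have "\<dots> = inv x \<otimes> ((x \<otimes> inv x) \<otimes> inv (inv x))" by (simp only: op_assoc)
  finally show ?thesis by simp
qed

sublocale grp: group op unit inv
  by unfold_locales (simp_all add: op_assoc)

lemma inv_cancel [simp]: "inv x \<otimes> (x \<otimes> y) = y" "x \<otimes> (inv x \<otimes> y) = y"
  by (simp_all flip: op_assoc)

lemma inv_op: "inv (x \<otimes> y) = inv y \<otimes> inv x"
  by (simp add: grp.inverse_distrib_swap)

lemmas left_cancel = grp.left_cancel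

lemma inv_apply: "inv x i = - x i - p i x (inv x)"
proof -
  have "(x \<otimes> inv x) i = 0" by (subst right_inv) (simp add: unit_def)
  thus ?thesis unfolding op_apply by simp
qed

lemma alg_inv:
  assumes "i < k" "\<And>j. j \<le> i \<Longrightarrow> alg \<rat> V (\<lambda>z. f z j)"
  shows "alg \<rat> V (\<lambda>z. inv (f z) i)"
  using assms
proof (induction i rule: less_induct)
  case (less i)
  show ?case
    by (subst inv_apply, use less in \<open>intro alg_diff alg_uminus alg_p\<close>) auto
qed

section \<open>The filtration, the lattice and the subgroup with integral coordinate 0\<close>

definition V :: "nat \<Rightarrow> (nat \<Rightarrow> real) set" where "V r = {x. \<forall>i<r. x i = 0}"

definition Gam :: "(nat \<Rightarrow> real) set" where "Gam = {x. \<forall>i. x i \<in> \<int>}"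

text \<open>Modulo \<open>Gam\<close> the coordinate 0 is trivial on this subgroup, so the effective
  coordinates start at 1. A translation with coordinate 0 equal to 1 keeps it invariant.\<close>

definition G0 :: "(nat \<Rightarrow> real) set" where "G0 = {x. x 0 \<in> \<int>}"

lemma V_apply_left: "v \<in> V r \<Longrightarrow> i \<le> r \<Longrightarrow> (v \<otimes> x) i = v i + x i"
  and V_apply_right: "v \<in> V r \<Longrightarrow> i \<le> r \<Longrightarrow> (x \<otimes> v) i = x i + v i"
  using p_low[of i v x] p_low[of i x v] by (auto simp: op_apply V_def)

lemma V_op: "v \<in> V r \<Longrightarrow> w \<in> V r \<Longrightarrow> v \<otimes> w \<in> V r"
  using V_apply_left[of v r _ w] by (auto simp: V_def)

lemma unit_V [simp]: "\<one> \<in> V r" by (simp add: V_def unit_def)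

lemma V_antimono: "r \<le> s \<Longrightarrow> V s \<subseteq> V r" by (auto simp: V_def)

lemma V_Suc: "v \<in> V (Suc r) \<longleftrightarrow> v \<in> V r \<and> v r = 0"
  by (auto simp: V_def less_Suc_eq)

lemma inv_low: "v \<in> V r \<Longrightarrow> i \<le> r \<Longrightarrow> inv v i = - v i"
  using V_apply_left[of v r i "inv v"] by (simp add: unit_def)

lemma V_inv: "v \<in> V r \<Longrightarrow> inv v \<in> V r"
  using inv_low[of v r] by (auto simp: V_def)

definition conj :: "(nat \<Rightarrow> real) \<Rightarrow> (nat \<Rightarrow> real) \<Rightarrow> nat \<Rightarrow> real" where "conj x v = x \<otimes> v \<otimes> inv x"

lemma conj_swap: "conj x v \<otimes> x = x \<otimes> v"
  by (simp add: conj_def op_assoc)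

lemma conj_op: "conj x (v \<otimes> w) = conj x v \<otimes> conj x w"
  by (simp add: conj_def op_assoc)

lemma conj_unit [simp]: "conj x \<one> = \<one>" by (simp add: conj_def)

lemma conj_low:
  assumes v: "v \<in> V r" and i: "i \<le> r"
  shows "conj x v i = v i"
  using i
proof (induction i rule: less_induct)
  case (less i)
  have z: "conj x v j = 0" if "j < i" for j using less that v by (auto simp: V_def)
  have "conj x v i + x i + p i (conj x v) x = x i + v i + p i x v"
    using fun_cong[OF conj_swap[of x v], of i] by (simp add: op_apply)
  moreover have "p i (conj x v) x = 0" using z by (intro p_low) auto
  moreover have "p i x v = 0" using v less.prems by (intro p_low) (auto simp: V_def)
  ultimately show ?case by simp
qed

lemma V_conj: "v \<in> V r \<Longrightarrow> conj x v \<in> V r"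
  using conj_low[of v r _ x] by (auto simp: V_def)

definition comm :: "(nat \<Rightarrow> real) \<Rightarrow> (nat \<Rightarrow> real) \<Rightarrow> nat \<Rightarrow> real" where
  "comm x v = conj x v \<otimes> inv v"

text \<open>Conjugation fixes the coordinate r of an element of \<open>V r\<close> and inversion
  negates it, so it cancels in the commutator. Thus \<open>V r\<close> is central modulo
  \<open>V (Suc r)\<close>, which is the source of nilpotency.\<close>

lemma comm_V: "v \<in> V r \<Longrightarrow> comm x v \<in> V (Suc r)"
  unfolding V_Suc comm_def
  using V_op[OF V_conj V_inv] V_apply_left[OF V_conj, of v r r x "inv v"] conj_low[of v r r x] inv_low[of v r r] by auto

definition e :: "nat \<Rightarrow> real \<Rightarrow> nat \<Rightarrow> real" where "e r s = (\<lambda>i. if i = r then s else 0)"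

lemma e_V: "e r s \<in> V r" by (auto simp: e_def V_def)

lemma e_0 [simp]: "e r 0 = \<one>" by (auto simp: e_def unit_def)

lemma V_decomp: "v \<in> V r \<Longrightarrow> inv (e r (v r)) \<otimes> v \<in> V (Suc r)"
  unfolding V_Suc using V_op[OF V_inv[OF e_V]] V_apply_left[OF V_inv[OF e_V], of r r "v r" v] inv_low[OF e_V, of r r "v r"]
  by (auto simp: e_def)

lemma Gam_op: "x \<in> Gam \<Longrightarrow> y \<in> Gam \<Longrightarrow> x \<otimes> y \<in> Gam"
  unfolding Gam_def op_apply using p_Ints[of x y] by auto

lemma unit_Gam [simp]: "\<one> \<in> Gam" by (simp add: Gam_def unit_def)

lemma e_Gam: "m \<in> \<int> \<Longrightarrow> e r m \<in> Gam" by (simp add: e_def Gam_def)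

lemma Gam_inv:
  assumes "x \<in> Gam"
  shows "inv x \<in> Gam"
proof -
  have "inv x i \<in> \<int>" for i
  proof (induction i rule: less_induct)
    case (less i)
    have "p i x (inv x) = p i x (\<lambda>j. if j < i then inv x j else 0)" by (intro p_cong) auto
    moreover have "\<dots> \<in> \<int>" using assms less by (intro p_Ints) (auto simp: Gam_def)
    ultimately have "p i x (inv x) \<in> \<int>" by simp
    moreover have "x i \<in> \<int>" using assms by (auto simp: Gam_def)
    ultimately show ?case by (subst inv_apply) (intro Ints_diff Ints_minus)
  qed
  thus ?thesis by (simp add: Gam_def)
qed

lemma p_first: "p 0 x y = 0" by (rule p_low) simp

lemma op_first: "(x \<otimes> y) 0 = x 0 + y 0" by (simp add: op_apply p_first)

lemma inv_first: "inv x 0 = - x 0" by (subst inv_apply) (simp add: p_first)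

lemma G0_op: "x \<in> G0 \<Longrightarrow> y \<in> G0 \<Longrightarrow> x \<otimes> y \<in> G0"
  by (auto simp: G0_def op_first)

lemma unit_G0 [simp]: "\<one> \<in> G0" by (simp add: G0_def unit_def)

lemma Gam_G0: "Gam \<subseteq> G0" by (auto simp: Gam_def G0_def)

lemma V_G0: "r > 0 \<Longrightarrow> V r \<subseteq> G0" by (auto simp: V_def G0_def)

primrec pow :: "(nat \<Rightarrow> real) \<Rightarrow> nat \<Rightarrow> nat \<Rightarrow> real" where
  "pow x 0 = \<one>"
| "pow x (Suc n) = x \<otimes> pow x n"

lemma pow_add: "pow x (m + n) = pow x m \<otimes> pow x n"
  by (induction m) (auto simp: op_assoc)

lemma pow_mult: "pow x (m * n) = pow (pow x m) n"
  by (induction n) (auto simp: pow_add)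

lemma pow_first: "pow x n 0 = real n * x 0"
  by (induction n) (auto simp: op_first unit_def algebra_simps)

lemma G0_pow: "x \<in> G0 \<Longrightarrow> pow x n \<in> G0"
  by (induction n) (auto intro: G0_op)

text \<open>The representative of \<open>x \<Gamma>\<close> in the unit cube is obtained by correcting one coordinate at a time.\<close>

primrec red_upto :: "(nat \<Rightarrow> real) \<Rightarrow> nat \<Rightarrow> nat \<Rightarrow> real" where
  "red_upto x 0 = x"
| "red_upto x (Suc i) = red_upto x i \<otimes> e i (- of_int \<lfloor>red_upto x i i\<rfloor>)"

definition red :: "(nat \<Rightarrow> real) \<Rightarrow> nat \<Rightarrow> real" where
  "red x = (\<lambda>i. frac (red_upto x i i))"

lemma red_upto_low: "j < i \<Longrightarrow> red_upto x i j = red x j"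
proof (induction i)
  case (Suc i)
  have "red_upto x (Suc i) j = red_upto x i j + e i (- of_int \<lfloor>red_upto x i i\<rfloor>) j"
    using Suc.prems by (simp add: V_apply_right[OF e_V])
  thus ?case using Suc by (cases "j = i") (auto simp: e_def red_def frac_def)
qed simp

lemma red_upto_coset: "\<exists>g\<in>Gam. red_upto x i = x \<otimes> g"
proof (induction i)
  case (Suc i)
  then obtain g where "g \<in> Gam" "red_upto x i = x \<otimes> g" by blast
  thus ?case by (intro bexI[of _ "g \<otimes> e i (- of_int \<lfloor>red_upto x i i\<rfloor>)"]) (auto simp: op_assoc intro!: Gam_op e_Gam Ints_minus)
qed (auto intro: bexI[of _ "\<one>"])

text \<open>Step i settles coordinate i for good, but no finite number of steps settles all of them.
  From k on the group law is plain addition, so a single lattice element h corrects all remaining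
  coordinates at once.\<close>

lemma red_coset: "\<exists>g\<in>Gam. red x = x \<otimes> g"
proof -
  obtain g where g: "g \<in> Gam" "red_upto x k = x \<otimes> g" using red_upto_coset by blast
  define h where "h = (\<lambda>i. if i < k then 0 else - real_of_int \<lfloor>(x \<otimes> g) i\<rfloor>)"
  have hV: "h \<in> V k" by (auto simp: h_def V_def)
  have beyond: "((x \<otimes> g) \<otimes> h) i = frac ((x \<otimes> g) i)" if "i \<ge> k" for i
    using that by (simp add: op_apply[of "x \<otimes> g"] p_beyond h_def frac_def)
  have ru: "red_upto x (k + n) i = (x \<otimes> g) i" if "k + n \<le> i" for n i
    using that
  proof (induction n)
    case 0
    thus ?case using g by simp
  next
    case (Suc n)
    have "red_upto x (Suc (k + n)) i = red_upto x (k + n) i + e (k + n) (- of_int \<lfloor>red_upto x (k + n) (k + n)\<rfloor>) i"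
      unfolding red_upto.simps op_apply using Suc.prems by (subst p_beyond) auto
    thus ?case using Suc by (simp add: e_def)
  qed
  have "red x i = (x \<otimes> (g \<otimes> h)) i" for i
  proof (cases "i < k")
    case True
    have "(x \<otimes> g \<otimes> h) i = (x \<otimes> g) i + h i" using True by (intro V_apply_right[OF hV]) auto
    thus ?thesis using True g(2) red_upto_low[OF True, of x] by (simp add: op_assoc h_def)
  next
    case False
    hence "red_upto x i i = (x \<otimes> g) i" using ru[of "i - k" i] by simp
    thus ?thesis using False beyond[of i] by (simp add: op_assoc red_def)
  qed
  moreover have "g \<otimes> h \<in> Gam" using g(1) by (intro Gam_op) (auto simp: Gam_def h_def)
  ultimately show ?thesis by blast
qed

lemma red_bounds: "0 \<le> red x i" "red x i < 1"
  by (simp_all add: red_def frac_lt_1)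

text \<open>Once the lower coordinates of g vanish, its next one acts by addition; an integer that
  moves a point of [0, 1) within [0, 1) is 0.\<close>

lemma red_unique:
  assumes g: "g \<in> Gam" and x: "\<And>i. 0 \<le> x i \<and> x i < 1" and y: "\<And>i. 0 \<le> (x \<otimes> g) i \<and> (x \<otimes> g) i < 1"
  shows "g = \<one>"
proof -
  have "g i = 0" for i
  proof (induction i rule: less_induct)
    case (less i)
    have "(x \<otimes> g) i = x i + g i" using less by (simp add: op_apply p_low)
    moreover obtain n where "g i = of_int n" using g by (auto simp: Gam_def elim: Ints_cases)
    ultimately show ?case using x[of i] y[of i] by auto
  qed
  thus ?thesis by (auto simp: unit_def)
qed

lemma red_right:
  assumes g: "g \<in> Gam"
  shows "red (x \<otimes> g) = red x"
proof -
  obtain a where a: "a \<in> Gam" "red x = x \<otimes> a" using red_coset by blast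
  obtain b where b: "b \<in> Gam" "red (x \<otimes> g) = x \<otimes> g \<otimes> b" using red_coset by blast
  have eq: "red (x \<otimes> g) = red x \<otimes> (inv a \<otimes> (g \<otimes> b))" unfolding a(2) b(2) by (simp add: op_assoc)
  have "inv a \<otimes> (g \<otimes> b) = \<one>"
  proof (rule red_unique[of _ "red x"])
    show "inv a \<otimes> (g \<otimes> b) \<in> Gam" using a b g by (intro Gam_op Gam_inv)
  qed (use red_bounds in \<open>auto simp flip: eq\<close>)
  thus ?thesis using eq by simp
qed

lemma red_G0: "x \<in> G0 \<Longrightarrow> red x 0 = 0"
  by (simp add: red_def G0_def frac_eq_0_iff)

end

subsection \<open>Uniform means\<close>

definition avg :: "(nat \<Rightarrow> 'a::real_normed_vector) \<Rightarrow> nat \<Rightarrow> nat \<Rightarrow> 'a" where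
  "avg a M N = (1 / real N) *\<^sub>R (\<Sum>n<N. a (M + n))"

lemma uniform_mean_avg: "uniform_mean a z \<longleftrightarrow> (\<forall>e>0. \<exists>H. \<forall>N\<ge>H. \<forall>M. norm (avg a M N - z) < e)"
  by (simp add: uniform_mean_def avg_def)

lemma uniform_meanI:
  assumes "\<And>e. e > 0 \<Longrightarrow> \<exists>H. \<forall>N\<ge>H. \<forall>M. norm (avg a M N - z) < e"
  shows "uniform_mean a z"
  using assms by (simp add: uniform_mean_avg)

lemma uniform_meanD:
  assumes "uniform_mean a z" "e > 0"
  obtains H where "\<And>N M. N \<ge> H \<Longrightarrow> norm (avg a M N - z) < e"
  using assms unfolding uniform_mean_avg by blast

lemma avg_const: "N > 0 \<Longrightarrow> avg (\<lambda>_. c) M N = c"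
  by (simp add: avg_def sum_constant_scaleR del: sum_constant)

lemma avg_add: "avg (\<lambda>n. a n + b n) M N = avg a M N + avg b M N"
  by (simp add: avg_def sum.distrib scaleR_add_right)

lemma avg_diff: "avg (\<lambda>n. a n - b n) M N = avg a M N - avg b M N"
  by (simp add: avg_def sum_subtractf scaleR_diff_right)

lemma avg_linear: "bounded_linear f \<Longrightarrow> avg (\<lambda>n. f (a n)) M N = f (avg a M N)"
  by (simp add: avg_def linear_sum[OF bounded_linear.linear] linear_scale[OF bounded_linear.linear])

lemma norm_avg_le: "(\<And>n. norm (a n) \<le> c n) \<Longrightarrow> norm (avg a M N) \<le> avg c M N"
  by (auto simp: avg_def intro!: divide_right_mono order_trans[OF norm_sum] sum_mono)

lemma uniform_mean_const: "uniform_mean (\<lambda>_. c) c"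
  by (rule uniform_meanI) (auto intro!: exI[of _ 1] simp: avg_const Suc_le_eq)

lemma uniform_mean_add:
  assumes "uniform_mean a y" "uniform_mean b z"
  shows "uniform_mean (\<lambda>n. a n + b n) (y + z)"
proof (rule uniform_meanI)
  fix e :: real assume "e > 0"
  hence e: "e / 2 > 0" by simp
  obtain H where H: "\<And>N M. N \<ge> H \<Longrightarrow> norm (avg a M N - y) < e / 2" using uniform_meanD[OF assms(1) e] by blast
  obtain K where K: "\<And>N M. N \<ge> K \<Longrightarrow> norm (avg b M N - z) < e / 2" using uniform_meanD[OF assms(2) e] by blast
  have "norm (avg (\<lambda>n. a n + b n) M N - (y + z)) < e" if "N \<ge> max H K" for M N
    using norm_triangle_ineq[of "avg a M N - y" "avg b M N - z"] H[of N M] K[of N M] that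
    unfolding avg_add by (simp add: add_diff_add)
  thus "\<exists>H. \<forall>N\<ge>H. \<forall>M. norm (avg (\<lambda>n. a n + b n) M N - (y + z)) < e" by blast
qed

lemma uniform_mean_linear:
  assumes "bounded_linear f" "uniform_mean a z"
  shows "uniform_mean (\<lambda>n. f (a n)) (f z)"
proof (rule uniform_meanI)
  fix e :: real assume e: "e > 0"
  obtain K where K: "K > 0" "\<And>x. norm (f x) \<le> norm x * K" using bounded_linear.pos_bounded[OF assms(1)] by blast
  obtain H where H: "\<And>N M. N \<ge> H \<Longrightarrow> norm (avg a M N - z) < e / K"
    using uniform_meanD[OF assms(2), of "e / K"] e K by auto
  have "norm (avg (\<lambda>n. f (a n)) M N - f z) < e" if "N \<ge> H" for M N
  proof -
    have "norm (avg (\<lambda>n. f (a n)) M N - f z) = norm (f (avg a M N - z))"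
      by (simp add: avg_linear[OF assms(1)] linear_diff[OF bounded_linear.linear[OF assms(1)]])
    also have "\<dots> \<le> norm (avg a M N - z) * K" by (rule K(2))
    also have "\<dots> < e" using H[OF that, of M] K(1) by (simp add: pos_less_divide_eq)
    finally show ?thesis .
  qed
  thus "\<exists>H. \<forall>N\<ge>H. \<forall>M. norm (avg (\<lambda>n. f (a n)) M N - f z) < e" by blast
qed

lemma uniform_mean_cmult:
  fixes a :: "nat \<Rightarrow> 'a::real_normed_algebra"
  shows "uniform_mean a z \<Longrightarrow> uniform_mean (\<lambda>n. c * a n) (c * z)"
  by (rule uniform_mean_linear[OF bounded_linear_mult_right])

lemma uniform_mean_diff:
  assumes "uniform_mean a y" "uniform_mean b z"
  shows "uniform_mean (\<lambda>n. a n - b n) (y - z)"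
  using uniform_mean_add[OF assms(1) uniform_mean_linear[OF bounded_linear_minus[OF bounded_linear_ident] assms(2)]] by simp

lemma uniform_mean_sum:
  assumes "\<And>i. i \<in> I \<Longrightarrow> uniform_mean (a i) (z i)"
  shows "uniform_mean (\<lambda>n. \<Sum>i\<in>I. a i n) (\<Sum>i\<in>I. z i)"
  using assms by (induction I rule: infinite_finite_induct) (auto intro: uniform_mean_add uniform_mean_const)

lemma uniform_mean_bound:
  assumes "uniform_mean a z" "uniform_mean c g" "\<And>n. norm (a n) \<le> c n"
  shows "norm z \<le> g"
proof (rule field_le_epsilon)
  fix e :: real assume "e > 0"
  hence e: "e / 2 > 0" by simp
  obtain H where H: "\<And>N M. N \<ge> H \<Longrightarrow> norm (avg a M N - z) < e / 2" using uniform_meanD[OF assms(1) e] by blast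
  obtain K where K: "\<And>N M. N \<ge> K \<Longrightarrow> norm (avg c M N - g) < e / 2" using uniform_meanD[OF assms(2) e] by blast
  define N where "N = max H K"
  have "norm z \<le> norm (avg a 0 N) + norm (avg a 0 N - z)"
    using norm_triangle_ineq4[of "avg a 0 N" "avg a 0 N - z"] by simp
  moreover have "norm (avg a 0 N) \<le> avg c 0 N" using assms(3) by (rule norm_avg_le)
  moreover have "norm (avg a 0 N - z) < e / 2" "\<bar>avg c 0 N - g\<bar> < e / 2"
    using H[of N 0] K[of N 0] by (simp_all add: N_def)
  ultimately show "norm z \<le> g + e" by linarith
qed

text \<open>The error is controlled only in the mean: a n may differ much from b n for a few n, as
  happens near discontinuities.\<close>

lemma uniform_mean_approx_to:
  assumes "\<And>e::real. e > 0 \<Longrightarrow> \<exists>b y c g. uniform_mean b y \<and> uniform_mean c g \<and>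
    (\<forall>n. norm (a n - b n) \<le> c n) \<and> g < e \<and> norm (y - z) < e"
  shows "uniform_mean a z"
proof (rule uniform_meanI)
  fix e :: real assume "e > 0"
  hence e: "e / 4 > 0" by simp
  obtain b y c g where b: "uniform_mean b y" "uniform_mean c g" "\<And>n. norm (a n - b n) \<le> c n" "g < e / 4" "norm (y - z) < e / 4"
    using assms[OF e] by blast
  obtain H where H: "\<And>N M. N \<ge> H \<Longrightarrow> norm (avg b M N - y) < e / 4" using uniform_meanD[OF b(1) e] by blast
  obtain K where K: "\<And>N M. N \<ge> K \<Longrightarrow> norm (avg c M N - g) < e / 4" using uniform_meanD[OF b(2) e] by blast
  have "norm (avg a M N - z) < e" if N: "N \<ge> max H K" for M N
  proof -
    have "norm (avg a M N - avg b M N) \<le> avg c M N"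
      unfolding avg_diff[symmetric] using b(3) by (rule norm_avg_le)
    moreover have "avg c M N < e / 2" using K[of N M] N b(4) unfolding real_norm_def by linarith
    moreover have "norm (avg a M N - z) \<le> norm (avg a M N - avg b M N) + norm (avg b M N - y) + norm (y - z)"
      using norm_triangle_ineq[of "avg a M N - avg b M N" "avg b M N - y"]
        norm_triangle_ineq[of "avg a M N - avg b M N + (avg b M N - y)" "y - z"] by simp
    ultimately show ?thesis using H[of N M] N b(5) by simp
  qed
  thus "\<exists>H. \<forall>N\<ge>H. \<forall>M. norm (avg a M N - z) < e" by blast
qed

text \<open>The means of the approximants form a Cauchy sequence, because the distance of two of
  them is at most the mean of the sum of their error bounds. No candidate for z is needed in
  advance.\<close>

lemma uniform_mean_approx:
  fixes a :: "nat \<Rightarrow> 'a::banach"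
  assumes "\<And>e::real. e > 0 \<Longrightarrow> \<exists>b y c g. uniform_mean b y \<and> uniform_mean c g \<and>
    (\<forall>n. norm (a n - b n) \<le> c n) \<and> g < e"
  shows "\<exists>z. uniform_mean a z"
proof -
  have "\<forall>j. \<exists>b y c g. uniform_mean b y \<and> uniform_mean c g \<and>
    (\<forall>n. norm (a n - b n) \<le> c n) \<and> g < 1 / real (Suc j)" by (intro allI assms) simp
  then obtain b y c g where b: "\<And>j. uniform_mean (b j) (y j)" "\<And>j. uniform_mean (c j) (g j)"
    "\<And>j n. norm (a n - b j n) \<le> c j n" "\<And>j. g j < 1 / real (Suc j)" by metis
  have dist: "norm (y i - y j) \<le> 1 / real (Suc i) + 1 / real (Suc j)" for i j
  proof -
    have "norm (y i - y j) \<le> g i + g j"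
    proof (rule uniform_mean_bound[OF uniform_mean_diff[OF b(1) b(1)] uniform_mean_add[OF b(2) b(2)]])
      show "norm (b i n - b j n) \<le> c i n + c j n" for n
        using norm_triangle_ineq4[of "a n - b j n" "a n - b i n"] b(3)[of n i] b(3)[of n j] by simp
    qed
    thus ?thesis using b(4)[of i] b(4)[of j] by linarith
  qed
  have lim: "(\<lambda>j. 1 / real (Suc j)) \<longlonglongrightarrow> 0" using LIMSEQ_inverse_real_of_nat by (simp add: inverse_eq_divide)
  have "Cauchy y"
  proof (rule CauchyI)
    fix e :: real assume "e > 0"
    then obtain J where J: "\<And>j. j \<ge> J \<Longrightarrow> 1 / real (Suc j) < e / 2"
      using LIMSEQ_D[OF lim, of "e / 2"] by auto
    show "\<exists>M. \<forall>m\<ge>M. \<forall>n\<ge>M. norm (y m - y n) < e"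
    proof (intro exI[of _ J] allI impI)
      fix m n assume "m \<ge> J" "n \<ge> J"
      thus "norm (y m - y n) < e" using dist[of m n] J[of m] J[of n] by linarith
    qed
  qed
  then obtain z where z: "y \<longlonglongrightarrow> z" using Cauchy_convergent convergent_def by blast
  have "uniform_mean a z"
  proof (rule uniform_mean_approx_to)
    fix e :: real assume "e > 0"
    then obtain I J where I: "\<And>j. j \<ge> I \<Longrightarrow> norm (y j - z) < e" and J: "\<And>j. j \<ge> J \<Longrightarrow> 1 / real (Suc j) < e"
      using LIMSEQ_D[OF lim, of e] LIMSEQ_D[OF z, of e] by auto
    show "\<exists>b y c g. uniform_mean b y \<and> uniform_mean c g \<and>
      (\<forall>n. norm (a n - b n) \<le> c n) \<and> g < e \<and> norm (y - z) < e"
      using b(1,2,3) I[of "max I J"] less_trans[OF b(4)[of "max I J"] J[of "max I J"]]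
      by (intro exI[of _ "b (max I J)"] exI[of _ "y (max I J)"] exI[of _ "c (max I J)"] exI[of _ "g (max I J)"]) auto
  qed
  thus ?thesis by blast
qed

lemma uniform_mean_Re: "uniform_mean a z \<Longrightarrow> uniform_mean (\<lambda>n. Re (a n)) (Re z)"
  by (rule uniform_mean_linear[OF bounded_linear_Re])

lemma sum_lessThan_add: "(\<Sum>n<m + q. f n) = (\<Sum>n<m. f n) + (\<Sum>n<q. f (m + n :: nat) :: 'a::comm_monoid_add)"
  by (induction q) (auto simp: add.assoc)

lemma sum_progressions:
  fixes f :: "nat \<Rightarrow> 'a::comm_monoid_add"
  shows "(\<Sum>n<D * q. f n) = (\<Sum>j<D. \<Sum>n<q. f (D * n + j))"
proof (induction q)
  case (Suc q)
  have "(\<Sum>n<D * q + D. f n) = (\<Sum>n<D * q. f n) + (\<Sum>j<D. f (D * q + j))" by (rule sum_lessThan_add)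
  thus ?case using Suc by (simp add: sum.distrib add.commute)
qed simp

text \<open>Start and length of a window are rounded down to multiples of D; the boundary terms,
  fewer than 3 D, are absorbed by the bound C.\<close>

lemma uniform_mean_progressions:
  fixes a :: "nat \<Rightarrow> 'a::real_normed_vector"
  assumes D: "D > 0" and m: "\<And>j. j < D \<Longrightarrow> uniform_mean (\<lambda>n. a (D * n + j)) (z j)" and C: "\<And>n. norm (a n) \<le> C"
  shows "uniform_mean a ((1 / real D) *\<^sub>R (\<Sum>j<D. z j))"
proof (rule uniform_meanI)
  fix e :: real assume e: "e > 0"
  define w where "w = (1 / real D) *\<^sub>R (\<Sum>j<D. z j)"
  have C0: "C \<ge> 0" using C[of 0] norm_ge_zero order_trans by blast
  have "\<forall>j\<in>{..<D}. \<exists>H. \<forall>N\<ge>H. \<forall>M. norm (avg (\<lambda>n. a (D * n + j)) M N - z j) < e / 2"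
    using m half_gt_zero[OF e] unfolding uniform_mean_avg by blast
  from bchoice[OF this] obtain H where
    "\<forall>j\<in>{..<D}. \<forall>N\<ge>H j. \<forall>M. norm (avg (\<lambda>n. a (D * n + j)) M N - z j) < e / 2" ..
  hence H: "norm (avg (\<lambda>n. a (D * n + j)) M N - z j) < e / 2" if "j < D" "N \<ge> H j" for j N M
    using that by simp
  define K where "K = (\<Sum>j<D. H j)"
  have HK: "j < D \<Longrightarrow> H j \<le> K" for j unfolding K_def by (intro member_le_sum) auto
  obtain L :: nat where L: "real L > 2 * (4 * real D * C + real D * norm w) / e" using reals_Archimedean2 by blast
  have tri: "norm (x + y - z - w) \<le> norm x + norm y + norm z + norm w" for x y z w :: 'a
    using norm_triangle_ineq4[of "x + y - z" w] norm_triangle_ineq4[of "x + y" z] norm_triangle_ineq[of x y] by linarith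
  have bnd: "norm (\<Sum>n<q. a (m + n)) \<le> real q * C" for m q
    using sum_norm_bound[of "{..<q}" "\<lambda>n. a (m + n)" C] C by simp
  show "\<exists>H. \<forall>N\<ge>H. \<forall>M. norm (avg a M N - (1 / real D) *\<^sub>R (\<Sum>j<D. z j)) < e"
    unfolding w_def[symmetric]
  proof (intro exI[of _ "Suc (max L (D * Suc K))"] allI impI)
    fix N M assume N: "Suc (max L (D * Suc K)) \<le> N"
    define mm q where "mm = M div D" and "q = N div D"
    define u v where "u = M mod D" and "v = N mod D"
    have uv: "u < D" "v < D" using D by (auto simp: u_def v_def)
    have MN: "M = D * mm + u" "N = D * q + v" by (auto simp: mm_def q_def u_def v_def)
    have "D * Suc K \<le> D * q + v" using N MN by linarith
    have "Suc K \<le> q"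
    proof (rule ccontr)
      assume "\<not> Suc K \<le> q"
      hence "D * q \<le> D * K" by (intro mult_le_mono2) simp
      moreover have "D * Suc K = D * K + D" by simp
      ultimately show False using \<open>D * Suc K \<le> D * q + v\<close> uv by linarith
    qed
    hence q: "q \<ge> K" "q > 0" by auto
    define S where "S = (\<Sum>n<D * q. a (D * mm + n))"
    have "S = (\<Sum>j<D. \<Sum>n<q. a (D * (mm + n) + j))"
      unfolding S_def sum_progressions by (simp add: algebra_simps)
    also have "\<dots> = (\<Sum>j<D. real q *\<^sub>R avg (\<lambda>n. a (D * n + j)) mm q)"
      using q by (simp add: avg_def)
    finally have "S - real (D * q) *\<^sub>R w = (\<Sum>j<D. real q *\<^sub>R (avg (\<lambda>n. a (D * n + j)) mm q - z j))"
      using D by (simp add: w_def scaleR_diff_right sum_subtractf scaleR_sum_right)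
    also have "norm \<dots> \<le> (\<Sum>j<D. real q * (e / 2))"
    proof (rule sum_norm_le)
      fix j assume "j \<in> {..<D}"
      hence "norm (avg (\<lambda>n. a (D * n + j)) mm q - z j) < e / 2" using HK[of j] q by (intro H) auto
      thus "norm (real q *\<^sub>R (avg (\<lambda>n. a (D * n + j)) mm q - z j)) \<le> real q * (e / 2)"
        by (simp only: norm_scaleR abs_of_nat) (intro mult_left_mono, auto)
    qed
    finally have "norm (S - real (D * q) *\<^sub>R w) \<le> (\<Sum>j<D. real q * (e / 2))" .
    hence S: "norm (S - real (D * q) *\<^sub>R w) \<le> real N * (e / 2)"
    proof -
      have "D * q \<le> N" using MN(2) by simp
      hence "real D * real q \<le> real N" by (simp only: of_nat_mult[symmetric] of_nat_le_iff)
      hence "real D * real q * (e / 2) \<le> real N * (e / 2)" using e by (intro mult_right_mono) auto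
      thus ?thesis using \<open>norm (S - real (D * q) *\<^sub>R w) \<le> (\<Sum>j<D. real q * (e / 2))\<close> by simp
    qed
    have "(\<Sum>n<u + N. a (D * mm + n)) = (\<Sum>n<u. a (D * mm + n)) + (\<Sum>n<N. a (M + n))"
      unfolding sum_lessThan_add MN(1) by (simp add: add.assoc)
    moreover have "u + N = D * q + (u + v)" using MN by simp
    moreover have "(\<Sum>n<D * q + (u + v). a (D * mm + n)) = S + (\<Sum>n<u + v. a (D * mm + D * q + n))"
      unfolding sum_lessThan_add S_def by (simp add: add.assoc)
    ultimately have "(\<Sum>n<N. a (M + n)) = S + (\<Sum>n<u + v. a (D * mm + D * q + n)) - (\<Sum>n<u. a (D * mm + n))"
      by (simp add: algebra_simps)
    hence "(\<Sum>n<N. a (M + n)) - real N *\<^sub>R w =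
      (S - real (D * q) *\<^sub>R w) + (\<Sum>n<u + v. a (D * mm + D * q + n)) - (\<Sum>n<u. a (D * mm + n)) - real v *\<^sub>R w"
      using MN(2) by (simp add: algebra_simps)
    also have "norm \<dots> \<le> norm (S - real (D * q) *\<^sub>R w) + norm (\<Sum>n<u + v. a (D * mm + D * q + n)) + norm (\<Sum>n<u. a (D * mm + n)) + norm (real v *\<^sub>R w)"
      by (rule tri)
    also have "\<dots> \<le> real N * (e / 2) + real (u + v) * C + real u * C + real v * norm w"
      by (intro add_mono S bnd) simp
    also have "\<dots> \<le> real N * (e / 2) + (2 * real D) * C + real D * C + real D * norm w"
      using uv C0 by (intro order_refl add_mono mult_right_mono) auto
    also have "\<dots> < real N * e"
    proof -
      have "2 * (4 * real D * C + real D * norm w) / e < real N" using L N by linarith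
      hence "2 * (4 * real D * C + real D * norm w) < real N * e" using e by (simp add: pos_divide_less_eq)
      moreover have "real D * C \<ge> 0" using C0 by simp
      ultimately show ?thesis by (simp add: algebra_simps)
    qed
    finally have "norm ((\<Sum>n<N. a (M + n)) - real N *\<^sub>R w) < real N * e" .
    moreover have "avg a M N - w = (1 / real N) *\<^sub>R ((\<Sum>n<N. a (M + n)) - real N *\<^sub>R w)"
      using N by (simp add: avg_def scaleR_diff_right)
    ultimately show "norm (avg a M N - w) < e" using N by (simp add: pos_divide_less_eq mult.commute)
  qed
qed

section \<open>Van der Corput's inequality\<close>

lemma norm_sum_squared: "complex_of_real ((norm (\<Sum>h\<in>A. x h))\<^sup>2) = (\<Sum>h\<in>A. \<Sum>h'\<in>A. x h * cnj (x h'))"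
  unfolding complex_norm_square cnj_sum sum_product ..

text \<open>Averaging over H shifts and Cauchy--Schwarz leave the correlations of pairs of shifts.
  Pairs closer than T are bounded trivially by C^2, the others by 2 d from the hypothesis on c; each
  estimate is uniform in the start M of the window.\<close>

lemma van_der_corput:
  fixes a :: "nat \<Rightarrow> complex"
  assumes b: "\<And>n. norm (a n) \<le> C"
    and c: "\<And>t. t > 0 \<Longrightarrow> uniform_mean (\<lambda>n. a (n + t) * cnj (a n)) (c t)" and lim: "c \<longlonglongrightarrow> 0"
  shows "uniform_mean a 0"
proof (rule uniform_meanI)
  fix e :: real assume e: "e > 0"
  have C0: "C \<ge> 0" using b[of 0] norm_ge_zero order_trans by blast
  \<comment> \<open>The final estimate is (norm Z)^2 <= 3 d (N H)^2, to be compared with (N H e /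
    2)^2.\<close>
  define d where "d = e\<^sup>2 / 16"
  have d: "d > 0" using e by (simp add: d_def)
  obtain T0 where "\<And>t. t \<ge> T0 \<Longrightarrow> norm (c t) < d" using LIMSEQ_D[OF lim d] by auto
  hence T0: "norm (c t) < d" if "t \<ge> Suc T0" for t using that by simp
  define T where "T = Suc T0"
  have T: "\<And>t. t \<ge> T \<Longrightarrow> norm (c t) < d" "T > 0" using T0 by (auto simp: T_def)
  \<comment> \<open>So many shifts that the close pairs, costing 2 T C^2 for each h, contribute at
    most d H.\<close>
  obtain H0 :: nat where H0: "real H0 > 2 * real T * C\<^sup>2 / d" using reals_Archimedean2 by blast
  define H where "H = Suc H0"
  have H: "H > 0" "2 * real T * C\<^sup>2 \<le> d * real H"
    using H0 d by (auto simp: H_def field_simps)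
  have "\<forall>t\<in>{0<..<H}. \<exists>K. \<forall>N\<ge>K. \<forall>M. norm (avg (\<lambda>n. a (n + t) * cnj (a n)) M N - c t) < d"
    using c d unfolding uniform_mean_avg by auto
  from bchoice[OF this] obtain K where
    "\<forall>t\<in>{0<..<H}. \<forall>N\<ge>K t. \<forall>M. norm (avg (\<lambda>n. a (n + t) * cnj (a n)) M N - c t) < d" ..
  hence K: "norm (avg (\<lambda>n. a (n + t) * cnj (a n)) M N - c t) < d" if "0 < t" "t < H" "N \<ge> K t" for t N M
    using that by simp
  define K' where "K' = (\<Sum>t<H. K t)"
  have KK': "t < H \<Longrightarrow> K t \<le> K'" for t unfolding K'_def by (intro member_le_sum) auto
  obtain L :: nat where L: "real L > 4 * real H * C / e" using reals_Archimedean2 by blast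
  show "\<exists>H. \<forall>N\<ge>H. \<forall>M. norm (avg a M N - 0) < e"
  proof (intro exI[of _ "Suc (max L K')"] allI impI)
    fix N M assume N: "Suc (max L K') \<le> N"
    have N0: "N > 0" using N by simp
    define x where "x n h = a (M + n + h)" for n h
    define S where "S h = (\<Sum>n<N. x n h)" for h
    have shift: "norm (S 0 - S h) \<le> 2 * real H * C" if "h < H" for h
    proof -
      have "(\<Sum>n<h. a (M + n)) + S h = S 0 + (\<Sum>n<h. a (M + N + n))"
        using sum_lessThan_add[of "\<lambda>n. a (M + n)" h N] sum_lessThan_add[of "\<lambda>n. a (M + n)" N h]
        by (simp add: S_def x_def add_ac)
      hence "S 0 - S h = (\<Sum>n<h. a (M + n)) - (\<Sum>n<h. a (M + N + n))"
        by (simp add: algebra_simps)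
      hence "norm (S 0 - S h) \<le> norm (\<Sum>n<h. a (M + n)) + norm (\<Sum>n<h. a (M + N + n))"
        using norm_triangle_ineq4 by metis
      also have "\<dots> \<le> real h * C + real h * C"
        using sum_norm_bound[of "{..<h}" "\<lambda>n. a (M + n)" C] sum_norm_bound[of "{..<h}" "\<lambda>n. a (M + N + n)" C] b
        by (intro add_mono) auto
      also have "\<dots> \<le> real H * C + real H * C" using that C0 by (intro add_mono mult_right_mono) auto
      finally show ?thesis by (simp add: mult_ac)
    qed
    define Z where "Z = (\<Sum>n<N. \<Sum>h<H. x n h)"
    have Zeq: "Z = (\<Sum>h<H. S h)" unfolding Z_def S_def by (rule sum.swap)
    have "of_nat H * S 0 - Z = (\<Sum>h<H. S 0 - S h)" unfolding Zeq by (simp add: sum_subtractf)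
    also have "norm \<dots> \<le> real H * (2 * real H * C)"
      using sum_norm_bound[of "{..<H}" "\<lambda>h. S 0 - S h" "2 * real H * C"] shift by simp
    finally have err: "norm (of_nat H * S 0 - Z) \<le> real H * (2 * real H * C)" .
    define W where "W = (\<Sum>n<N. (norm (\<Sum>h<H. x n h))\<^sup>2)"
    have CS: "(norm Z)\<^sup>2 \<le> real N * W"
    proof -
      have "norm Z \<le> (\<Sum>n<N. 1 * norm (\<Sum>h<H. x n h))" unfolding Z_def by (simp add: norm_sum)
      hence "(norm Z)\<^sup>2 \<le> (\<Sum>n<N. 1 * norm (\<Sum>h<H. x n h))\<^sup>2" by (rule power_mono) simp
      also have "\<dots> \<le> (\<Sum>n<N. 1\<^sup>2) * (\<Sum>n<N. (norm (\<Sum>h<H. x n h))\<^sup>2)" by (rule Cauchy_Schwarz_ineq_sum)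
      finally show ?thesis by (simp add: W_def)
    qed
    have pair: "norm (\<Sum>n<N. x n h * cnj (x n h')) \<le> real N * (if h < h' + T \<and> h' < h + T then C\<^sup>2 else 2 * d)"
      if hh: "h < H" "h' < H" for h h'
    proof (cases "h < h' + T \<and> h' < h + T")
      case True
      have "norm (x n h * cnj (x n h')) \<le> C * C" for n
        unfolding norm_mult x_def using b C0 by (intro mult_mono) auto
      thus ?thesis using sum_norm_bound[of "{..<N}" "\<lambda>n. x n h * cnj (x n h')" "C * C"] True
        by (simp add: power2_eq_square)
    next
      case False
      note bound_eq = if_not_P[OF False, of "C\<^sup>2" "2 * d"]
      have ord: "norm (\<Sum>n<N. x n h * cnj (x n h')) \<le> real N * (2 * d)" if "h' + T \<le> h" "h < H" for h h'
      proof -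
        define t where "t = h - h'"
        have t: "0 < t" "t < H" "T \<le> t" "h = h' + t" using that T(2) by (auto simp: t_def)
        have "K t \<le> N" using KK'[of t] t N by simp
        hence "norm (avg (\<lambda>n. a (n + t) * cnj (a n)) (M + h') N - c t) < d" by (rule K[OF t(1,2)])
        hence "norm (avg (\<lambda>n. a (n + t) * cnj (a n)) (M + h') N) < 2 * d"
          using T(1)[OF t(3)] norm_triangle_ineq[of "avg (\<lambda>n. a (n + t) * cnj (a n)) (M + h') N - c t" "c t"] by simp
        moreover have "avg (\<lambda>n. a (n + t) * cnj (a n)) (M + h') N = (1 / real N) *\<^sub>R (\<Sum>n<N. x n h * cnj (x n h'))"
          unfolding avg_def x_def t(4) by (simp add: add_ac)
        ultimately show ?thesis using N0 by (simp add: field_simps)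
      qed
      show ?thesis
      proof (cases "h' + T \<le> h")
        case True
        show ?thesis using ord[OF True hh(1)] unfolding bound_eq .
      next
        case nle: False
        hence "h + T \<le> h'" using False by simp
        hence "norm (\<Sum>n<N. x n h' * cnj (x n h)) \<le> real N * (2 * d)" by (rule ord[OF _ hh(2)])
        moreover have "(\<Sum>n<N. x n h * cnj (x n h')) = cnj (\<Sum>n<N. x n h' * cnj (x n h))"
          by (simp add: mult.commute)
        ultimately have "norm (\<Sum>n<N. x n h * cnj (x n h')) \<le> real N * (2 * d)" by (simp only: complex_mod_cnj)
        thus ?thesis unfolding bound_eq .
      qed
    qed
    have "complex_of_real W = (\<Sum>n<N. \<Sum>h<H. \<Sum>h'<H. x n h * cnj (x n h'))"
      unfolding W_def of_real_sum norm_sum_squared ..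
    also have "\<dots> = (\<Sum>h<H. \<Sum>n<N. \<Sum>h'<H. x n h * cnj (x n h'))" by (rule sum.swap)
    also have "\<dots> = (\<Sum>h<H. \<Sum>h'<H. \<Sum>n<N. x n h * cnj (x n h'))" by (rule sum.cong[OF refl], rule sum.swap)
    also have "norm \<dots> \<le> (\<Sum>h<H. \<Sum>h'<H. real N * (if h < h' + T \<and> h' < h + T then C\<^sup>2 else 2 * d))"
      by (intro sum_norm_le pair) auto
    finally have "norm (complex_of_real W) \<le> (\<Sum>h<H. \<Sum>h'<H. real N * (if h < h' + T \<and> h' < h + T then C\<^sup>2 else 2 * d))" .
    hence "W \<le> (\<Sum>h<H. \<Sum>h'<H. real N * (if h < h' + T \<and> h' < h + T then C\<^sup>2 else 2 * d))"
      by simp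
    also have "\<dots> \<le> (\<Sum>h<H. \<Sum>h'<H. real N * ((if h' \<in> {h - T..<h + T} then C\<^sup>2 else 0) + 2 * d))"
      using d by (intro sum_mono mult_left_mono) auto
    also have "\<dots> = real N * (\<Sum>h<H. (\<Sum>h'<H. if h' \<in> {h - T..<h + T} then C\<^sup>2 else 0) + real H * (2 * d))"
      by (simp add: sum_distrib_left[symmetric] sum.distrib)
    also have "\<dots> \<le> real N * (\<Sum>h<H. 2 * real T * C\<^sup>2 + real H * (2 * d))"
    proof (intro mult_left_mono sum_mono add_mono order_refl)
      fix h
      have "(\<Sum>h'<H. if h' \<in> {h - T..<h + T} then C\<^sup>2 else 0) = real (card ({..<H} \<inter> {h - T..<h + T})) * C\<^sup>2"
        using sum.inter_restrict[of "{..<H}" "\<lambda>_. C\<^sup>2" "{h - T..<h + T}"] by simp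
      also have "card ({..<H} \<inter> {h - T..<h + T}) \<le> card {h - T..<h + T}" by (intro card_mono) auto
      also have "\<dots> \<le> 2 * T" by simp
      finally show "(\<Sum>h'<H. if h' \<in> {h - T..<h + T} then C\<^sup>2 else 0) \<le> 2 * real T * C\<^sup>2"
        by (simp add: mult_right_mono)
    qed auto
    also have "\<dots> \<le> real N * (\<Sum>h<H. real H * (3 * d))"
      using H(2) by (intro mult_left_mono sum_mono) (auto simp: algebra_simps)
    finally have W: "W \<le> real N * (real H * (real H * (3 * d)))" by simp
    have "(norm Z)\<^sup>2 \<le> real N * (real N * (real H * (real H * (3 * d))))"
      using CS mult_left_mono[OF W, of "real N"] by simp
    also have "\<dots> \<le> (real N * real H * (e / 2))\<^sup>2"
    proof -
      have "real N * (real N * (real H * (real H * (3 * d)))) = (real N * real H * e)\<^sup>2 * (3 / 16)"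
        by (simp add: d_def power2_eq_square)
      also have "\<dots> \<le> (real N * real H * e)\<^sup>2 * (1 / 4)" by (intro mult_left_mono) auto
      also have "\<dots> = (real N * real H * (e / 2))\<^sup>2" by (simp add: power2_eq_square)
      finally show ?thesis .
    qed
    finally have "norm Z \<le> real N * real H * (e / 2)" by (rule power2_le_imp_le) (use e in simp)
    moreover have "real H * norm (S 0) \<le> norm (of_nat H * S 0 - Z) + norm Z"
      using norm_triangle_ineq[of "of_nat H * S 0 - Z" Z] by (simp add: norm_mult)
    ultimately have "real H * norm (S 0) \<le> real H * (2 * real H * C + real N * (e / 2))"
      using err by (simp add: algebra_simps)
    hence "norm (S 0) \<le> 2 * real H * C + real N * (e / 2)" using H(1) by simp
    also have "\<dots> < real N * e"
    proof -
      have "4 * real H * C / e < real N" using L N by linarith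
      thus ?thesis using e by (simp add: field_simps)
    qed
    finally have "norm (S 0) < real N * e" .
    moreover have "avg a M N = (1 / real N) *\<^sub>R S 0" by (simp add: avg_def S_def x_def)
    ultimately show "norm (avg a M N - 0) < e" using N0 by (simp add: field_simps)
  qed
qed

subsection \<open>Trigonometric approximation\<close>

definition ee :: "real \<Rightarrow> complex" where "ee t = cis (2 * pi * t)"

lemma ee_add: "ee (s + t) = ee s * ee t"
  by (simp add: ee_def cis_mult algebra_simps)

lemma ee_0 [simp]: "ee 0 = 1" by (simp add: ee_def)

lemma norm_ee [simp]: "norm (ee t) = 1" by (simp add: ee_def)

lemma cnj_ee: "cnj (ee t) = ee (- t)" by (simp add: ee_def cis_cnj)

lemma ee_minus: "ee (- t) * ee t = 1" by (simp flip: ee_add)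

lemma ee_Ints: "m \<in> \<int> \<Longrightarrow> ee m = 1"
  by (simp add: ee_def cis_conv_exp exp_eq_1 Ints_def) (auto simp: mult_ac)

lemma ee_eq_1: "ee t = 1 \<Longrightarrow> t \<in> \<int>"
proof -
  assume "ee t = 1"
  hence "cos (2 * pi * t) = 1" by (simp add: ee_def complex_eq_iff)
  then obtain n :: int where "2 * pi * t = of_int n * (2 * pi)" by (auto simp: cos_one_2pi_int)
  thus ?thesis by simp
qed

lemma ee_half: "ee (1 / 2) = - 1" by (simp add: ee_def)

lemma continuous_on_ee [continuous_intros]: "continuous_on S f \<Longrightarrow> continuous_on S (\<lambda>x. ee (f x))"
  unfolding ee_def cis_conv_exp by (intro continuous_intros) 

lemma ee_power: "ee t ^ n = ee (real n * t)"
  by (induction n) (auto simp: ee_add[symmetric] algebra_simps)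

lemma periodic_integral_shift:
  fixes f :: "real \<Rightarrow> complex"
  assumes cont: "continuous_on UNIV f" and per: "\<And>s. f (s + 1) = f s"
  shows "integral {0..1} (\<lambda>s. f (s + t)) = integral {0..1} f"
proof -
  have int: "f integrable_on {a..b}" for a b
    by (rule integrable_continuous_real) (rule continuous_on_subset[OF cont], simp)
  have pos: "integral {0..1} (\<lambda>s. f (s + t)) = integral {0..1} f" if t: "t \<ge> 0" for t
  proof -
    have "integral {0..1} (\<lambda>s. f (s + t)) = integral {t..1 + t} f"
      using integral_shift_real_ivl[of t t "1 + t" f] by simp
    moreover have "integral {0..t} f + integral {t..1 + t} f = integral {0..1 + t} f"
      using t int by (intro Henstock_Kurzweil_Integration.integral_combine) auto
    moreover have "integral {0..1} f + integral {1..1 + t} f = integral {0..1 + t} f"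
      using t int by (intro Henstock_Kurzweil_Integration.integral_combine) auto
    moreover have "integral {1..1 + t} f = integral {0..t} f"
      using integral_shift_real_ivl[of 1 1 "1 + t" f] per by simp
    ultimately have "integral {0..t} f + integral {0..1} (\<lambda>s. f (s + t)) = integral {0..t} f + integral {0..1} f"
      by (simp only: add.commute)
    thus ?thesis by simp
  qed
  have pern: "f (s + real n) = f s" for s n
  proof (induction n)
    case (Suc n)
    show ?case using per[of "s + real n"] Suc by (simp add: add_ac)
  qed simp
  obtain n :: nat where n: "- t \<le> real n" using real_arch_simple by blast
  have "integral {0..1} (\<lambda>s. f (s + t)) = integral {0..1} (\<lambda>s. f (s + (t + real n)))"
    using pern by (simp flip: add.assoc)
  also have "\<dots> = integral {0..1} f" using n by (intro pos) simp
  finally show ?thesis .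
qed

text \<open>Translation by half a period, 1 / (2 m), changes the sign of the integrand but, by
  periodicity, not the integral.\<close>

lemma integral_ee:
  assumes m: "m \<noteq> 0"
  shows "integral {0..1} (\<lambda>s. ee (of_int m * s)) = 0"
proof -
  let ?f = "\<lambda>s. ee (of_int m * s)" and ?t = "1 / (2 * of_int m) :: real"
  have sh: "?f (s + ?t) = - ?f s" for s
  proof -
    have "?f (s + ?t) = ee (of_int m * s + 1 / 2)" using m by (simp add: algebra_simps)
    thus ?thesis by (simp only: ee_add ee_half) simp
  qed
  have per: "?f (s + 1) = ?f s" for s
    using ee_Ints[of "of_int m"] by (simp add: algebra_simps ee_add)
  have cont: "continuous_on UNIV ?f" by (intro continuous_intros)
  have "integral {0..1} ?f = integral {0..1} (\<lambda>s. ?f (s + ?t))"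
    by (rule periodic_integral_shift[symmetric, OF cont per])
  also have "\<dots> = integral {0..1} (\<lambda>s. - ?f s)" by (simp only: sh)
  also have "\<dots> = - integral {0..1} ?f" by simp
  finally show ?thesis by simp
qed

text \<open>The kernel is a normalized even power of \<open>2 cos (\<pi> s)\<close>.\<close>

lemma trig_kernel:
  fixes d e :: real
  assumes d: "0 < d" "d < 1 / 2" and e: "e > 0"
  obtains n :: nat and c :: "int \<Rightarrow> real" and K :: "real \<Rightarrow> real" where
    "c 0 = 1" "\<And>s. complex_of_real (K s) = (\<Sum>m\<in>{- int n..int n}. of_real (c m) * ee (of_int m * s))"
    "\<And>s. 0 \<le> K s" "\<And>s. d \<le> s \<Longrightarrow> s \<le> 1 - d \<Longrightarrow> K s \<le> e"
proof -
  define q where "q = (cos (pi * d))\<^sup>2"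
  have cd: "0 < cos (pi * d)" "cos (pi * d) < 1"
  proof -
    show "0 < cos (pi * d)" using d by (intro cos_gt_zero_pi) (auto simp: field_simps intro: less_trans[of _ 0])
    have "cos (pi * d) < cos 0" using d by (subst cos_mono_less_eq) (auto simp: field_simps)
    thus "cos (pi * d) < 1" by simp
  qed
  hence q: "0 \<le> q" "q < 1" unfolding q_def by (simp_all add: abs_square_less_1)
  \<comment> \<open>Normalizing by the central binomial coefficient costs a factor of at most 2 n
    against 4^n, so 2 n q^n has to be small.\<close>
  have "(\<lambda>n. real n * q ^ n) \<longlonglongrightarrow> 0" using q by (intro powser_times_n_limit_0) auto
  hence "(\<lambda>n. 2 * (real n * q ^ n)) \<longlonglongrightarrow> 0" by (rule tendsto_mult_right_zero)
  from LIMSEQ_D[OF this e] obtain n0 where "\<And>n. n \<ge> n0 \<Longrightarrow> norm (2 * (real n * q ^ n) - 0) < e" by blast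
  from this[of "Suc n0"] have n: "2 * (real (Suc n0) * q ^ Suc n0) < e" using q by simp
  define n where "n = Suc n0"
  define B where "B = real (2 * n choose n)"
  have B: "B > 0" unfolding B_def by simp
  define K where "K s = (2 * cos (pi * s)) ^ (2 * n) / B" for s
  define c where "c m = real (2 * n choose nat (m + int n)) / B" for m :: int
  show ?thesis
  proof (rule that[of c K n])
    show "c 0 = 1" using B unfolding c_def B_def by simp
    show "0 \<le> K s" for s unfolding K_def using B by (auto intro!: divide_nonneg_pos simp: power_mult)
    show "complex_of_real (K s) = (\<Sum>m\<in>{- int n..int n}. of_real (c m) * ee (of_int m * s))" for s
    proof -
      have "complex_of_real (2 * cos (pi * s)) = ee (s / 2) + ee (- (s / 2))"
        by (simp add: ee_def complex_eq_iff)
      hence "complex_of_real ((2 * cos (pi * s)) ^ (2 * n)) = (ee (s / 2) + ee (- (s / 2))) ^ (2 * n)"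
        by (simp only: of_real_power)
      also have "\<dots> = (\<Sum>j\<le>2 * n. of_nat (2 * n choose j) * ee (s / 2) ^ j * ee (- (s / 2)) ^ (2 * n - j))"
        by (rule binomial_ring)
      also have "\<dots> = (\<Sum>j\<le>2 * n. of_nat (2 * n choose j) * ee (of_int (int j - int n) * s))"
      proof (intro sum.cong refl)
        fix j assume j: "j \<in> {..2 * n}"
        have "real j * (s / 2) + real (2 * n - j) * (- (s / 2)) = of_int (int j - int n) * s"
          using j by (simp add: of_nat_diff field_simps)
        thus "of_nat (2 * n choose j) * ee (s / 2) ^ j * ee (- (s / 2)) ^ (2 * n - j) =
          of_nat (2 * n choose j) * ee (of_int (int j - int n) * s)"
          unfolding ee_power mult.assoc ee_add[symmetric] by (simp only:)
      qed
      also have "\<dots> = (\<Sum>m\<in>{- int n..int n}. of_nat (2 * n choose nat (m + int n)) * ee (of_int m * s))"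
        by (rule sum.reindex_bij_witness[of _ "\<lambda>m. nat (m + int n)" "\<lambda>j. int j - int n"]) auto
      finally show ?thesis
        unfolding K_def c_def using B by (simp add: sum_divide_distrib)
    qed
    fix s assume s: "d \<le> s" "s \<le> 1 - d"
    have c2: "(cos (pi * s))\<^sup>2 \<le> q"
    proof -
      have up: "cos (pi * s) \<le> cos (pi * d)" using s d by (subst cos_mono_le_eq) auto
      have "cos (pi * (1 - d)) \<le> cos (pi * s)" using s d by (subst cos_mono_le_eq) auto
      moreover have "cos (pi * (1 - d)) = - cos (pi * d)" by (simp add: algebra_simps cos_diff)
      ultimately have "\<bar>cos (pi * s)\<bar> \<le> \<bar>cos (pi * d)\<bar>" using up by simp
      thus ?thesis unfolding q_def by (simp only: abs_le_square_iff)
    qed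
    have "4 ^ n / (2 * real n) \<le> B" unfolding B_def by (rule central_binomial_lower_bound) (simp add: n_def)
    hence B4: "4 ^ n \<le> B * (2 * real n)" by (simp add: n_def field_simps)
    have "(2 * cos (pi * s)) ^ (2 * n) = 4 ^ n * ((cos (pi * s))\<^sup>2) ^ n"
      by (simp add: power_mult power_mult_distrib)
    also have "\<dots> \<le> B * (2 * real n) * q ^ n" using B4 c2 B by (intro mult_mono power_mono) auto
    also have "\<dots> = B * (2 * (real n * q ^ n))" by simp
    also have "\<dots> \<le> B * e" using n B unfolding n_def by (intro mult_left_mono) auto
    finally show "K s \<le> e" unfolding K_def using B by (simp add: pos_divide_le_eq mult.commute)
  qed
qed

text \<open>The kernel K has integral 1 because c 0 = 1, and it is at most e away from the integers;
  near s = 1 periodicity replaces f s by f (s - 1). The choice of n and c precedes f, since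
  \<open>fourier_approx\<close> applies them to a whole family of lines at once.\<close>

lemma trig_approx:
  fixes d e :: real
  assumes d: "0 < d" "d < 1 / 2" and e: "e > 0"
  shows "\<exists>(n :: nat) (c :: int \<Rightarrow> real). c 0 = 1 \<and> (\<forall>f C h. continuous_on UNIV f \<longrightarrow> (\<forall>s. f (s + 1) = f s) \<longrightarrow>
      (\<forall>s. norm (f s) \<le> C) \<longrightarrow> (\<forall>s. \<bar>s\<bar> \<le> d \<longrightarrow> norm (f s - f 0) \<le> h) \<longrightarrow>
      norm (f 0 - (\<Sum>m\<in>{- int n..int n}. of_real (c m) * integral {0..1} (\<lambda>s. f s * ee (of_int m * s)))) \<le> h + 2 * C * e)"
proof -
  obtain n c K where K: "c 0 = 1" "\<And>s. complex_of_real (K s) = (\<Sum>m\<in>{- int n..int n}. of_real (c m) * ee (of_int m * s))"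
    "\<And>s. 0 \<le> K s" "\<And>s. d \<le> s \<Longrightarrow> s \<le> 1 - d \<Longrightarrow> K s \<le> e"
    by (rule trig_kernel[OF d e], rule that)
  show ?thesis
  proof (intro exI[of _ n] exI[of _ c] conjI allI impI)
    fix f :: "real \<Rightarrow> complex" and C h :: real
    assume cont: "continuous_on UNIV f" and "\<forall>s. f (s + 1) = f s" and "\<forall>s. norm (f s) \<le> C"
      and "\<forall>s. \<bar>s\<bar> \<le> d \<longrightarrow> norm (f s - f 0) \<le> h"
    hence per: "\<And>s. f (s + 1) = f s" and C: "\<And>s. norm (f s) \<le> C"
      and h: "\<And>s. \<bar>s\<bar> \<le> d \<Longrightarrow> norm (f s - f 0) \<le> h" by auto
    have contf: "continuous_on {0..1} f" using cont by (rule continuous_on_subset) simp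
    have C0: "C \<ge> 0" using C[of 0] norm_ge_zero order_trans by blast
    have h0: "h \<ge> 0" using h[of 0] d by simp
    have contKc: "continuous_on {0..1} (\<lambda>s. complex_of_real (K s))"
      unfolding K(2) by (intro continuous_intros)
    have contK: "continuous_on {0..1} K"
      using continuous_on_Re[OF contKc] by simp
    have sumint: "integral {0..1} (\<lambda>s. g s * of_real (K s)) = (\<Sum>m\<in>{- int n..int n}. of_real (c m) * integral {0..1} (\<lambda>s. g s * ee (of_int m * s)))"
      if g: "continuous_on {0..1} g" for g :: "real \<Rightarrow> complex"
    proof -
      have "integral {0..1} (\<lambda>s. g s * of_real (K s)) = integral {0..1} (\<lambda>s. \<Sum>m\<in>{- int n..int n}. of_real (c m) * (g s * ee (of_int m * s)))"
        unfolding K(2) by (simp add: sum_distrib_left mult_ac)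
      also have "\<dots> = (\<Sum>m\<in>{- int n..int n}. integral {0..1} (\<lambda>s. of_real (c m) * (g s * ee (of_int m * s))))"
        by (intro integral_sum integrable_continuous_real) (auto intro!: continuous_intros g)
      finally show ?thesis by simp
    qed
    have "integral {0..1} (\<lambda>s. complex_of_real (K s)) = (\<Sum>m\<in>{- int n..int n}. of_real (c m) * integral {0..1} (\<lambda>s. ee (of_int m * s)))"
      using sumint[of "\<lambda>_. 1"] by simp
    also have "\<dots> = (\<Sum>m\<in>{- int n..int n}. if m = 0 then 1 else 0)"
      using K(1) integral_ee by (intro sum.cong refl) auto
    also have "\<dots> = 1" by simp
    finally have I1: "integral {0..1} (\<lambda>s. complex_of_real (K s)) = 1" .
    have IK: "integral {0..1} K = 1"
      using integral_linear[OF integrable_continuous_real[OF contKc] bounded_linear_Re] I1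
      by (simp add: o_def)
    have eq: "f 0 - integral {0..1} (\<lambda>s. f s * of_real (K s)) = integral {0..1} (\<lambda>s. (f 0 - f s) * of_real (K s))"
    proof -
      have "integral {0..1} (\<lambda>s. (f 0 - f s) * of_real (K s)) = integral {0..1} (\<lambda>s. f 0 * of_real (K s) - f s * of_real (K s))"
        by (simp add: algebra_simps)
      also have "\<dots> = integral {0..1} (\<lambda>s. f 0 * of_real (K s)) - integral {0..1} (\<lambda>s. f s * of_real (K s))"
        by (intro Henstock_Kurzweil_Integration.integral_diff integrable_continuous_real continuous_intros contKc contf)
      finally show ?thesis using I1 by simp
    qed
    have pt: "norm ((f 0 - f s) * of_real (K s)) \<le> h * K s + 2 * C * e" if s: "s \<in> {0..1}" for s
    proof (cases "d \<le> s \<and> s \<le> 1 - d")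
      case True
      have "norm (f 0 - f s) \<le> 2 * C" using norm_triangle_ineq4[of "f 0" "f s"] C[of 0] C[of s] by simp
      hence "norm (f 0 - f s) * K s \<le> 2 * C * e" using K(3,4)[of s] True C0 by (intro mult_mono) auto
      thus ?thesis using h0 K(3)[of s] by (simp add: norm_mult add_increasing)
    next
      case False
      have "norm (f s - f 0) \<le> h"
      proof (cases "s < d")
        case True
        thus ?thesis using s by (intro h) auto
      next
        case nlt: False
        have "norm (f (s - 1) - f 0) \<le> h" using s nlt False by (intro h) auto
        thus ?thesis using per[of "s - 1"] by simp
      qed
      hence "norm (f 0 - f s) * K s \<le> h * K s" using K(3)[of s] by (intro mult_right_mono) (auto simp: norm_minus_commute)
      thus ?thesis using C0 e K(3)[of s] by (simp add: norm_mult add_increasing2)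
    qed
    have "norm (integral {0..1} (\<lambda>s. (f 0 - f s) * of_real (K s))) \<le> integral {0..1} (\<lambda>s. h * K s + 2 * C * e)"
      by (intro integral_norm_bound_integral pt integrable_continuous_real continuous_intros contKc contK contf)
    also have "\<dots> = h * integral {0..1} K + 2 * C * e"
      by (subst Henstock_Kurzweil_Integration.integral_add) (auto intro!: integrable_continuous_real continuous_intros contK)
    finally show "norm (f 0 - (\<Sum>m\<in>{- int n..int n}. of_real (c m) * integral {0..1} (\<lambda>s. f s * ee (of_int m * s)))) \<le> h + 2 * C * e"
      unfolding sumint[OF contf, symmetric] eq IK by simp
  qed (rule K(1))
qed

subsection \<open>Topology of the group\<close>

lemma continuous_on_coord: "continuous_on S f \<Longrightarrow> continuous_on S (\<lambda>x. f x i)"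
  by (rule continuous_on_compose2[OF continuous_on_product_coordinates]) auto

definition cube :: "(nat \<Rightarrow> real) set" where "cube = {x. \<forall>i. 0 \<le> x i \<and> x i \<le> 1}"

text \<open>It contains a representative of every coset of \<open>G0\<close> modulo
  \<open>Gam\<close>. The closed cube is used for compactness, although boundary points may then
  represent the same coset.\<close>

definition face :: "(nat \<Rightarrow> real) set" where "face = {x\<in>cube. x 0 = 0}"

lemma compact_cube: "compact cube"
proof -
  have "cube = PiE UNIV (\<lambda>_. {0..1})" by (auto simp: cube_def PiE_def)
  moreover have "compactin (product_topology (\<lambda>_. euclidean) UNIV) (PiE UNIV (\<lambda>_::nat. {0..1::real}))"
    by (subst compactin_PiE) (auto simp: compactin_euclidean_iff)
  ultimately show ?thesis by (simp add: euclidean_product_topology compactin_euclidean_iff)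
qed

lemma compact_face: "compact face"
proof -
  have "closed {x :: nat \<Rightarrow> real. x 0 = 0}"
    by (intro closed_Collect_eq continuous_on_product_coordinates continuous_on_const)
  moreover have "face = cube \<inter> {x. x 0 = 0}" by (auto simp: face_def)
  ultimately show ?thesis using compact_Int_closed[OF compact_cube] by metis
qed

text \<open>Compactness of the face makes continuity at s = 0 uniform in y.\<close>

lemma uniform_at_zero:
  fixes \<Phi> :: "real \<Rightarrow> (nat \<Rightarrow> real) \<Rightarrow> complex"
  assumes "continuous_on (UNIV \<times> face) (\<lambda>(s, y). \<Phi> s y)" "h > 0"
  obtains d where "d > 0" "\<And>s y. \<bar>s\<bar> \<le> d \<Longrightarrow> y \<in> face \<Longrightarrow> norm (\<Phi> s y - \<Phi> 0 y) \<le> h"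
proof -
  obtain X where X: "0 \<in> X" "open X" "\<forall>s\<in>X \<inter> UNIV. \<forall>y\<in>face. dist (case (s, y) of (s, y) \<Rightarrow> \<Phi> s y) (case (0, y) of (s, y) \<Rightarrow> \<Phi> s y) \<le> h"
    by (rule continuous_on_prod_compactE[OF assms(1) compact_face UNIV_I[of 0] assms(2)], rule that)
  obtain d where d: "d > 0" "cball 0 d \<subseteq> X" using X(1,2) open_contains_cball by blast
  show ?thesis
  proof (rule that[OF d(1)])
    fix s :: real and y assume "\<bar>s\<bar> \<le> d" "y \<in> face"
    moreover from this have "s \<in> X" using d(2) by auto
    ultimately show "norm (\<Phi> s y - \<Phi> 0 y) \<le> h" using X(3) by (auto simp: dist_norm)
  qed
qed

context tower
begin

lemma continuous_on_p:
  assumes "\<And>j. continuous_on S (\<lambda>z. f z j)" "\<And>j. continuous_on S (\<lambda>z. g z j)"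
  shows "continuous_on S (\<lambda>z. p i (f z) (g z))"
proof (cases "i < k")
  case True
  have "continuous_on S (\<lambda>z. p i (\<lambda>j. case_sum (f z) (g z) (Inl j)) (\<lambda>j. case_sum (f z) (g z) (Inr j)))"
    using assms by (intro alg_continuous[OF p_alg[OF True]]) auto
  thus ?thesis by simp
qed (simp add: p_beyond)

lemma continuous_on_op [continuous_intros]:
  assumes "continuous_on S f" "continuous_on S g"
  shows "continuous_on S (\<lambda>z. f z \<otimes> g z)"
proof (rule continuous_on_coordinatewise_then_product)
  note c = assms[THEN continuous_on_coord]
  show "continuous_on S (\<lambda>z. (f z \<otimes> g z) i)" for i
    unfolding op_apply by (rule continuous_on_add[OF continuous_on_add[OF c] continuous_on_p[OF c]])
qed

lemma continuous_on_e [continuous_intros]: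
  "continuous_on S g \<Longrightarrow> continuous_on S (\<lambda>z. e r (g z))"
  unfolding e_def by (rule continuous_on_coordinatewise_then_product, rename_tac i, case_tac "i = r") auto

lemma red_face: "x \<in> G0 \<Longrightarrow> red x \<in> face"
  using red_bounds[of x] red_G0[of x] by (auto simp: face_def cube_def less_imp_le)

lemma face_G0: "face \<subseteq> G0" by (auto simp: face_def G0_def)

definition invariant :: "((nat \<Rightarrow> real) \<Rightarrow> 'a) \<Rightarrow> bool" where
  "invariant F \<longleftrightarrow> (\<forall>x\<in>G0. \<forall>g\<in>Gam. F (x \<otimes> g) = F x)"

lemma invariant_red:
  assumes "invariant F" "x \<in> G0"
  shows "F (red x) = F x"
proof -
  obtain g where "g \<in> Gam" "red x = x \<otimes> g" using red_coset by blast
  thus ?thesis using assms by (simp add: invariant_def)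
qed

lemma invariant_bounded:
  fixes F :: "(nat \<Rightarrow> real) \<Rightarrow> 'a::real_normed_vector"
  assumes "invariant F" "continuous_on G0 F"
  obtains C where "\<And>x. x \<in> G0 \<Longrightarrow> norm (F x) \<le> C"
proof -
  have "compact (F ` face)" by (intro compact_continuous_image compact_face continuous_on_subset[OF assms(2) face_G0])
  then obtain C where C: "\<And>z. z \<in> F ` face \<Longrightarrow> norm z \<le> C" using compact_imp_bounded bounded_iff by metis
  show ?thesis
  proof (rule that)
    fix x assume x: "x \<in> G0"
    show "norm (F x) \<le> C" using C[OF imageI[OF red_face[OF x]]] invariant_red[OF assms(1) x] by simp
  qed
qed

end

subsection \<open>Invariant characters\<close>

context tower
begin

text \<open>Meaningful on \<open>V r\<close> only, but given by a rational polynomial in all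
  coordinates. Invariance under conjugation makes \<open>L\<close> vanish on commutators with
  elements of \<open>V r\<close>, so that left and right translations by \<open>V r\<close>
  transform functions alike.\<close>

definition chr :: "nat \<Rightarrow> ((nat \<Rightarrow> real) \<Rightarrow> real) \<Rightarrow> bool" where
  "chr r L \<longleftrightarrow> alg \<rat> {..<k} L \<and> (\<forall>v\<in>V r. \<forall>w\<in>V r. L (v \<otimes> w) = L v + L w) \<and> (\<forall>x. \<forall>v\<in>V r. L (conj x v) = L v)"

lemma chr_alg: "chr r L \<Longrightarrow> alg \<rat> {..<k} L"
  and chr_op: "chr r L \<Longrightarrow> v \<in> V r \<Longrightarrow> w \<in> V r \<Longrightarrow> L (v \<otimes> w) = L v + L w"
  and chr_conj: "chr r L \<Longrightarrow> v \<in> V r \<Longrightarrow> L (conj x v) = L v"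
  by (auto simp: chr_def)

lemma chr_unit: "chr r L \<Longrightarrow> L \<one> = 0"
  using chr_op[of r L \<one> \<one>] by simp

lemma chr_inv: "chr r L \<Longrightarrow> v \<in> V r \<Longrightarrow> L (inv v) = - L v"
  using chr_op[of r L v "inv v"] V_inv[of v r] chr_unit[of r L] by simp

lemma alg_comm:
  assumes "i < k" "\<And>j. j \<le> i \<Longrightarrow> alg \<rat> W (\<lambda>z. f z j)" "\<And>j. j \<le> i \<Longrightarrow> alg \<rat> W (\<lambda>z. h z j)"
  shows "alg \<rat> W (\<lambda>z. comm (f z) (h z) i)"
  unfolding comm_def conj_def using assms by (intro alg_op alg_inv) auto

lemma alg_e: "alg \<rat> W f \<Longrightarrow> alg \<rat> W (\<lambda>z. e r (f z) j)"
  unfolding e_def by (cases "j = r") (auto intro: alg_const)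

lemma alg_chr:
  assumes "chr r L" "\<And>i. i < k \<Longrightarrow> alg \<rat> W (\<lambda>z. f z i)"
  shows "alg \<rat> W (\<lambda>z. L (f z))"
  using alg_subst[OF chr_alg[OF assms(1)], of W "\<lambda>i z. f z i"] assms(2) by auto

lemma comm_op_right: "comm x (v \<otimes> w) = comm x v \<otimes> conj v (comm x w)"
  by (simp add: comm_def conj_def op_assoc inv_op)

lemma comm_op_left: "comm (x \<otimes> y) v = conj x (comm y v) \<otimes> comm x v"
  by (simp add: comm_def conj_def op_assoc inv_op)

lemma comm_inv: "inv (comm x v) = comm v x"
  by (simp add: comm_def conj_def op_assoc inv_op)

lemma chr_comm_V: "chr r L \<Longrightarrow> v \<in> V r \<Longrightarrow> L (comm x v) = 0"
  unfolding comm_def by (simp add: chr_op V_conj V_inv chr_conj chr_inv)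

lemma chr_comm_op:
  assumes "chr (Suc r) L" "v \<in> V r" "w \<in> V r"
  shows "L (comm x (v \<otimes> w)) = L (comm x v) + L (comm x w)"
  unfolding comm_op_right using assms comm_V
  by (simp add: chr_op V_conj chr_conj)

text \<open>If \<open>lam L r\<close> is not zero, translation by \<open>e r s\<close> along an orbit acts on a function with character \<open>L\<close>
  as multiplication by a linear phase, and van der Corput's inequality gives mean zero. Otherwise \<open>L\<close>
  extends to \<open>V r\<close>.\<close>

definition lam :: "((nat \<Rightarrow> real) \<Rightarrow> real) \<Rightarrow> nat \<Rightarrow> (nat \<Rightarrow> real) \<Rightarrow> real" where
  "lam L r x = L (comm x (e r 1))"

text \<open>The failure of \<open>e r\<close> to be a one-parameter subgroup; it lies in
  \<open>V (Suc r)\<close>.\<close>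

definition zeta :: "nat \<Rightarrow> real \<Rightarrow> real \<Rightarrow> nat \<Rightarrow> real" where
  "zeta r s t = inv (e r (s + t)) \<otimes> (e r s \<otimes> e r t)"

lemma zeta_V: "zeta r s t \<in> V (Suc r)"
proof -
  have "(e r s \<otimes> e r t) r = s + t" using V_apply_left[OF e_V, of r r s "e r t"] by (simp add: e_def)
  thus ?thesis using V_decomp[OF V_op[OF e_V e_V], of r s t] by (simp add: zeta_def)
qed

lemma e_op: "e r s \<otimes> e r t = e r (s + t) \<otimes> zeta r s t"
  by (simp add: zeta_def)

text \<open>The left side is polynomial in s, and additive because \<open>L\<close> kills the
  commutators with \<open>zeta r s t\<close>.\<close>

lemma lam_scale:
  assumes L: "chr (Suc r) L"
  shows "L (comm x (e r s)) = s * lam L r x"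
proof -
  have "alg \<rat> UNIV (\<lambda>z. L (comm (\<lambda>j. z (Inl j)) (e r (z (Inr ())))))"
    by (intro alg_chr[OF L] alg_comm alg_e alg_var) auto
  from alg_line[OF this, of "case_sum x (\<lambda>_. 0)" "case_sum (\<lambda>_. 0) (\<lambda>_. 1)"]
  obtain pl where pl: "\<And>s. L (comm x (e r s)) = poly pl s" by auto
  have "poly pl (s + t) = poly pl s + poly pl t" for s t
  proof -
    have "L (comm x (e r (s + t) \<otimes> zeta r s t)) = L (comm x (e r (s + t))) + L (comm x (zeta r s t))"
      using zeta_V[of r s t] V_antimono[of r "Suc r"] by (intro chr_comm_op[OF L e_V]) auto
    hence "L (comm x (e r s \<otimes> e r t)) = L (comm x (e r (s + t)))"
      unfolding e_op using chr_comm_V[OF L zeta_V] by simp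
    thus ?thesis using chr_comm_op[OF L e_V e_V] pl by simp
  qed
  hence "poly pl s = s * poly pl 1" by (rule additive_poly_linear)
  thus ?thesis using pl by (simp add: lam_def)
qed

lemma lam_op:
  assumes L: "chr (Suc r) L"
  shows "lam L r (x \<otimes> y) = lam L r x + lam L r y"
  unfolding lam_def comm_op_left using comm_V[OF e_V] by (simp add: chr_op[OF L] V_conj chr_conj[OF L])

lemma lam_alg:
  assumes L: "chr (Suc r) L"
  shows "alg \<rat> {..<k} (lam L r)"
  unfolding lam_def by (rule alg_chr[OF L]) (intro alg_comm alg_e alg_var alg_const, auto)

lemma lam_V:
  assumes L: "chr (Suc r) L" and v: "v \<in> V r"
  shows "L (comm x v) = v r * lam L r x"
proof -
  have "L (comm x (e r (v r) \<otimes> (inv (e r (v r)) \<otimes> v))) = L (comm x (e r (v r))) + L (comm x (inv (e r (v r)) \<otimes> v))"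
    using V_decomp[OF v] V_antimono[of r "Suc r"] by (intro chr_comm_op[OF L e_V]) auto
  thus ?thesis using lam_scale[OF L] chr_comm_V[OF L V_decomp[OF v]] by simp
qed

text \<open>On the axis \<open>e 0 s\<close> the antisymmetry of the commutator gives - s times the
  value at s = 1, which is therefore its own negative. On \<open>V 1\<close> the value is L w - L w.
  Thus a character of \<open>V 1\<close> always extends to the whole group.\<close>

lemma lam_first:
  assumes L: "chr (Suc 0) L"
  shows "lam L 0 x = 0"
proof -
  have e1: "lam L 0 (e 0 s) = - s * lam L 0 (e 0 1)" for s
  proof -
    have "lam L 0 (e 0 s) = L (inv (comm (e 0 1) (e 0 s)))" by (simp add: comm_inv lam_def)
    also have "\<dots> = - L (comm (e 0 1) (e 0 s))" by (rule chr_inv[OF L comm_V[OF e_V]])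
    finally show ?thesis using lam_scale[OF L] by simp
  qed
  have e0: "lam L 0 (e 0 s) = 0" for s using e1[of s] e1[of 1] by simp
  have w: "lam L 0 w = 0" if "w \<in> V 1" for w
  proof -
    have "comm w (e 0 1) = w \<otimes> conj (e 0 1) (inv w)" by (simp add: comm_def conj_def op_assoc)
    thus ?thesis unfolding lam_def using that
      by (simp add: chr_op[OF L] V_conj V_inv chr_conj[OF L] chr_inv[OF L])
  qed
  have "x = e 0 (x 0) \<otimes> (inv (e 0 (x 0)) \<otimes> x)" by simp
  moreover have "inv (e 0 (x 0)) \<otimes> x \<in> V 1" using V_decomp[of x 0] by (simp add: V_def)
  ultimately show ?thesis using lam_op[OF L, of "e 0 (x 0)" "inv (e 0 (x 0)) \<otimes> x"] e0 w by simp
qed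

text \<open>A character of \<open>V (r + 1)\<close> extends to \<open>V r\<close> because the polynomial cocycle \<open>L \<circ> zeta r\<close> in two
  real variables is a coboundary.\<close>

lemma chr_extend:
  assumes r: "r < k" and L: "chr (Suc r) L" and lam: "\<And>x. lam L r x = 0"
  obtains L' where "chr r L'" "\<And>v. v \<in> V (Suc r) \<Longrightarrow> L' v = L v" "L' (e r 1) = 0"
proof -
  define \<sigma> where "\<sigma> s t = L (zeta r s t)" for s t
  \<comment> \<open>Both bracketings of the product of three axis elements are compared; the
    conjugation that appears is invisible to \<open>L\<close>.\<close>
  have cocycle: "\<sigma> s t + \<sigma> (s + t) u = \<sigma> s (t + u) + \<sigma> t u" for s t u
  proof -
    have "e r (s + t + u) \<otimes> (zeta r (s + t) u \<otimes> conj (inv (e r u)) (zeta r s t)) =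
          e r s \<otimes> e r t \<otimes> e r u"
      by (simp add: zeta_def conj_def op_assoc)
    also have "\<dots> = e r (s + t + u) \<otimes> (zeta r s (t + u) \<otimes> zeta r t u)"
      by (simp add: zeta_def op_assoc add.assoc)
    finally have "zeta r (s + t) u \<otimes> conj (inv (e r u)) (zeta r s t) = zeta r s (t + u) \<otimes> zeta r t u"
      by (simp add: left_cancel)
    hence "L (zeta r (s + t) u \<otimes> conj (inv (e r u)) (zeta r s t)) = L (zeta r s (t + u) \<otimes> zeta r t u)" by simp
    thus ?thesis unfolding \<sigma>_def by (simp add: chr_op[OF L] zeta_V V_conj chr_conj[OF L])
  qed
  have "alg \<rat> UNIV (\<lambda>z. L (zeta r (z ()) 1))"
    unfolding zeta_def by (rule alg_chr[OF L]) (intro alg_op alg_inv alg_e alg_var alg_add alg_const, auto)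
  from alg_rat_poly[OF this] obtain ps where ps0: "\<forall>i. coeff ps i \<in> \<rat>" "\<forall>z. L (zeta r (z ()) 1) = poly ps (z ())"
    by blast
  have ps: "coeff ps i \<in> \<rat>" "\<sigma> s 1 = poly ps s" for i s
    using ps0(1) ps0(2)[rule_format, of "\<lambda>_. s"] by (auto simp: \<sigma>_def)
  \<comment> \<open>This solves the coboundary equation for t = 1. By the cocycle identity the
    defect D then has period 1 in t; it is polynomial in t and 0 at t = 0, hence 0.\<close>
  obtain q where q: "\<And>i. coeff q i \<in> \<rat>" "poly q 0 = 0" "\<And>x. poly q (x + 1) - poly q x = poly (- ps) x"
    using poly_antidifference[of "- ps"] ps(1) by (auto simp: Rats_minus_iff)
  define D where "D s t = poly q s + poly q t - poly q (s + t) - \<sigma> s t" for s t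
  have D0: "D s 0 = 0" for s
    by (simp add: D_def q(2) \<sigma>_def zeta_def chr_unit[OF L])
  have Dstep: "D s (t + 1) = D s t" for s t
    using cocycle[of s t 1] q(3)[of t] q(3)[of "s + t"] ps(2)[of t] ps(2)[of "s + t"]
    by (simp add: D_def add.assoc)
  have Dn: "D s (real n) = 0" for s n
  proof (induction n)
    case (Suc n)
    thus ?case using Dstep[of s "real n"] by (simp add: add.commute)
  qed (simp add: D0)
  have D: "D s t = 0" for s t
  proof -
    have "alg \<rat> UNIV (\<lambda>z. L (zeta r (z False) (z True)))"
      unfolding zeta_def by (rule alg_chr[OF L]) (intro alg_op alg_inv alg_e alg_var alg_add alg_const, auto)
    from alg_line[OF this, of "\<lambda>b. if b then 0 else s" "\<lambda>b. if b then 1 else 0"]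
    obtain pt where pt: "\<And>t. \<sigma> s t = poly pt t" by (auto simp: \<sigma>_def)
    define w where "w = [:poly q s:] + q - pcompose q [:s, 1:] - pt"
    have w: "D s t = poly w t" for t by (simp add: D_def w_def poly_pcompose pt)
    have "poly w (real n) = 0" for n using w[of "real n"] Dn[of s n] by simp
    hence "range real \<subseteq> {x. poly w x = 0}" by auto
    moreover have "infinite (range real)" by (simp add: finite_image_iff)
    ultimately have "w = 0" using poly_roots_finite finite_subset by blast
    thus ?thesis using w by simp
  qed
  hence \<sigma>: "\<sigma> s t = poly q s + poly q t - poly q (s + t)" for s t by (simp add: D_def)
  have q1: "poly q 1 = 0" using q(3)[of 0] q(2) ps(2)[of 0] by (simp add: \<sigma>_def zeta_def chr_unit[OF L])
  define L' where "L' v = L (inv (e r (v r)) \<otimes> v) + poly q (v r)" for v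
  show ?thesis
  proof (rule that)
    show "L' (e r 1) = 0" 
    proof -
      have "e r 1 r = 1" by (simp add: e_def)
      thus ?thesis using q1 by (simp add: L'_def chr_unit[OF L])
    qed
    show "L' v = L v" if "v \<in> V (Suc r)" for v
      using that by (simp add: L'_def V_def q(2))
    show "chr r L'"
      unfolding chr_def
    proof (intro conjI ballI allI)
      have "alg \<rat> {..<k} (\<lambda>v. L (inv (e r (v r)) \<otimes> v))"
        by (rule alg_chr[OF L]) (use r in \<open>intro alg_op alg_inv alg_e alg_var, auto\<close>)
      moreover have "alg \<rat> {..<k} (\<lambda>v. poly q (v r))" using q(1) r by (intro alg_poly alg_var) auto
      ultimately show "alg \<rat> {..<k} L'" unfolding L'_def by (rule alg_add)
    next
      fix v v' assume v: "v \<in> V r" "v' \<in> V r"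
      define s t w w' where "s = v r" and "t = v' r" and "w = inv (e r s) \<otimes> v" and "w' = inv (e r t) \<otimes> v'"
      have w: "w \<in> V (Suc r)" "w' \<in> V (Suc r)" using V_decomp v by (auto simp: s_def t_def w_def w'_def)
      have st: "(v \<otimes> v') r = s + t" using V_apply_left[OF v(1), of r v'] by (simp add: s_def t_def)
      have "inv (e r (s + t)) \<otimes> (v \<otimes> v') = zeta r s t \<otimes> (conj (inv (e r t)) w \<otimes> w')"
        by (simp add: zeta_def conj_def w_def w'_def op_assoc)
      hence "L' (v \<otimes> v') = \<sigma> s t + (L w + L w') + poly q (s + t)"
        unfolding L'_def st using w
        by (simp add: chr_op[OF L] zeta_V V_conj V_op chr_conj[OF L] \<sigma>_def)
      thus "L' (v \<otimes> v') = L' v + L' v'" by (simp add: \<sigma> L'_def s_def t_def w_def w'_def)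
    next
      fix x v assume v: "v \<in> V r"
      have "inv (e r (v r)) \<otimes> conj x v = conj (inv (e r (v r))) (comm x v) \<otimes> (inv (e r (v r)) \<otimes> v)"
        by (simp add: comm_def conj_def op_assoc)
      hence "L (inv (e r (v r)) \<otimes> conj x v) = L (comm x v) + L (inv (e r (v r)) \<otimes> v)"
        using V_decomp[OF v] comm_V[OF v] by (simp add: chr_op[OF L] V_conj chr_conj[OF L])
      thus "L' (conj x v) = L' v"
        unfolding L'_def using conj_low[OF v, of r] lam_V[OF L v] lam by simp
    qed
  qed
qed

lemma chr_coordinate:
  assumes "r < k" "m \<in> \<int>" "chr r L"
  shows "chr r (\<lambda>v. L v + m * v r)"
  unfolding chr_def
proof (intro conjI ballI allI)
  show "alg \<rat> {..<k} (\<lambda>v. L v + m * v r)"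
    using assms by (intro alg_add alg_mult alg_const alg_var chr_alg[OF assms(3)]) (auto elim!: Ints_cases)
  show "L (v \<otimes> w) + m * (v \<otimes> w) r = L v + m * v r + (L w + m * w r)" if "v \<in> V r" "w \<in> V r" for v w
    using that V_apply_left[OF that(1), of r w] chr_op[OF assms(3)] by (simp add: algebra_simps)
  show "L (conj x v) + m * conj x v r = L v + m * v r" if "v \<in> V r" for x v
    using that conj_low[OF that, of r x] chr_conj[OF assms(3)] by simp
qed

lemma chr_zero: "chr r (\<lambda>_. 0)"
  by (auto simp: chr_def intro: alg_const)

end

subsection \<open>Fourier components and equidistribution of generic orbits\<close>

lemma uniform_mean_ee:
  assumes b: "\<beta> \<notin> \<int>"
  shows "uniform_mean (\<lambda>n. ee (real n * \<beta>) * z) 0"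
proof (rule uniform_meanI)
  fix e :: real assume e: "e > 0"
  have ne: "ee \<beta> - 1 \<noteq> 0" using b ee_eq_1 by auto
  obtain L :: nat where L: "real L > 2 * norm z / (e * norm (ee \<beta> - 1))" using reals_Archimedean2 by blast
  have "norm (avg (\<lambda>n. ee (real n * \<beta>) * z) M N - 0) < e" if N: "N \<ge> Suc L" for N M
  proof -
    let ?S = "\<Sum>n<N. ee (real (M + n) * \<beta>)"
    have "(ee \<beta> - 1) * ?S = (\<Sum>n<N. ee (real (Suc (M + n)) * \<beta>) - ee (real (M + n) * \<beta>))"
      by (simp add: sum_distrib_left algebra_simps ee_add)
    also have "\<dots> = ee (real (M + N) * \<beta>) - ee (real M * \<beta>)"
      by (induction N) auto
    finally have "norm (ee \<beta> - 1) * norm ?S = norm (ee (real (M + N) * \<beta>) - ee (real M * \<beta>))"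
      by (metis norm_mult)
    also have "\<dots> \<le> 2" using norm_triangle_ineq4[of "ee (real (M + N) * \<beta>)" "ee (real M * \<beta>)"] by simp
    finally have S: "norm (ee \<beta> - 1) * norm ?S \<le> 2" .
    have "avg (\<lambda>n. ee (real n * \<beta>) * z) M N = (1 / real N) *\<^sub>R (?S * z)"
      by (simp add: avg_def sum_distrib_right)
    hence "norm (avg (\<lambda>n. ee (real n * \<beta>) * z) M N) = norm ?S * norm z / real N"
      by (simp add: norm_mult)
    also have "\<dots> < e"
    proof -
      have "2 * norm z / (e * norm (ee \<beta> - 1)) < real N" using L N by linarith
      hence "2 * norm z < real N * (e * norm (ee \<beta> - 1))" using e ne by (simp add: pos_divide_less_eq)
      moreover have "norm (ee \<beta> - 1) * (norm ?S * norm z) \<le> 2 * norm z"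
        using mult_right_mono[OF S norm_ge_zero[of z]] by (simp add: mult.assoc)
      ultimately have "norm (ee \<beta> - 1) * (norm ?S * norm z) < norm (ee \<beta> - 1) * (real N * e)"
        by (simp add: mult_ac)
      hence "norm ?S * norm z < real N * e" using ne by simp
      thus ?thesis using N by (simp add: pos_divide_less_eq mult.commute)
    qed
    finally show ?thesis by simp
  qed
  thus "\<exists>H. \<forall>N\<ge>H. \<forall>M. norm (avg (\<lambda>n. ee (real n * \<beta>) * z) M N - 0) < e" by blast
qed

context tower
begin

definition equivariant :: "nat \<Rightarrow> ((nat \<Rightarrow> real) \<Rightarrow> real) \<Rightarrow> ((nat \<Rightarrow> real) \<Rightarrow> complex) \<Rightarrow> bool" where
  "equivariant r L F \<longleftrightarrow> continuous_on G0 F \<and> invariant F \<and> (\<forall>y\<in>G0. \<forall>w\<in>V r. F (y \<otimes> w) = ee (L w) * F y)"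

lemma equivariantD:
  assumes "equivariant r L F"
  shows "continuous_on G0 F" "invariant F" "\<And>y w. y \<in> G0 \<Longrightarrow> w \<in> V r \<Longrightarrow> F (y \<otimes> w) = ee (L w) * F y"
  using assms by (auto simp: equivariant_def)

lemma equivariant_cong: "(\<And>w. w \<in> V r \<Longrightarrow> L w = L' w) \<Longrightarrow> equivariant r L F \<longleftrightarrow> equivariant r L' F"
  by (auto simp: equivariant_def)

lemma equivariant_left:
  assumes F: "equivariant r L F" and L: "chr r L" and c: "c \<in> V r" and z: "z \<in> G0"
  shows "F (c \<otimes> z) = ee (L c) * F z"
proof -
  have "c \<otimes> z = z \<otimes> conj (inv z) c" by (simp add: conj_def op_assoc)
  thus ?thesis using equivariantD(3)[OF F z V_conj[OF c, of "inv z"]] chr_conj[OF L c, of "inv z"] by simp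
qed

text \<open>The twist compensates for \<open>zeta\<close>: with it, translating y along the axis
  becomes a translation of s up to a constant phase, and the function has period 1 in s if L (e r 1)
  = 0.\<close>

definition line :: "nat \<Rightarrow> ((nat \<Rightarrow> real) \<Rightarrow> real) \<Rightarrow> ((nat \<Rightarrow> real) \<Rightarrow> complex) \<Rightarrow> (nat \<Rightarrow> real) \<Rightarrow> real \<Rightarrow> complex" where
  "line r L F y s = F (y \<otimes> e r s) * ee (- L (e r s))"

text \<open>The Fourier coefficient with index m along coordinate r. It gains equivariance: from
  \<open>V (Suc r)\<close> to \<open>V r\<close>, with character L v + m v r.\<close>

definition comp :: "nat \<Rightarrow> ((nat \<Rightarrow> real) \<Rightarrow> real) \<Rightarrow> int \<Rightarrow> ((nat \<Rightarrow> real) \<Rightarrow> complex) \<Rightarrow> (nat \<Rightarrow> real) \<Rightarrow> complex" where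
  "comp r L m F y = integral {0..1} (\<lambda>s. line r L F y s * ee (- of_int m * s))"

lemma e_G0: "r > 0 \<Longrightarrow> e r s \<in> G0"
  using V_G0 e_V by blast

context
  fixes r L F
  assumes r: "0 < r" and L: "chr r L" and L1: "L (e r 1) = 0" and F: "equivariant (Suc r) L F"
begin

lemma chr_e_add: "L (e r s) + L (e r t) = L (e r (s + t)) + L (zeta r s t)"
proof -
  have "zeta r s t \<in> V r" using zeta_V V_antimono[of r "Suc r"] by auto
  thus ?thesis using e_op[of r s t] chr_op[OF L e_V e_V, of s t] chr_op[OF L e_V, of "zeta r s t" "s + t"] by simp
qed

lemma line_shift:
  assumes y: "y \<in> G0"
  shows "line r L F (y \<otimes> e r t) s = ee (L (e r t)) * line r L F y (s + t)"
proof -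
  have "y \<otimes> e r t \<otimes> e r s = y \<otimes> e r (s + t) \<otimes> zeta r t s"
    using e_op[of r t s] by (simp add: op_assoc add.commute)
  hence "F (y \<otimes> e r t \<otimes> e r s) = ee (L (zeta r t s)) * F (y \<otimes> e r (s + t))"
    using equivariantD(3)[OF F G0_op[OF y e_G0[OF r]] zeta_V] by simp
  moreover have "L (zeta r t s) + - L (e r s) = L (e r t) + - L (e r (s + t))"
    using chr_e_add[of t s] by (simp add: add.commute)
  hence "ee (L (zeta r t s)) * ee (- L (e r s)) = ee (L (e r t)) * ee (- L (e r (s + t)))"
    by (simp only: ee_add[symmetric])
  ultimately show ?thesis by (simp add: line_def mult_ac)
qed

lemma line_periodic:
  assumes y: "y \<in> G0"
  shows "line r L F y (s + 1) = line r L F y s"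
proof -
  have "line r L F (y \<otimes> e r s) 1 = F (y \<otimes> e r s)"
    using equivariantD(2)[OF F] G0_op[OF y e_G0[OF r]] e_Gam[of 1 r] L1 by (simp add: line_def invariant_def)
  hence "F (y \<otimes> e r s) = ee (L (e r s)) * line r L F y (s + 1)"
    using line_shift[OF y, of s 1] by (simp add: add.commute)
  thus ?thesis using ee_minus[of "L (e r s)"] by (simp add: line_def mult_ac)
qed

lemma continuous_on_line:
  "continuous_on (UNIV \<times> G0) (\<lambda>(s, y). line r L F y s)"
  unfolding line_def split_beta
proof (intro continuous_on_mult continuous_on_ee continuous_on_minus)
  have "continuous_on (UNIV \<times> G0) (\<lambda>x. snd x \<otimes> e r (fst x))"
    by (intro continuous_intros)
  moreover have "(\<lambda>x. snd x \<otimes> e r (fst x)) ` (UNIV \<times> G0) \<subseteq> G0"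
    using G0_op e_G0[OF r] by auto
  ultimately show "continuous_on (UNIV \<times> G0) (\<lambda>x. F (snd x \<otimes> e r (fst x)))"
    using continuous_on_compose2[OF equivariantD(1)[OF F]] by blast
  show "continuous_on (UNIV \<times> G0) (\<lambda>x. L (e r (fst x)))"
    by (rule alg_continuous[OF chr_alg[OF L]], rule continuous_on_coord) (intro continuous_intros)
qed

lemma continuous_on_line1:
  assumes "y \<in> G0"
  shows "continuous_on UNIV (line r L F y)"
proof -
  have "continuous_on UNIV (\<lambda>s. (s, y))" by (intro continuous_intros)
  from continuous_on_compose2[OF continuous_on_line this] assms show ?thesis by auto
qed

lemma comp_e:
  assumes y: "y \<in> G0"
  shows "comp r L m F (y \<otimes> e r t) = ee (L (e r t) + of_int m * t) * comp r L m F y"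
proof -
  have "comp r L m F (y \<otimes> e r t) = integral {0..1} (\<lambda>s. ee (L (e r t) + of_int m * t) * (line r L F y (s + t) * ee (- of_int m * (s + t))))"
    unfolding comp_def
  proof (rule integral_cong)
    fix s
    have "ee (L (e r t) + of_int m * t) * ee (- of_int m * (s + t)) = ee (L (e r t)) * ee (- of_int m * s)"
      by (simp add: ee_add[symmetric] algebra_simps)
    thus "line r L F (y \<otimes> e r t) s * ee (- of_int m * s) = ee (L (e r t) + of_int m * t) * (line r L F y (s + t) * ee (- of_int m * (s + t)))"
      by (simp only: line_shift[OF y] mult_ac) (metis mult.assoc mult.commute)
  qed
  also have "\<dots> = ee (L (e r t) + of_int m * t) * integral {0..1} (\<lambda>s. line r L F y (s + t) * ee (- of_int m * (s + t)))"
    by simp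
  also have "integral {0..1} (\<lambda>s. line r L F y (s + t) * ee (- of_int m * (s + t))) = comp r L m F y"
    unfolding comp_def
  proof (rule periodic_integral_shift)
    show "continuous_on UNIV (\<lambda>s. line r L F y s * ee (- real_of_int m * s))"
      by (intro continuous_intros continuous_on_line1[OF y])
    show "line r L F y (s + 1) * ee (- of_int m * (s + 1)) = line r L F y s * ee (- of_int m * s)" for s
    proof -
      have "- real_of_int m * (s + 1) = - of_int m * s + - of_int m" by (simp add: algebra_simps)
      thus ?thesis using ee_Ints[of "- of_int m"] by (simp only: line_periodic[OF y] ee_add) simp
    qed
  qed
  finally show ?thesis .
qed

lemma comp_V:
  assumes y: "y \<in> G0" and w: "w \<in> V (Suc r)"
  shows "comp r L m F (y \<otimes> w) = ee (L w) * comp r L m F y"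
proof -
  have wr: "w \<in> V r" using w V_antimono[of r "Suc r"] by auto
  have "F (y \<otimes> w \<otimes> e r s) = ee (L w) * F (y \<otimes> e r s)" for s
  proof -
    have "y \<otimes> w \<otimes> e r s = y \<otimes> e r s \<otimes> conj (inv (e r s)) w" by (simp add: conj_def op_assoc)
    thus ?thesis using equivariantD(3)[OF F G0_op[OF y e_G0[OF r]] V_conj[OF w]] chr_conj[OF L wr] by simp
  qed
  hence "line r L F (y \<otimes> w) s = ee (L w) * line r L F y s" for s by (simp add: line_def)
  thus ?thesis unfolding comp_def by (simp add: mult.assoc)
qed

lemma comp_equivariant: "equivariant r (\<lambda>v. L v + of_int m * v r) (comp r L m F)"
  unfolding equivariant_def
proof (intro conjI ballI)
  have "continuous_on (G0 \<times> cbox 0 1) (\<lambda>(y, s). line r L F y s * ee (- of_int m * s))"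
  proof -
    have "continuous_on (G0 \<times> cbox 0 1) (\<lambda>x. (snd x :: real, fst x))" by (intro continuous_intros)
    moreover have "(\<lambda>x. (snd x :: real, fst x)) ` (G0 \<times> cbox 0 1) \<subseteq> UNIV \<times> G0" by auto
    ultimately have "continuous_on (G0 \<times> cbox 0 1) (\<lambda>x. case (snd x :: real, fst x) of (s, y) \<Rightarrow> line r L F y s)"
      by (rule continuous_on_compose2[OF continuous_on_line])
    hence "continuous_on (G0 \<times> cbox 0 1) (\<lambda>x. line r L F (fst x) (snd x))" by simp
    hence "continuous_on (G0 \<times> cbox 0 1) (\<lambda>x. line r L F (fst x) (snd x) * ee (- of_int m * snd x))"
      by (intro continuous_intros)
    thus ?thesis by (simp add: split_beta)
  qed
  from integral_continuous_on_param[OF this]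
  show "continuous_on G0 (comp r L m F)" by (simp add: comp_def[abs_def])
next
  show "invariant (comp r L m F)"
    unfolding invariant_def
  proof (intro ballI)
    fix y h assume y: "y \<in> G0" and h: "h \<in> Gam"
    have "F (y \<otimes> h \<otimes> e r s) = F (y \<otimes> e r s)" for s
    proof -
      \<comment> \<open>Moving h past the axis element costs a commutator in
        \<open>V (Suc r)\<close>. It acts on F through \<open>L\<close>, which vanishes there
        because \<open>L\<close> is already a character of \<open>V r\<close>.\<close>
      let ?w = "comm (inv (e r s)) h"
      have eq: "?w = inv (comm h (inv (e r s)))" by (simp add: comm_inv)
      have wV: "?w \<in> V (Suc r)" unfolding eq by (intro V_inv comm_V e_V)
      have L0: "L ?w = 0"
        unfolding eq using chr_inv[OF L, of "comm h (inv (e r s))"] comm_V[OF V_inv[OF e_V], of h r s] V_antimono[of r "Suc r"]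
          chr_comm_V[OF L V_inv[OF e_V]] by auto
      have "y \<otimes> h \<otimes> e r s = (y \<otimes> e r s \<otimes> ?w) \<otimes> h" by (simp add: comm_def conj_def op_assoc)
      moreover have "y \<otimes> e r s \<otimes> ?w \<in> G0" using y wV V_G0[of "Suc r"] e_G0[OF r] by (intro G0_op) auto
      ultimately have "F (y \<otimes> h \<otimes> e r s) = F (y \<otimes> e r s \<otimes> ?w)"
        using equivariantD(2)[OF F] h by (simp add: invariant_def)
      thus ?thesis using equivariantD(3)[OF F G0_op[OF y e_G0[OF r]] wV] L0 by simp
    qed
    thus "comp r L m F (y \<otimes> h) = comp r L m F y" by (simp add: comp_def line_def)
  qed
next
  fix y v assume y: "y \<in> G0" and v: "v \<in> V r"
  define w where "w = inv (e r (v r)) \<otimes> v"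
  have w: "w \<in> V (Suc r)" "v = e r (v r) \<otimes> w" using V_decomp[OF v] by (auto simp: w_def)
  have "comp r L m F (y \<otimes> v) = ee (L w) * (ee (L (e r (v r)) + of_int m * v r) * comp r L m F y)"
    using comp_V[OF G0_op[OF y e_G0[OF r]] w(1)] comp_e[OF y] w(2) by (metis op_assoc)
  moreover have "L v = L (e r (v r)) + L w"
    using chr_op[OF L e_V, of w "v r"] w V_antimono[of r "Suc r"] by auto
  ultimately show "comp r L m F (y \<otimes> v) = ee (L v + of_int m * v r) * comp r L m F y"
    by (simp add: ee_add mult_ac)
qed

text \<open>Uniformity comes from the compact face; invariance under the lattice carries the
  estimate to all of \<open>G0\<close>.\<close>

lemma fourier_approx:
  assumes h: "h > 0"
  obtains n c where "c 0 = (1::real)"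
    "\<And>y. y \<in> G0 \<Longrightarrow> norm (F y - (\<Sum>m\<in>{- int n..int n}. of_real (c m) * comp r L (- m) F y)) \<le> h"
proof -
  obtain C where C: "\<And>x. x \<in> G0 \<Longrightarrow> norm (F x) \<le> C"
    by (rule invariant_bounded[OF equivariantD(2,1)[OF F]], rule that)
  have C0: "C \<ge> 0" using C[OF unit_G0] norm_ge_zero order_trans by blast
  have h2: "h / 2 > 0" using h by simp
  have "continuous_on (UNIV \<times> face) (\<lambda>(s, y). line r L F y s)"
    by (rule continuous_on_subset[OF continuous_on_line]) (use face_G0 in auto)
  from uniform_at_zero[OF this h2] obtain d0 where d0: "d0 > 0"
    "\<And>s y. \<bar>s\<bar> \<le> d0 \<Longrightarrow> y \<in> face \<Longrightarrow> norm (line r L F y s - line r L F y 0) \<le> h / 2" by blast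
  define d where "d = min d0 (1 / 4)"
  define e' where "e' = h / (4 * (C + 1))"
  have d: "0 < d" "d < 1 / 2" and e': "e' > 0" using d0 h C0 by (auto simp: d_def e'_def)
  obtain n :: nat and c :: "int \<Rightarrow> real" where nc: "c 0 = 1" "\<forall>f C h. continuous_on UNIV f \<longrightarrow> (\<forall>s. f (s + 1) = f s) \<longrightarrow>
      (\<forall>s. norm (f s) \<le> C) \<longrightarrow> (\<forall>s. \<bar>s\<bar> \<le> d \<longrightarrow> norm (f s - f 0) \<le> h) \<longrightarrow>
      norm (f 0 - (\<Sum>m\<in>{- int n..int n}. of_real (c m) * integral {0..1} (\<lambda>s. f s * ee (of_int m * s)))) \<le> h + 2 * C * e'"
    using trig_approx[OF d e'] by (elim exE conjE) (rule that)
  have ce: "2 * C * e' \<le> h / 2" using h C0 by (simp add: e'_def field_simps)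
  have face: "norm (F y - (\<Sum>m\<in>{- int n..int n}. of_real (c m) * comp r L (- m) F y)) \<le> h" if y: "y \<in> face" for y
  proof -
    have yG: "y \<in> G0" using y face_G0 by auto
    have "norm (line r L F y 0 - (\<Sum>m\<in>{- int n..int n}. of_real (c m) * integral {0..1} (\<lambda>s. line r L F y s * ee (of_int m * s)))) \<le> h / 2 + 2 * C * e'"
    proof (rule nc(2)[rule_format])
      show "norm (line r L F y s) \<le> C" for s using C[OF G0_op[OF yG e_G0[OF r]]] by (simp add: line_def norm_mult)
      show "norm (line r L F y s - line r L F y 0) \<le> h / 2" if "\<bar>s\<bar> \<le> d" for s using that d0(2)[OF _ y] by (simp add: d_def)
    qed (rule continuous_on_line1[OF yG] line_periodic[OF yG])+
    moreover have "line r L F y 0 = F y" by (simp add: line_def chr_unit[OF L])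
    ultimately show ?thesis using ce by (simp add: comp_def)
  qed
  show ?thesis
  proof (rule that[of c n, OF nc(1)])
    fix y assume y: "y \<in> G0"
    have "F (red y) = F y" "\<And>m. comp r L m F (red y) = comp r L m F y"
      using invariant_red[OF equivariantD(2)[OF F] y] invariant_red[OF equivariantD(2)[OF comp_equivariant] y] by auto
    thus "norm (F y - (\<Sum>m\<in>{- int n..int n}. of_real (c m) * comp r L (- m) F y)) \<le> h"
      using face[OF red_face[OF y]] by simp
  qed
qed

end

end

section \<open>Equidistribution of generic orbits by induction along \<open>V r\<close>\<close>

locale generic_orbit = tower +
  fixes g :: "nat \<Rightarrow> real"
  assumes g_first: "g 0 = 1"
    and generic: "\<And>h x. alg \<rat> {..<k} h \<Longrightarrow> (\<And>x y. h (x \<otimes> y) = h x + h y) \<Longrightarrow> h g = 0 \<Longrightarrow> h x = 0"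
begin

abbreviation orb :: "(nat \<Rightarrow> real) \<Rightarrow> nat \<Rightarrow> nat \<Rightarrow> real" where "orb x n \<equiv> pow g n \<otimes> x"

lemma g_G0: "g \<in> G0" by (simp add: G0_def g_first)

lemma orb_G0: "x \<in> G0 \<Longrightarrow> orb x n \<in> G0"
  by (intro G0_op G0_pow g_G0)

text \<open>The mean is the same for all starting points; \<open>mean_zero_Suc\<close> relies on
  this when it compares the orbits of x and of a translate of x.\<close>

definition mean_exists :: "nat \<Rightarrow> bool" where
  "mean_exists r \<longleftrightarrow> (\<forall>F. equivariant r (\<lambda>_. 0) F \<longrightarrow> (\<exists>z. \<forall>x\<in>G0. uniform_mean (\<lambda>n. F (orb x n)) z))"

definition mean_zero :: "nat \<Rightarrow> bool" where
  "mean_zero r \<longleftrightarrow> (\<forall>L F x. chr r L \<longrightarrow> (\<exists>v\<in>V r. L v \<noteq> 0) \<longrightarrow> equivariant r L F \<longrightarrow> x \<in> G0 \<longrightarrow> uniform_mean (\<lambda>n. F (orb x n)) 0)"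

text \<open>\<open>V 1\<close> and the lattice together act transitively on \<open>G0\<close>, so F
  is constant there.\<close>

lemma mean_exists_1: "mean_exists 1"
  unfolding mean_exists_def
proof (intro allI impI)
  fix F :: "(nat \<Rightarrow> real) \<Rightarrow> complex" assume F: "equivariant 1 (\<lambda>_. 0) F"
  have "F x = F \<one>" if x: "x \<in> G0" for x
  proof -
    let ?w = "inv (e 0 (x 0)) \<otimes> x"
    have e: "e 0 (x 0) \<in> Gam" using x by (intro e_Gam) (simp add: G0_def)
    have "?w \<in> V 1" using V_decomp[of x 0] by (simp add: V_def)
    hence "F (e 0 (x 0) \<otimes> ?w) = F (e 0 (x 0))" using equivariantD(3)[OF F, of "e 0 (x 0)" ?w] e Gam_G0 by auto
    moreover have "F (\<one> \<otimes> e 0 (x 0)) = F \<one>" using equivariantD(2)[OF F] e unit_G0 unfolding invariant_def by blast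
    ultimately show ?thesis by simp
  qed
  hence "(\<lambda>n. F (orb x n)) = (\<lambda>_. F \<one>)" if "x \<in> G0" for x using orb_G0[OF that] by metis
  thus "\<exists>z. \<forall>x\<in>G0. uniform_mean (\<lambda>n. F (orb x n)) z" by (metis uniform_mean_const)
qed

text \<open>With the extension L2 of \<open>L\<close> to the whole group, F is an eigenfunction of
  the translation with eigenvalue ee (L2 g). If L2 g were an integer, then L2 - L2 g * (coordinate
  0) would be a rational homomorphism vanishing at g, hence zero, and \<open>L\<close> would vanish
  on \<open>V 1\<close>.\<close>

lemma mean_zero_1: "mean_zero 1"
  unfolding mean_zero_def
proof (intro allI impI)
  fix L F x assume L: "chr 1 L" and nz: "\<exists>v\<in>V 1. L v \<noteq> 0" and F: "equivariant 1 L F" and x: "x \<in> G0"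
  have L': "chr (Suc 0) L" using L by simp
  obtain L2 where L2: "chr 0 L2" "\<And>v. v \<in> V (Suc 0) \<Longrightarrow> L2 v = L v" "L2 (e 0 1) = 0"
    by (rule chr_extend[OF k_pos L' lam_first[OF L']], rule that)
  have all: "v \<in> V 0" for v by (simp add: V_def)
  have step: "F (g \<otimes> y) = ee (L2 g) * F y" if y: "y \<in> G0" for y
  proof -
    define v where "v = conj (inv y) g"
    define w where "w = v \<otimes> inv (e 0 1)"
    have v0: "v 0 = 1" unfolding v_def using conj_low[OF all, of 0 "inv y" g] g_first by simp
    have w: "w \<in> V 1" by (simp add: V_def w_def op_first inv_first v0 e_def)
    have "g \<otimes> y = (y \<otimes> w) \<otimes> e 0 1" by (simp add: w_def v_def conj_def op_assoc)
    moreover have "y \<otimes> w \<in> G0" using y w V_G0[of 1] by (intro G0_op) auto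
    ultimately have "F (g \<otimes> y) = F (y \<otimes> w)" using equivariantD(2)[OF F] e_Gam[of 1 0] by (simp add: invariant_def)
    also have "\<dots> = ee (L w) * F y" by (rule equivariantD(3)[OF F y w])
    also have "L w = L2 g"
    proof -
      have "L w = L2 w" using L2(2)[of w] w by simp
      also have "\<dots> = L2 v + L2 (inv (e 0 1))" unfolding w_def by (rule chr_op[OF L2(1) all all])
      also have "\<dots> = L2 v" using chr_inv[OF L2(1) all] L2(3) by simp
      also have "\<dots> = L2 g" unfolding v_def by (rule chr_conj[OF L2(1) all])
      finally show ?thesis .
    qed
    finally show ?thesis .
  qed
  have orb: "F (orb x n) = ee (real n * L2 g) * F x" for n
  proof (induction n)
    case (Suc n)
    have "F (orb x (Suc n)) = ee (L2 g) * F (orb x n)" using step[OF orb_G0[OF x]] by (simp add: op_assoc)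
    thus ?case using Suc by (simp add: ee_add algebra_simps)
  qed simp
  have "L2 g \<notin> \<int>"
  proof
    assume i: "L2 g \<in> \<int>"
    have "alg \<rat> {..<k} (\<lambda>v. L2 v + (- L2 g) * v 0)"
      using chr_coordinate[OF k_pos Ints_minus[OF i] L2(1)] by (rule chr_alg)
    moreover have "L2 (y \<otimes> z) + (- L2 g) * (y \<otimes> z) 0 = (L2 y + (- L2 g) * y 0) + (L2 z + (- L2 g) * z 0)" for y z
      using chr_op[OF L2(1) all all] by (simp add: op_first algebra_simps)
    moreover have "L2 g + (- L2 g) * g 0 = 0" by (simp add: g_first)
    ultimately have gen: "L2 v + (- L2 g) * v 0 = 0" for v by (rule generic)
    obtain v where v: "v \<in> V 1" "L v \<noteq> 0" using nz by blast
    have "v 0 = 0" using v(1) by (simp add: V_def)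
    thus False using gen[of v] L2(2)[of v] v by simp
  qed
  thus "uniform_mean (\<lambda>n. F (orb x n)) 0" unfolding orb by (rule uniform_mean_ee)
qed

lemma uniform_mean_comp:
  assumes r: "0 < r" and L: "chr r L" and L1: "L (e r 1) = 0" and F: "equivariant (Suc r) L F"
    and x: "x \<in> G0"
    and z: "\<And>m. uniform_mean (\<lambda>n. comp r L m F (orb x n)) (if m = 0 then z else 0)"
  shows "uniform_mean (\<lambda>n. F (orb x n)) z"
proof (rule uniform_mean_approx_to)
  fix h :: real assume h: "h > 0"
  hence h2: "h / 2 > 0" by simp
  obtain N c where N: "c 0 = (1::real)" "\<And>y. y \<in> G0 \<Longrightarrow> norm (F y - (\<Sum>m\<in>{- int N..int N}. of_real (c m) * comp r L (- m) F y)) \<le> h / 2"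
    by (rule fourier_approx[OF r L L1 F h2], rule that)
  have "uniform_mean (\<lambda>n. \<Sum>m\<in>{- int N..int N}. of_real (c m) * comp r L (- m) F (orb x n))
     (\<Sum>m\<in>{- int N..int N}. of_real (c m) * (if - m = 0 then z else 0))"
    by (intro uniform_mean_sum uniform_mean_cmult z)
  also have "(\<Sum>m\<in>{- int N..int N}. complex_of_real (c m) * (if - m = 0 then z else 0)) = z"
    using N(1) by (simp add: if_distrib cong: if_cong)
  finally show "\<exists>b y c g. uniform_mean b y \<and> uniform_mean c g \<and> (\<forall>n. norm (F (orb x n) - b n) \<le> c n) \<and> g < h \<and> norm (y - z) < h"
    using N(2)[OF orb_G0[OF x]] uniform_mean_const[of "h / 2"] h
    by (intro exI[of _ "\<lambda>n. \<Sum>m\<in>{- int N..int N}. of_real (c m) * comp r L (- m) F (orb x n)"] exI[of _ z] exI[of _ "\<lambda>_. h / 2"] exI[of _ "h / 2"]) auto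
qed

lemma mean_comp:
  assumes r: "0 < r" "r < k" and F: "equivariant (Suc r) (\<lambda>_. 0) F" and mz: "mean_zero r"
    and x: "x \<in> G0" and z: "uniform_mean (\<lambda>n. comp r (\<lambda>_. 0) 0 F (orb x n)) z"
  shows "uniform_mean (\<lambda>n. F (orb x n)) z"
proof (rule uniform_mean_comp[OF r(1) chr_zero refl F x])
  fix m :: int
  show "uniform_mean (\<lambda>n. comp r (\<lambda>_. 0) m F (orb x n)) (if m = 0 then z else 0)"
  proof (cases "m = 0")
    case False
    have "chr r (\<lambda>v. 0 + of_int m * v r)" by (rule chr_coordinate[OF r(2) _ chr_zero]) simp
    moreover have "0 + of_int m * e r 1 r \<noteq> 0" using False by (simp add: e_def)
    ultimately show ?thesis
      using mz comp_equivariant[OF r(1) chr_zero refl F, of m] x e_V[of r 1] False unfolding mean_zero_def by force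
  qed (simp add: z)
qed

text \<open>Every Fourier component with nonzero index has a nontrivial character on
  \<open>V r\<close>, so its mean is 0; the component with index 0 is invariant under
  \<open>V r\<close>.\<close>

lemma mean_exists_Suc:
  assumes r: "0 < r" "r < k" and me: "mean_exists r" and mz: "mean_zero r"
  shows "mean_exists (Suc r)"
  unfolding mean_exists_def
proof (intro allI impI)
  fix F :: "(nat \<Rightarrow> real) \<Rightarrow> complex" assume F: "equivariant (Suc r) (\<lambda>_. 0) F"
  have "equivariant r (\<lambda>_. 0) (comp r (\<lambda>_. 0) 0 F)" using comp_equivariant[OF r(1) chr_zero refl F, of 0] by simp
  then obtain z where z: "\<And>x. x \<in> G0 \<Longrightarrow> uniform_mean (\<lambda>n. comp r (\<lambda>_. 0) 0 F (orb x n)) z"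
    using me unfolding mean_exists_def by blast
  thus "\<exists>z. \<forall>x\<in>G0. uniform_mean (\<lambda>n. F (orb x n)) z" using mean_comp[OF r F mz] by blast
qed

text \<open>In the van der Corput case the correlation H t is invariant under
  \<open>V (Suc r)\<close>, so its mean c t is the same along the orbits of x and of
  \<open>e r s \<otimes> x\<close>. On the other hand a small translation by \<open>e r s\<close>
  multiplies H t by nearly ee (t s \<theta>), with \<theta> the value of the homomorphism
  \<open>lam L r\<close> at g, nonzero by genericity. Taking this phase equal to -1 forces c t to be
  small.\<close>

lemma mean_zero_Suc:
  assumes r: "0 < r" "r < k" and me: "mean_exists (Suc r)" and mz: "mean_zero r"
  shows "mean_zero (Suc r)"
  unfolding mean_zero_def
proof (intro allI impI)
  fix L F x assume L: "chr (Suc r) L" and nz: "\<exists>v\<in>V (Suc r). L v \<noteq> 0" and F: "equivariant (Suc r) L F" and x: "x \<in> G0"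
  show "uniform_mean (\<lambda>n. F (orb x n)) 0"
  proof (cases "\<forall>y. lam L r y = 0")
    case True
    obtain L2 where L2: "chr r L2" "\<And>v. v \<in> V (Suc r) \<Longrightarrow> L2 v = L v" "L2 (e r 1) = 0"
      by (rule chr_extend[OF r(2) L True[rule_format]], rule that)
    have F2: "equivariant (Suc r) L2 F" using F equivariant_cong[of "Suc r" L2 L F] L2(2) by simp
    show ?thesis
    proof (rule uniform_mean_comp[OF r(1) L2(1,3) F2 x])
      fix m :: int
      obtain v where v: "v \<in> V (Suc r)" "L v \<noteq> 0" using nz by blast
      \<comment> \<open>Adding m v r changes nothing on \<open>V (Suc r)\<close>, where
        \<open>L\<close> is nonzero; so every component, also that with index 0, has a nontrivial
        character.\<close>
      have "chr r (\<lambda>v. L2 v + of_int m * v r)" by (rule chr_coordinate[OF r(2) _ L2(1)]) simp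
      moreover have "v \<in> V r" "L2 v + of_int m * v r \<noteq> 0"
        using v L2(2)[OF v(1)] by (auto simp: V_Suc)
      ultimately have "uniform_mean (\<lambda>n. comp r L2 m F (orb x n)) 0"
        using mz comp_equivariant[OF r(1) L2(1,3) F2, of m] x unfolding mean_zero_def by blast
      thus "uniform_mean (\<lambda>n. comp r L2 m F (orb x n)) (if m = 0 then 0 else 0)" by simp
    qed
  next
    case False
    define \<theta> where "\<theta> = lam L r g"
    have \<theta>: "\<theta> \<noteq> 0"
    proof
      assume "\<theta> = 0"
      hence "lam L r g = 0" by (simp add: \<theta>_def)
      hence "lam L r y = 0" for y by (rule generic[OF lam_alg[OF L] lam_op[OF L]])
      thus False using False by blast
    qed
    have lam_pow: "lam L r (pow g t) = real t * \<theta>" for t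
    proof (induction t)
      case 0
      show ?case using lam_op[OF L, of \<one> \<one>] by simp
    next
      case (Suc t)
      thus ?case using lam_op[OF L, of g "pow g t"] by (simp add: \<theta>_def algebra_simps)
    qed
    obtain C where C: "\<And>x. x \<in> G0 \<Longrightarrow> norm (F x) \<le> C"
      by (rule invariant_bounded[OF equivariantD(2,1)[OF F]], rule that)
    have C0: "C \<ge> 0" using C[OF unit_G0] norm_ge_zero order_trans by blast
    define H where "H t y = F (pow g t \<otimes> y) * cnj (F y)" for t y
    have gG: "pow g t \<otimes> y \<in> G0" if "y \<in> G0" for t y using that by (rule orb_G0)
    have Heq: "equivariant (Suc r) (\<lambda>_. 0) (H t)" for t
      unfolding equivariant_def
    proof (intro conjI ballI)
      have "continuous_on G0 (\<lambda>y. F (pow g t \<otimes> y))"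
      proof (rule continuous_on_compose2[OF equivariantD(1)[OF F]])
        show "continuous_on G0 (\<lambda>y. pow g t \<otimes> y)" by (intro continuous_intros)
      qed (use gG in auto)
      thus "continuous_on G0 (H t)" unfolding H_def[abs_def] using equivariantD(1)[OF F] by (intro continuous_intros)
      show "invariant (H t)" using equivariantD(2)[OF F] gG by (simp add: invariant_def H_def flip: op_assoc)
      fix y w assume y: "y \<in> G0" and w: "w \<in> V (Suc r)"
      have "F (pow g t \<otimes> (y \<otimes> w)) = ee (L w) * F (pow g t \<otimes> y)"
        using equivariantD(3)[OF F gG[OF y] w] by (simp add: op_assoc)
      moreover have "cnj (F (y \<otimes> w)) = ee (- L w) * cnj (F y)"
        using equivariantD(3)[OF F y w] by (simp add: cnj_ee)
      ultimately have "H t (y \<otimes> w) = (ee (- L w) * ee (L w)) * H t y" by (simp add: H_def mult_ac)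
      thus "H t (y \<otimes> w) = ee 0 * H t y" by (simp add: ee_minus)
    qed
    have "\<forall>t. \<exists>z. \<forall>x\<in>G0. uniform_mean (\<lambda>n. H t (orb x n)) z" using me Heq unfolding mean_exists_def by blast
    from choice[OF this] obtain c where "\<forall>t. \<forall>x\<in>G0. uniform_mean (\<lambda>n. H t (orb x n)) (c t)" ..
    hence c: "\<And>t x. x \<in> G0 \<Longrightarrow> uniform_mean (\<lambda>n. H t (orb x n)) (c t)" by blast
    have key: "norm (c t - ee (real t * s * \<theta>) * c t) \<le> 2 * C * h"
      if h: "\<And>y. y \<in> G0 \<Longrightarrow> norm (F (e r s \<otimes> y) - F y) \<le> h" for t s h
    proof -
      have eG: "e r s \<otimes> y \<in> G0" if "y \<in> G0" for y using that e_G0[OF r(1)] by (intro G0_op)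
      \<comment> \<open>Moving the axis element from the starting point to the front produces a
        commutator in \<open>V (Suc r)\<close>, under which H t is invariant.\<close>
      have swap: "H t (orb (e r s \<otimes> x) n) = H t (e r s \<otimes> orb x n)" for n
      proof -
        let ?w = "conj (inv (e r s \<otimes> orb x n)) (comm (pow g n) (e r s))"
        have w: "?w \<in> V (Suc r)" by (intro V_conj comm_V e_V)
        have "orb (e r s \<otimes> x) n = (e r s \<otimes> orb x n) \<otimes> ?w"
          by (simp add: comm_def conj_def op_assoc inv_op)
        thus ?thesis using equivariantD(3)[OF Heq eG[OF orb_G0[OF x]] w] by simp
      qed
      have "uniform_mean (\<lambda>n. H t (e r s \<otimes> orb x n)) (c t)" using c[OF eG[OF x], of t] by (simp add: swap)
      from uniform_mean_diff[OF this uniform_mean_cmult[OF c[OF x, of t], of "ee (real t * s * \<theta>)"]]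
      have um: "uniform_mean (\<lambda>n. H t (e r s \<otimes> orb x n) - ee (real t * s * \<theta>) * H t (orb x n)) (c t - ee (real t * s * \<theta>) * c t)" .
      show ?thesis
      proof (rule uniform_mean_bound[OF um uniform_mean_const])
        fix n
        define y where "y = orb x n"
        have y: "y \<in> G0" unfolding y_def by (rule orb_G0[OF x])
        have "pow g t \<otimes> (e r s \<otimes> y) = comm (pow g t) (e r s) \<otimes> (e r s \<otimes> (pow g t \<otimes> y))"
          by (simp add: comm_def conj_def op_assoc)
        moreover have "L (comm (pow g t) (e r s)) = real t * s * \<theta>" using lam_scale[OF L] lam_pow by simp
        ultimately have e1: "F (pow g t \<otimes> (e r s \<otimes> y)) = ee (real t * s * \<theta>) * F (e r s \<otimes> (pow g t \<otimes> y))"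
          using equivariant_left[OF F L comm_V[OF e_V] eG[OF gG[OF y]], of "pow g t" s] by simp
        define A B A' B' where "A = F (e r s \<otimes> (pow g t \<otimes> y))" and "B = F (e r s \<otimes> y)" and "A' = F (pow g t \<otimes> y)" and "B' = F y"
        have "H t (e r s \<otimes> y) - ee (real t * s * \<theta>) * H t y = ee (real t * s * \<theta>) * ((A - A') * cnj B + A' * cnj (B - B'))"
          unfolding H_def e1 A_def B_def A'_def B'_def by (simp add: algebra_simps)
        hence "norm (H t (e r s \<otimes> y) - ee (real t * s * \<theta>) * H t y) \<le> norm (A - A') * norm B + norm A' * norm (B - B')"
          using norm_triangle_ineq[of "(A - A') * cnj B" "A' * cnj (B - B')"] by (simp add: norm_mult flip: complex_cnj_diff)
        also have "\<dots> \<le> h * C + C * h"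
          unfolding A_def B_def A'_def B'_def using C eG gG y h C0 order_trans[OF norm_ge_zero h[OF y]]
          by (intro add_mono mult_mono) auto
        finally show "norm (H t (e r s \<otimes> orb x n) - ee (real t * s * \<theta>) * H t (orb x n)) \<le> 2 * C * h"
          by (simp add: y_def)
      qed
    qed
    have lim: "c \<longlonglongrightarrow> 0"
    proof (rule LIMSEQ_I)
      fix \<epsilon> :: real assume \<epsilon>: "\<epsilon> > 0"
      define h where "h = \<epsilon> / (2 * (C + 1))"
      have h: "h > 0" using \<epsilon> C0 by (simp add: h_def)
      have "continuous_on (UNIV \<times> face) (\<lambda>(s, y). F (e r s \<otimes> y))"
        unfolding split_beta
      proof (rule continuous_on_compose2[OF equivariantD(1)[OF F]])
        show "continuous_on (UNIV \<times> face) (\<lambda>z. e r (fst z) \<otimes> snd z)" by (intro continuous_intros)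
        show "(\<lambda>z. e r (fst z) \<otimes> snd z) ` (UNIV \<times> face) \<subseteq> G0"
          using face_G0 G0_op[OF e_G0[OF r(1)]] by auto
      qed
      from uniform_at_zero[OF this h] obtain d where d: "d > 0"
        "\<And>s y. \<bar>s\<bar> \<le> d \<Longrightarrow> y \<in> face \<Longrightarrow> norm (F (e r s \<otimes> y) - F (e r 0 \<otimes> y)) \<le> h" by blast
      have small: "norm (F (e r s \<otimes> y) - F y) \<le> h" if s: "\<bar>s\<bar> \<le> d" and y: "y \<in> G0" for s y
      proof -
        obtain a where a: "a \<in> Gam" "red y = y \<otimes> a" using red_coset by blast
        have "F (e r s \<otimes> red y) = F (e r s \<otimes> y)"
          using equivariantD(2)[OF F] a G0_op[OF e_G0[OF r(1)] y] by (simp add: invariant_def flip: op_assoc)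
        thus ?thesis using d(2)[OF s red_face[OF y]] invariant_red[OF equivariantD(2)[OF F] y] by simp
      qed
      obtain T :: nat where T: "real T > 1 / (2 * \<bar>\<theta>\<bar> * d)" using reals_Archimedean2 by blast
      show "\<exists>no. \<forall>t\<ge>no. norm (c t - 0) < \<epsilon>"
      proof (intro exI[of _ "Suc T"] allI impI)
        fix t assume t: "t \<ge> Suc T"
        \<comment> \<open>The phase t s \<theta> becomes 1 / 2, while s tends to 0 as t grows, so
          the translation is harmless.\<close>
        define s where "s = 1 / (2 * real t * \<theta>)"
        have t0: "real t > 0" using t by simp
        have "1 / (2 * \<bar>\<theta>\<bar> * d) \<le> real t" using T t by linarith
        hence "\<bar>s\<bar> \<le> d" using t0 \<theta> d(1) by (simp add: s_def abs_mult field_simps)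
        hence "norm (c t - ee (real t * s * \<theta>) * c t) \<le> 2 * C * h" by (intro key small)
        moreover have "real t * s * \<theta> = 1 / 2" using t0 \<theta> by (simp add: s_def)
        ultimately have "norm (2 * c t) \<le> 2 * C * h" by (simp add: ee_half)
        hence "norm (c t) \<le> C * h" by (simp add: norm_mult)
        also have "\<dots> < \<epsilon>" using \<epsilon> C0 by (simp add: h_def field_simps add_nonneg_pos)
        finally show "norm (c t - 0) < \<epsilon>" by simp
      qed
    qed
    show ?thesis
    proof (rule van_der_corput[OF _ _ lim])
      show "norm (F (orb x n)) \<le> C" for n by (rule C[OF orb_G0[OF x]])
      have "orb x (n + t) = pow g t \<otimes> orb x n" for n t
        using pow_add[of g t n] by (simp add: add.commute[of n t] op_assoc)
      thus "uniform_mean (\<lambda>n. F (orb x (n + t)) * cnj (F (orb x n))) (c t)" for t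
        using c[OF x, of t] by (simp add: H_def)
    qed
  qed
qed

theorem means:
  assumes "0 < r" "r \<le> k"
  shows "mean_exists r \<and> mean_zero r"
  using assms
proof (induction r)
  case (Suc r)
  show ?case
  proof (cases "r = 0")
    case True
    thus ?thesis using mean_exists_1 mean_zero_1 by simp
  next
    case False
    hence "mean_exists r" "mean_zero r" "0 < r" "r < k" using Suc by auto
    thus ?thesis using mean_exists_Suc mean_zero_Suc by blast
  qed
qed simp

end

subsection \<open>Means of functions on the fundamental cube\<close>

text \<open>A trapezoid vanishing at both ends of [0, 1]. Opposite faces of the cube are glued with
  a twist given by the group law, so a function on the cube is made to vanish there rather than to
  be periodic.\<close>

definition chi :: "real \<Rightarrow> real \<Rightarrow> real" where "chi d t = min 1 (min t (1 - t) / d)"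

definition cutoff :: "real \<Rightarrow> nat \<Rightarrow> (nat \<Rightarrow> real) \<Rightarrow> real" where
  "cutoff d i v = (\<Prod>j\<in>{1..<i}. chi d (v j))"

definition fibre :: "nat \<Rightarrow> ((nat \<Rightarrow> real) \<Rightarrow> complex) \<Rightarrow> (nat \<Rightarrow> real) \<Rightarrow> complex" where
  "fibre i \<phi> v = integral {0..1} (\<lambda>s. \<phi> (v(i := s)))"

text \<open>The integral over the coordinates 1 to i with all others set to 0. The highest
  coordinate is integrated first, in the order in which \<open>mean_lift\<close> removes
  coordinates.\<close>

primrec fibres :: "nat \<Rightarrow> ((nat \<Rightarrow> real) \<Rightarrow> complex) \<Rightarrow> complex" where
  "fibres 0 \<phi> = \<phi> (\<lambda>_. 0)"
| "fibres (Suc i) \<phi> = fibres i (fibre (Suc i) \<phi>)"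

lemma chi_bounds:
  assumes "0 < d" "0 \<le> t" "t \<le> 1"
  shows "0 \<le> chi d t" "chi d t \<le> 1"
  using assms by (auto simp: chi_def)

lemma chi_ends [simp]: "chi d 0 = 0" "chi d 1 = 0"
  by (simp_all add: chi_def)

lemma continuous_on_chi [continuous_intros]: "0 < d \<Longrightarrow> continuous_on S f \<Longrightarrow> continuous_on S (\<lambda>x. chi d (f x))"
  unfolding chi_def by (intro continuous_intros) auto

lemma chi_frac_le:
  assumes d: "0 < d" and m: "m \<in> \<int>"
  shows "chi d (frac t) \<le> \<bar>t - m\<bar> / d"
proof -
  obtain n :: int where n: "m = of_int n" using m by (auto elim: Ints_cases)
  have "min (frac t) (1 - frac t) \<le> \<bar>t - m\<bar>"
  proof (cases "t \<ge> m")
    case True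
    hence "of_int n \<le> (of_int \<lfloor>t\<rfloor> :: real)" unfolding n by (simp add: le_floor_iff)
    hence "frac t \<le> t - m" by (simp add: frac_def n)
    thus ?thesis by linarith
  next
    case False
    hence "\<lfloor>t\<rfloor> < n" unfolding n by (simp add: floor_less_iff)
    hence "(of_int \<lfloor>t\<rfloor> :: real) + 1 \<le> of_int n" by linarith
    hence "1 - frac t \<le> m - t" by (simp add: frac_def n)
    thus ?thesis using False by linarith
  qed
  hence "min (frac t) (1 - frac t) / d \<le> \<bar>t - m\<bar> / d" using d by (intro divide_right_mono) auto
  thus ?thesis unfolding chi_def by linarith
qed

lemma integral_chi:
  assumes d: "0 < d" "d \<le> 1 / 2"
  shows "integral {0..1} (chi d) = 1 - d"
proof -
  have "((\<lambda>t. t / d) has_integral (d ^ 2 / (2 * d) - 0 ^ 2 / (2 * d))) {0..d}"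
    using d by (intro fundamental_theorem_of_calculus)
      (auto intro!: derivative_eq_intros simp flip: has_real_derivative_iff_has_vector_derivative)
  hence "((\<lambda>t. t / d) has_integral d / 2) {0..d}" using d by (simp add: power2_eq_square)
  hence 1: "(chi d has_integral d / 2) {0..d}"
    by (rule has_integral_eq[rotated]) (use d in \<open>auto simp: chi_def min_def field_simps\<close>)
  have "((\<lambda>t. 1) has_integral (1 - 2 * d)) {d..1 - d}" using has_integral_const_real[of "1::real" d "1 - d"] d by simp
  hence 2: "(chi d has_integral (1 - 2 * d)) {d..1 - d}"
    by (rule has_integral_eq[rotated]) (use d in \<open>auto simp: chi_def min_def field_simps\<close>)
  define G where "G t = - ((1 - t) ^ 2) / (2 * d)" for t
  have "((\<lambda>t. (1 - t) / d) has_integral (G 1 - G (1 - d))) {1 - d..1}"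
    unfolding G_def using d by (intro fundamental_theorem_of_calculus)
      (auto intro!: derivative_eq_intros simp: field_simps simp flip: has_real_derivative_iff_has_vector_derivative)
  hence "((\<lambda>t. (1 - t) / d) has_integral d / 2) {1 - d..1}" using d by (simp add: G_def power2_eq_square)
  hence 3: "(chi d has_integral d / 2) {1 - d..1}"
    by (rule has_integral_eq[rotated]) (use d in \<open>auto simp: chi_def min_def field_simps\<close>)
  have "(chi d has_integral (d / 2 + (1 - 2 * d))) {0..1 - d}"
    using d by (intro has_integral_combine[OF _ _ 1 2]) auto
  from has_integral_combine[OF _ _ this 3] d have "(chi d has_integral (d / 2 + (1 - 2 * d) + d / 2)) {0..1}" by auto
  thus ?thesis by (simp add: integral_unique)
qed

lemma cutoff_bounds:
  assumes "0 < d" "v \<in> cube"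
  shows "0 \<le> cutoff d i v" "cutoff d i v \<le> 1"
  unfolding cutoff_def using assms chi_bounds[of d]
  by (auto intro!: prod_nonneg prod_le_1 simp: cube_def)

lemma cutoff_Suc: "i > 0 \<Longrightarrow> cutoff d (Suc i) v = cutoff d i v * chi d (v i)"
  unfolding cutoff_def by (simp add: atLeastLessThanSuc mult.commute)

lemma cutoff_update: "j \<ge> i \<Longrightarrow> cutoff d i (v(j := s)) = cutoff d i v"
  unfolding cutoff_def by (intro prod.cong) auto

lemma continuous_on_cutoff: "0 < d \<Longrightarrow> continuous_on S (cutoff d i)"
  unfolding cutoff_def[abs_def]
  by (intro continuous_on_prod continuous_on_chi continuous_on_subset[OF continuous_on_product_coordinates]) auto

lemma face_update: "v \<in> face \<Longrightarrow> 0 < i \<Longrightarrow> 0 \<le> s \<Longrightarrow> s \<le> 1 \<Longrightarrow> v(i := s) \<in> face"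
  by (auto simp: face_def cube_def)

lemma continuous_on_update: "continuous_on S (\<lambda>z :: (nat \<Rightarrow> real) \<times> real. (fst z)(i := snd z))"
proof (rule continuous_on_coordinatewise_then_product)
  fix j
  show "continuous_on S (\<lambda>z. ((fst z)(i := snd z)) j)"
  proof (cases "j = i")
    case False
    have "continuous_on S (\<lambda>z. fst z j)" by (rule continuous_on_coord) (intro continuous_intros)
    thus ?thesis using False by simp
  qed (auto intro: continuous_intros)
qed

lemma continuous_on_face_update:
  assumes "continuous_on face \<phi>" "0 < i" "v \<in> face"
  shows "continuous_on {0..1} (\<lambda>s. \<phi> (v(i := s)))"
proof (rule continuous_on_compose2[OF assms(1)])
  have "continuous_on {0..1} (\<lambda>s. (v, s :: real))" by (intro continuous_intros)
  from continuous_on_compose2[OF continuous_on_update[of UNIV i] this]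
  show "continuous_on {0..1} (\<lambda>s. v(i := s))" by simp
qed (use assms face_update in auto)

lemma continuous_on_fibre:
  assumes "continuous_on face \<phi>" "0 < i"
  shows "continuous_on face (fibre i \<phi>)"
proof -
  have "continuous_on (face \<times> cbox 0 1) (\<lambda>z. \<phi> ((fst z)(i := snd z)))"
    by (rule continuous_on_compose2[OF assms(1) continuous_on_update]) (use face_update assms(2) in auto)
  hence "continuous_on (face \<times> cbox 0 1) (\<lambda>(v, s). \<phi> (v(i := s)))" by (simp add: split_beta)
  from integral_continuous_on_param[OF this] show ?thesis by (simp add: fibre_def[abs_def])
qed

lemma norm_fibre_le:
  assumes "continuous_on face \<phi>" "0 < i" "v \<in> face" "\<And>u. u \<in> face \<Longrightarrow> norm (\<phi> u) \<le> C"
  shows "norm (fibre i \<phi> v) \<le> C"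
proof -
  have "norm (fibre i \<phi> v) \<le> C * (1 - 0)"
    unfolding fibre_def using assms face_update
    by (intro integral_bound continuous_on_face_update) auto
  thus ?thesis by simp
qed

lemma fibres_cutoff:
  assumes d: "0 < d" "d \<le> 1 / 2"
  shows "fibres i (\<lambda>v. of_real (cutoff d (Suc i) v)) = of_real ((1 - d) ^ i)"
proof (induction i)
  case 0
  show ?case by (simp add: cutoff_def)
next
  case (Suc i)
  have "fibre (Suc i) (\<lambda>v. complex_of_real (cutoff d (Suc (Suc i)) v)) v = of_real (1 - d) * of_real (cutoff d (Suc i) v)" for v
  proof -
    have "fibre (Suc i) (\<lambda>v. complex_of_real (cutoff d (Suc (Suc i)) v)) v = integral {0..1} (\<lambda>s. complex_of_real (cutoff d (Suc i) v) * of_real (chi d s))"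
      unfolding fibre_def by (simp add: cutoff_Suc cutoff_update)
    also have "\<dots> = of_real (cutoff d (Suc i) v) * integral {0..1} (\<lambda>s. complex_of_real (chi d s))" by simp
    also have "integral {0..1} (\<lambda>s. complex_of_real (chi d s)) = of_real (1 - d)"
    proof -
      have "chi d integrable_on {0..1}"
        using d continuous_on_chi[OF d(1) continuous_on_id, of "{0..1}"] by (intro integrable_continuous_real) simp
      hence "((\<lambda>s. complex_of_real (chi d s)) has_integral of_real (1 - d)) {0..1}"
        using integral_chi[OF d] by (intro has_integral_of_real) (simp add: has_integral_iff)
      thus ?thesis by (rule integral_unique)
    qed
    finally show ?thesis by simp
  qed
  hence "fibre (Suc i) (\<lambda>v. complex_of_real (cutoff d (Suc (Suc i)) v)) = (\<lambda>v. of_real (1 - d) * of_real (cutoff d (Suc i) v))"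
    by (rule ext)
  moreover have "fibre j (\<lambda>v. c * \<phi> v) = (\<lambda>v. c * fibre j \<phi> v)" for j c \<phi>
    by (auto simp: fibre_def)
  hence "fibres i (\<lambda>v. c * \<phi> v) = c * fibres i \<phi>" for c \<phi>
    by (induction i arbitrary: \<phi>) simp_all
  ultimately show ?case using Suc by simp
qed

text \<open>If \<open>R (v(i := t))\<close> is not identically zero in \<open>t\<close>, it has only finitely many zeros, so that
  dominated convergence applies to one coordinate after the other.\<close>

lemma fibres_tendsto_zero:
  assumes "\<And>j. continuous_on face (\<phi> j)" "\<And>j v. v \<in> face \<Longrightarrow> norm (\<phi> j v) \<le> 1"
    and "alg UNIV {1..i} R" "R u \<noteq> 0" "\<And>v. v \<in> face \<Longrightarrow> R v \<noteq> 0 \<Longrightarrow> (\<lambda>j. \<phi> j v) \<longlonglongrightarrow> 0"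
  shows "(\<lambda>j. fibres i (\<phi> j)) \<longlonglongrightarrow> 0"
  using assms
proof (induction i arbitrary: \<phi> R u)
  case 0
  have "R (\<lambda>_. 0) = R u" using 0(3) by (rule alg_cong) auto
  moreover have "(\<lambda>_. 0) \<in> face" by (simp add: face_def cube_def)
  ultimately show ?case using 0(4,5) by simp
next
  case (Suc i)
  \<comment> \<open>Freezing the last coordinate at its value in u keeps R' u nonzero; where R' is
    nonzero at v, the polynomial t -> R (v(Suc i := t)) is not identically zero.\<close>
  define R' where "R' v = R (v(Suc i := u (Suc i)))" for v
  have "(\<lambda>j. fibres i (fibre (Suc i) (\<phi> j))) \<longlonglongrightarrow> 0"
  proof (rule Suc.IH[of _ R' u])
    show "continuous_on face (fibre (Suc i) (\<phi> j))" for j by (intro continuous_on_fibre Suc.prems) auto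
    show "norm (fibre (Suc i) (\<phi> j) v) \<le> 1" if "v \<in> face" for j v
      by (rule norm_fibre_le[OF Suc.prems(1) _ that Suc.prems(2)]) auto
    have "alg UNIV {1..i} (\<lambda>x. R (\<lambda>w. (x(Suc i := u (Suc i))) w))"
      by (rule alg_subst[OF Suc.prems(3)], rename_tac w, case_tac "w = Suc i") (auto intro: alg_const alg_var)
    moreover have "(\<lambda>x. R (\<lambda>w. (x(Suc i := u (Suc i))) w)) = R'" by (simp only: R'_def[abs_def] fun_upd_def)
    ultimately show "alg UNIV {1..i} R'" by (simp only:)
    show "R' u \<noteq> 0" using Suc.prems(4) by (simp add: R'_def)
    fix v assume v: "v \<in> face" and Rv: "R' v \<noteq> 0"
    obtain q where q: "\<And>t. R (v(Suc i := t)) = poly q t" using alg_update[OF Suc.prems(3)] by blast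
    have "q \<noteq> 0" using Rv q[of "u (Suc i)"] by (auto simp: R'_def)
    hence fin: "finite {t. poly q t = 0}" by (rule poly_roots_finite)
    define f where "f j t = (if poly q t = 0 then 0 else \<phi> j (v(Suc i := t)))" for j t
    have int: "(\<lambda>t. \<phi> j (v(Suc i := t))) integrable_on {0..1}" for j
      by (intro integrable_continuous_real continuous_on_face_update Suc.prems v) auto
    have vf: "v(Suc i := t) \<in> face" if "t \<in> {0..1}" for t
      using face_update[OF v, of "Suc i" t] that by simp
    have eq: "integral {0..1} (f j) = fibre (Suc i) (\<phi> j) v" for j
      unfolding fibre_def by (rule integral_spike[of "{t. poly q t = 0}"]) (use fin in \<open>auto simp: f_def negligible_finite\<close>)
    have "(\<lambda>j. integral {0..1} (f j)) \<longlonglongrightarrow> integral {0..1} (\<lambda>_ :: real. 0)"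
    proof (rule Equivalence_Lebesgue_Henstock_Integration.dominated_convergence(2))
      show "f j integrable_on {0..1}" for j
        by (rule integrable_spike_finite[OF fin _ int]) (auto simp: f_def)
      show "(\<lambda>_. 1 :: real) integrable_on {0..1::real}" by (intro integrable_continuous_real continuous_intros)
      show "norm (f j t) \<le> 1" if "t \<in> {0..1}" for j t
        by (cases "poly q t = 0") (simp_all add: f_def Suc.prems(2)[OF vf[OF that]])
      show "(\<lambda>j. f j t) \<longlonglongrightarrow> 0" if "t \<in> {0..1}" for t
      proof (cases "poly q t = 0")
        case False
        hence "R (v(Suc i := t)) \<noteq> 0" using q[of t] by simp
        from Suc.prems(5)[OF vf[OF that] this] show ?thesis by (simp only: f_def False if_False)
      qed (simp add: f_def)
    qed
    thus "(\<lambda>j. fibre (Suc i) (\<phi> j) v) \<longlonglongrightarrow> 0" by (simp add: eq)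
  qed
  thus ?case by simp
qed

section \<open>Functions on the cube as functions on the quotient\<close>

context tower
begin

text \<open>An element of \<open>V i\<close> passes the corrections of lower coordinates by being
  conjugated, which preserves \<open>V i\<close> and the coordinate i.\<close>

lemma red_upto_V:
  assumes v: "v \<in> V i"
  shows "j \<le> i \<Longrightarrow> \<exists>v'\<in>V i. v' i = v i \<and> red_upto (y \<otimes> v) j = red_upto y j \<otimes> v'"
proof (induction j)
  case 0
  show ?case using v by (intro bexI[of _ v]) auto
next
  case (Suc j)
  then obtain v' where v': "v' \<in> V i" "v' i = v i" "red_upto (y \<otimes> v) j = red_upto y j \<otimes> v'" by auto
  have "(red_upto y j \<otimes> v') j = red_upto y j j"
    using V_apply_right[OF v'(1), of j "red_upto y j"] v'(1) Suc.prems by (simp add: V_def)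
  hence "red_upto (y \<otimes> v) (Suc j) = red_upto y (Suc j) \<otimes> conj (inv (e j (- of_int \<lfloor>red_upto y j j\<rfloor>))) v'"
    using v'(3) by (simp add: conj_def op_assoc)
  thus ?case using V_conj[OF v'(1)] conj_low[OF v'(1), of i] v'(2) by (metis order_refl)
qed

lemma red_V_low: "v \<in> V i \<Longrightarrow> j < i \<Longrightarrow> red (y \<otimes> v) j = red y j"
  using red_upto_V[of v i i y] red_upto_low[of j i y] red_upto_low[of j i "y \<otimes> v"] V_apply_right[of _ i j "red_upto y i"]
  by (force simp: V_def)

lemma red_V_at: "v \<in> V i \<Longrightarrow> red (y \<otimes> v) i = frac (red_upto y i i + v i)"
  using red_upto_V[of v i i y] V_apply_right[of _ i i "red_upto y i"] by (force simp: red_def)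

text \<open>The lattice correction is locally constant as long as no coordinate lies at a jump of
  the floor function. Coordinate 0 always does, but on \<open>G0\<close> it takes only integral
  values and is itself locally constant.\<close>

lemma red_upto_locally:
  assumes y: "y \<in> G0" and nz: "\<And>j. 1 \<le> j \<Longrightarrow> j < m \<Longrightarrow> red y j \<noteq> 0"
  shows "\<exists>a\<in>Gam. red_upto y m = y \<otimes> a \<and> (\<forall>\<^sub>F z in at y within G0. red_upto z m = z \<otimes> a)"
  using nz
proof (induction m)
  case 0
  show ?case by (intro bexI[of _ \<one>]) auto
next
  case (Suc m)
  then obtain a where a: "a \<in> Gam" "red_upto y m = y \<otimes> a" "\<forall>\<^sub>F z in at y within G0. red_upto z m = z \<otimes> a" by force
  let ?t = "(y \<otimes> a) m"
  have "continuous_on G0 (\<lambda>z. (z \<otimes> a) m)"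
    by (rule continuous_on_coord) (intro continuous_intros)
  hence lim: "((\<lambda>z. (z \<otimes> a) m) \<longlongrightarrow> ?t) (at y within G0)"
    using y by (simp add: continuous_on_def)
  have fl: "\<forall>\<^sub>F z in at y within G0. \<lfloor>(z \<otimes> a) m\<rfloor> = \<lfloor>?t\<rfloor>"
  proof (cases "m = 0")
    case True
    have "\<forall>\<^sub>F z in at y within G0. dist ((z \<otimes> a) m) ?t < 1" using lim by (rule tendstoD) simp
    moreover have "\<forall>\<^sub>F z in at y within G0. z \<in> G0" by (simp add: eventually_at_filter)
    ultimately show ?thesis
    proof eventually_elim
      case (elim z)
      have "z \<otimes> a \<in> G0" "y \<otimes> a \<in> G0" using elim y a(1) Gam_G0 by (auto intro: G0_op)
      then obtain b c :: int where "(z \<otimes> a) m = of_int b" "?t = of_int c"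
        using True by (auto simp: G0_def elim!: Ints_cases)
      thus ?case using elim(1) by (simp add: dist_real_def)
    qed
  next
    case False
    have "frac ?t \<noteq> 0" using Suc.prems[of m] False a(2) by (simp add: red_def)
    hence t: "of_int \<lfloor>?t\<rfloor> < ?t" "?t < of_int \<lfloor>?t\<rfloor> + 1"
      using of_int_floor_le[of ?t] unfolding frac_def by linarith+
    from order_tendstoD(1)[OF lim t(1)] order_tendstoD(2)[OF lim t(2)]
    show ?thesis by eventually_elim (simp add: floor_eq_iff)
  qed
  show ?case
  proof (intro bexI[of _ "a \<otimes> e m (- of_int \<lfloor>?t\<rfloor>)"] conjI)
    show "a \<otimes> e m (- of_int \<lfloor>?t\<rfloor>) \<in> Gam" using a(1) by (intro Gam_op e_Gam) auto
    show "red_upto y (Suc m) = y \<otimes> (a \<otimes> e m (- of_int \<lfloor>?t\<rfloor>))" using a(2) by (simp add: op_assoc)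
    show "\<forall>\<^sub>F z in at y within G0. red_upto z (Suc m) = z \<otimes> (a \<otimes> e m (- of_int \<lfloor>?t\<rfloor>))"
      using a(3) fl by eventually_elim (simp add: op_assoc)
  qed
qed

definition dep :: "nat \<Rightarrow> ((nat \<Rightarrow> real) \<Rightarrow> 'a) \<Rightarrow> bool" where
  "dep i \<phi> \<longleftrightarrow> (\<forall>u v. (\<forall>j<i. u j = v j) \<longrightarrow> \<phi> u = \<phi> v)"

lemma depD: "dep i \<phi> \<Longrightarrow> (\<And>j. j < i \<Longrightarrow> u j = v j) \<Longrightarrow> \<phi> u = \<phi> v"
  by (simp add: dep_def)

definition lift :: "real \<Rightarrow> nat \<Rightarrow> ((nat \<Rightarrow> real) \<Rightarrow> complex) \<Rightarrow> (nat \<Rightarrow> real) \<Rightarrow> complex" where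
  "lift d i \<phi> y = \<phi> (red y) * of_real (cutoff d i (red y))"

lemma face_bounded:
  fixes \<phi> :: "(nat \<Rightarrow> real) \<Rightarrow> complex"
  assumes "continuous_on face \<phi>"
  obtains C where "\<And>v. v \<in> face \<Longrightarrow> norm (\<phi> v) \<le> C" "C \<ge> 0"
proof -
  have "compact (\<phi> ` face)" by (intro compact_continuous_image compact_face assms)
  then obtain C where C: "\<And>z. z \<in> \<phi> ` face \<Longrightarrow> norm z \<le> C" using compact_imp_bounded bounded_iff by metis
  show ?thesis by (rule that[of "max C 0"]) (use C in \<open>force intro: max.coboundedI1\<close>)+
qed

text \<open>Away from jumps the reduction is locally a translation by a fixed lattice element. At a
  jump the cutoff vanishes, and it tends to 0 linearly in the distance.\<close>

lemma continuous_on_lift: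
  assumes d: "0 < d" and \<phi>: "continuous_on face \<phi>" "dep i \<phi>" and i: "0 < i"
  shows "continuous_on G0 (lift d i \<phi>)"
  unfolding continuous_on_def
proof
  fix y assume y: "y \<in> G0"
  have G: "\<forall>\<^sub>F z in at y within G0. z \<in> G0" by (simp add: eventually_at_filter)
  have lim: "((\<lambda>z. (z \<otimes> a) m) \<longlongrightarrow> (y \<otimes> a) m) (at y within G0)" for a m
  proof -
    have "continuous_on G0 (\<lambda>z. (z \<otimes> a) m)" by (rule continuous_on_coord) (intro continuous_intros)
    thus ?thesis using y by (simp add: continuous_on_def)
  qed
  show "(lift d i \<phi> \<longlongrightarrow> lift d i \<phi> y) (at y within G0)"
  proof (cases "\<exists>m. 1 \<le> m \<and> m < i \<and> red y m = 0")
    case False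
    then obtain a where a: "red_upto y i = y \<otimes> a" "\<forall>\<^sub>F z in at y within G0. red_upto z i = z \<otimes> a"
      using red_upto_locally[OF y, of i] by auto
    \<comment> \<open>The coordinates of \<open>red z\<close> from i on may jump; neither \<phi> nor
      the cutoff depends on them, so they are replaced by 0.\<close>
    define T where "T v = (\<lambda>j. if j < i then v j else 0 :: real)" for v
    have red_T: "(\<lambda>j. if j < i then red z j else 0) = T (z \<otimes> a)" if "red_upto z i = z \<otimes> a" for z
      using red_upto_low[of _ i z] that by (auto simp: T_def)
    have Tface: "T (z \<otimes> a) \<in> face" if "red_upto z i = z \<otimes> a" "z \<in> G0" for z
      using red_bounds[of z] red_G0[OF that(2)] by (auto simp: red_T[OF that(1), symmetric] face_def cube_def less_imp_le)
    define \<psi> where "\<psi> v = \<phi> v * of_real (cutoff d i v)" for v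
    have \<psi>: "continuous_on face \<psi>"
      unfolding \<psi>_def by (intro continuous_intros \<phi>(1) continuous_on_cutoff d)
    have lift_T: "lift d i \<phi> z = \<psi> (T (z \<otimes> a))" if "red_upto z i = z \<otimes> a" for z
    proof -
      have "\<phi> (red z) = \<phi> (T (z \<otimes> a))"
        unfolding red_T[OF that, symmetric] by (rule depD[OF \<phi>(2)]) simp
      moreover have "cutoff d i (red z) = cutoff d i (T (z \<otimes> a))"
        unfolding cutoff_def red_T[OF that, symmetric] by (intro prod.cong) auto
      ultimately show ?thesis by (simp add: lift_def \<psi>_def)
    qed
    have "((\<lambda>z. T (z \<otimes> a)) \<longlongrightarrow> T (y \<otimes> a)) (at y within G0)"
    proof -
      have "continuous_on G0 (\<lambda>z. T (z \<otimes> a))"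
      proof (rule continuous_on_coordinatewise_then_product)
        fix j
        have "continuous_on G0 (\<lambda>z. (z \<otimes> a) j)" by (rule continuous_on_coord) (intro continuous_intros)
        thus "continuous_on G0 (\<lambda>z. T (z \<otimes> a) j)" by (cases "j < i") (auto simp: T_def)
      qed
      thus ?thesis using y by (simp add: continuous_on_def)
    qed
    moreover have "\<forall>\<^sub>F z in at y within G0. T (z \<otimes> a) \<in> face"
      using a(2) G by eventually_elim (rule Tface)
    ultimately have "((\<lambda>z. \<psi> (T (z \<otimes> a))) \<longlongrightarrow> \<psi> (T (y \<otimes> a))) (at y within G0)"
      using Tface[OF a(1) y] by (intro continuous_on_tendsto_compose[OF \<psi>])
    moreover have "\<forall>\<^sub>F z in at y within G0. \<psi> (T (z \<otimes> a)) = lift d i \<phi> z"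
      using a(2) by eventually_elim (simp add: lift_T)
    ultimately show ?thesis unfolding lift_T[OF a(1)] by (rule Lim_transform_eventually)
  next
    case True
    \<comment> \<open>Below the first vanishing coordinate the correction is still locally constant.
      The factor \<open>chi\<close> of coordinate m alone then forces the limit 0, whatever the
      later coordinates do.\<close>
    define m where "m = (LEAST m. 1 \<le> m \<and> m < i \<and> red y m = 0)"
    have m: "1 \<le> m" "m < i" "red y m = 0" using LeastI_ex[OF True] by (auto simp: m_def)
    have "red y j \<noteq> 0" if "1 \<le> j" "j < m" for j
      using not_less_Least[of j "\<lambda>m. 1 \<le> m \<and> m < i \<and> red y m = 0"] that m(2) by (auto simp: m_def)
    then obtain a where a: "red_upto y m = y \<otimes> a" "\<forall>\<^sub>F z in at y within G0. red_upto z m = z \<otimes> a"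
      using red_upto_locally[OF y, of m] by auto
    let ?t = "(y \<otimes> a) m"
    have t: "?t \<in> \<int>" using m(3) a(1) by (simp add: red_def frac_eq_0_iff)
    obtain C where C: "\<And>v. v \<in> face \<Longrightarrow> norm (\<phi> v) \<le> C" "C \<ge> 0" by (rule face_bounded[OF \<phi>(1)], rule that)
    have le: "norm (lift d i \<phi> z) \<le> C * (\<bar>(z \<otimes> a) m - ?t\<bar> / d)" if z: "red_upto z m = z \<otimes> a" "z \<in> G0" for z
    proof -
      have rf: "red z \<in> cube" "red z \<in> face" using red_face[OF z(2)] by (auto simp: face_def)
      have "cutoff d i (red z) = chi d (red z m) * (\<Prod>j\<in>{1..<i} - {m}. chi d (red z j))"
        unfolding cutoff_def using m by (subst prod.remove[of _ m]) auto
      also have "\<dots> \<le> chi d (red z m) * 1"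
        using chi_bounds[OF d] red_bounds[of z] by (intro mult_left_mono prod_le_1) (auto simp: less_imp_le)
      also have "\<dots> \<le> \<bar>(z \<otimes> a) m - ?t\<bar> / d" using chi_frac_le[OF d t, of "(z \<otimes> a) m"] z(1) by (simp add: red_def)
      finally have "cutoff d i (red z) \<le> \<bar>(z \<otimes> a) m - ?t\<bar> / d" .
      thus ?thesis unfolding lift_def norm_mult using C rf cutoff_bounds[OF d rf(1), of i]
        by (intro mult_mono) auto
    qed
    have "((\<lambda>z. C * (\<bar>(z \<otimes> a) m - ?t\<bar> / d)) \<longlongrightarrow> C * (\<bar>?t - ?t\<bar> / d)) (at y within G0)"
      using d by (intro tendsto_intros lim) auto
    hence "((\<lambda>z. C * (\<bar>(z \<otimes> a) m - ?t\<bar> / d)) \<longlongrightarrow> 0) (at y within G0)" by simp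
    moreover have "\<forall>\<^sub>F z in at y within G0. norm (lift d i \<phi> z) \<le> C * (\<bar>(z \<otimes> a) m - ?t\<bar> / d)"
      using a(2) G by eventually_elim (rule le)
    ultimately have "(lift d i \<phi> \<longlongrightarrow> 0) (at y within G0)" by (rule Lim_null_comparison[rotated])
    moreover have "lift d i \<phi> y = 0" using le[OF a(1) y] by simp
    ultimately show ?thesis by simp
  qed
qed

lemma equivariant_lift:
  assumes d: "0 < d" and \<phi>: "continuous_on face \<phi>" "dep i \<phi>" and i: "0 < i"
  shows "equivariant i (\<lambda>_. 0) (lift d i \<phi>)"
  unfolding equivariant_def
proof (intro conjI ballI)
  show "continuous_on G0 (lift d i \<phi>)" by (rule continuous_on_lift[OF assms])
  show "invariant (lift d i \<phi>)" by (auto simp: invariant_def lift_def red_right)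
  fix y w assume "y \<in> G0" and w: "w \<in> V i"
  have "\<phi> (red (y \<otimes> w)) = \<phi> (red y)" by (rule depD[OF \<phi>(2)]) (rule red_V_low[OF w])
  moreover have "cutoff d i (red (y \<otimes> w)) = cutoff d i (red y)"
    unfolding cutoff_def using red_V_low[OF w] by (intro prod.cong) auto
  ultimately show "lift d i \<phi> (y \<otimes> w) = ee 0 * lift d i \<phi> y" by (simp add: lift_def)
qed

lemma comp_lift:
  assumes d: "0 < d" and \<phi>: "continuous_on face \<phi>" "dep (Suc i) \<phi>" and i: "0 < i" and y: "y \<in> G0"
  shows "comp i (\<lambda>_. 0) 0 (lift d (Suc i) \<phi>) y = lift d i (fibre i (\<lambda>v. \<phi> v * of_real (chi d (v i)))) y"
proof -
  note E = equivariant_lift[OF d \<phi> zero_less_Suc]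
  let ?u = "red_upto y i i"
  \<comment> \<open>The component with index 0 is invariant under \<open>V i\<close>; after moving
    the coordinate i to 0, the integration variable s is that coordinate, so the integral is a fibre
    integral.\<close>
  have "comp i (\<lambda>_. 0) 0 (lift d (Suc i) \<phi>) y = comp i (\<lambda>_. 0) 0 (lift d (Suc i) \<phi>) (y \<otimes> e i (- ?u))"
    using equivariantD(3)[OF comp_equivariant[OF i chr_zero refl E, of 0] y e_V, of "- ?u"] by simp
  also have "\<dots> = integral {0..1} (\<lambda>s. of_real (cutoff d i (red y)) * (\<phi> ((red y)(i := s)) * of_real (chi d s)))"
    unfolding comp_def
  proof (rule integral_cong)
    fix s :: real assume s: "s \<in> {0..1}"
    let ?v = "e i (- ?u) \<otimes> e i s"
    have v: "?v \<in> V i" "?v i = s - ?u"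
      using V_op[OF e_V e_V] V_apply_left[OF e_V, of i i "- ?u" "e i s"] by (auto simp: e_def)
    have at: "red (y \<otimes> ?v) i = frac s" using red_V_at[OF v(1), of y] v(2) by simp
    have low: "red (y \<otimes> ?v) j = red y j" if "j < i" for j using red_V_low[OF v(1) that] .
    have c: "cutoff d i (red (y \<otimes> ?v)) = cutoff d i (red y)"
      unfolding cutoff_def using low by (intro prod.cong) auto
    have val: "lift d (Suc i) \<phi> (y \<otimes> ?v) = \<phi> (red (y \<otimes> ?v)) * of_real (cutoff d i (red y) * chi d (frac s))"
      by (simp add: lift_def cutoff_Suc[OF i] at c)
    have "lift d (Suc i) \<phi> (y \<otimes> ?v) = of_real (cutoff d i (red y)) * (\<phi> ((red y)(i := s)) * of_real (chi d s))"
    proof (cases "s = 1")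
      case True
      thus ?thesis unfolding val by simp
    next
      case False
      hence fr: "frac s = s" using s by (simp add: frac_eq)
      have "\<phi> (red (y \<otimes> ?v)) = \<phi> ((red y)(i := s))"
        by (rule depD[OF \<phi>(2)]) (use low at fr in \<open>auto simp: less_Suc_eq\<close>)
      thus ?thesis unfolding val fr by simp
    qed
    thus "line i (\<lambda>_. 0) (lift d (Suc i) \<phi>) (y \<otimes> e i (- ?u)) s * ee (- real_of_int 0 * s)
      = of_real (cutoff d i (red y)) * (\<phi> ((red y)(i := s)) * of_real (chi d s))"
      by (simp add: line_def op_assoc)
  qed
  also have "\<dots> = lift d i (fibre i (\<lambda>v. \<phi> v * of_real (chi d (v i)))) y"
    by (simp add: lift_def fibre_def)
  finally show ?thesis .
qed

end

context generic_orbit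
begin

text \<open>At each level \<open>mean_comp\<close> passes to the Fourier component with index 0
  along the last coordinate, which \<open>comp_lift\<close> identifies with the lift of a fibre
  integral. At the bottom only coordinate 0 is left, on which the reduction is constant.\<close>

lemma mean_lift:
  assumes d: "0 < d" and \<phi>: "continuous_on face \<phi>" "dep (Suc i) \<phi>" and i: "Suc i \<le> k" and x: "x \<in> G0"
  shows "uniform_mean (\<lambda>n. lift d (Suc i) \<phi> (orb x n)) (fibres i (\<lambda>v. \<phi> v * of_real (cutoff d (Suc i) v)))"
  using \<phi> i
proof (induction i arbitrary: \<phi>)
  case 0
  have "lift d (Suc 0) \<phi> y = \<phi> (\<lambda>_. 0)" if y: "y \<in> G0" for y
    using depD[OF 0(2), of "red y" "\<lambda>_. 0"] red_G0[OF y] by (simp add: lift_def cutoff_def)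
  hence "(\<lambda>n. lift d (Suc 0) \<phi> (orb x n)) = (\<lambda>_. \<phi> (\<lambda>_. 0))" by (simp only: orb_G0[OF x])
  thus ?case using uniform_mean_const[of "\<phi> (\<lambda>_. 0)"] by (simp add: cutoff_def)
next
  case (Suc i)
  define \<psi> where "\<psi> = fibre (Suc i) (\<lambda>v. \<phi> v * of_real (chi d (v (Suc i))))"
  have \<psi>c: "continuous_on face \<psi>"
    unfolding \<psi>_def by (intro continuous_on_fibre continuous_intros Suc.prems(1) d
      continuous_on_subset[OF continuous_on_product_coordinates]) auto
  have \<psi>d: "dep (Suc i) \<psi>"
    unfolding dep_def
  proof (intro allI impI)
    fix u v :: "nat \<Rightarrow> real" assume "\<forall>j<Suc i. u j = v j"
    hence "\<phi> (u(Suc i := s)) = \<phi> (v(Suc i := s))" for s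
      using \<open>\<forall>j<Suc i. u j = v j\<close> by (intro depD[OF Suc.prems(2)]) (auto simp: less_Suc_eq)
    thus "\<psi> u = \<psi> v" by (simp add: \<psi>_def fibre_def)
  qed
  have "uniform_mean (\<lambda>n. lift d (Suc i) \<psi> (orb x n)) (fibres i (\<lambda>v. \<psi> v * of_real (cutoff d (Suc i) v)))"
    using Suc.prems(3) by (intro Suc.IH \<psi>c \<psi>d) simp
  also have "(\<lambda>n. lift d (Suc i) \<psi> (orb x n)) = (\<lambda>n. comp (Suc i) (\<lambda>_. 0) 0 (lift d (Suc (Suc i)) \<phi>) (orb x n))"
    unfolding \<psi>_def by (simp only: comp_lift[OF d Suc.prems(1,2) zero_less_Suc orb_G0[OF x]])
  finally have "uniform_mean (\<lambda>n. lift d (Suc (Suc i)) \<phi> (orb x n)) (fibres i (\<lambda>v. \<psi> v * of_real (cutoff d (Suc i) v)))"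
    using Suc.prems(3) means[of "Suc i"]
    by (intro mean_comp[OF _ _ equivariant_lift[OF d Suc.prems(1,2)] _ x]) auto
  moreover have "\<psi> v * of_real (cutoff d (Suc i) v) = fibre (Suc i) (\<lambda>v. \<phi> v * of_real (cutoff d (Suc (Suc i)) v)) v" for v
    unfolding \<psi>_def fibre_def by (simp add: cutoff_Suc[of "Suc i"] cutoff_update mult_ac flip: integral_mult_right)
  ultimately show ?case by simp
qed

lemma mean_cutoff:
  assumes d: "0 < d" "d \<le> 1 / 2" and x: "x \<in> G0"
  shows "uniform_mean (\<lambda>n. 1 - cutoff d k (red (orb x n))) (1 - (1 - d) ^ (k - 1))"
proof -
  have k: "Suc (k - 1) = k" using k_pos by simp
  have "uniform_mean (\<lambda>n. lift d (Suc (k - 1)) (\<lambda>_. 1) (orb x n)) (fibres (k - 1) (\<lambda>v. 1 * of_real (cutoff d (Suc (k - 1)) v)))"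
    by (rule mean_lift[OF d(1) _ _ _ x]) (use k_pos in \<open>auto simp: dep_def\<close>)
  hence "uniform_mean (\<lambda>n. complex_of_real (cutoff d k (red (orb x n)))) (of_real ((1 - d) ^ (k - 1)))"
    unfolding lift_def mult_1_left fibres_cutoff[OF d] unfolding k .
  from uniform_mean_Re[OF this] have "uniform_mean (\<lambda>n. cutoff d k (red (orb x n))) ((1 - d) ^ (k - 1))" by simp
  thus ?thesis by (intro uniform_mean_diff uniform_mean_const)
qed

lemma small_cutoff:
  assumes "h > 0"
  obtains d where "0 < d" "d \<le> 1 / 2" "1 - (1 - d) ^ (k - 1) < (h :: real)"
proof -
  have "((\<lambda>d. 1 - (1 - d) ^ (k - 1)) \<longlongrightarrow> 1 - (1 - 0) ^ (k - 1)) (at_right (0::real))" by (intro tendsto_intros)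
  hence "((\<lambda>d. 1 - (1 - d) ^ (k - 1)) \<longlongrightarrow> 0) (at_right (0::real))" by simp
  hence "\<forall>\<^sub>F d in at_right 0. 1 - (1 - d) ^ (k - 1) < h" using assms by (rule order_tendstoD)
  moreover have "\<forall>\<^sub>F d in at_right (0::real). 0 < d \<and> d < 1 / 2"
    by (auto simp: eventually_at_right_field intro!: exI[of _ "1/2"])
  ultimately have "\<forall>\<^sub>F d in at_right 0. 0 < d \<and> d < 1 / 2 \<and> 1 - (1 - d) ^ (k - 1) < h" by eventually_elim auto
  then obtain d where "0 < d \<and> d < 1 / 2 \<and> 1 - (1 - d) ^ (k - 1) < h"
    using eventually_happens'[OF trivial_limit_at_right_real] by blast
  thus ?thesis using that[of d] by auto
qed

text \<open>\<phi> need not match on glued faces, so it is not itself a function on the quotient.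
  Its distance from the lift is at most (C + 1) (1 - cutoff), which \<open>mean_cutoff\<close> makes
  small in the mean.\<close>

lemma mean_continuous:
  fixes \<phi> :: "(nat \<Rightarrow> real) \<Rightarrow> complex"
  assumes \<phi>: "continuous_on face \<phi>" "dep k \<phi>" and x: "x \<in> G0"
  shows "\<exists>z. uniform_mean (\<lambda>n. \<phi> (red (orb x n))) z"
proof (rule uniform_mean_approx)
  fix h :: real assume h: "h > 0"
  obtain C where C: "\<And>v. v \<in> face \<Longrightarrow> norm (\<phi> v) \<le> C" "C \<ge> 0" by (rule face_bounded[OF \<phi>(1)], rule that)
  have hC: "h / (C + 1) > 0" using h C by simp
  obtain d where d: "0 < d" "d \<le> 1 / 2" "1 - (1 - d) ^ (k - 1) < h / (C + 1)" by (rule small_cutoff[OF hC], rule that)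
  have k: "Suc (k - 1) = k" using k_pos by simp
  have um: "uniform_mean (\<lambda>n. lift d k \<phi> (orb x n)) (fibres (k - 1) (\<lambda>v. \<phi> v * of_real (cutoff d k v)))"
    using mean_lift[OF d(1) \<phi>(1) _ _ x, of "k - 1"] \<phi>(2) unfolding k by simp
  have le: "norm (\<phi> (red (orb x n)) - lift d k \<phi> (orb x n)) \<le> (C + 1) * (1 - cutoff d k (red (orb x n)))" for n
  proof -
    have rf: "red (orb x n) \<in> face" "red (orb x n) \<in> cube" using red_face[OF orb_G0[OF x]] by (auto simp: face_def)
    have "\<phi> (red (orb x n)) - lift d k \<phi> (orb x n) = \<phi> (red (orb x n)) * of_real (1 - cutoff d k (red (orb x n)))"
      by (simp add: lift_def algebra_simps)
    hence "norm (\<phi> (red (orb x n)) - lift d k \<phi> (orb x n)) = norm (\<phi> (red (orb x n))) * (1 - cutoff d k (red (orb x n)))"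
      using cutoff_bounds[OF d(1) rf(2), of k] by (simp only: norm_mult norm_of_real)
    also have "\<dots> \<le> (C + 1) * (1 - cutoff d k (red (orb x n)))"
      using C(1)[OF rf(1)] cutoff_bounds[OF d(1) rf(2), of k] by (intro mult_right_mono) auto
    finally show ?thesis .
  qed
  have "(C + 1) * (1 - (1 - d) ^ (k - 1)) < h" using d(3) C(2) by (simp add: pos_less_divide_eq mult.commute)
  thus "\<exists>b y c g. uniform_mean b y \<and> uniform_mean c g \<and> (\<forall>n. norm (\<phi> (red (orb x n)) - b n) \<le> c n) \<and> g < h"
    using um le uniform_mean_cmult[OF mean_cutoff[OF d(1,2) x], of "C + 1"] by blast
qed

end

subsection \<open>Piecewise polynomial functions on generic orbits\<close>

text \<open>Closure under floors makes the class contain the coordinates of a reduced product; hence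
  it is stable under the passage to a kernel.\<close>

inductive pp :: "nat set \<Rightarrow> ((nat \<Rightarrow> real) \<Rightarrow> real) \<Rightarrow> bool" for V where
  pp_const: "pp V (\<lambda>_. c)"
| pp_var: "i \<in> V \<Longrightarrow> pp V (\<lambda>x. x i)"
| pp_add: "pp V f \<Longrightarrow> pp V g \<Longrightarrow> pp V (\<lambda>x. f x + g x)"
| pp_mult: "pp V f \<Longrightarrow> pp V g \<Longrightarrow> pp V (\<lambda>x. f x * g x)"
| pp_floor: "pp V f \<Longrightarrow> pp V (\<lambda>x. of_int \<lfloor>f x\<rfloor>)"

lemma pp_cong: "pp V f \<Longrightarrow> (\<And>v. v \<in> V \<Longrightarrow> x v = y v) \<Longrightarrow> f x = f y"
  by (induction rule: pp.induct) auto

lemma pp_subst: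
  assumes "pp V f" "\<And>v. v \<in> V \<Longrightarrow> pp W (\<lambda>x. \<phi> v x)"
  shows "pp W (\<lambda>x. f (\<lambda>v. \<phi> v x))"
  using assms by (induction rule: pp.induct) (auto intro: pp.intros)

lemma pp_alg_subst:
  assumes "alg K V f" "\<And>v. v \<in> V \<Longrightarrow> pp W (\<lambda>x. \<phi> v x)"
  shows "pp W (\<lambda>x. f (\<lambda>v. \<phi> v x))"
  using assms by (induction rule: alg.induct) (auto intro: pp.intros)

lemma pp_uminus: "pp V f \<Longrightarrow> pp V (\<lambda>x. - f x)"
  using pp_mult[OF pp_const[of V "-1"]] by fastforce

lemma pp_diff: "pp V f \<Longrightarrow> pp V g \<Longrightarrow> pp V (\<lambda>x. f x - g x)"
  using pp_add[OF _ pp_uminus] by fastforce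

lemma pp_frac: "pp V f \<Longrightarrow> pp V (\<lambda>x. frac (f x))"
  unfolding frac_def by (intro pp_diff pp_floor)

lemma pp_bounded:
  assumes "pp V f"
  shows "\<exists>C\<ge>0. \<forall>v\<in>cube. \<bar>f v\<bar> \<le> C"
  using assms
proof (induction rule: pp.induct)
  case (pp_const c)
  show ?case by (intro exI[of _ "\<bar>c\<bar>"]) auto
next
  case (pp_var i)
  show ?case by (intro exI[of _ 1]) (auto simp: cube_def)
next
  case (pp_add f g)
  then obtain C D where "C \<ge> 0" "\<forall>v\<in>cube. \<bar>f v\<bar> \<le> C" "D \<ge> 0" "\<forall>v\<in>cube. \<bar>g v\<bar> \<le> D" by blast
  thus ?case by (intro exI[of _ "C + D"]) (auto intro: order_trans[OF abs_triangle_ineq] add_mono)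
next
  case (pp_mult f g)
  then obtain C D where "C \<ge> 0" "\<forall>v\<in>cube. \<bar>f v\<bar> \<le> C" "D \<ge> 0" "\<forall>v\<in>cube. \<bar>g v\<bar> \<le> D" by blast
  thus ?case by (intro exI[of _ "C * D"]) (auto simp: abs_mult intro: mult_mono)
next
  case (pp_floor f)
  then obtain C where C: "C \<ge> 0" "\<forall>v\<in>cube. \<bar>f v\<bar> \<le> C" by blast
  have "\<bar>of_int \<lfloor>f v\<rfloor>\<bar> \<le> C + (1 :: real)" if "v \<in> cube" for v
    using C(2)[rule_format, OF that] by linarith
  thus ?case using C(1) by (intro exI[of _ "C + 1"]) auto
qed

lemma alg_continuous_UNIV: "alg K V f \<Longrightarrow> continuous_on S f" for f :: "(nat \<Rightarrow> real) \<Rightarrow> real"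
  by (rule alg_continuous[where \<phi> = "\<lambda>x. x"], assumption, rule continuous_on_coord, rule continuous_on_id)

lemma alg_eventually_near:
  fixes q :: "(nat \<Rightarrow> real) \<Rightarrow> real"
  assumes "alg K V q" "open U" "q v \<in> U"
  shows "\<forall>\<^sub>F u in nhds v. q u \<in> U"
proof -
  have "open (q -` U)" using alg_continuous_UNIV[OF assms(1), of UNIV] assms(2) by (simp add: continuous_on_open_vimage)
  thus ?thesis using assms(3) by (auto simp: eventually_nhds intro!: exI[of _ "q -` U"])
qed

lemma alg_prod_nonzero:
  assumes "finite A" "\<And>a. a \<in> A \<Longrightarrow> alg UNIV V (f a)" "\<And>a. a \<in> A \<Longrightarrow> \<exists>u. f a u \<noteq> (0 :: real)"
  shows "alg UNIV V (\<lambda>x. \<Prod>a\<in>A. f a x) \<and> (\<exists>u. (\<Prod>a\<in>A. f a u) \<noteq> 0)"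
  using assms
proof (induction A rule: finite_induct)
  case empty
  show ?case by (auto intro: alg_const)
next
  case (insert a A)
  have fa: "alg UNIV V (f a)" and A: "alg UNIV V (\<lambda>x. \<Prod>a\<in>A. f a x)" using insert by auto
  obtain u w where "f a u \<noteq> 0" "(\<Prod>a\<in>A. f a w) \<noteq> 0" using insert by blast
  hence "\<exists>x. f a x * (\<Prod>a\<in>A. f a x) \<noteq> 0" by (intro alg_mult_nonzero[OF fa _ A])
  thus ?case using insert by (auto intro: alg_mult)
qed

text \<open>R is an equation of the walls between the pieces. Agreement with a member of Q is only
  local, which avoids describing the pieces themselves.\<close>

definition piecewise :: "nat set \<Rightarrow> ((nat \<Rightarrow> real) \<Rightarrow> real) \<Rightarrow> ((nat \<Rightarrow> real) \<Rightarrow> real) \<Rightarrow> ((nat \<Rightarrow> real) \<Rightarrow> real) set \<Rightarrow> bool" where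
  "piecewise V f R Q \<longleftrightarrow> alg UNIV V R \<and> (\<exists>u. R u \<noteq> 0) \<and> finite Q \<and> (\<forall>q\<in>Q. alg UNIV V q) \<and>
     (\<forall>v\<in>cube. R v \<noteq> 0 \<longrightarrow> (\<exists>q\<in>Q. \<forall>\<^sub>F u in nhds v. f u = q u))"

lemma piecewise_combine:
  assumes f: "piecewise V f R Q" and g: "piecewise V g R' Q'"
    and op: "\<And>q q'. alg UNIV V q \<Longrightarrow> alg UNIV V q' \<Longrightarrow> alg UNIV V (\<lambda>x. F (q x) (q' x))"
  shows "\<exists>R Q. piecewise V (\<lambda>x. F (f x) (g x)) R Q"
proof (intro exI)
  let ?Q = "(\<lambda>(q, q') x. F (q x) (q' x)) ` (Q \<times> Q')"
  show "piecewise V (\<lambda>x. F (f x) (g x)) (\<lambda>x. R x * R' x) ?Q"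
    unfolding piecewise_def
  proof (intro conjI ballI impI)
    show "alg UNIV V (\<lambda>x. R x * R' x)" using f g by (auto simp: piecewise_def intro: alg_mult)
    obtain u w where "alg UNIV V R" "R u \<noteq> 0" "alg UNIV V R'" "R' w \<noteq> 0" using f g unfolding piecewise_def by blast
    thus "\<exists>u. R u * R' u \<noteq> 0" by (rule alg_mult_nonzero)
    show "finite ?Q" using f g by (auto simp: piecewise_def)
    show "alg UNIV V q" if "q \<in> ?Q" for q using that f g op by (auto simp: piecewise_def)
    fix v assume v: "v \<in> cube" "R v * R' v \<noteq> 0"
    obtain q q' where q: "q \<in> Q" "\<forall>\<^sub>F u in nhds v. f u = q u" "q' \<in> Q'" "\<forall>\<^sub>F u in nhds v. g u = q' u"
      using f g v unfolding piecewise_def by (metis mult_not_zero)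
    have "\<forall>\<^sub>F u in nhds v. F (f u) (g u) = F (q u) (q' u)" using q(2,4) by eventually_elim simp
    moreover have "(\<lambda>x. F (q x) (q' x)) \<in> ?Q" using q by (intro image_eqI[of _ _ "(q, q')"]) auto
    ultimately show "\<exists>q\<in>?Q. \<forall>\<^sub>F u in nhds v. F (f u) (g u) = q u"
      by (intro bexI[of _ "\<lambda>x. F (q x) (q' x)"])
  qed
qed

text \<open>The new walls are q = c, for q in Q and the finitely many integers c within the bounds
  of Q on the cube. A polynomial constantly equal to c needs no wall; its factor is 1, which keeps
  the product nonzero.\<close>

lemma piecewise_floor:
  assumes f: "piecewise V f R Q"
  shows "\<exists>R Q. piecewise V (\<lambda>x. of_int \<lfloor>f x\<rfloor>) R Q"
proof -
  have alg: "q \<in> Q \<Longrightarrow> alg UNIV V q" and finQ: "finite Q" for q using f by (auto simp: piecewise_def)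
  obtain u0 where R: "alg UNIV V R" "R u0 \<noteq> 0" using f by (auto simp: piecewise_def)
  have "\<forall>q\<in>Q. \<exists>B::int. \<forall>v\<in>cube. \<bar>q v\<bar> \<le> of_int B"
  proof
    fix q assume "q \<in> Q"
    hence "compact (q ` cube)" by (intro compact_continuous_image compact_cube alg_continuous_UNIV[OF alg])
    then obtain b where b: "\<And>z. z \<in> q ` cube \<Longrightarrow> norm z \<le> b" using compact_imp_bounded bounded_iff by metis
    obtain n :: nat where "b \<le> real n" using real_arch_simple by blast
    thus "\<exists>B::int. \<forall>v\<in>cube. \<bar>q v\<bar> \<le> of_int B" using b by (intro exI[of _ "int n"]) force
  qed
  from bchoice[OF this] obtain Bq :: "_ \<Rightarrow> int" where Bq: "\<forall>q\<in>Q. \<forall>v\<in>cube. \<bar>q v\<bar> \<le> of_int (Bq q)" ..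
  define B where "B = Max (insert 0 (Bq ` Q))"
  have B: "\<bar>q v\<bar> \<le> of_int B" if "q \<in> Q" "v \<in> cube" for q v
  proof -
    have "Bq q \<le> B" unfolding B_def using finQ that by (intro Max_ge) auto
    thus ?thesis using Bq[rule_format, OF that] by linarith
  qed
  define S where "S = (\<lambda>(q :: (nat \<Rightarrow> real) \<Rightarrow> real, c :: int). if \<forall>u. q u = of_int c then (\<lambda>_. 1) else (\<lambda>u. q u - of_int c))"
  define A where "A = Q \<times> {- B..B}"
  have S: "alg UNIV V (S a) \<and> (\<exists>u. S a u \<noteq> 0)" if "a \<in> A" for a
  proof -
    obtain q c where a1: "a = (q, c)" by (cases a)
    hence a: "a = (q, c)" "q \<in> Q" using that by (simp_all add: A_def)
    have "alg UNIV V (\<lambda>u. q u - of_int c)" by (intro alg_diff alg[OF a(2)] alg_const) auto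
    moreover have "alg UNIV V (\<lambda>_. 1)" by (rule alg_const) simp
    ultimately show ?thesis unfolding S_def a(1) by auto
  qed
  have P: "alg UNIV V (\<lambda>x. \<Prod>a\<in>A. S a x)" "\<exists>u. (\<Prod>a\<in>A. S a u) \<noteq> 0"
    using alg_prod_nonzero[of A V S] S finQ by (simp_all add: A_def)
  let ?Q = "(\<lambda>(c::int) _. real_of_int c) ` {- B - 1..B}"
  have "piecewise V (\<lambda>x. of_int \<lfloor>f x\<rfloor>) (\<lambda>x. R x * (\<Prod>a\<in>A. S a x)) ?Q"
    unfolding piecewise_def
  proof (intro conjI ballI impI)
    show "alg UNIV V (\<lambda>x. R x * (\<Prod>a\<in>A. S a x))" by (rule alg_mult[OF R(1) P(1)])
    obtain w where "(\<Prod>a\<in>A. S a w) \<noteq> 0" using P(2) ..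
    thus "\<exists>u. R u * (\<Prod>a\<in>A. S a u) \<noteq> 0" by (rule alg_mult_nonzero[OF R P(1)])
    show "finite ?Q" by simp
    show "alg UNIV V q" if "q \<in> ?Q" for q using that by (auto intro: alg_const)
    fix v assume v: "v \<in> cube" "R v * (\<Prod>a\<in>A. S a v) \<noteq> 0"
    have SA: "S a v \<noteq> 0" if "a \<in> A" for a using v(2) that finQ by (auto simp: A_def)
    obtain q where q: "q \<in> Q" "\<forall>\<^sub>F u in nhds v. f u = q u"
      using f v unfolding piecewise_def by (metis mult_zero_left)
    have bd: "\<lfloor>q v\<rfloor> \<in> {- B - 1..B}" using B[OF q(1) v(1)] by (auto simp: floor_le_iff le_floor_iff)
    have "\<forall>\<^sub>F u in nhds v. \<lfloor>q u\<rfloor> = \<lfloor>q v\<rfloor>"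
    proof (cases "q v \<in> \<int>")
      case True
      then obtain c :: int where c: "q v = of_int c" by (auto elim: Ints_cases)
      have "(q, c) \<in> A" using B[OF q(1) v(1)] q(1) c by (auto simp: A_def)
      from SA[OF this] have "\<forall>u. q u = of_int c" using c by (auto simp: S_def split: if_splits)
      thus ?thesis by simp
    next
      case False
      hence "q v \<noteq> of_int \<lfloor>q v\<rfloor>" by (metis Ints_of_int)
      hence "q v \<in> {of_int \<lfloor>q v\<rfloor><..<of_int \<lfloor>q v\<rfloor> + 1}"
        using of_int_floor_le[of "q v"] unfolding greaterThanLessThan_iff by linarith
      from alg_eventually_near[OF alg[OF q(1)] open_greaterThanLessThan this]
      show ?thesis by eventually_elim (simp add: floor_eq_iff)
    qed
    hence "\<forall>\<^sub>F u in nhds v. of_int \<lfloor>f u\<rfloor> = (of_int \<lfloor>q v\<rfloor> :: real)" using q(2) by eventually_elim simp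
    thus "\<exists>q\<in>?Q. \<forall>\<^sub>F u in nhds v. of_int \<lfloor>f u\<rfloor> = q u"
      using bd by (intro bexI[of _ "\<lambda>_. of_int \<lfloor>q v\<rfloor>"]) (assumption, blast)
  qed
  thus ?thesis by blast
qed

lemma pp_piecewise: "pp V f \<Longrightarrow> \<exists>R Q. piecewise V f R Q"
proof (induction rule: pp.induct)
  case (pp_const c)
  show ?case by (intro exI[of _ "\<lambda>_. 1"] exI[of _ "{\<lambda>_. c}"]) (auto simp: piecewise_def intro: alg_const)
next
  case (pp_var i)
  thus ?case by (intro exI[of _ "\<lambda>_. 1"] exI[of _ "{\<lambda>x. x i}"]) (auto simp: piecewise_def intro: alg_const alg_var)
next
  case (pp_add f g)
  thus ?case using piecewise_combine[of V f _ _ g _ _ "(+)"] alg_add by blast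
next
  case (pp_mult f g)
  thus ?case using piecewise_combine[of V f _ _ g _ _ "(*)"] alg_mult by blast
next
  case (pp_floor f)
  thus ?case using piecewise_floor by blast
qed

text \<open>Continuous majorants of the indicator of the walls, which tend to 0 off the walls as j
  grows.\<close>

definition spike :: "nat \<Rightarrow> ((nat \<Rightarrow> real) \<Rightarrow> real) \<Rightarrow> (nat \<Rightarrow> real) \<Rightarrow> real" where
  "spike j R v = max 0 (1 - real j * \<bar>R v\<bar>)"

lemma spike_bounds: "0 \<le> spike j R v" "spike j R v \<le> 1"
  by (auto simp: spike_def)

lemma continuous_on_spike: "alg UNIV V R \<Longrightarrow> continuous_on S (spike j R)"
  unfolding spike_def[abs_def] by (intro continuous_intros alg_continuous_UNIV)

lemma spike_tendsto:
  assumes "R v \<noteq> 0"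
  shows "(\<lambda>j. spike j R v) \<longlonglongrightarrow> 0"
proof -
  obtain J :: nat where J: "real J > 1 / \<bar>R v\<bar>" using reals_Archimedean2 by blast
  have "spike j R v = 0" if "j \<ge> J" for j
  proof -
    have "1 / \<bar>R v\<bar> \<le> real j" using J that by linarith
    hence "1 \<le> real j * \<bar>R v\<bar>" using assms by (simp add: field_simps)
    thus ?thesis by (simp add: spike_def)
  qed
  thus ?thesis by (intro tendsto_eventually) (auto simp: eventually_sequentially)
qed

context generic_orbit
begin

text \<open>With the cutoff the mean is an iterated integral, which tends to 0 with growing j;
  dropping the cutoff costs at most 1 - (1 - d)^(k - 1).\<close>

lemma mean_spike:
  assumes R: "alg UNIV {1..<k} R" "R u \<noteq> 0" and x: "x \<in> G0" and h: "h > 0"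
  shows "\<exists>j z. uniform_mean (\<lambda>n. spike j R (red (orb x n))) z \<and> z < h"
proof -
  have k: "Suc (k - 1) = k" using k_pos by simp
  define \<phi> where "\<phi> j v = complex_of_real (spike j R v)" for j v
  have \<phi>c: "continuous_on S (\<phi> j)" for S j unfolding \<phi>_def by (intro continuous_intros continuous_on_spike[OF R(1)])
  have \<phi>d: "dep k (\<phi> j)" for j
    unfolding dep_def
  proof (intro allI impI)
    fix u v :: "nat \<Rightarrow> real" assume "\<forall>j<k. u j = v j"
    hence "R u = R v" by (intro alg_cong[OF R(1)]) auto
    thus "\<phi> j u = \<phi> j v" by (simp add: \<phi>_def spike_def)
  qed
  have h2: "h / 2 > 0" using h by simp
  obtain d where d: "0 < d" "d \<le> 1 / 2" "1 - (1 - d) ^ (k - 1) < h / 2" by (rule small_cutoff[OF h2], rule that)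
  define w where "w j = fibres (k - 1) (\<lambda>v. \<phi> j v * of_real (cutoff d k v))" for j
  have kk: "{1..k - 1} = {1..<k}" using k_pos by auto
  have "w \<longlonglongrightarrow> 0"
    unfolding w_def
  proof (rule fibres_tendsto_zero)
    show "continuous_on face (\<lambda>v. \<phi> j v * of_real (cutoff d k v))" for j
      by (intro continuous_intros \<phi>c continuous_on_cutoff d)
    show "norm (\<phi> j v * of_real (cutoff d k v)) \<le> 1" if "v \<in> face" for j v
    proof -
      have "v \<in> cube" using that by (simp add: face_def)
      hence "spike j R v * cutoff d k v \<le> 1 * 1" using spike_bounds cutoff_bounds[OF d(1)] by (intro mult_mono) auto
      thus ?thesis using spike_bounds cutoff_bounds[OF d(1) \<open>v \<in> cube\<close>, of k] by (simp add: \<phi>_def norm_mult)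
    qed
    show "alg UNIV {1..k - 1} R" using R(1) unfolding kk .
    show "R u \<noteq> 0" by (rule R(2))
    show "(\<lambda>j. \<phi> j v * of_real (cutoff d k v)) \<longlonglongrightarrow> 0" if "R v \<noteq> 0" for v
    proof -
      have "(\<lambda>j. \<phi> j v) \<longlonglongrightarrow> of_real 0" unfolding \<phi>_def by (intro tendsto_of_real spike_tendsto that)
      thus ?thesis by (intro tendsto_mult_left_zero) simp
    qed
  qed
  from LIMSEQ_D[OF this h2] obtain j where j: "norm (w j) < h / 2" by auto
  obtain z where z: "uniform_mean (\<lambda>n. \<phi> j (red (orb x n))) z" using mean_continuous[OF \<phi>c \<phi>d x] by blast
  have um: "uniform_mean (\<lambda>n. lift d k (\<phi> j) (orb x n)) (w j)"
    using mean_lift[OF d(1) \<phi>c, of "k - 1" j] \<phi>d x unfolding k w_def by simp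
  have "norm (z - w j) \<le> 1 - (1 - d) ^ (k - 1)"
  proof (rule uniform_mean_bound[OF uniform_mean_diff[OF z um] mean_cutoff[OF d(1,2) x]])
    fix n
    let ?v = "red (orb x n)"
    have v: "?v \<in> cube" using red_face[OF orb_G0[OF x]] by (auto simp: face_def)
    have "\<phi> j ?v - lift d k (\<phi> j) (orb x n) = of_real (spike j R ?v * (1 - cutoff d k ?v))"
      by (simp add: lift_def \<phi>_def algebra_simps)
    hence "norm (\<phi> j ?v - lift d k (\<phi> j) (orb x n)) = spike j R ?v * (1 - cutoff d k ?v)"
      using spike_bounds[of j R ?v] cutoff_bounds[OF d(1) v, of k] by (simp only: norm_of_real) simp
    also have "\<dots> \<le> 1 * (1 - cutoff d k ?v)"
      using spike_bounds[of j R ?v] cutoff_bounds[OF d(1) v, of k] by (intro mult_right_mono) auto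
    finally show "norm (\<phi> j ?v - lift d k (\<phi> j) (orb x n)) \<le> 1 - cutoff d k ?v" by simp
  qed
  hence "norm z < h" using j d(3) norm_triangle_ineq[of "z - w j" "w j"] by simp
  moreover have "uniform_mean (\<lambda>n. spike j R (red (orb x n))) (Re z)"
    using uniform_mean_Re[OF z] by (simp add: \<phi>_def)
  ultimately show ?thesis using complex_Re_le_cmod[of z] by (intro exI[of _ j] exI[of _ "Re z"]) auto
qed

text \<open>f (1 - spike) is continuous on the face: off the walls f is locally polynomial, and on
  the walls the second factor vanishes while f is bounded. The remainder f * spike is small in the
  mean.\<close>

theorem mean_pp:
  assumes f: "pp {1..<k} f" and x: "x \<in> G0"
  shows "\<exists>z. uniform_mean (\<lambda>n. f (red (orb x n))) z"
proof (rule uniform_mean_approx)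
  fix h :: real assume h: "h > 0"
  obtain R Q where RQ: "piecewise {1..<k} f R Q" using pp_piecewise[OF f] by blast
  obtain u where R: "alg UNIV {1..<k} R" "R u \<noteq> 0" using RQ by (auto simp: piecewise_def)
  obtain C where C: "C \<ge> 0" "\<And>v. v \<in> cube \<Longrightarrow> \<bar>f v\<bar> \<le> C" using pp_bounded[OF f] by blast
  have "h / (C + 1) > 0" using h C by simp
  from mean_spike[OF R x this] obtain j z where j: "uniform_mean (\<lambda>n. spike j R (red (orb x n))) z" "z < h / (C + 1)" by blast
  define \<phi> where "\<phi> v = complex_of_real (f v * (1 - spike j R v))" for v
  have "dep k \<phi>"
    unfolding dep_def
  proof (intro allI impI)
    fix u v :: "nat \<Rightarrow> real" assume "\<forall>j<k. u j = v j"
    hence "R u = R v" "f u = f v" by (auto intro!: alg_cong[OF R(1)] pp_cong[OF f])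
    thus "\<phi> u = \<phi> v" by (simp add: \<phi>_def spike_def)
  qed
  moreover have "continuous_on face \<phi>"
    unfolding continuous_on_def
  proof
    fix v assume v: "v \<in> face"
    hence vc: "v \<in> cube" by (simp add: face_def)
    have sp: "((\<lambda>u. spike j R u) \<longlongrightarrow> spike j R v) (at v within face)"
      using continuous_on_spike[OF R(1), of face j] v by (simp add: continuous_on_def)
    have "((\<lambda>u. f u * (1 - spike j R u)) \<longlongrightarrow> f v * (1 - spike j R v)) (at v within face)"
    proof (cases "R v = 0")
      case False
      then obtain q where q: "q \<in> Q" "\<forall>\<^sub>F u in nhds v. f u = q u" using RQ vc by (auto simp: piecewise_def)
      have "alg UNIV {1..<k} q" using RQ q by (auto simp: piecewise_def)
      hence "(q \<longlongrightarrow> q v) (at v within face)" using alg_continuous_UNIV[of UNIV "{1..<k}" q face] v by (simp add: continuous_on_def)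
      moreover have "\<forall>\<^sub>F u in at v within face. q u = f u"
        using q(2) by (auto simp: eventually_at_filter elim: eventually_mono)
      moreover have "f v = q v" using q(2) by (rule eventually_nhds_x_imp_x)
      ultimately have "(f \<longlongrightarrow> f v) (at v within face)" by (metis (mono_tags) Lim_transform_eventually)
      thus ?thesis by (intro tendsto_intros sp)
    next
      case True
      hence "spike j R v = 1" by (simp add: spike_def)
      hence "((\<lambda>u. C * (1 - spike j R u)) \<longlongrightarrow> C * (1 - 1)) (at v within face)"
        using sp by (intro tendsto_intros) simp
      hence "((\<lambda>u. C * (1 - spike j R u)) \<longlongrightarrow> 0) (at v within face)" by simp
      moreover have "\<forall>\<^sub>F u in at v within face. norm (f u * (1 - spike j R u)) \<le> C * (1 - spike j R u)"
        unfolding eventually_at_filter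
      proof (rule always_eventually, intro allI impI)
        fix u assume "u \<in> face"
        hence "\<bar>f u\<bar> \<le> C" by (intro C) (simp add: face_def)
        thus "norm (f u * (1 - spike j R u)) \<le> C * (1 - spike j R u)"
          using spike_bounds[of j R u] by (simp add: abs_mult mult_right_mono)
      qed
      ultimately have "((\<lambda>u. f u * (1 - spike j R u)) \<longlongrightarrow> 0) (at v within face)" by (rule Lim_null_comparison[rotated])
      thus ?thesis using \<open>spike j R v = 1\<close> by simp
    qed
    thus "(\<phi> \<longlongrightarrow> \<phi> v) (at v within face)" unfolding \<phi>_def[abs_def] by (rule tendsto_of_real)
  qed
  ultimately obtain y where "uniform_mean (\<lambda>n. \<phi> (red (orb x n))) y" using mean_continuous[OF _ _ x] by blast
  hence um: "uniform_mean (\<lambda>n. f (red (orb x n)) * (1 - spike j R (red (orb x n)))) (Re y)"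
    using uniform_mean_Re by (fastforce simp: \<phi>_def)
  have le: "norm (f (red (orb x n)) - f (red (orb x n)) * (1 - spike j R (red (orb x n)))) \<le> (C + 1) * spike j R (red (orb x n))" for n
  proof -
    let ?v = "red (orb x n)"
    have "?v \<in> cube" using red_face[OF orb_G0[OF x]] by (auto simp: face_def)
    hence "\<bar>f ?v\<bar> * spike j R ?v \<le> (C + 1) * spike j R ?v"
      using C(2)[of ?v] spike_bounds[of j R ?v] by (intro mult_right_mono) auto
    moreover have "f ?v - f ?v * (1 - spike j R ?v) = f ?v * spike j R ?v" by (simp add: algebra_simps)
    ultimately show ?thesis using spike_bounds[of j R ?v] by (simp add: abs_mult)
  qed
  have "(C + 1) * z < h" using j(2) C(1) by (simp add: pos_less_divide_eq mult.commute)
  thus "\<exists>b y c g. uniform_mean b y \<and> uniform_mean c g \<and> (\<forall>n. norm (f (red (orb x n)) - b n) \<le> c n) \<and> g < h"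
    using um le uniform_mean_cmult[OF j(1), of "C + 1"] by blast
qed

end

subsection \<open>Removing rational relations\<close>

lemma alg_Rats: "alg \<rat> V f \<Longrightarrow> (\<And>v. v \<in> V \<Longrightarrow> z v \<in> \<rat>) \<Longrightarrow> f z \<in> \<rat>"
  by (induction rule: alg.induct) auto

text \<open>With coordinates divisible by a high power of \<open>N\<close>, the values of a rational polynomial
  without constant term are divisible by almost the same power.\<close>

lemma alg_denominator_dvd:
  assumes "alg \<rat> V f" "f (\<lambda>_. 0) = 0"
  shows "\<exists>D::nat. D > 0 \<and> (\<forall>N::nat. N > 0 \<longrightarrow> D dvd N \<longrightarrow> (\<forall>m x. (\<forall>v\<in>V. x v / real N ^ Suc m \<in> \<int>) \<longrightarrow> f x / real N ^ m \<in> \<int>))"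
proof -
  obtain D :: nat where D: "D > 0" "\<And>M z. (\<forall>v\<in>V. z v \<in> \<int>) \<Longrightarrow>
     \<exists>j\<in>\<int>. real D * (f (\<lambda>v. of_int M * z v) - f (\<lambda>_. 0)) = of_int M * j"
    using alg_denominators[OF assms(1)] by blast
  have "f x / real N ^ m \<in> \<int>" if N: "N > 0" "D dvd N" and x: "\<forall>v\<in>V. x v / real N ^ Suc m \<in> \<int>" for N m x
  proof -
    define z where "z v = x v / real N ^ Suc m" for v
    obtain j where j: "j \<in> \<int>" "real D * (f (\<lambda>v. of_int (int N ^ Suc m) * z v) - f (\<lambda>_. 0)) = of_int (int N ^ Suc m) * j"
      using D(2)[of z "int N ^ Suc m"] x by (auto simp: z_def)
    have "(\<lambda>v. of_int (int N ^ Suc m) * z v) = x" using N by (auto simp: z_def)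
    hence "real D * f x = real N ^ Suc m * j" using j(2) assms(2) by simp
    moreover obtain q where "N = D * q" using N(2) by auto
    ultimately have "real D * f x = real D * (real q * real N ^ m * j)" by (simp add: mult_ac)
    hence "f x = real q * real N ^ m * j" using D(1) by simp
    hence "f x / real N ^ m = real q * j" using N by simp
    thus ?thesis using j(1) by auto
  qed
  thus ?thesis using D(1) by blast
qed

section \<open>Piecewise polynomials under the group law, and homomorphisms to the reals\<close>

context tower
begin

lemma pp_p:
  assumes "i < k" "\<And>j. j < i \<Longrightarrow> pp W (\<lambda>z. f z j)" "\<And>j. j < i \<Longrightarrow> pp W (\<lambda>z. h z j)"
  shows "pp W (\<lambda>z. p i (f z) (h z))"
proof -
  have "pp W (\<lambda>z. p i (\<lambda>j. case_sum (f z) (h z) (Inl j)) (\<lambda>j. case_sum (f z) (h z) (Inr j)))"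
    using assms(2,3) by (intro pp_alg_subst[OF p_alg[OF assms(1)]]) auto
  thus ?thesis by simp
qed

lemma pp_op:
  assumes "i < k" "\<And>j. j \<le> i \<Longrightarrow> pp W (\<lambda>z. f z j)" "\<And>j. j \<le> i \<Longrightarrow> pp W (\<lambda>z. h z j)"
  shows "pp W (\<lambda>z. (f z \<otimes> h z) i)"
  unfolding op_apply using assms by (intro pp_add pp_p) auto

lemma pp_red_upto:
  assumes "\<And>j. j < k \<Longrightarrow> pp W (\<lambda>z. f z j)"
  shows "m < k \<Longrightarrow> i < k \<Longrightarrow> pp W (\<lambda>z. red_upto (f z) m i)"
proof (induction m arbitrary: i)
  case 0
  thus ?case using assms by simp
next
  case (Suc m)
  have "pp W (\<lambda>z. e m (- of_int \<lfloor>red_upto (f z) m m\<rfloor>) j)" for j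
  proof (cases "j = m")
    case True
    have "pp W (\<lambda>z. red_upto (f z) m m)" using Suc by auto
    thus ?thesis using True by (simp add: e_def pp_uminus pp_floor)
  qed (simp add: e_def pp_const)
  thus ?case using Suc unfolding red_upto.simps by (intro pp_op) auto
qed

lemma pp_red:
  assumes "\<And>j. j < k \<Longrightarrow> pp W (\<lambda>z. f z j)" "i < k"
  shows "pp W (\<lambda>z. red (f z) i)"
  unfolding red_def using assms by (intro pp_frac pp_red_upto) auto

definition trunc :: "nat \<Rightarrow> (nat \<Rightarrow> real) \<Rightarrow> nat \<Rightarrow> real" where
  "trunc r x = (\<lambda>i. if i < r then x i else 0)"

lemma trunc_decomp:
  shows "inv (trunc r x) \<otimes> x \<in> V r" "(inv (trunc r x) \<otimes> x) r = x r"
proof -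
  define v where "v = inv (trunc r x) \<otimes> x"
  have tv: "trunc r x \<otimes> v = x" by (simp add: v_def)
  have low: "i < r \<Longrightarrow> v i = 0" for i
  proof (induction i rule: less_induct)
    case (less i)
    hence "p i (trunc r x) v = 0" by (intro p_low) auto
    thus ?case using fun_cong[OF tv, of i] less.prems by (simp add: op_apply trunc_def)
  qed
  thus "inv (trunc r x) \<otimes> x \<in> V r" by (simp add: V_def v_def)
  have "p r (trunc r x) v = 0" using low by (intro p_low) auto
  moreover have "trunc r x r = 0" by (simp add: trunc_def)
  ultimately have "v r = x r" using fun_cong[OF tv, of r] by (simp add: op_apply)
  thus "(inv (trunc r x) \<otimes> x) r = x r" by (simp add: v_def)
qed

text \<open>r is the last axis on which h is nonzero. By downward induction h vanishes on
  \<open>V (Suc r)\<close>, hence it is linear on the axis r, and the equation h x = 0 can be solved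
  for x r in terms of lower coordinates.\<close>

lemma hom_last_coordinate:
  assumes h: "alg \<rat> {..<k} h" "\<And>x y. h (x \<otimes> y) = h x + h y" and nz: "h x0 \<noteq> 0"
  obtains r where "r < k" "h (e r 1) \<noteq> 0" "\<And>v. v \<in> V (Suc r) \<Longrightarrow> h v = 0"
    "\<And>x. h x = h (trunc r x) + h (e r 1) * x r"
proof -
  have h0: "h \<one> = 0" using h(2)[of \<one> \<one>] by simp
  have scale: "h (e r s) = s * h (e r 1)" if V: "\<And>v. v \<in> V (Suc r) \<Longrightarrow> h v = 0" for r s
  proof -
    have "alg \<rat> UNIV (\<lambda>z. h (\<lambda>i. e r (z ()) i))"
      by (rule alg_subst[OF h(1)]) (intro alg_e alg_var UNIV_I)
    from alg_line[OF this, of "\<lambda>_. 0" "\<lambda>_. 1"] obtain q where q: "\<And>s. h (e r s) = poly q s" by auto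
    have "poly q (s + t) = poly q s + poly q t" for s t
    proof -
      have "h (e r s \<otimes> e r t) = h (e r (s + t) \<otimes> zeta r s t)" by (simp add: e_op)
      thus ?thesis using V[OF zeta_V[of r s t]] by (simp add: h(2) q)
    qed
    hence "poly q s = s * poly q 1" by (rule additive_poly_linear)
    thus ?thesis by (simp add: q)
  qed
  have zero: "(\<And>i. r \<le> i \<Longrightarrow> i < k \<Longrightarrow> h (e i 1) = 0) \<Longrightarrow> v \<in> V r \<Longrightarrow> h v = 0" if "r \<le> k" for r v
    using that
  proof (induction r arbitrary: v rule: inc_induct)
    case base
    have "h v = h \<one>" using base by (intro alg_cong[OF h(1)]) (auto simp: V_def unit_def)
    thus ?case using h0 by simp
  next
    case (step r)
    have V: "h w = 0" if "w \<in> V (Suc r)" for w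
      by (rule step.IH[OF _ that]) (rule step.prems(1), auto)
    have "h v = h (e r (v r)) + h (inv (e r (v r)) \<otimes> v)"
      using h(2)[of "e r (v r)" "inv (e r (v r)) \<otimes> v"] by simp
    moreover have "h (inv (e r (v r)) \<otimes> v) = 0" by (rule V[OF V_decomp[OF step.prems(2)]])
    moreover have "h (e r (v r)) = v r * h (e r 1)" by (rule scale[OF V])
    moreover have "h (e r 1) = 0" using step.prems(1)[of r] step.hyps by linarith
    ultimately show ?case by (simp only: mult_zero_right add_0_right)
  qed
  define A where "A = {i. i < k \<and> h (e i 1) \<noteq> 0}"
  have "A \<noteq> {}" using zero[of 0 x0] nz by (auto simp: A_def V_def)
  moreover have fA: "finite A" by (simp add: A_def)
  ultimately have M: "Max A \<in> A" by (rule Max_in[rotated])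
  define r where "r = Max A"
  have r: "r < k" "h (e r 1) \<noteq> 0" using M by (auto simp: A_def r_def)
  have V: "h v = 0" if "v \<in> V (Suc r)" for v
  proof (rule zero[of "Suc r"])
    show "h (e i 1) = 0" if "Suc r \<le> i" "i < k" for i
    proof (rule ccontr)
      assume "h (e i 1) \<noteq> 0"
      hence "i \<le> r" unfolding r_def using that(2) by (intro Max_ge[OF fA]) (simp add: A_def)
      thus False using that(1) by simp
    qed
  qed (use r that in auto)
  show ?thesis
  proof (rule that[OF r V])
    fix x
    define v where "v = inv (trunc r x) \<otimes> x"
    have v: "v \<in> V r" "v r = x r" using trunc_decomp[of r x] by (auto simp: v_def)
    have "h x = h (trunc r x) + h v" using h(2)[of "trunc r x" v] by (simp add: v_def)
    also have "h v = h (e r (v r)) + h (inv (e r (v r)) \<otimes> v)"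
      using h(2)[of "e r (v r)" "inv (e r (v r)) \<otimes> v"] by simp
    also have "h (inv (e r (v r)) \<otimes> v) = 0" by (rule V[OF V_decomp[OF v(1)]])
    also have "h (e r (v r)) = v r * h (e r 1)" by (rule scale[OF V])
    also have "h (trunc r x) + (v r * h (e r 1) + 0) = h (trunc r x) + h (e r 1) * x r" using v(2) by simp
    finally show "h x = h (trunc r x) + h (e r 1) * x r" .
  qed
qed

end

text \<open>The kernel of \<open>h\<close> in the coordinates \<open>y\<close>: the coordinate \<open>r\<close> is determined by the lower ones, and the
  scaling by powers of \<open>N\<close> makes the group law integral again.\<close>

locale kernel = tower +
  fixes h :: "(nat \<Rightarrow> real) \<Rightarrow> real" and r N :: nat
  assumes h_alg: "alg \<rat> {..<k} h" and h_op: "h (x \<otimes> y) = h x + h y"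
    and r: "0 < r" "r < k" and h_r: "h (e r 1) \<noteq> 0" and h_decomp: "h x = h (trunc r x) + h (e r 1) * x r"
    and N_pos: "N > 0"
    and N_p: "i < k \<Longrightarrow> \<forall>j<i. x j / real N ^ Suc m \<in> \<int> \<and> y j / real N ^ Suc m \<in> \<int> \<Longrightarrow> p i x y / real N ^ m \<in> \<int>"
    and N_h: "\<forall>j<r. x j / real N ^ Suc m \<in> \<int> \<Longrightarrow> h (trunc r x) / h (e r 1) / real N ^ m \<in> \<int>"
begin

definition sig :: "nat \<Rightarrow> nat" where "sig i = (if i < r then i else Suc i)"

text \<open>Two powers of N for each coordinate: one is lost when the coordinate r is computed from
  h, the other in the correction term p. Lower coordinates get higher powers because later ones
  depend on them.\<close>

definition scl :: "nat \<Rightarrow> real" where "scl i = real N ^ (2 * (k - i))"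

definition low :: "(nat \<Rightarrow> real) \<Rightarrow> nat \<Rightarrow> real" where "low y = (\<lambda>i. if i < r then scl i * y i else 0)"

definition iota :: "(nat \<Rightarrow> real) \<Rightarrow> nat \<Rightarrow> real" where
  "iota y = (\<lambda>i. if i < r then scl i * y i else if i = r then - h (low y) / h (e r 1) else scl (i - 1) * y (i - 1))"

definition proj :: "(nat \<Rightarrow> real) \<Rightarrow> nat \<Rightarrow> real" where "proj x = (\<lambda>i. x (sig i) / scl i)"

definition p' :: "nat \<Rightarrow> (nat \<Rightarrow> real) \<Rightarrow> (nat \<Rightarrow> real) \<Rightarrow> real" where
  "p' i y z = p (sig i) (iota y) (iota z) / scl i"

lemma scl_pos: "scl i > 0" using N_pos by (simp add: scl_def)

lemma iota_sig: "iota y (sig i) = scl i * y i"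
  by (auto simp: iota_def sig_def)

lemma trunc_iota: "trunc r (iota y) = low y"
  by (auto simp: trunc_def low_def iota_def)

lemma h_iota: "h (iota y) = 0"
  using h_decomp[of "iota y"] h_r unfolding trunc_iota by (simp add: iota_def)

lemma iota_proj:
  assumes "h x = 0"
  shows "iota (proj x) = x"
proof
  fix i
  have "low (proj x) = trunc r x" using scl_pos by (auto simp: low_def proj_def sig_def trunc_def less_imp_neq[symmetric])
  moreover have "x r = - h (trunc r x) / h (e r 1)" using assms h_decomp[of x] h_r by (simp add: field_simps)
  ultimately show "iota (proj x) i = x i"
    using scl_pos by (auto simp: iota_def proj_def sig_def less_imp_neq[symmetric])
qed

lemma p'_op: "(\<lambda>i. y i + z i + p' i y z) = proj (iota y \<otimes> iota z)"
  using scl_pos by (auto simp: p'_def proj_def op_apply iota_sig add_divide_distrib less_imp_neq[symmetric])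

lemma iota_p'_op: "iota (\<lambda>i. y i + z i + p' i y z) = iota y \<otimes> iota z"
  unfolding p'_op by (rule iota_proj) (simp add: h_op h_iota)

lemma iota_zero: "iota (\<lambda>_. 0) = \<one>"
proof -
  have "h \<one> = 0" using h_op[of \<one> \<one>] by simp
  moreover have "low (\<lambda>_. 0) = \<one>" by (auto simp: low_def unit_def)
  ultimately show ?thesis by (auto simp: iota_def unit_def)
qed

lemma alg_low_h:
  assumes "\<And>j. j < r \<Longrightarrow> alg \<rat> W (\<lambda>z. f z j)"
  shows "alg \<rat> W (\<lambda>z. h (low (f z)))"
proof -
  have "alg \<rat> W (\<lambda>z. low (f z) j)" for j
    unfolding low_def scl_def using assms by (cases "j < r") (auto intro!: alg_cmult alg_const)
  hence "alg \<rat> W (\<lambda>z. h (\<lambda>j. low (f z) j))" by (intro alg_subst[OF h_alg])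
  thus ?thesis by simp
qed

lemma h_e_Rats: "h (e r 1) \<in> \<rat>"
  by (rule alg_Rats[OF h_alg]) (simp add: e_def)

lemma alg_iota:
  assumes f: "\<And>j. j < i \<Longrightarrow> alg \<rat> W (\<lambda>z. f z j)" and j: "j < sig i"
  shows "alg \<rat> W (\<lambda>z. iota (f z) j)"
proof -
  consider "j < r" | "j = r" | "j > r" by linarith
  thus ?thesis
  proof cases
    case 1
    hence "j < i" using j by (auto simp: sig_def split: if_splits)
    thus ?thesis using 1 f by (auto simp: iota_def scl_def intro!: alg_cmult)
  next
    case 2
    hence "r \<le> i" using j by (auto simp: sig_def split: if_splits)
    hence "alg \<rat> W (\<lambda>z. (- 1 / h (e r 1)) * h (low (f z)))"
      using f h_e_Rats by (intro alg_cmult alg_low_h) (auto intro: Rats_divide)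
    thus ?thesis using 2 by (simp add: iota_def)
  next
    case 3
    hence "j - 1 < i" using j by (auto simp: sig_def split: if_splits)
    thus ?thesis using 3 f by (auto simp: iota_def scl_def intro!: alg_cmult)
  qed
qed

lemma pp_iota:
  assumes f: "\<And>j. j < k - 1 \<Longrightarrow> pp W (\<lambda>z. f z j)" and j: "j < k"
  shows "pp W (\<lambda>z. iota (f z) j)"
proof -
  consider "j < r" | "j = r" | "j > r" by linarith
  thus ?thesis
  proof cases
    case 1
    thus ?thesis using f r by (auto simp: iota_def intro!: pp_mult pp_const)
  next
    case 2
    have "pp W (\<lambda>z. low (f z) i)" for i
      unfolding low_def using f r by (cases "i < r") (auto intro!: pp_mult pp_const)
    hence "pp W (\<lambda>z. h (\<lambda>i. low (f z) i))" by (intro pp_alg_subst[OF h_alg])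
    hence "pp W (\<lambda>z. (- 1 / h (e r 1)) * h (low (f z)))" by (intro pp_mult pp_const) simp
    thus ?thesis using 2 by (simp add: iota_def)
  next
    case 3
    thus ?thesis using f j by (auto simp: iota_def intro!: pp_mult pp_const)
  qed
qed

lemma iota_dvd:
  assumes y: "\<And>j. y j \<in> \<int>" and j: "j < sig i" and i: "i < k"
  shows "iota y j / real N ^ Suc (2 * (k - i)) \<in> \<int>"
proof -
  have mult: "real N ^ b / real N ^ a \<in> \<int>" if "a \<le> b" for a b
    using N_pos that by (simp add: power_diff[symmetric])
  have scl: "scl l * y l / real N ^ (2 * (k - i) + 2) \<in> \<int>" if "l < i" for l
    using Ints_mult[OF mult[of "2 * (k - i) + 2" "2 * (k - l)"] y[of l]] that i by (simp add: scl_def)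
  have weaken: "z / real N ^ Suc m \<in> \<int> \<Longrightarrow> z / real N ^ m \<in> \<int>" for z m
    using Ints_mult[OF Ints_of_nat[of N], of "z / real N ^ Suc m"] N_pos by simp
  have scl1: "scl l * y l / real N ^ Suc (2 * (k - i)) \<in> \<int>" if "l < i" for l
    by (rule weaken) (use scl[OF that] in simp)
  consider "j < r" | "j = r" | "j > r" by linarith
  thus ?thesis
  proof cases
    case 1
    hence "j < i" using j by (auto simp: sig_def split: if_splits)
    thus ?thesis using 1 scl1 by (simp add: iota_def)
  next
    case 2
    hence ri: "r \<le> i" using j by (auto simp: sig_def split: if_splits)
    have "h (trunc r (iota y)) / h (e r 1) / real N ^ Suc (2 * (k - i)) \<in> \<int>"
    proof (rule N_h, intro allI impI)
      fix l assume "l < r"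
      thus "iota y l / real N ^ Suc (Suc (2 * (k - i))) \<in> \<int>" using scl[of l] ri by (simp add: iota_def)
    qed
    hence "- (h (low y) / h (e r 1) / real N ^ Suc (2 * (k - i))) \<in> \<int>" unfolding trunc_iota by (rule Ints_minus)
    thus ?thesis using 2 by (simp add: iota_def)
  next
    case 3
    hence "j - 1 < i" using j by (auto simp: sig_def split: if_splits)
    thus ?thesis using 3 scl1[of "j - 1"] by (simp add: iota_def)
  qed
qed

lemma iota_Gam:
  assumes "y \<in> Gam"
  shows "iota y \<in> Gam"
proof -
  have y: "y j \<in> \<int>" for j using assms by (simp add: Gam_def)
  have "iota y j \<in> \<int>" for j
  proof (cases "j = r")
    case True
    hence "iota y j / real N ^ Suc (2 * (k - r)) \<in> \<int>" using r by (intro iota_dvd y) (auto simp: sig_def)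
    hence "real (N ^ Suc (2 * (k - r))) * (iota y j / real N ^ Suc (2 * (k - r))) \<in> \<int>" by (intro Ints_mult Ints_of_nat)
    thus ?thesis using N_pos by simp
  next
    case False
    have "scl l * y l \<in> \<int>" for l unfolding scl_def using y by (intro Ints_mult) (auto simp flip: of_nat_power)
    thus ?thesis using False by (auto simp: iota_def)
  qed
  thus ?thesis by (simp add: Gam_def)
qed

sublocale sub: tower "k - 1" p'
proof
  show "alg \<rat> (Inl ` {..<i} \<union> Inr ` {..<i}) (\<lambda>z. p' i (\<lambda>j. z (Inl j)) (\<lambda>j. z (Inr j)))" if i: "i < k - 1" for i
  proof -
    let ?W = "Inl ` {..<i} \<union> Inr ` {..<i} :: (nat + nat) set"
    have "alg \<rat> ?W (\<lambda>z. p (sig i) (iota (\<lambda>j. z (Inl j))) (iota (\<lambda>j. z (Inr j))))"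
    proof (rule alg_p)
      show "sig i < k" using i by (auto simp: sig_def)
      show "alg \<rat> ?W (\<lambda>z. iota (\<lambda>j. z (Inl j)) j)" if "j < sig i" for j
        by (rule alg_iota[OF _ that]) (auto intro: alg_var)
      show "alg \<rat> ?W (\<lambda>z. iota (\<lambda>j. z (Inr j)) j)" if "j < sig i" for j
        by (rule alg_iota[OF _ that]) (auto intro: alg_var)
    qed
    from alg_cmult[OF this, of "1 / scl i"] show ?thesis by (simp add: p'_def scl_def)
  qed
  show "p' i x y = 0" if "i \<ge> k - 1" for i x y
    unfolding p'_def using that r by (subst p_beyond) (auto simp: sig_def)
  show "p' i x (\<lambda>_. 0) = 0" for i x
    unfolding p'_def iota_zero by (simp add: unit_def p_zero_right)
  show "p' i (\<lambda>_. 0) x = 0" for i x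
    unfolding p'_def iota_zero by (simp add: unit_def p_zero_left)
  show "(\<lambda>i. (x i + y i + p' i x y) + z i + p' i (\<lambda>i. x i + y i + p' i x y) z) =
       (\<lambda>i. x i + (y i + z i + p' i y z) + p' i x (\<lambda>i. y i + z i + p' i y z))" for x y z
    unfolding p'_op[of "\<lambda>i. x i + y i + p' i x y" z] p'_op[of x "\<lambda>i. y i + z i + p' i y z"] iota_p'_op
    by (simp add: op_assoc)
  show "p' i x y \<in> \<int>" if x: "\<And>j. x j \<in> \<int>" and y: "\<And>j. y j \<in> \<int>" for i x y
  proof (cases "i < k - 1")
    case True
    thus ?thesis unfolding p'_def scl_def using iota_dvd[OF x, of _ i] iota_dvd[OF y, of _ i] by (intro N_p) (auto simp: sig_def)
  next
    case False
    thus ?thesis unfolding p'_def using r by (subst p_beyond) (auto simp: sig_def)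
  qed
  show "k - 1 > 0" using r by simp
qed

lemma iota_op: "iota (sub.op y z) = iota y \<otimes> iota z"
  unfolding sub.op_def by (rule iota_p'_op)

lemma iota_pow: "iota (sub.pow y n) = pow (iota y) n"
  by (induction n) (simp_all add: iota_op iota_zero sub.unit_def)

text \<open>\<open>iota\<close> maps the lattice of the kernel into \<open>Gam\<close>, so reducing
  inside the kernel does not change the coset in the larger group.\<close>

lemma iota_red:
  "red (a \<otimes> iota (sub.red y)) = red (a \<otimes> iota y)"
proof -
  obtain b where b: "b \<in> sub.Gam" "sub.red y = sub.op y b" using sub.red_coset by blast
  have "iota b \<in> Gam" using b(1) by (intro iota_Gam) (simp add: sub.Gam_def Gam_def)
  thus ?thesis using red_right[of "iota b" "a \<otimes> iota y"] b(2) by (simp add: iota_op op_assoc)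
qed

end

text \<open>If the orbit is not generic, a relation removes a coordinate r with 0 < r < k. For k = 1
  there is none, so the induction ends with a generic orbit.\<close>

theorem tower_pp:
  assumes "tower k p" "g 0 = 1" "pp {..<k} f"
  shows "\<exists>z. uniform_mean (\<lambda>n. f (tower.red p (tower.pow p g n))) z"
  using assms
proof (induction k arbitrary: p g f rule: less_induct)
  case (less k)
  interpret tower k p by (rule less.prems(1))
  show ?case
  proof (cases "generic_orbit_axioms k p g")
    case True
    interpret generic_orbit k p g using less.prems(1) True by (rule generic_orbit.intro)
    \<comment> \<open>Along the orbit the reduced coordinate 0 is 0, and \<open>mean_pp\<close>
      admits only functions of the coordinates from 1 on.\<close>
    define f' where "f' v = f (v(0 := 0))" for v
    have "pp {1..<k} (\<lambda>v. f (\<lambda>i. (v(0 := 0)) i))"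
    proof (rule pp_subst[OF less.prems(3)])
      show "pp {1..<k} (\<lambda>v. (v(0 := 0)) i)" if "i \<in> {..<k}" for i
        using that by (cases "i = 0") (auto intro: pp_const pp_var)
    qed
    moreover have "(\<lambda>v. f (\<lambda>i. (v(0 := 0)) i)) = f'" by (simp only: f'_def[abs_def] fun_upd_def)
    ultimately have f': "pp {1..<k} f'" by (simp only:)
    have "f' (red (orb unit n)) = f (red (pow g n))" for n
    proof -
      have "red (pow g n) 0 = 0" using red_G0[OF G0_pow[OF g_G0]] by simp
      hence "(red (pow g n))(0 := 0) = red (pow g n)" by (metis fun_upd_triv)
      thus ?thesis by (simp add: f'_def)
    qed
    thus ?thesis using mean_pp[OF f' unit_G0] by simp
  next
    case False
    then obtain h x0 where h: "alg \<rat> {..<k} h" "\<And>x y. h (op x y) = h x + h y" "h g = 0" "h x0 \<noteq> 0"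
      using less.prems(2) unfolding generic_orbit_axioms_def by blast
    obtain r where r: "r < k" "h (e r 1) \<noteq> 0" "\<And>v. v \<in> V (Suc r) \<Longrightarrow> h v = 0"
      "\<And>x. h x = h (trunc r x) + h (e r 1) * x r"
      by (rule hom_last_coordinate[OF h(1,2,4)], rule that)
    \<comment> \<open>For r = 0, h would be a nonzero multiple of coordinate 0, which is 1 at
      g.\<close>
    have r0: "0 < r"
    proof (rule ccontr)
      assume "\<not> 0 < r"
      hence "h g = h (trunc 0 g) + h (e r 1) * g 0" using r(4)[of g] by simp
      moreover have "trunc 0 g = unit" by (simp add: trunc_def unit_def)
      moreover have "h unit = 0" using h(2)[of unit unit] by simp
      ultimately show False using h(3) r(2) less.prems(2) by simp
    qed
    have h1Q: "h (e r 1) \<in> \<rat>" by (rule alg_Rats[OF h(1)]) (simp add: e_def)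
    have "alg \<rat> {..<r} (\<lambda>x. h (\<lambda>i. trunc r x i))"
    proof (rule alg_subst[OF h(1)])
      show "alg \<rat> {..<r} (\<lambda>x. trunc r x i)" for i
        by (cases "i < r") (auto simp: trunc_def intro: alg_var alg_const)
    qed
    from alg_cmult[OF this, of "1 / h (e r 1)"] have "alg \<rat> {..<r} (\<lambda>x. h (trunc r x) / h (e r 1))"
      using h1Q by (simp add: Rats_divide)
    moreover have "h (trunc r (\<lambda>_. 0)) / h (e r 1) = 0"
    proof -
      have "trunc r (\<lambda>_. 0) = unit" by (simp add: trunc_def unit_def)
      moreover have "h unit = 0" using h(2)[of unit unit] by simp
      ultimately show ?thesis by simp
    qed
    ultimately have "\<exists>D::nat. D > 0 \<and> (\<forall>N::nat. N > 0 \<longrightarrow> D dvd N \<longrightarrow> (\<forall>m x.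
       (\<forall>v\<in>{..<r}. x v / real N ^ Suc m \<in> \<int>) \<longrightarrow> h (trunc r x) / h (e r 1) / real N ^ m \<in> \<int>))"
      by (rule alg_denominator_dvd)
    then obtain Dh :: nat where Dh': "Dh > 0 \<and> (\<forall>N::nat. N > 0 \<longrightarrow> Dh dvd N \<longrightarrow> (\<forall>m x.
       (\<forall>v\<in>{..<r}. x v / real N ^ Suc m \<in> \<int>) \<longrightarrow> h (trunc r x) / h (e r 1) / real N ^ m \<in> \<int>))" ..
    note Dh = Dh'[THEN conjunct1] Dh'[THEN conjunct2, rule_format]
    have "\<forall>i\<in>{..<k}. \<exists>D::nat. D > 0 \<and> (\<forall>N>0. D dvd N \<longrightarrow> (\<forall>m z. (\<forall>v\<in>Inl ` {..<i} \<union> Inr ` {..<i}. z v / real N ^ Suc m \<in> \<int>) \<longrightarrow>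
        p i (\<lambda>j. z (Inl j)) (\<lambda>j. z (Inr j)) / real N ^ m \<in> \<int>))"
      by (intro ballI alg_denominator_dvd[OF p_alg]) (auto simp: p_zero_left)
    from bchoice[OF this] obtain Dp :: "nat \<Rightarrow> nat" where "\<forall>i\<in>{..<k}. Dp i > 0 \<and> (\<forall>N>0. Dp i dvd N \<longrightarrow>
      (\<forall>m z. (\<forall>v\<in>Inl ` {..<i} \<union> Inr ` {..<i}. z v / real N ^ Suc m \<in> \<int>) \<longrightarrow>
        p i (\<lambda>j. z (Inl j)) (\<lambda>j. z (Inr j)) / real N ^ m \<in> \<int>))" ..
    hence Dp: "Dp i > 0" "\<And>N m z. N > 0 \<Longrightarrow> Dp i dvd N \<Longrightarrow> (\<forall>v\<in>Inl ` {..<i} \<union> Inr ` {..<i}. z v / real N ^ Suc m \<in> \<int>) \<Longrightarrow>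
        p i (\<lambda>j. z (Inl j)) (\<lambda>j. z (Inr j)) / real N ^ m \<in> \<int>" if "i < k" for i
      using that by auto
    define N where "N = Dh * (\<Prod>i<k. Dp i)"
    have N0: "N > 0" using Dh(1) Dp(1) by (auto simp: N_def)
    have NDp: "Dp i dvd N" if "i < k" for i
      unfolding N_def by (rule dvd_mult, rule dvd_prodI) (use that in simp_all)
    interpret kernel k p h r N
    proof (rule kernel.intro[OF less.prems(1)], unfold_locales)
      show "p i x y / real N ^ m \<in> \<int>" if "i < k" "\<forall>j<i. x j / real N ^ Suc m \<in> \<int> \<and> y j / real N ^ Suc m \<in> \<int>" for i x y m
      proof -
        have "\<forall>v\<in>Inl ` {..<i} \<union> Inr ` {..<i}. case_sum x y v / real N ^ Suc m \<in> \<int>" using that(2) by auto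
        from Dp(2)[OF that(1) N0 NDp[OF that(1)] this] show ?thesis by simp
      qed
      show "h (trunc r x) / h (e r 1) / real N ^ m \<in> \<int>" if "\<forall>j<r. x j / real N ^ Suc m \<in> \<int>" for x m
        by (rule Dh(2)[OF N0]) (use that in \<open>auto simp: N_def\<close>)
    qed (fact h(1) h(2) r0 r(1) r(2) r(4) N0)+
    define g1 where "g1 = proj g"
    \<comment> \<open>This is the scaling of coordinate 0, so g1 has 1 / E there and its E-th power
      has 1 again. The exponent n is therefore treated in residue classes modulo E.\<close>
    define E where "E = N ^ (2 * k)"
    define g2 where "g2 = sub.pow g1 E"
    have E0: "E > 0" using N0 by (simp add: E_def)
    have iota_g1: "iota g1 = g" unfolding g1_def by (rule iota_proj[OF h(3)])
    have "g1 0 = 1 / real E" using r0 less.prems(2) by (simp add: g1_def proj_def sig_def scl_def E_def)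
    hence g2: "g2 0 = 1" using E0 by (simp add: g2_def sub.pow_first)
    obtain C where C: "\<And>v. v \<in> cube \<Longrightarrow> \<bar>f v\<bar> \<le> C" using pp_bounded[OF less.prems(3)] by blast
    have "\<exists>z. uniform_mean (\<lambda>n. f (red (pow g (E * n + j)))) z" for j
    proof -
      \<comment> \<open>The offset g^j and the embedding of the kernel are absorbed into the
        function, which stays piecewise polynomial, now in k - 1 coordinates.\<close>
      define F where "F v = f (red (op (pow g j) (iota v)))" for v
      have "pp {..<k - 1} (\<lambda>v. red (op (pow g j) (iota v)) i)" if "i < k" for i
      proof (rule pp_red[OF _ that])
        show "pp {..<k - 1} (\<lambda>v. (op (pow g j) (iota v)) i)" if "i < k" for i
          using that by (intro pp_op pp_const pp_iota pp_var) auto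
      qed
      hence "pp {..<k - 1} (\<lambda>v. f (\<lambda>i. red (op (pow g j) (iota v)) i))" by (intro pp_subst[OF less.prems(3)]) auto
      hence F: "pp {..<k - 1} F" by (simp only: F_def[abs_def])
      have "\<exists>z. uniform_mean (\<lambda>n. F (sub.red (sub.pow g2 n))) z"
      proof (rule less.IH)
        show "k - 1 < k" using r by simp
        show "tower (k - 1) p'" by (rule sub.tower_axioms)
      qed (fact g2 F)+
      moreover have "F (sub.red (sub.pow g2 n)) = f (red (pow g (E * n + j)))" for n
      proof -
        have "iota (sub.pow g2 n) = pow g (E * n)"
          by (simp add: g2_def iota_pow iota_g1 pow_mult)
        moreover have "op (pow g j) (pow g (E * n)) = pow g (E * n + j)"
          using pow_add[of g j "E * n"] by (simp add: add.commute)
        ultimately show ?thesis by (simp add: F_def iota_red)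
      qed
      ultimately show ?thesis by simp
    qed
    hence "\<forall>j. \<exists>z. uniform_mean (\<lambda>n. f (red (pow g (E * n + j)))) z" by blast
    from choice[OF this] obtain z where z: "\<forall>j. uniform_mean (\<lambda>n. f (red (pow g (E * n + j)))) (z j)" ..
    have "norm (f (red (pow g n))) \<le> C" for n
      using C[of "red (pow g n)"] red_bounds by (simp add: cube_def less_imp_le)
    from uniform_mean_progressions[OF E0 z[rule_format] this] show ?thesis by blast
  qed
qed

subsection \<open>Unitriangular matrices\<close>

text \<open>Matrices are functions of which only the entries with indices below \<open>m\<close> matter.\<close>

definition mm :: "nat \<Rightarrow> (nat \<Rightarrow> nat \<Rightarrow> real) \<Rightarrow> (nat \<Rightarrow> nat \<Rightarrow> real) \<Rightarrow> nat \<Rightarrow> nat \<Rightarrow> real" where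
  "mm m A B i j = (\<Sum>l<m. A i l * B l j)"

definition unitri :: "nat \<Rightarrow> (nat \<Rightarrow> nat \<Rightarrow> real) \<Rightarrow> bool" where
  "unitri m A \<longleftrightarrow> (\<forall>i<m. A i i = 1) \<and> (\<forall>i<m. \<forall>j<i. A i j = 0)"

lemma mm_assoc: "mm m (mm m A B) C i j = mm m A (mm m B C) i j"
proof -
  have "mm m (mm m A B) C i j = (\<Sum>l<m. \<Sum>l'<m. A i l' * B l' l * C l j)" by (simp add: mm_def sum_distrib_right)
  also have "\<dots> = (\<Sum>l'<m. \<Sum>l<m. A i l' * B l' l * C l j)" by (rule sum.swap)
  finally show ?thesis by (simp add: mm_def sum_distrib_left mult.assoc)
qed

lemma mm_unitri:
  assumes "unitri m A" "unitri m B" "i < m" "j < m" "j \<le> i"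
  shows "mm m A B i j = (if i = j then 1 else 0)"
proof -
  have z: "A i l * B l j = 0" if "l < m" "l \<noteq> i" for l
    using assms that by (cases "l < i") (auto simp: unitri_def)
  have "mm m A B i j = (\<Sum>l\<in>{i}. A i l * B l j)"
    unfolding mm_def using assms(3) z by (intro sum.mono_neutral_right) auto
  thus ?thesis using assms by (auto simp: unitri_def)
qed

text \<open>The Kronecker product. Pairs of indices are coded lexicographically by quotient and
  remainder, so that unitriangularity is preserved.\<close>

definition kron :: "nat \<Rightarrow> (nat \<Rightarrow> nat \<Rightarrow> real) \<Rightarrow> (nat \<Rightarrow> nat \<Rightarrow> real) \<Rightarrow> nat \<Rightarrow> nat \<Rightarrow> real" where
  "kron m' A B i j = A (i div m') (j div m') * B (i mod m') (j mod m')"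

lemma sum_div_mod:
  fixes f :: "nat \<Rightarrow> nat \<Rightarrow> 'a::comm_monoid_add"
  shows "(\<Sum>t<m * m'. f (t div m') (t mod m')) = (\<Sum>a<m. \<Sum>b<m'. f a b)"
  by (simp add: sum_mult_product)

lemma div_mod_less:
  assumes "(t::nat) < m * m'"
  shows "t div m' < m" "t mod m' < m'"
  using assms by (auto simp: less_mult_imp_div_less intro!: mod_less_divisor gr0I)

lemma div_mod_order:
  assumes "(i::nat) < j"
  shows "i div m < j div m \<or> (i div m = j div m \<and> i mod m < j mod m)"
proof -
  have "i div m \<le> j div m" using assms by (intro div_le_mono) simp
  moreover have "i mod m < j mod m" if "i div m = j div m"
    using assms that div_mult_mod_eq[of i m] div_mult_mod_eq[of j m] by (metis nat_add_left_cancel_less)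
  ultimately show ?thesis by linarith
qed

lemma mm_kron: "mm (m * m') (kron m' A B) (kron m' C D) = kron m' (mm m A C) (mm m' B D)"
proof (intro ext)
  fix i j
  have "mm (m * m') (kron m' A B) (kron m' C D) i j = (\<Sum>a<m. \<Sum>b<m'. (A (i div m') a * C a (j div m')) * (B (i mod m') b * D b (j mod m')))"
    unfolding mm_def kron_def by (subst sum_div_mod[symmetric]) (simp add: mult_ac)
  thus "mm (m * m') (kron m' A B) (kron m' C D) i j = kron m' (mm m A C) (mm m' B D) i j"
    by (simp add: mm_def kron_def sum_product)
qed

lemma unitri_kron:
  assumes A: "unitri m A" and B: "unitri m' B"
  shows "unitri (m * m') (kron m' A B)"
  unfolding unitri_def
proof (intro conjI allI impI)
  fix i assume i: "i < m * m'"
  note d = div_mod_less[OF i]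
  show "kron m' A B i i = 1" using A B d by (simp add: unitri_def kron_def)
  fix j assume "j < i"
  from div_mod_order[OF this, of m'] show "kron m' A B i j = 0" using A B d by (auto simp: unitri_def kron_def)
qed

text \<open>The block matrix with rows (1, r) and (0, A).\<close>

definition bord :: "(nat \<Rightarrow> real) \<Rightarrow> (nat \<Rightarrow> nat \<Rightarrow> real) \<Rightarrow> nat \<Rightarrow> nat \<Rightarrow> real" where
  "bord r A i j = (case i of 0 \<Rightarrow> (case j of 0 \<Rightarrow> 1 | Suc j \<Rightarrow> r j) | Suc i \<Rightarrow> (case j of 0 \<Rightarrow> 0 | Suc j \<Rightarrow> A i j))"

lemma mm_bord: "mm (Suc m) (bord r A) (bord s B) = bord (\<lambda>j. s j + (\<Sum>l<m. r l * B l j)) (mm m A B)"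
  by (intro ext) (auto simp: mm_def bord_def sum.lessThan_Suc_shift simp del: sum.lessThan_Suc split: nat.split)

lemma unitri_bord: "unitri m A \<Longrightarrow> unitri (Suc m) (bord r A)"
  by (auto simp: unitri_def bord_def split: nat.split)

subsection \<open>Generalized polynomials along unipotent orbits\<close>

text \<open>An orbit \<open>X n\<close> of the unipotent matrix \<open>G\<close>, together with integral \<open>W n\<close> moving \<open>X n\<close> to a
  representative of its coset with entries in the unit interval.\<close>

definition reduced_orbit :: "nat \<Rightarrow> (nat \<Rightarrow> nat \<Rightarrow> real) \<Rightarrow> (nat \<Rightarrow> nat \<Rightarrow> nat \<Rightarrow> real) \<Rightarrow> (nat \<Rightarrow> nat \<Rightarrow> nat \<Rightarrow> real) \<Rightarrow> bool" where
  "reduced_orbit m G X W \<longleftrightarrow> m > 0 \<and> unitri m G \<and>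
    (\<forall>n. unitri m (X n) \<and> unitri m (W n) \<and>
      (\<forall>i<m. \<forall>j<m. X (Suc n) i j = mm m G (X n) i j \<and> W n i j \<in> \<int>) \<and>
      (\<forall>j<m. \<forall>i<j. 0 \<le> mm m (X n) (W n) i j \<and> mm m (X n) (W n) i j < 1))"

text \<open>An entry above the diagonal is an entry of V above its diagonal times a factor at most
  1, or a diagonal entry 1 of V times an entry of V' above its diagonal; both lie in [0, 1).\<close>

lemma reduced_orbit_kron:
  assumes 1: "reduced_orbit m G X W" and 2: "reduced_orbit m' G' X' W'"
  shows "reduced_orbit (m * m') (kron m' G G') (\<lambda>n. kron m' (X n) (X' n)) (\<lambda>n. kron m' (W n) (W' n))"
  unfolding reduced_orbit_def
proof (intro conjI allI impI)
  note d1 = 1[unfolded reduced_orbit_def] and d2 = 2[unfolded reduced_orbit_def]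
  show "0 < m * m'" "unitri (m * m') (kron m' G G')" using d1 d2 by (auto intro: unitri_kron)
  fix n
  show "unitri (m * m') (kron m' (X n) (X' n))" "unitri (m * m') (kron m' (W n) (W' n))"
    using d1 d2 by (auto intro: unitri_kron)
  fix j assume j: "j < m * m'"
  note dj = div_mod_less[OF j]
  {
    fix i assume i: "i < m * m'"
    note di = div_mod_less[OF i]
    show "kron m' (X (Suc n)) (X' (Suc n)) j i = mm (m * m') (kron m' G G') (kron m' (X n) (X' n)) j i"
      unfolding mm_kron using d1 d2 di dj by (simp add: kron_def)
    show "kron m' (W n) (W' n) j i \<in> \<int>" using d1 d2 di dj by (simp add: kron_def)
  }
  fix i assume ij: "i < j"
  hence i: "i < m * m'" using j by simp
  note di = div_mod_less[OF i]
  define V V' where "V = mm m (X n) (W n)" and "V' = mm m' (X' n) (W' n)"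
  have lt: "0 \<le> V a b \<and> V a b < 1" if "a < b" "b < m" for a b using d1 that by (simp add: V_def)
  have lt': "0 \<le> V' a b \<and> V' a b < 1" if "a < b" "b < m'" for a b using d2 that by (simp add: V'_def)
  have eq: "V a a = 1" if "a < m" for a using d1 that mm_unitri[of m "X n" "W n" a a] by (simp add: V_def)
  have le': "0 \<le> V' a b \<and> V' a b \<le> 1" if "a < m'" "b < m'" for a b
  proof (cases "a < b")
    case True
    thus ?thesis using lt'[of a b] that by simp
  next
    case False
    thus ?thesis using d2 that mm_unitri[of m' "X' n" "W' n" a b] by (simp add: V'_def)
  qed
  have "0 \<le> kron m' V V' i j \<and> kron m' V V' i j < 1"
  proof (cases "i div m' < j div m'")
    case True
    let ?v = "V (i div m') (j div m')" and ?v' = "V' (i mod m') (j mod m')"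
    have v: "0 \<le> ?v" "?v < 1" "0 \<le> ?v'" "?v' \<le> 1" using lt[OF True dj(1)] le'[OF di(2) dj(2)] by auto
    have "?v * ?v' \<le> ?v * 1" using v by (intro mult_left_mono) auto
    thus ?thesis using v by (simp add: kron_def)
  next
    case False
    hence "i div m' = j div m'" "i mod m' < j mod m'" using div_mod_order[OF ij, of m'] by auto
    thus ?thesis using lt'[OF _ dj(2)] eq[OF dj(1)] by (simp add: kron_def)
  qed
  thus "0 \<le> mm (m * m') (kron m' (X n) (X' n)) (kron m' (W n) (W' n)) i j"
    "mm (m * m') (kron m' (X n) (X' n)) (kron m' (W n) (W' n)) i j < 1"
    unfolding mm_kron V_def V'_def by auto
qed

text \<open>The added row c of X is not changed by the translation. Multiplied by W it becomes Q,
  and the integral row - floor Q reduces it to frac Q: taking the integer part is a correction by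
  the lattice.\<close>

lemma reduced_orbit_floor:
  fixes c :: "nat \<Rightarrow> real"
  assumes "reduced_orbit m G X W"
  defines "Q \<equiv> \<lambda>n j. \<Sum>a<m. c a * W n a j"
  shows "reduced_orbit (Suc m) (bord (\<lambda>_. 0) G) (\<lambda>n. bord c (X n)) (\<lambda>n. bord (\<lambda>j. - of_int \<lfloor>Q n j\<rfloor>) (W n))"
    and "mm (Suc m) (bord c (X n)) (bord (\<lambda>j. - of_int \<lfloor>Q n j\<rfloor>) (W n)) 0 m = frac (Q n (m - 1))"
proof -
  note d = assms(1)[unfolded reduced_orbit_def]
  have V: "mm (Suc m) (bord c (X n)) (bord (\<lambda>j. - of_int \<lfloor>Q n j\<rfloor>) (W n)) = bord (\<lambda>j. frac (Q n j)) (mm m (X n) (W n))" for n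
    unfolding mm_bord by (simp add: frac_def Q_def add.commute)
  show "mm (Suc m) (bord c (X n)) (bord (\<lambda>j. - of_int \<lfloor>Q n j\<rfloor>) (W n)) 0 m = frac (Q n (m - 1))"
    unfolding V using d by (cases m) (auto simp: bord_def)
  show "reduced_orbit (Suc m) (bord (\<lambda>_. 0) G) (\<lambda>n. bord c (X n)) (\<lambda>n. bord (\<lambda>j. - of_int \<lfloor>Q n j\<rfloor>) (W n))"
    unfolding reduced_orbit_def V
    using d by (auto simp: mm_bord unitri_bord bord_def frac_lt_1 split: nat.split)
qed

text \<open>Generalized polynomials are read off from the integral matrices W, where the floors
  occur as entries. The last column is used because its bottom entry is 1, which supplies constants,
  and because Kronecker products multiply last columns.\<close>

definition represented :: "(nat \<Rightarrow> real) \<Rightarrow> bool" where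
  "represented Q \<longleftrightarrow> (\<exists>m G X W c. reduced_orbit m G X W \<and> (\<forall>n. Q n = (\<Sum>a<m. c a * W n a (m - 1))))"

lemma representedI: "reduced_orbit m G X W \<Longrightarrow> (\<And>n. Q n = (\<Sum>a<m. c a * W n a (m - 1))) \<Longrightarrow> represented Q"
  unfolding represented_def by blast

text \<open>The powers of a 2 x 2 unipotent matrix are integral and reduce to the identity, so W n
  is the inverse power and has the entry - n.\<close>

lemma represented_linear: "represented (\<lambda>n. c * real n + d)"
proof -
  define U :: "real \<Rightarrow> nat \<Rightarrow> nat \<Rightarrow> real" where "U t i j = (if i = j then 1 else if i < j then t else 0)" for t i j
  have mmU: "mm 2 (U s) (U t) i j = U (s + t) i j" if "i < 2" "j < 2" for i j s t
    using that by (auto simp: mm_def U_def numeral_2_eq_2 less_Suc_eq)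
  have tri: "unitri 2 (U t)" for t by (auto simp: unitri_def U_def)
  have "reduced_orbit 2 (U 1) (\<lambda>n. U (real n)) (\<lambda>n. U (- real n))"
    unfolding reduced_orbit_def by (auto simp: tri mmU) (auto simp: U_def)
  thus ?thesis
    by (rule representedI[where c = "\<lambda>a. if a = 0 then - c else d"]) (simp add: U_def numeral_2_eq_2)
qed

lemma represented_bilinear:
  assumes 1: "reduced_orbit m G X W" and 2: "reduced_orbit m' G' X' W'"
  shows "represented (\<lambda>n. \<Sum>a<m. \<Sum>b<m'. C a b * (W n a (m - 1) * W' n b (m' - 1)))"
proof (rule representedI[OF reduced_orbit_kron[OF 1 2]])
  have pos: "m > 0" "m' > 0" using 1 2 by (auto simp: reduced_orbit_def)
  have eq: "m * m' - 1 = (m' - 1) + (m - 1) * m'" using pos by (cases m; cases m') auto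
  have last: "(m * m' - 1) div m' = m - 1" unfolding eq using pos by (subst div_mult_self1) auto
  have last': "(m * m' - 1) mod m' = m' - 1" unfolding eq using pos by (subst mod_mult_self1) auto
  show "(\<Sum>a<m. \<Sum>b<m'. C a b * (W n a (m - 1) * W' n b (m' - 1))) =
      (\<Sum>t<m * m'. C (t div m') (t mod m') * kron m' (W n) (W' n) t (m * m' - 1))" for n
    unfolding kron_def last last' by (subst sum_div_mod[symmetric]) simp
qed

lemma represented_mult:
  assumes "represented Q" "represented Q'"
  shows "represented (\<lambda>n. Q n * Q' n)"
proof -
  obtain m G X W c where 1: "reduced_orbit m G X W" "\<And>n. Q n = (\<Sum>a<m. c a * W n a (m - 1))"
    using assms(1) unfolding represented_def by blast
  obtain m' G' X' W' c' where 2: "reduced_orbit m' G' X' W'" "\<And>n. Q' n = (\<Sum>a<m'. c' a * W' n a (m' - 1))"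
    using assms(2) unfolding represented_def by blast
  have "Q n * Q' n = (\<Sum>a<m. \<Sum>b<m'. (c a * c' b) * (W n a (m - 1) * W' n b (m' - 1)))" for n
    unfolding 1(2) 2(2) sum_product by (simp add: mult_ac)
  thus ?thesis using represented_bilinear[OF 1(1) 2(1), of "\<lambda>a b. c a * c' b"] by simp
qed

text \<open>A sum is written as the bilinear expression Q * 1 + 1 * Q', each 1 being the bottom
  entry of a last column.\<close>

lemma represented_add:
  assumes "represented Q" "represented Q'"
  shows "represented (\<lambda>n. Q n + Q' n)"
proof -
  obtain m G X W c where 1: "reduced_orbit m G X W" "\<And>n. Q n = (\<Sum>a<m. c a * W n a (m - 1))"
    using assms(1) unfolding represented_def by blast
  obtain m' G' X' W' c' where 2: "reduced_orbit m' G' X' W'" "\<And>n. Q' n = (\<Sum>a<m'. c' a * W' n a (m' - 1))"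
    using assms(2) unfolding represented_def by blast
  define C where "C a b = c a * of_bool (b = m' - 1) + of_bool (a = m - 1) * c' b" for a b
  have last: "W n (m - 1) (m - 1) = 1" "W' n (m' - 1) (m' - 1) = 1" "m - 1 < m" "m' - 1 < m'" for n
    using 1(1) 2(1) by (auto simp: reduced_orbit_def unitri_def)
  have "Q n + Q' n = (\<Sum>a<m. \<Sum>b<m'. C a b * (W n a (m - 1) * W' n b (m' - 1)))" for n
  proof -
    have "(\<Sum>a<m. \<Sum>b<m'. C a b * (W n a (m - 1) * W' n b (m' - 1))) =
      (\<Sum>a<m. \<Sum>b<m'. (c a * W n a (m - 1)) * (of_bool (b = m' - 1) * W' n b (m' - 1))) +
      (\<Sum>a<m. \<Sum>b<m'. (of_bool (a = m - 1) * W n a (m - 1)) * (c' b * W' n b (m' - 1)))"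
      by (simp add: C_def algebra_simps sum.distrib)
    also have "\<dots> = Q n * (\<Sum>b<m'. of_bool (b = m' - 1) * W' n b (m' - 1)) + (\<Sum>a<m. of_bool (a = m - 1) * W n a (m - 1)) * Q' n"
      unfolding 1(2) 2(2) sum_product by simp
    also have "(\<Sum>b<m'. of_bool (b = m' - 1) * W' n b (m' - 1)) = 1"
      using last by (subst sum.remove[of _ "m' - 1"]) auto
    also have "(\<Sum>a<m. of_bool (a = m - 1) * W n a (m - 1)) = 1"
      using last by (subst sum.remove[of _ "m - 1"]) auto
    finally show ?thesis by simp
  qed
  thus ?thesis using represented_bilinear[OF 1(1) 2(1), of C] by simp
qed

lemma represented_floor:
  assumes "represented Q"
  shows "represented (\<lambda>n. of_int \<lfloor>Q n\<rfloor>)"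
proof -
  obtain m G X W c where 1: "reduced_orbit m G X W" "\<And>n. Q n = (\<Sum>a<m. c a * W n a (m - 1))"
    using assms(1) unfolding represented_def by blast
  show ?thesis
  proof (rule representedI[OF reduced_orbit_floor(1)[OF 1(1), of c], where c = "\<lambda>a. if a = 0 then - 1 else 0"])
    have "m > 0" using 1(1) by (auto simp: reduced_orbit_def)
    thus "of_int \<lfloor>Q n\<rfloor> = (\<Sum>a<Suc m. (if a = 0 then - 1 else 0) * bord (\<lambda>j. - of_int \<lfloor>\<Sum>a<m. c a * W n a j\<rfloor>) (W n) a (Suc m - 1))" for n
      by (cases m) (auto simp: bord_def 1(2) sum.lessThan_Suc_shift simp del: sum.lessThan_Suc)
  qed
qed

lemma represented_generalized_polynomial: "generalized_polynomial Q \<Longrightarrow> represented Q"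
proof (induction rule: generalized_polynomial.induct)
  case (poly p)
  show ?case
  proof (induction p)
    case 0
    show ?case using represented_linear[of 0 0] by simp
  next
    case (pCons a p)
    from represented_add[OF represented_linear[of 0 a] represented_mult[OF represented_linear[of 1 0] pCons.IH]]
    show ?case by simp
  qed
qed (blast intro: represented_floor represented_add represented_mult)+

subsection \<open>Unitriangular matrices in tower coordinates\<close>

text \<open>The entry \<open>(i, j)\<close> above the diagonal has the coordinate \<open>(j - i) * m + i\<close>, so that the diagonals
  are listed by their distance from the main one. The remaining coordinates are additive; among them is
  the coordinate 0.\<close>

definition mx :: "nat \<Rightarrow> (nat \<Rightarrow> real) \<Rightarrow> nat \<Rightarrow> nat \<Rightarrow> real" where
  "mx m x i j = (if i = j then 1 else if i < j \<and> j < m then x ((j - i) * m + i) else 0)"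

definition mp :: "nat \<Rightarrow> nat \<Rightarrow> (nat \<Rightarrow> real) \<Rightarrow> (nat \<Rightarrow> real) \<Rightarrow> real" where
  "mp m t x y = (let i = t mod m; j = i + t div m in
     if j < m then \<Sum>l\<in>{i<..<j}. x ((l - i) * m + i) * y ((j - l) * m + l) else 0)"

lemma mx_coordinate:
  assumes "t div m > 0" "t mod m + t div m < m"
  shows "mx m x (t mod m) (t mod m + t div m) = x t"
  using assms by (simp add: mx_def)

lemma mp_entry:
  assumes "i < j" "j < m"
  shows "mp m ((j - i) * m + i) x y = (\<Sum>l\<in>{i<..<j}. x ((l - i) * m + i) * y ((j - l) * m + l))"
  using assms by (simp add: mp_def Let_def)

lemma mx_op:
  assumes ij: "i < m" "j < m"
  shows "mx m (\<lambda>t. x t + y t + mp m t x y) i j = mm m (mx m x) (mx m y) i j"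
proof (cases "i < j")
  case True
  have "mm m (mx m x) (mx m y) i j = (\<Sum>l\<in>{i..j}. mx m x i l * mx m y l j)"
    unfolding mm_def using ij by (intro sum.mono_neutral_right) (auto simp: mx_def)
  also have "{i..j} = insert i (insert j {i<..<j})" using True by auto
  also have "(\<Sum>l\<in>\<dots>. mx m x i l * mx m y l j) = mx m y i j + mx m x i j + (\<Sum>l\<in>{i<..<j}. mx m x i l * mx m y l j)"
    using True by (simp add: mx_def)
  also have "(\<Sum>l\<in>{i<..<j}. mx m x i l * mx m y l j) = (\<Sum>l\<in>{i<..<j}. x ((l - i) * m + i) * y ((j - l) * m + l))"
    using ij by (intro sum.cong) (auto simp: mx_def)
  also have "mx m y i j + mx m x i j + \<dots> = mx m (\<lambda>t. x t + y t + mp m t x y) i j"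
    using True ij mp_entry[OF True ij(2), of x y] by (simp add: mx_def)
  finally show ?thesis by (rule sym)
next
  case False
  have "unitri m (mx m x)" "unitri m (mx m y)" by (auto simp: unitri_def mx_def)
  from mm_unitri[OF this ij] show ?thesis using False by (auto simp: mx_def)
qed

lemma coordinate_cases:
  obtains "t div m > 0" "t mod m + t div m < m" | "\<And>x y. mp m t x y = 0"
  by (cases "t div m > 0 \<and> t mod m + t div m < m") (auto simp: mp_def Let_def)

text \<open>The correction to an entry involves only entries strictly closer to the diagonal, which
  have smaller coordinates. Associativity is that of matrix multiplication, as all other coordinates
  are additive.\<close>

lemma tower_matrix:
  assumes m: "m > 0"
  shows "tower (m * m) (mp m)"
proof unfold_locales
  show "m * m > 0" using m by simp
  show "mp m t x y = 0" if "m * m \<le> t" for t x y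
  proof -
    have "m \<le> t div m" using that m by (simp add: less_eq_div_iff_mult_less_eq)
    thus ?thesis by (simp add: mp_def Let_def)
  qed
  show "mp m t x (\<lambda>_. 0) = 0" "mp m t (\<lambda>_. 0) y = 0" for t x y
    by (simp_all add: mp_def Let_def)
  show "mp m t x y \<in> \<int>" if "\<And>j. x j \<in> \<int>" "\<And>j. y j \<in> \<int>" for t x y
    using that by (auto simp: mp_def Let_def)
  show "alg \<rat> (Inl ` {..<t} \<union> Inr ` {..<t}) (\<lambda>z. mp m t (\<lambda>j. z (Inl j)) (\<lambda>j. z (Inr j)))" for t
  proof (cases "t mod m + t div m < m")
    case True
    let ?i = "t mod m" and ?j = "t mod m + t div m"
    have t: "t = t div m * m + ?i" by simp
    have less: "(l - ?i) * m + ?i < t" "(?j - l) * m + l < t" if "?i < l" "l < ?j" for l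
    proof -
      have "(l - ?i) * m < t div m * m" using that m by simp
      thus "(l - ?i) * m + ?i < t" using t by linarith
      have "Suc (?j - l) \<le> t div m" using that by linarith
      hence "Suc (?j - l) * m \<le> t div m * m" by (rule mult_le_mono1)
      moreover have "Suc (?j - l) * m = m + (?j - l) * m" by simp
      moreover have "l < m" using that True by linarith
      ultimately show "(?j - l) * m + l < t" using t by linarith
    qed
    have "alg \<rat> (Inl ` {..<t} \<union> Inr ` {..<t}) (\<lambda>z. \<Sum>l\<in>{?i<..<?j}. z (Inl ((l - ?i) * m + ?i)) * z (Inr ((?j - l) * m + l)))"
      by (intro alg_sum alg_mult alg_var) (use less in auto)
    thus ?thesis using True by (simp add: mp_def Let_def)
  qed (simp add: mp_def Let_def alg_const)
  fix x y z
  let ?op = "\<lambda>x y t. x t + y t + mp m t x y"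
  show "?op (?op x y) z = ?op x (?op y z)"
  proof
    fix t
    show "?op (?op x y) z t = ?op x (?op y z) t"
    proof (cases rule: coordinate_cases[of t m])
      case 1
      let ?i = "t mod m" and ?j = "t mod m + t div m"
      have ij: "?i < m" "?j < m" using 1 m by auto
      have eq: "?op u v t = mm m (mx m u) (mx m v) ?i ?j" for u v
        using mx_op[OF ij, of u v] mx_coordinate[OF 1, of "?op u v"] by simp
      have "?op (?op x y) z t = mm m (mx m (?op x y)) (mx m z) ?i ?j" by (rule eq)
      also have "\<dots> = mm m (mm m (mx m x) (mx m y)) (mx m z) ?i ?j"
        unfolding mm_def[of m _ "mx m z"] by (intro sum.cong refl) (simp add: mx_op[OF ij(1)])
      also have "\<dots> = mm m (mx m x) (mm m (mx m y) (mx m z)) ?i ?j" by (rule mm_assoc)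
      also have "\<dots> = mm m (mx m x) (mx m (?op y z)) ?i ?j"
        unfolding mm_def[of m "mx m x"] by (intro sum.cong refl) (simp add: mx_op[OF _ ij(2)])
      also have "\<dots> = ?op x (?op y z) t" by (rule eq[symmetric])
      finally show ?thesis .
    qed simp
  qed
qed

section \<open>Matrix orbits as orbits in a tower\<close>

context tower
begin

lemma pow_conj: "pow (conj x v) n = conj x (pow v n)"
  by (induction n) (simp_all add: conj_op)

lemma red_eq:
  assumes "g \<in> Gam" "\<And>i. 0 \<le> (x \<otimes> g) i \<and> (x \<otimes> g) i < 1"
  shows "red x = x \<otimes> g"
proof -
  obtain a where a: "a \<in> Gam" "red (x \<otimes> g) = x \<otimes> g \<otimes> a" using red_coset by blast
  have "a = \<one>" by (rule red_unique[OF a(1), of "x \<otimes> g"]) (use assms(2) red_bounds in \<open>auto simp flip: a(2)\<close>)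
  thus ?thesis using a(2) red_right[OF assms(1), of x] by simp
qed

lemma red_op_red: "red (x \<otimes> red y) = red (x \<otimes> y)"
proof -
  obtain a where a: "a \<in> Gam" "red y = y \<otimes> a" using red_coset by blast
  show ?thesis unfolding a(2) using red_right[OF a(1), of "x \<otimes> y"] by (simp add: op_assoc)
qed

end

lemma reduced_orbit_mean:
  assumes orbit: "reduced_orbit m G X W" and m: "m > 1" and f: "pp {0} f"
  shows "\<exists>z. uniform_mean (\<lambda>n. f (\<lambda>_. mm m (X n) (W n) 0 (m - 1))) z"
proof -
  note d = orbit[unfolded reduced_orbit_def]
  interpret tower "m * m" "mp m" by (rule tower_matrix) (use m in simp)
  define vec where "vec A t = (if t div m > 0 \<and> t mod m + t div m < m then A (t mod m) (t mod m + t div m) else 0)"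
    for A :: "nat \<Rightarrow> nat \<Rightarrow> real" and t
  have mx_vec: "mx m (\<lambda>t. if t div m > 0 \<and> t mod m + t div m < m then vec A t else u t) i j = A i j"
    if "unitri m A" "i < m" "j < m" for A u i j
    using that by (auto simp: mx_def vec_def unitri_def linorder_neq_iff)
  have mx_op': "mx m (op x y) i j = mm m (mx m x) (mx m y) i j" if "i < m" "j < m" for x y i j
    unfolding op_def by (rule mx_op[OF that])
  define x0 where "x0 = vec (X 0)"
  \<comment> \<open>Entries above the diagonal have coordinates at least m, so coordinate 0 is free;
    the value 1 normalizes the translation without touching the matrix.\<close>
  define g where "g = (vec G)(0 := 1)"
  have mx_x0: "mx m x0 i j = X 0 i j" if "i < m" "j < m" for i j
    using d that by (auto simp: x0_def mx_def vec_def unitri_def linorder_neq_iff)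
  have "g = (\<lambda>t. if t div m > 0 \<and> t mod m + t div m < m then vec G t else g t)" by (auto simp: g_def)
  hence mx_g: "mx m g i j = G i j" if "i < m" "j < m" for i j
    using mx_vec[of G i j g] d that by simp
  have mx_y: "mx m (op (pow g n) x0) i j = X n i j" if "i < m" "j < m" for n i j
    using that
  proof (induction n arbitrary: i j)
    case 0
    thus ?case by (simp add: mx_x0)
  next
    case (Suc n)
    have "mx m (op (pow g (Suc n)) x0) i j = mm m (mx m g) (mx m (op (pow g n) x0)) i j"
      using mx_op'[OF Suc.prems, of g "op (pow g n) x0"] by (simp add: op_assoc)
    also have "\<dots> = mm m G (X n) i j" unfolding mm_def using Suc mx_g by (intro sum.cong) auto
    finally show ?case using d Suc.prems by simp
  qed
  define t0 where "t0 = (m - 1) * m"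
  have t0: "t0 div m > 0" "t0 mod m + t0 div m < m" "t0 mod m = 0" "t0 div m = m - 1" using m by (auto simp: t0_def)
  have red_y: "red (op (pow g n) x0) t0 = mm m (X n) (W n) 0 (m - 1)" for n
  proof -
    let ?y = "op (pow g n) x0"
    \<comment> \<open>The entries of W n reduce the matrix coordinates; the additive ones are
      reduced by their floors. By uniqueness the result is the representative chosen by
      \<open>red\<close>.\<close>
    define w where "w = (\<lambda>t. if t div m > 0 \<and> t mod m + t div m < m then vec (W n) t else - of_int \<lfloor>?y t\<rfloor>)"
    have w: "w \<in> Gam" using d by (auto simp: Gam_def w_def vec_def)
    have entry: "mx m (op ?y w) i j = mm m (X n) (W n) i j" if "i < m" "j < m" for i j
    proof -
      have "mx m w i j = W n i j" if "i < m" "j < m" for i j using mx_vec[of "W n" i j] d that by (simp add: w_def)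
      thus ?thesis unfolding mx_op'[OF that] mm_def using mx_y that by (intro sum.cong) auto
    qed
    have coord: "(op ?y w) t = mm m (X n) (W n) (t mod m) (t mod m + t div m)" if "t div m > 0" "t mod m + t div m < m" for t
      using entry[of "t mod m" "t mod m + t div m"] mx_coordinate[OF that, of "op ?y w"] that by simp
    have "0 \<le> (op ?y w) t \<and> (op ?y w) t < 1" for t
    proof (cases "t div m > 0 \<and> t mod m + t div m < m")
      case True
      thus ?thesis using coord[of t] d by simp
    next
      case False
      hence "(op ?y w) t = frac (?y t)" by (cases rule: coordinate_cases[of t m]) (auto simp: op_apply w_def frac_def)
      thus ?thesis by (simp add: frac_lt_1)
    qed
    from red_eq[OF w this] show ?thesis using coord[OF t0(1,2)] t0 by simp
  qed
  \<comment> \<open>\<open>tower_pp\<close> treats orbits of the unit. Conjugating the translation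
    moves the starting point x0 to the left of the powers, where it becomes part of the
    function.\<close>
  define g' where "g' = conj (inv x0) g"
  have "g' 0 = g 0" unfolding g'_def by (rule conj_low[of _ 0]) (auto simp: V_def)
  hence g': "g' 0 = 1" by (simp add: g_def)
  have y_eq: "op x0 (pow g' n) = op (pow g n) x0" for n
    unfolding g'_def pow_conj by (simp add: conj_def op_assoc)
  have "m * m > t0" using m by (simp add: t0_def)
  hence "pp {..<m * m} (\<lambda>v. red (op x0 v) t0)"
    by (intro pp_red pp_op pp_const pp_var) auto
  hence "pp {..<m * m} (\<lambda>v. f (\<lambda>_. red (op x0 v) t0))" by (intro pp_subst[OF f])
  from tower_pp[where g = g' and f = "\<lambda>v. f (\<lambda>_. red (op x0 v) t0)", OF tower_axioms g' this] show ?thesis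
    by (simp add: red_op_red y_eq red_y)
qed

text \<open>One more bordering of the representing orbit puts frac (Q n) into the upper right corner
  of the reduced matrix.\<close>

lemma generalized_polynomial_mean:
  assumes "generalized_polynomial Q" and f: "pp {0} f"
  shows "\<exists>z. uniform_mean (\<lambda>n. f (\<lambda>_. frac (Q n))) z"
proof -
  obtain m G X W c where 1: "reduced_orbit m G X W" "\<And>n. Q n = (\<Sum>a<m. c a * W n a (m - 1))"
    using represented_generalized_polynomial[OF assms(1)] unfolding represented_def by blast
  have "Suc m > 1" using 1(1) by (simp add: reduced_orbit_def)
  from reduced_orbit_mean[OF reduced_orbit_floor(1)[OF 1(1), of c] this f]
  show ?thesis by (simp add: reduced_orbit_floor(2)[OF 1(1), of c] 1(2))
qed

lemma uniform_mean_average: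
  fixes a :: "nat \<Rightarrow> real"
  assumes "uniform_mean a z"
  shows "(\<lambda>N. (\<Sum>n\<in>{1..N}. a n) / real N) \<longlonglongrightarrow> z"
proof (rule LIMSEQ_I)
  fix e :: real assume "e > 0"
  then obtain H where "\<And>N M. N \<ge> H \<Longrightarrow> norm ((1 / real N) *\<^sub>R (\<Sum>n<N. a (M + n)) - z) < e"
    using assms unfolding uniform_mean_def by blast
  from this[of _ 1] show "\<exists>H. \<forall>N\<ge>H. norm ((\<Sum>n\<in>{1..N}. a n) / real N - z) < e"
    by (auto simp: sum.atLeast1_atMost_eq)
qed

theorem corollary1p6:
  fixes Q :: "nat \<Rightarrow> real"
  assumes "generalized_polynomial Q"
  shows "uniformly_distributed_mod1 (\<lambda>n. Q (bigomega n)) \<longleftrightarrow> uniformly_distributed_mod1 Q"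
proof -
  have "(\<lambda>N. real (card {n \<in> {1..N}. frac (Q (bigomega n)) \<in> {a..<b}}) / real N) \<longlonglongrightarrow> b - a \<longleftrightarrow>
        (\<lambda>N. real (card {n \<in> {1..N}. frac (Q n) \<in> {a..<b}}) / real N) \<longlonglongrightarrow> b - a"
    if ab: "0 \<le> a" "a < b" "b \<le> 1" for a b
  proof -
    \<comment> \<open>For t in [0, 1) both floors are 0 or -1, and their difference is the indicator
      of [a, b); in this form it is visibly piecewise polynomial.\<close>
    define I where "I t = real_of_int \<lfloor>t - a\<rfloor> + (- 1) * real_of_int \<lfloor>t + (- b)\<rfloor>" for t
    have I: "I (frac t) = of_bool (frac t \<in> {a..<b})" for t
    proof -
      have fl: "\<lfloor>u - s\<rfloor> = (if s \<le> u then 0 else - 1)" if "0 \<le> s" "s \<le> 1" "0 \<le> u" "u < 1" for s u :: real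
        using that by (auto simp: floor_eq_iff)
      show ?thesis using fl[of a "frac t"] fl[of b "frac t"] ab by (auto simp: I_def frac_lt_1)
    qed
    have "pp {0} (\<lambda>x. I (x 0))" unfolding I_def diff_conv_add_uminus
      by (intro pp_add pp_mult pp_floor pp_const pp_var) auto
    from generalized_polynomial_mean[OF assms this]
    obtain z where z: "uniform_mean (\<lambda>n. I (frac (Q n))) z" by auto
    have card: "real (card {n \<in> {1..N}. frac (q n) \<in> {a..<b}}) = (\<Sum>n\<in>{1..N}. I (frac (q n)))" for q :: "nat \<Rightarrow> real" and N
      by (simp add: I sum_of_bool_eq Int_def)
    have 1: "(\<lambda>N. real (card {n \<in> {1..N}. frac (Q n) \<in> {a..<b}}) / real N) \<longlonglongrightarrow> z"
      unfolding card by (rule uniform_mean_average[OF z])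
    have 2: "(\<lambda>N. real (card {n \<in> {1..N}. frac (Q (bigomega n)) \<in> {a..<b}}) / real N) \<longlonglongrightarrow> z"
      unfolding card by (rule uniform_mean_bigomega[OF _ z]) (simp add: I)
    show ?thesis
    proof
      assume "(\<lambda>N. real (card {n \<in> {1..N}. frac (Q (bigomega n)) \<in> {a..<b}}) / real N) \<longlonglongrightarrow> b - a"
      with 1 LIMSEQ_unique[OF 2 this] show "(\<lambda>N. real (card {n \<in> {1..N}. frac (Q n) \<in> {a..<b}}) / real N) \<longlonglongrightarrow> b - a"
        by simp
    next
      assume "(\<lambda>N. real (card {n \<in> {1..N}. frac (Q n) \<in> {a..<b}}) / real N) \<longlonglongrightarrow> b - a"
      with 2 LIMSEQ_unique[OF 1 this] show "(\<lambda>N. real (card {n \<in> {1..N}. frac (Q (bigomega n)) \<in> {a..<b}}) / real N) \<longlonglongrightarrow> b - a"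
        by simp
    qed
  qed
  thus ?thesis unfolding uniformly_distributed_mod1_def by blast
qed

end
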